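(* Let $k$ be a field and let $G$ be a finite abelian group which splits over $k$. Let $\mathcal{T}$ be a (skeletally small) $k$-linear pre-triangulated category which is idempotent complete and Hom-finite, with a $k$-linear triangle $G$-action $\{(F_g,\omega_g),\varepsilon_{g,h}\mid g,h\in G\}$, and consider the dual $\widehat{G}$-action on $\mathcal{T}^G$. Then there is a bijection $$\iota\colon {\rm Tilt}^G(\mathcal{T})\longrightarrow{\rm Tilt}^{\widehat{G}}(\mathcal{T}^G),\quad T\mapsto\iota(T),$$ such that ${\rm add}\,\iota(T)={\rm add}\,{\rm Ind}(T)$. Moreover, $\iota$ induces a bijection on orbit sets $${\rm Tilt}^G(\mathcal{T})/{\rm Aut}_\vartriangle(\mathcal{T};G)\longrightarrow{\rm Tilt}^{\widehat{G}}(\mathcal{T}^G)/{\rm Aut}_\vartriangle(\mathcal{T}^G;\widehat{G}).$$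
   Context: All functors are $k$-linear. A pre-triangulated category is a triangulated category except that the octahedral axiom need not hold. $G$ splits over $k$ if $kG$ is a product of copies of $k$. $\widehat{G}={\rm Hom}(G,k^* )$. ${\rm add}\,M$ is the full subcategory of direct summands of finite direct sums of copies of $M$. A triangle functor $(F,\omega)$ is an additive functor with a natural isomorphism $\omega\colon F\Sigma\to\Sigma F$ sending exact triangles to exact triangles; natural transformations of triangle functors respect the $\omega$'s. A triangle $G$-action consists of triangle autoequivalences $(F_g,\omega_g)$ and isomorphisms of triangle functors $\varepsilon_{g,h}\colon F_gF_h\to F_{gh}$ with $\varepsilon_{gh,l}\circ\varepsilon_{g,h}F_l=\varepsilon_{g,hl}\circ F_g\varepsilon_{h,l}$. $\mathcal{T}^G$ is the category of pairs $(X,\alpha)$ with isomorphisms $\alpha_g\colon X\to F_g(X)$ satisfying $\alpha_{gh}=(\varepsilon_{g,h})_X\circ F_g(\alpha_h)\circ\alpha_g$, and morphisms $f\colon(X,\alpha)\to(Y,\beta)$ with $\beta_gf=F_g(f)\alpha_g$. It is pre-triangulated with translation $\Sigma^G(X,\alpha)=(\Sigma X,((\omega_g)_X^{-1}\circ\Sigma(\alpha_g))_g)$, a triangle being exact iff the underlying triangle in $\mathcal{T}$ is. The induction functor ${\rm Ind}\colon\mathcal{T}\to\mathcal{T}^G$ is ${\rm Ind}(X)=(\bigoplus_{h\in G}F_h(X),\varepsilon(X))$, where $\varepsilon(X)_g$ is diagonally induced by the isomorphisms $(\varepsilon_{g,g^{-1}h})_X^{-1}\colon F_h(X)\to F_gF_{g^{-1}h}(X)$.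 The dual action is the strict triangle $\widehat{G}$-action $F_\chi(X,\alpha)=(X,(\chi(g^{-1})\alpha_g)_g)$, identity on morphisms, with trivial connecting isomorphisms. ${\rm Aut}_\vartriangle(\mathcal{T};G)$ is the group of isoclasses of $G$-equivariant triangle autoequivalences $((F,\omega),\delta)$: $(F,\omega)$ is a triangle autoequivalence and $\delta_g\colon FF_g\to F_gF$ are isomorphisms of triangle functors with $\delta_{gh}\circ F\varepsilon_{g,h}=\varepsilon_{g,h}F\circ F_g\delta_h\circ\delta_gF_h$; isomorphisms are isomorphisms $\phi\colon F\to F'$ of triangle functors with $F_g\phi\circ\delta_g=\delta'_g\circ\phi F_g$. An object $T$ is tilting if ${\rm Hom}(T,\Sigma^iT)=0$ for all $i\neq0$ and the smallest triangulated subcategory containing $T$ and closed under direct summands is the whole category. It is basic if each indecomposable summand has multiplicity one, and $G$-stable if $F_g(T)\simeq T$ for all $g$. ${\rm Tilt}^G(\mathcal{T})$ is the set of isoclasses of basic $G$-stable tilting objects, on which ${\rm Aut}_\vartriangle(\mathcal{T};G)$ acts by $[(F,\omega),\delta].T=F(T)$. Likewise for $\mathcal{T}^G$ with the dual $\widehat{G}$-action. *)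

theory Defs
  imports "HOL-Algebra.Module" "HOL-Algebra.QuotRing" "HOL-Algebra.Group_Action"
begin

section \<open>Linear categories\<close>

text \<open>
  The morphism spaces are modules in the sense of the theory Module of HOL-Algebra; the
  ring-multiplication fields \<open>mult\<close> and \<open>one\<close> that these records also contain play no role.
  Morphisms know their source and target (\<open>hom_disjoint\<close>), so that a functor acts on
  morphisms by a plain function. The objects form a set, hence skeletal smallness is automatic.
\<close>

record ('k, 'o, 'm) lin_category =
  Obj :: "'o set"
  Hom :: "'o \<Rightarrow> 'o \<Rightarrow> ('k, 'm) module"
  Id :: "'o \<Rightarrow> 'm"
  Comp :: "'m \<Rightarrow> 'm \<Rightarrow> 'm"  (infixl \<open>\<bullet>\<index>\<close> 70)

abbreviation Homs :: "('k, 'o, 'm, 'z) lin_category_scheme \<Rightarrow> 'o \<Rightarrow> 'o \<Rightarrow> 'm set"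
  where "Homs C X Y \<equiv> carrier (Hom C X Y)"

locale linear_category = field K for K +
  fixes C :: "('k, 'o, 'm, 'z) lin_category_scheme" (structure)
  assumes hom_disjoint:
      "\<lbrakk>X \<in> Obj C; Y \<in> Obj C; X' \<in> Obj C; Y' \<in> Obj C; f \<in> Homs C X Y; f \<in> Homs C X' Y'\<rbrakk>
       \<Longrightarrow> X = X' \<and> Y = Y'"
    and id_hom: "X \<in> Obj C \<Longrightarrow> Id C X \<in> Homs C X X"
    and comp_hom:
      "\<lbrakk>X \<in> Obj C; Y \<in> Obj C; Z \<in> Obj C; f \<in> Homs C X Y; g \<in> Homs C Y Z\<rbrakk>
       \<Longrightarrow> g \<bullet> f \<in> Homs C X Z"
    and comp_id_right: "\<lbrakk>X \<in> Obj C; Y \<in> Obj C; f \<in> Homs C X Y\<rbrakk> \<Longrightarrow> f \<bullet> Id C X = f"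
    and comp_id_left: "\<lbrakk>X \<in> Obj C; Y \<in> Obj C; f \<in> Homs C X Y\<rbrakk> \<Longrightarrow> Id C Y \<bullet> f = f"
    and comp_assoc:
      "\<lbrakk>W \<in> Obj C; X \<in> Obj C; Y \<in> Obj C; Z \<in> Obj C;
        f \<in> Homs C W X; g \<in> Homs C X Y; h \<in> Homs C Y Z\<rbrakk>
       \<Longrightarrow> (h \<bullet> g) \<bullet> f = h \<bullet> (g \<bullet> f)"
    and hom_module: "\<lbrakk>X \<in> Obj C; Y \<in> Obj C\<rbrakk> \<Longrightarrow> module K (Hom C X Y)"
    and comp_add_right:
      "\<lbrakk>X \<in> Obj C; Y \<in> Obj C; Z \<in> Obj C;
        f \<in> Homs C X Y; f' \<in> Homs C X Y; g \<in> Homs C Y Z\<rbrakk>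
       \<Longrightarrow> g \<bullet> (f \<oplus>\<^bsub>Hom C X Y\<^esub> f') = (g \<bullet> f) \<oplus>\<^bsub>Hom C X Z\<^esub> (g \<bullet> f')"
    and comp_add_left:
      "\<lbrakk>X \<in> Obj C; Y \<in> Obj C; Z \<in> Obj C;
        f \<in> Homs C X Y; g \<in> Homs C Y Z; g' \<in> Homs C Y Z\<rbrakk>
       \<Longrightarrow> (g \<oplus>\<^bsub>Hom C Y Z\<^esub> g') \<bullet> f = (g \<bullet> f) \<oplus>\<^bsub>Hom C X Z\<^esub> (g' \<bullet> f)"
    and comp_smult_right:
      "\<lbrakk>c \<in> carrier K; X \<in> Obj C; Y \<in> Obj C; Z \<in> Obj C; f \<in> Homs C X Y; g \<in> Homs C Y Z\<rbrakk>
       \<Longrightarrow> g \<bullet> (c \<odot>\<^bsub>Hom C X Y\<^esub> f) = c \<odot>\<^bsub>Hom C X Z\<^esub> (g \<bullet> f)"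
    and comp_smult_left:
      "\<lbrakk>c \<in> carrier K; X \<in> Obj C; Y \<in> Obj C; Z \<in> Obj C; f \<in> Homs C X Y; g \<in> Homs C Y Z\<rbrakk>
       \<Longrightarrow> (c \<odot>\<^bsub>Hom C Y Z\<^esub> g) \<bullet> f = c \<odot>\<^bsub>Hom C X Z\<^esub> (g \<bullet> f)"

definition inverse_mors ::
    "('k, 'o, 'm, 'z) lin_category_scheme \<Rightarrow> 'o \<Rightarrow> 'o \<Rightarrow> 'm \<Rightarrow> 'm \<Rightarrow> bool"
  where "inverse_mors C X Y f g \<longleftrightarrow>
    f \<in> Homs C X Y \<and> g \<in> Homs C Y X \<and> g \<bullet>\<^bsub>C\<^esub> f = Id C X \<and> f \<bullet>\<^bsub>C\<^esub> g = Id C Y"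

definition iso_mor :: "('k, 'o, 'm, 'z) lin_category_scheme \<Rightarrow> 'o \<Rightarrow> 'o \<Rightarrow> 'm \<Rightarrow> bool"
  where "iso_mor C X Y f \<longleftrightarrow> (\<exists>g. inverse_mors C X Y f g)"

definition inv_mor :: "('k, 'o, 'm, 'z) lin_category_scheme \<Rightarrow> 'o \<Rightarrow> 'o \<Rightarrow> 'm \<Rightarrow> 'm"
  where "inv_mor C X Y f = (THE g. inverse_mors C X Y f g)"

definition isomorphic :: "('k, 'o, 'm, 'z) lin_category_scheme \<Rightarrow> 'o \<Rightarrow> 'o \<Rightarrow> bool"
  where "isomorphic C X Y \<longleftrightarrow> X \<in> Obj C \<and> Y \<in> Obj C \<and> (\<exists>f. iso_mor C X Y f)"

definition isoclass :: "('k, 'o, 'm, 'z) lin_category_scheme \<Rightarrow> 'o \<Rightarrow> 'o set"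
  where "isoclass C X = {Y. isomorphic C X Y}"

definition zero_obj :: "('k, 'o, 'm, 'z) lin_category_scheme \<Rightarrow> 'o \<Rightarrow> bool"
  where "zero_obj C Z \<longleftrightarrow> Z \<in> Obj C \<and>
    (\<forall>X\<in>Obj C. (\<exists>!f. f \<in> Homs C X Z) \<and> (\<exists>!f. f \<in> Homs C Z X))"

definition biproduct ::
    "('k, 'o, 'm, 'z) lin_category_scheme \<Rightarrow> 'i set \<Rightarrow> ('i \<Rightarrow> 'o) \<Rightarrow> 'o
     \<Rightarrow> ('i \<Rightarrow> 'm) \<Rightarrow> ('i \<Rightarrow> 'm) \<Rightarrow> bool"
  where "biproduct C I M B \<iota> \<pi> \<longleftrightarrow>
    finite I \<and> B \<in> Obj C \<and>
    (\<forall>i\<in>I. M i \<in> Obj C \<and> \<iota> i \<in> Homs C (M i) B \<and> \<pi> i \<in> Homs C B (M i)) \<and>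
    (\<forall>i\<in>I. \<forall>j\<in>I. \<pi> j \<bullet>\<^bsub>C\<^esub> \<iota> i = (if i = j then Id C (M i) else \<zero>\<^bsub>Hom C (M i) (M j)\<^esub>)) \<and>
    (\<Oplus>\<^bsub>Hom C B B\<^esub>i\<in>I. \<iota> i \<bullet>\<^bsub>C\<^esub> \<pi> i) = Id C B"

definition direct_sum ::
    "('k, 'o, 'm, 'z) lin_category_scheme \<Rightarrow> 'i set \<Rightarrow> ('i \<Rightarrow> 'o) \<Rightarrow> 'o \<Rightarrow> bool"
  where "direct_sum C I M B \<longleftrightarrow> (\<exists>\<iota> \<pi>. biproduct C I M B \<iota> \<pi>)"

definition direct_sum2 :: "('k, 'o, 'm, 'z) lin_category_scheme \<Rightarrow> 'o \<Rightarrow> 'o \<Rightarrow> 'o \<Rightarrow> bool"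
  where "direct_sum2 C X Y B \<longleftrightarrow> direct_sum C (UNIV :: bool set) (\<lambda>b. if b then X else Y) B"

definition summand :: "('k, 'o, 'm, 'z) lin_category_scheme \<Rightarrow> 'o \<Rightarrow> 'o \<Rightarrow> bool"
  where "summand C X Y \<longleftrightarrow> (\<exists>X'. direct_sum2 C X X' Y)"

definition add_of :: "('k, 'o, 'm, 'z) lin_category_scheme \<Rightarrow> 'o \<Rightarrow> 'o set"
  where "add_of C M =
    {X. \<exists>(n::nat) S. direct_sum C {..<n} (\<lambda>_. M) S \<and> summand C X S}"

definition indecomposable :: "('k, 'o, 'm, 'z) lin_category_scheme \<Rightarrow> 'o \<Rightarrow> bool"
  where "indecomposable C X \<longleftrightarrow> X \<in> Obj C \<and> \<not> zero_obj C X \<and>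
    (\<forall>Y Z. direct_sum2 C Y Z X \<longrightarrow> zero_obj C Y \<or> zero_obj C Z)"

text \<open>
  Used for Krull-Schmidt categories only, where a decomposition into indecomposables
  exists and is unique up to isomorphism and permutation.
\<close>

definition basic :: "('k, 'o, 'm, 'z) lin_category_scheme \<Rightarrow> 'o \<Rightarrow> bool"
  where "basic C X \<longleftrightarrow>
    (\<exists>(n::nat) M. direct_sum C {..<n} M X \<and> (\<forall>i<n. indecomposable C (M i)) \<and>
      (\<forall>i<n. \<forall>j<n. i \<noteq> j \<longrightarrow> \<not> isomorphic C (M i) (M j)))"

definition additive_category :: "('k, 'r) ring_scheme \<Rightarrow> ('k, 'o, 'm, 'z) lin_category_scheme \<Rightarrow> bool"
  where "additive_category K C \<longleftrightarrow> linear_category K C \<and> (\<exists>Z. zero_obj C Z) \<and>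
    (\<forall>X\<in>Obj C. \<forall>Y\<in>Obj C. \<exists>B. direct_sum2 C X Y B)"

definition idempotent_complete :: "('k, 'o, 'm, 'z) lin_category_scheme \<Rightarrow> bool"
  where "idempotent_complete C \<longleftrightarrow>
    (\<forall>X\<in>Obj C. \<forall>e\<in>Homs C X X. e \<bullet>\<^bsub>C\<^esub> e = e \<longrightarrow>
      (\<exists>Y\<in>Obj C. \<exists>r\<in>Homs C X Y. \<exists>s\<in>Homs C Y X. s \<bullet>\<^bsub>C\<^esub> r = e \<and> r \<bullet>\<^bsub>C\<^esub> s = Id C Y))"

definition finitely_spanned :: "('k, 'r) ring_scheme \<Rightarrow> ('k, 'm, 'z) module_scheme \<Rightarrow> bool"
  where "finitely_spanned K M \<longleftrightarrow>
    (\<exists>S. finite S \<and> S \<subseteq> carrier M \<and>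
      (\<forall>f\<in>carrier M. \<exists>c\<in>S \<rightarrow> carrier K. f = (\<Oplus>\<^bsub>M\<^esub>s\<in>S. c s \<odot>\<^bsub>M\<^esub> s)))"

definition hom_finite :: "('k, 'r) ring_scheme \<Rightarrow> ('k, 'o, 'm, 'z) lin_category_scheme \<Rightarrow> bool"
  where "hom_finite K C \<longleftrightarrow> (\<forall>X\<in>Obj C. \<forall>Y\<in>Obj C. finitely_spanned K (Hom C X Y))"


section \<open>Linear functors and natural isomorphisms\<close>

record ('o, 'm, 'p, 'n) cat_functor =
  FObj :: "'o \<Rightarrow> 'p"
  FMor :: "'m \<Rightarrow> 'n"

definition linear_functor ::
    "('k, 'r) ring_scheme \<Rightarrow> ('k, 'o, 'm, 'y) lin_category_scheme \<Rightarrow> ('k, 'p, 'n, 'z) lin_category_scheme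
     \<Rightarrow> ('o, 'm, 'p, 'n, 'f) cat_functor_scheme \<Rightarrow> bool"
  where "linear_functor K C D F \<longleftrightarrow>
    (\<forall>X\<in>Obj C. FObj F X \<in> Obj D \<and> FMor F (Id C X) = Id D (FObj F X)) \<and>
    (\<forall>X\<in>Obj C. \<forall>Y\<in>Obj C. \<forall>f\<in>Homs C X Y. FMor F f \<in> Homs D (FObj F X) (FObj F Y)) \<and>
    (\<forall>X\<in>Obj C. \<forall>Y\<in>Obj C. \<forall>Z\<in>Obj C. \<forall>f\<in>Homs C X Y. \<forall>g\<in>Homs C Y Z.
       FMor F (g \<bullet>\<^bsub>C\<^esub> f) = FMor F g \<bullet>\<^bsub>D\<^esub> FMor F f) \<and>
    (\<forall>X\<in>Obj C. \<forall>Y\<in>Obj C. \<forall>f\<in>Homs C X Y. \<forall>f'\<in>Homs C X Y.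
       FMor F (f \<oplus>\<^bsub>Hom C X Y\<^esub> f') = FMor F f \<oplus>\<^bsub>Hom D (FObj F X) (FObj F Y)\<^esub> FMor F f') \<and>
    (\<forall>X\<in>Obj C. \<forall>Y\<in>Obj C. \<forall>c\<in>carrier K. \<forall>f\<in>Homs C X Y.
       FMor F (c \<odot>\<^bsub>Hom C X Y\<^esub> f) = c \<odot>\<^bsub>Hom D (FObj F X) (FObj F Y)\<^esub> FMor F f)"

definition id_functor :: "('o, 'm, 'o, 'm) cat_functor"
  where "id_functor = \<lparr>FObj = (\<lambda>X. X), FMor = (\<lambda>f. f)\<rparr>"

definition comp_functor ::
    "('p, 'n, 'q, 'l, 'f) cat_functor_scheme \<Rightarrow> ('o, 'm, 'p, 'n, 'e) cat_functor_scheme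
     \<Rightarrow> ('o, 'm, 'q, 'l) cat_functor"
  where "comp_functor F E = \<lparr>FObj = FObj F \<circ> FObj E, FMor = FMor F \<circ> FMor E\<rparr>"

definition nat_iso ::
    "('k, 'o, 'm, 'y) lin_category_scheme \<Rightarrow> ('k, 'p, 'n, 'z) lin_category_scheme
     \<Rightarrow> ('o, 'm, 'p, 'n, 'f) cat_functor_scheme \<Rightarrow> ('o, 'm, 'p, 'n, 'e) cat_functor_scheme
     \<Rightarrow> ('o \<Rightarrow> 'n) \<Rightarrow> bool"
  where "nat_iso C D F F' \<phi> \<longleftrightarrow>
    (\<forall>X\<in>Obj C. iso_mor D (FObj F X) (FObj F' X) (\<phi> X)) \<and>
    (\<forall>X\<in>Obj C. \<forall>Y\<in>Obj C. \<forall>f\<in>Homs C X Y. \<phi> Y \<bullet>\<^bsub>D\<^esub> FMor F f = FMor F' f \<bullet>\<^bsub>D\<^esub> \<phi> X)"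

definition equivalence_functor ::
    "('k, 'r) ring_scheme \<Rightarrow> ('k, 'o, 'm, 'y) lin_category_scheme \<Rightarrow> ('k, 'p, 'n, 'z) lin_category_scheme
     \<Rightarrow> ('o, 'm, 'p, 'n, 'f) cat_functor_scheme \<Rightarrow> bool"
  where "equivalence_functor K C D F \<longleftrightarrow> linear_functor K C D F \<and>
    (\<exists>(E :: ('p, 'n, 'o, 'm) cat_functor) \<eta> \<theta>. linear_functor K D C E \<and>
      nat_iso C C id_functor (comp_functor E F) \<eta> \<and>
      nat_iso D D (comp_functor F E) id_functor \<theta>)"


section \<open>Pre-triangulated categories and triangle functors\<close>

text \<open>
  A sextuple \<open>(X, Y, Z, u, v, w)\<close> stands for \<open>X \<rightarrow> Y \<rightarrow> Z \<rightarrow> \<Sigma>X\<close> with morphisms \<open>u, v, w\<close>.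
\<close>

type_synonym ('o, 'm) triangle = "'o \<times> 'o \<times> 'o \<times> 'm \<times> 'm \<times> 'm"

record ('k, 'o, 'm) tri_category = "('k, 'o, 'm) lin_category" +
  Shift :: "('o, 'm, 'o, 'm) cat_functor"
  Exact :: "('o, 'm) triangle set"

abbreviation \<Sigma>o :: "('k, 'o, 'm, 'z) tri_category_scheme \<Rightarrow> 'o \<Rightarrow> 'o"
  where "\<Sigma>o C \<equiv> FObj (Shift C)"

abbreviation \<Sigma>m :: "('k, 'o, 'm, 'z) tri_category_scheme \<Rightarrow> 'm \<Rightarrow> 'm"
  where "\<Sigma>m C \<equiv> FMor (Shift C)"

definition triangles :: "('k, 'o, 'm, 'z) tri_category_scheme \<Rightarrow> ('o, 'm) triangle set"
  where "triangles C = {(X, Y, Z, u, v, w). X \<in> Obj C \<and> Y \<in> Obj C \<and> Z \<in> Obj C \<and>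
    u \<in> Homs C X Y \<and> v \<in> Homs C Y Z \<and> w \<in> Homs C Z (\<Sigma>o C X)}"

text \<open>
  The translation functor is only required to be an autoequivalence, which includes the
  convention that it is an automorphism.
\<close>

locale pretriangulated_category = linear_category K C
  for K and C :: "('k, 'o, 'm, 'z) tri_category_scheme" (structure) +
  assumes additive: "additive_category K C"
    and shift: "equivalence_functor K C C (Shift C)"
    and exact_triangles: "Exact C \<subseteq> triangles C"
    and exact_iso:
      "\<lbrakk>(X, Y, Z, u, v, w) \<in> Exact C; (X', Y', Z', u', v', w') \<in> triangles C;
        iso_mor C X X' a; iso_mor C Y Y' b; iso_mor C Z Z' c;
        b \<bullet> u = u' \<bullet> a; c \<bullet> v = v' \<bullet> b; \<Sigma>m C a \<bullet> w = w' \<bullet> c\<rbrakk>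
       \<Longrightarrow> (X', Y', Z', u', v', w') \<in> Exact C"
    and TR1_id:
      "\<lbrakk>X \<in> Obj C; zero_obj C Z\<rbrakk>
       \<Longrightarrow> (X, X, Z, Id C X, \<zero>\<^bsub>Hom C X Z\<^esub>, \<zero>\<^bsub>Hom C Z (\<Sigma>o C X)\<^esub>) \<in> Exact C"
    and TR1_cone:
      "\<lbrakk>X \<in> Obj C; Y \<in> Obj C; u \<in> Homs C X Y\<rbrakk> \<Longrightarrow> \<exists>Z v w. (X, Y, Z, u, v, w) \<in> Exact C"
    and TR2:
      "(X, Y, Z, u, v, w) \<in> triangles C \<Longrightarrow>
       (X, Y, Z, u, v, w) \<in> Exact C \<longleftrightarrow>
       (Y, Z, \<Sigma>o C X, v, w, \<ominus>\<^bsub>Hom C (\<Sigma>o C X) (\<Sigma>o C Y)\<^esub> \<Sigma>m C u) \<in> Exact C"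
    and TR3:
      "\<lbrakk>(X, Y, Z, u, v, w) \<in> Exact C; (X', Y', Z', u', v', w') \<in> Exact C;
        a \<in> Homs C X X'; b \<in> Homs C Y Y'; b \<bullet> u = u' \<bullet> a\<rbrakk>
       \<Longrightarrow> \<exists>c\<in>Homs C Z Z'. c \<bullet> v = v' \<bullet> b \<and> \<Sigma>m C a \<bullet> w = w' \<bullet> c"

record ('o, 'm, 'p, 'n) tri_functor = "('o, 'm, 'p, 'n) cat_functor" +
  omega :: "'o \<Rightarrow> 'n"

definition triangle_functor ::
    "('k, 'r) ring_scheme \<Rightarrow> ('k, 'o, 'm, 'y) tri_category_scheme \<Rightarrow> ('k, 'p, 'n, 'z) tri_category_scheme
     \<Rightarrow> ('o, 'm, 'p, 'n) tri_functor \<Rightarrow> bool"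
  where "triangle_functor K C D F \<longleftrightarrow> linear_functor K C D F \<and>
    nat_iso C D (comp_functor F (Shift C)) (comp_functor (Shift D) F) (omega F) \<and>
    (\<forall>(X, Y, Z, u, v, w)\<in>Exact C.
      (FObj F X, FObj F Y, FObj F Z, FMor F u, FMor F v, omega F X \<bullet>\<^bsub>D\<^esub> FMor F w) \<in> Exact D)"

definition triangle_autoequivalence ::
    "('k, 'r) ring_scheme \<Rightarrow> ('k, 'o, 'm, 'y) tri_category_scheme \<Rightarrow> ('o, 'm, 'o, 'm) tri_functor \<Rightarrow> bool"
  where "triangle_autoequivalence K C F \<longleftrightarrow>
    triangle_functor K C C F \<and> equivalence_functor K C C F"

definition id_tri_functor :: "('k, 'o, 'm, 'y) tri_category_scheme \<Rightarrow> ('o, 'm, 'o, 'm) tri_functor"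
  where "id_tri_functor C = \<lparr>FObj = (\<lambda>X. X), FMor = (\<lambda>f. f), omega = (\<lambda>X. Id C (\<Sigma>o C X))\<rparr>"

definition comp_tri_functor ::
    "('k, 'o, 'm, 'y) tri_category_scheme \<Rightarrow> ('o, 'm, 'o, 'm) tri_functor \<Rightarrow> ('o, 'm, 'o, 'm) tri_functor
     \<Rightarrow> ('o, 'm, 'o, 'm) tri_functor"
  where "comp_tri_functor C F E =
    \<lparr>FObj = FObj F \<circ> FObj E, FMor = FMor F \<circ> FMor E,
     omega = (\<lambda>X. omega F (FObj E X) \<bullet>\<^bsub>C\<^esub> FMor F (omega E X))\<rparr>"

definition tri_nat_iso ::
    "('k, 'o, 'm, 'y) tri_category_scheme \<Rightarrow> ('k, 'p, 'n, 'z) tri_category_scheme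
     \<Rightarrow> ('o, 'm, 'p, 'n) tri_functor \<Rightarrow> ('o, 'm, 'p, 'n) tri_functor \<Rightarrow> ('o \<Rightarrow> 'n) \<Rightarrow> bool"
  where "tri_nat_iso C D F F' \<phi> \<longleftrightarrow> nat_iso C D F F' \<phi> \<and>
    (\<forall>X\<in>Obj C. omega F' X \<bullet>\<^bsub>D\<^esub> \<phi> (\<Sigma>o C X) = \<Sigma>m D (\<phi> X) \<bullet>\<^bsub>D\<^esub> omega F X)"


section \<open>Triangle actions and the category of equivariant objects\<close>

record ('g, 'o, 'm) tri_action =
  act :: "'g \<Rightarrow> ('o, 'm, 'o, 'm) tri_functor"
  eps :: "'g \<Rightarrow> 'g \<Rightarrow> 'o \<Rightarrow> 'm"

definition triangle_action ::
    "('k, 'r) ring_scheme \<Rightarrow> ('k, 'o, 'm, 'y) tri_category_scheme \<Rightarrow> ('g, 'z) monoid_scheme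
     \<Rightarrow> ('g, 'o, 'm) tri_action \<Rightarrow> bool"
  where "triangle_action K C G A \<longleftrightarrow> group G \<and>
    (\<forall>g\<in>carrier G. triangle_autoequivalence K C (act A g)) \<and>
    (\<forall>g\<in>carrier G. \<forall>h\<in>carrier G.
      tri_nat_iso C C (comp_tri_functor C (act A g) (act A h)) (act A (g \<otimes>\<^bsub>G\<^esub> h)) (eps A g h)) \<and>
    (\<forall>g\<in>carrier G. \<forall>h\<in>carrier G. \<forall>l\<in>carrier G. \<forall>X\<in>Obj C.
      eps A (g \<otimes>\<^bsub>G\<^esub> h) l X \<bullet>\<^bsub>C\<^esub> eps A g h (FObj (act A l) X) =
      eps A g (h \<otimes>\<^bsub>G\<^esub> l) X \<bullet>\<^bsub>C\<^esub> FMor (act A g) (eps A h l X))"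

text \<open>
  Equivariant objects are pairs \<open>(X, \<alpha>)\<close>; the family \<open>\<alpha>\<close> is kept extensional so that equality
  of pairs is equality of the families indexed by the group. A morphism is stored together
  with its source and target.
\<close>

type_synonym ('g, 'o, 'm) eobj = "'o \<times> ('g \<Rightarrow> 'm)"
type_synonym ('g, 'o, 'm) emor = "('g, 'o, 'm) eobj \<times> 'm \<times> ('g, 'o, 'm) eobj"

definition equivariant_objects ::
    "('k, 'o, 'm, 'y) tri_category_scheme \<Rightarrow> ('g, 'z) monoid_scheme \<Rightarrow> ('g, 'o, 'm) tri_action
     \<Rightarrow> ('g, 'o, 'm) eobj set"
  where "equivariant_objects C G A =
    {(X, \<alpha>). X \<in> Obj C \<and> \<alpha> \<in> extensional (carrier G) \<and>
      (\<forall>g\<in>carrier G. iso_mor C X (FObj (act A g) X) (\<alpha> g)) \<and>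
      (\<forall>g\<in>carrier G. \<forall>h\<in>carrier G.
        \<alpha> (g \<otimes>\<^bsub>G\<^esub> h) = eps A g h X \<bullet>\<^bsub>C\<^esub> FMor (act A g) (\<alpha> h) \<bullet>\<^bsub>C\<^esub> \<alpha> g)}"

definition equivariant_hom ::
    "('k, 'o, 'm, 'y) tri_category_scheme \<Rightarrow> ('g, 'z) monoid_scheme \<Rightarrow> ('g, 'o, 'm) tri_action
     \<Rightarrow> ('g, 'o, 'm) eobj \<Rightarrow> ('g, 'o, 'm) eobj \<Rightarrow> ('k, ('g, 'o, 'm) emor) module"
  where "equivariant_hom C G A U V =
    \<lparr>carrier = {(U, f, V) | f. f \<in> Homs C (fst U) (fst V) \<and>
       (\<forall>g\<in>carrier G. snd V g \<bullet>\<^bsub>C\<^esub> f = FMor (act A g) f \<bullet>\<^bsub>C\<^esub> snd U g)},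
     mult = undefined, one = undefined,
     zero = (U, \<zero>\<^bsub>Hom C (fst U) (fst V)\<^esub>, V),
     add = (\<lambda>(_, f, _) (_, f', _). (U, f \<oplus>\<^bsub>Hom C (fst U) (fst V)\<^esub> f', V)),
     smult = (\<lambda>c (_, f, _). (U, c \<odot>\<^bsub>Hom C (fst U) (fst V)\<^esub> f, V))\<rparr>"

definition equivariant_shift ::
    "('k, 'o, 'm, 'y) tri_category_scheme \<Rightarrow> ('g, 'z) monoid_scheme \<Rightarrow> ('g, 'o, 'm) tri_action
     \<Rightarrow> ('g, 'o, 'm) eobj \<Rightarrow> ('g, 'o, 'm) eobj"
  where "equivariant_shift C G A U =
    (\<Sigma>o C (fst U),
     \<lambda>g\<in>carrier G.
       inv_mor C (FObj (act A g) (\<Sigma>o C (fst U))) (\<Sigma>o C (FObj (act A g) (fst U)))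
         (omega (act A g) (fst U))
       \<bullet>\<^bsub>C\<^esub> \<Sigma>m C (snd U g))"

definition equivariant_category ::
    "('k, 'o, 'm, 'y) tri_category_scheme \<Rightarrow> ('g, 'z) monoid_scheme \<Rightarrow> ('g, 'o, 'm) tri_action
     \<Rightarrow> ('k, ('g, 'o, 'm) eobj, ('g, 'o, 'm) emor) tri_category"
  where "equivariant_category C G A =
    \<lparr>Obj = equivariant_objects C G A,
     Hom = equivariant_hom C G A,
     Id = (\<lambda>U. (U, Id C (fst U), U)),
     Comp = (\<lambda>(V, f', W) (U, f, V'). (U, f' \<bullet>\<^bsub>C\<^esub> f, W)),
     Shift = \<lparr>FObj = equivariant_shift C G A,
       FMor = (\<lambda>(U, f, V). (equivariant_shift C G A U, \<Sigma>m C f, equivariant_shift C G A V))\<rparr>,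
     Exact = {(U, V, W, (U, u, V), (V, v, W), (W, w, equivariant_shift C G A U)) | U V W u v w.
       U \<in> equivariant_objects C G A \<and> V \<in> equivariant_objects C G A \<and>
       W \<in> equivariant_objects C G A \<and>
       (U, u, V) \<in> carrier (equivariant_hom C G A U V) \<and>
       (V, v, W) \<in> carrier (equivariant_hom C G A V W) \<and>
       (W, w, equivariant_shift C G A U) \<in>
         carrier (equivariant_hom C G A W (equivariant_shift C G A U)) \<and>
       (fst U, fst V, fst W, u, v, w) \<in> Exact C}\<rparr>"

text \<open>
  The component of \<open>\<epsilon>(X)\<^sub>g\<close> out of \<open>F\<^sub>h(X)\<close> is the inverse of \<open>\<epsilon>\<close> at \<open>g\<close> and \<open>g\<inverse>h\<close>, followed
  by the image under \<open>F\<^sub>g\<close> of the inclusion of the summand with index \<open>g\<inverse>h\<close>. The biproduct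
  is an arbitrarily chosen one, so the induced object is determined up to isomorphism.
\<close>

definition Ind ::
    "('k, 'o, 'm, 'y) tri_category_scheme \<Rightarrow> ('g, 'z) monoid_scheme \<Rightarrow> ('g, 'o, 'm) tri_action
     \<Rightarrow> 'o \<Rightarrow> ('g, 'o, 'm) eobj"
  where "Ind C G A X =
    (let (B, \<iota>, \<pi>) = (SOME (B, \<iota>, \<pi>).
           biproduct C (carrier G) (\<lambda>h. FObj (act A h) X) B \<iota> \<pi>)
     in (B, \<lambda>g\<in>carrier G. \<Oplus>\<^bsub>Hom C B (FObj (act A g) B)\<^esub>h\<in>carrier G.
          FMor (act A g) (\<iota> (inv\<^bsub>G\<^esub> g \<otimes>\<^bsub>G\<^esub> h))
          \<bullet>\<^bsub>C\<^esub> inv_mor C (FObj (act A g) (FObj (act A (inv\<^bsub>G\<^esub> g \<otimes>\<^bsub>G\<^esub> h)) X)) (FObj (act A h) X)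
                (eps A g (inv\<^bsub>G\<^esub> g \<otimes>\<^bsub>G\<^esub> h) X)
          \<bullet>\<^bsub>C\<^esub> \<pi> h))"


section \<open>Splitting of the group, characters and the dual action\<close>

definition group_algebra :: "('k, 'r) ring_scheme \<Rightarrow> ('g, 'z) monoid_scheme \<Rightarrow> ('k, 'g \<Rightarrow> 'k) module"
  where "group_algebra K G =
    \<lparr>carrier = carrier G \<rightarrow>\<^sub>E carrier K,
     mult = (\<lambda>a b. \<lambda>g\<in>carrier G. \<Oplus>\<^bsub>K\<^esub>h\<in>carrier G. a h \<otimes>\<^bsub>K\<^esub> b (inv\<^bsub>G\<^esub> h \<otimes>\<^bsub>G\<^esub> g)),
     one = (\<lambda>g\<in>carrier G. if g = \<one>\<^bsub>G\<^esub> then \<one>\<^bsub>K\<^esub> else \<zero>\<^bsub>K\<^esub>),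
     zero = (\<lambda>g\<in>carrier G. \<zero>\<^bsub>K\<^esub>),
     add = (\<lambda>a b. \<lambda>g\<in>carrier G. a g \<oplus>\<^bsub>K\<^esub> b g),
     smult = (\<lambda>c a. \<lambda>g\<in>carrier G. c \<otimes>\<^bsub>K\<^esub> a g)\<rparr>"

definition power_algebra :: "('k, 'r) ring_scheme \<Rightarrow> nat \<Rightarrow> ('k, nat \<Rightarrow> 'k) module"
  where "power_algebra K n =
    \<lparr>carrier = {..<n} \<rightarrow>\<^sub>E carrier K,
     mult = (\<lambda>a b. \<lambda>i\<in>{..<n}. a i \<otimes>\<^bsub>K\<^esub> b i),
     one = (\<lambda>i\<in>{..<n}. \<one>\<^bsub>K\<^esub>),
     zero = (\<lambda>i\<in>{..<n}. \<zero>\<^bsub>K\<^esub>),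
     add = (\<lambda>a b. \<lambda>i\<in>{..<n}. a i \<oplus>\<^bsub>K\<^esub> b i),
     smult = (\<lambda>c a. \<lambda>i\<in>{..<n}. c \<otimes>\<^bsub>K\<^esub> a i)\<rparr>"

definition splits_over :: "('g, 'z) monoid_scheme \<Rightarrow> ('k, 'r) ring_scheme \<Rightarrow> bool"
  where "splits_over G K \<longleftrightarrow>
    (\<exists>n. \<exists>\<phi>\<in>ring_iso (group_algebra K G) (power_algebra K n).
      \<forall>c\<in>carrier K. \<forall>a\<in>carrier (group_algebra K G).
        \<phi> (c \<odot>\<^bsub>group_algebra K G\<^esub> a) = c \<odot>\<^bsub>power_algebra K n\<^esub> \<phi> a)"

definition character_group :: "('k, 'r) ring_scheme \<Rightarrow> ('g, 'z) monoid_scheme \<Rightarrow> ('g \<Rightarrow> 'k) monoid"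
  where "character_group K G =
    \<lparr>carrier = hom G (units_of K) \<inter> extensional (carrier G),
     mult = (\<lambda>\<chi> \<psi>. \<lambda>g\<in>carrier G. \<chi> g \<otimes>\<^bsub>K\<^esub> \<psi> g),
     one = (\<lambda>g\<in>carrier G. \<one>\<^bsub>K\<^esub>)\<rparr>"

definition dual_obj ::
    "('k, 'o, 'm, 'y) tri_category_scheme \<Rightarrow> ('g, 'z) monoid_scheme \<Rightarrow> ('g, 'o, 'm) tri_action
     \<Rightarrow> ('g \<Rightarrow> 'k) \<Rightarrow> ('g, 'o, 'm) eobj \<Rightarrow> ('g, 'o, 'm) eobj"
  where "dual_obj C G A \<chi> U =
    (fst U, \<lambda>g\<in>carrier G. \<chi> (inv\<^bsub>G\<^esub> g) \<odot>\<^bsub>Hom C (fst U) (FObj (act A g) (fst U))\<^esub> snd U g)"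

definition dual_action ::
    "('k, 'o, 'm, 'y) tri_category_scheme \<Rightarrow> ('g, 'z) monoid_scheme \<Rightarrow> ('g, 'o, 'm) tri_action
     \<Rightarrow> ('g \<Rightarrow> 'k, ('g, 'o, 'm) eobj, ('g, 'o, 'm) emor) tri_action"
  where "dual_action C G A =
    (let E = equivariant_category C G A in
    \<lparr>act = (\<lambda>\<chi>. \<lparr>FObj = dual_obj C G A \<chi>,
       FMor = (\<lambda>(U, f, V). (dual_obj C G A \<chi> U, f, dual_obj C G A \<chi> V)),
       omega = (\<lambda>U. Id E (dual_obj C G A \<chi> (\<Sigma>o E U)))\<rparr>),
     eps = (\<lambda>\<chi> \<psi> U. Id E (dual_obj C G A \<chi> (dual_obj C G A \<psi> U)))\<rparr>)"


section \<open>Equivariant triangle autoequivalences\<close>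

type_synonym ('g, 'o, 'm) equiv_functor = "('o, 'm, 'o, 'm) tri_functor \<times> ('g \<Rightarrow> 'o \<Rightarrow> 'm)"

definition equivariant_autoequivalence ::
    "('k, 'r) ring_scheme \<Rightarrow> ('k, 'o, 'm, 'y) tri_category_scheme \<Rightarrow> ('g, 'z) monoid_scheme
     \<Rightarrow> ('g, 'o, 'm) tri_action \<Rightarrow> ('g, 'o, 'm) equiv_functor \<Rightarrow> bool"
  where "equivariant_autoequivalence K C G A = (\<lambda>(F, \<delta>).
    triangle_autoequivalence K C F \<and>
    (\<forall>g\<in>carrier G.
      tri_nat_iso C C (comp_tri_functor C F (act A g)) (comp_tri_functor C (act A g) F) (\<delta> g)) \<and>
    (\<forall>g\<in>carrier G. \<forall>h\<in>carrier G. \<forall>X\<in>Obj C.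
      \<delta> (g \<otimes>\<^bsub>G\<^esub> h) X \<bullet>\<^bsub>C\<^esub> FMor F (eps A g h X) =
      eps A g h (FObj F X) \<bullet>\<^bsub>C\<^esub> FMor (act A g) (\<delta> h X) \<bullet>\<^bsub>C\<^esub> \<delta> g (FObj (act A h) X)))"

definition equivariant_isomorphic ::
    "('k, 'o, 'm, 'y) tri_category_scheme \<Rightarrow> ('g, 'z) monoid_scheme \<Rightarrow> ('g, 'o, 'm) tri_action
     \<Rightarrow> ('g, 'o, 'm) equiv_functor \<Rightarrow> ('g, 'o, 'm) equiv_functor \<Rightarrow> bool"
  where "equivariant_isomorphic C G A = (\<lambda>(F, \<delta>) (F', \<delta>').
    \<exists>\<phi>. tri_nat_iso C C F F' \<phi> \<and>
      (\<forall>g\<in>carrier G. \<forall>X\<in>Obj C.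
        FMor (act A g) (\<phi> X) \<bullet>\<^bsub>C\<^esub> \<delta> g X = \<delta>' g X \<bullet>\<^bsub>C\<^esub> \<phi> (FObj (act A g) X)))"

definition equivariant_isoclass ::
    "('k, 'r) ring_scheme \<Rightarrow> ('k, 'o, 'm, 'y) tri_category_scheme \<Rightarrow> ('g, 'z) monoid_scheme
     \<Rightarrow> ('g, 'o, 'm) tri_action \<Rightarrow> ('g, 'o, 'm) equiv_functor \<Rightarrow> ('g, 'o, 'm) equiv_functor set"
  where "equivariant_isoclass K C G A P =
    {Q. equivariant_autoequivalence K C G A Q \<and> equivariant_isomorphic C G A P Q}"

definition comp_equiv_functor ::
    "('k, 'o, 'm, 'y) tri_category_scheme \<Rightarrow> ('g, 'o, 'm) equiv_functor \<Rightarrow> ('g, 'o, 'm) equiv_functor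
     \<Rightarrow> ('g, 'o, 'm) equiv_functor"
  where "comp_equiv_functor C = (\<lambda>(F, \<delta>) (F', \<delta>').
    (comp_tri_functor C F F', \<lambda>g X. \<delta> g (FObj F' X) \<bullet>\<^bsub>C\<^esub> FMor F (\<delta>' g X)))"

definition id_equiv_functor ::
    "('k, 'o, 'm, 'y) tri_category_scheme \<Rightarrow> ('g, 'o, 'm) tri_action \<Rightarrow> ('g, 'o, 'm) equiv_functor"
  where "id_equiv_functor C A = (id_tri_functor C, \<lambda>g X. Id C (FObj (act A g) X))"

definition Aut_tri ::
    "('k, 'r) ring_scheme \<Rightarrow> ('k, 'o, 'm, 'y) tri_category_scheme \<Rightarrow> ('g, 'z) monoid_scheme
     \<Rightarrow> ('g, 'o, 'm) tri_action \<Rightarrow> ('g, 'o, 'm) equiv_functor set monoid"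
  where "Aut_tri K C G A =
    \<lparr>carrier = {equivariant_isoclass K C G A P | P. equivariant_autoequivalence K C G A P},
     mult = (\<lambda>\<P> \<Q>. \<Union>P\<in>\<P>. \<Union>Q\<in>\<Q>. equivariant_isoclass K C G A (comp_equiv_functor C P Q)),
     one = equivariant_isoclass K C G A (id_equiv_functor C A)\<rparr>"


section \<open>Stable tilting objects\<close>

text \<open>
  \<open>is_shift C i X Y\<close> says that \<open>Y\<close> is the \<open>i\<close>-th translate of \<open>X\<close>. For negative \<open>i\<close> it is
  determined up to isomorphism only, because the translation functor is an autoequivalence.
\<close>

definition is_shift :: "('k, 'o, 'm, 'y) tri_category_scheme \<Rightarrow> int \<Rightarrow> 'o \<Rightarrow> 'o \<Rightarrow> bool"
  where "is_shift C i X Y \<longleftrightarrow> Y \<in> Obj C \<and>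
    (if 0 \<le> i then Y = (\<Sigma>o C ^^ nat i) X else isomorphic C ((\<Sigma>o C ^^ nat (- i)) Y) X)"

text \<open>Full subcategories are given by their sets of objects.\<close>

definition triangulated_subcategory :: "('k, 'o, 'm, 'y) tri_category_scheme \<Rightarrow> 'o set \<Rightarrow> bool"
  where "triangulated_subcategory C S \<longleftrightarrow> S \<subseteq> Obj C \<and>
    (\<forall>X\<in>S. \<forall>Y. isomorphic C X Y \<longrightarrow> Y \<in> S) \<and>
    (\<forall>Z. zero_obj C Z \<longrightarrow> Z \<in> S) \<and>
    (\<forall>X\<in>S. \<forall>Y\<in>S. \<forall>B. direct_sum2 C X Y B \<longrightarrow> B \<in> S) \<and>
    (\<forall>X\<in>Obj C. \<Sigma>o C X \<in> S \<longleftrightarrow> X \<in> S) \<and>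
    (\<forall>(X, Y, Z, u, v, w)\<in>Exact C.
      (X \<in> S \<and> Y \<in> S \<longrightarrow> Z \<in> S) \<and> (Y \<in> S \<and> Z \<in> S \<longrightarrow> X \<in> S) \<and> (X \<in> S \<and> Z \<in> S \<longrightarrow> Y \<in> S))"

definition thick_closure :: "('k, 'o, 'm, 'y) tri_category_scheme \<Rightarrow> 'o \<Rightarrow> 'o set"
  where "thick_closure C T = \<Inter>{S. triangulated_subcategory C S \<and>
    (\<forall>Y\<in>S. \<forall>X. summand C X Y \<longrightarrow> X \<in> S) \<and> T \<in> S}"

definition tilting :: "('k, 'o, 'm, 'y) tri_category_scheme \<Rightarrow> 'o \<Rightarrow> bool"
  where "tilting C T \<longleftrightarrow> T \<in> Obj C \<and>
    (\<forall>i Y. i \<noteq> 0 \<and> is_shift C i T Y \<longrightarrow> Homs C T Y = {\<zero>\<^bsub>Hom C T Y\<^esub>}) \<and>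
    thick_closure C T = Obj C"

definition stable ::
    "('k, 'o, 'm, 'y) tri_category_scheme \<Rightarrow> ('g, 'z) monoid_scheme \<Rightarrow> ('g, 'o, 'm) tri_action
     \<Rightarrow> 'o \<Rightarrow> bool"
  where "stable C G A T \<longleftrightarrow> (\<forall>g\<in>carrier G. isomorphic C (FObj (act A g) T) T)"

definition Tilt ::
    "('k, 'o, 'm, 'y) tri_category_scheme \<Rightarrow> ('g, 'z) monoid_scheme \<Rightarrow> ('g, 'o, 'm) tri_action
     \<Rightarrow> 'o set set"
  where "Tilt C G A = {isoclass C T | T. tilting C T \<and> basic C T \<and> stable C G A T}"

definition aut_act ::
    "('k, 'o, 'm, 'y) tri_category_scheme \<Rightarrow> ('g, 'o, 'm) equiv_functor set \<Rightarrow> 'o set \<Rightarrow> 'o set"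
  where "aut_act C \<P> \<T> = (\<Union>(F, \<delta>)\<in>\<P>. \<Union>T\<in>\<T>. isoclass C (FObj F T))"

definition Tilt_orbits ::
    "('k, 'r) ring_scheme \<Rightarrow> ('k, 'o, 'm, 'y) tri_category_scheme \<Rightarrow> ('g, 'z) monoid_scheme
     \<Rightarrow> ('g, 'o, 'm) tri_action \<Rightarrow> 'o set set set"
  where "Tilt_orbits K C G A = orbits (Aut_tri K C G A) (Tilt C G A) (aut_act C)"

end

theory Submission imports Defs begin

text \<open>
  Why the theorem holds. The forgetful functor and induction transport additive closures back and
  forth. For an equivariant object \<open>U\<close> the object \<open>Ind (U)\<close>, with \<open>U\<close> regarded as an object of
  \<open>T\<close>, is the direct sum of all twists \<open>F\<^sub>\<chi> U\<close>: the order of \<open>G\<close> is invertible in \<open>k\<close> and the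
  characters are orthogonal, so the orbit of the unit of the adjunction under the twists splits the
  identity (\<open>Ind_fst_decomposition\<close>). Conversely \<open>X\<close> is a summand of the underlying object
  \<open>\<Oplus> F\<^sub>h X\<close> of \<open>Ind X\<close>. Hence stable objects on both sides generate matching additive closures,
  and Krull-Schmidt theory (\<open>basic_exists\<close>, \<open>basic_unique\<close>) turns a matching of additive closures
  into a bijection between isoclasses of basic objects. A morphism space of \<open>T\<close> between underlying
  objects vanishes once the morphism spaces between all twists vanish (\<open>hom_zero_forget\<close>), and both
  functors are exact, so that preimages of thick subcategories are thick (\<open>generates_forget\<close>); this
  transfers the tilting property.

  For the orbits, an equivariant autoequivalence \<open>F\<close> of \<open>T\<close> induces \<open>F\<^sup>G\<close> on equivariant objects,
  which commutes strictly with the dual action (\<open>lift_autoequivalence\<close>). Every autoequivalence \<open>\<Phi>\<close>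
  on the other side has to come from one of \<open>T\<close> up to additive closures. The dual action has its
  own equivariant objects, with an action of the double dual and hence of \<open>G\<close>, and \<open>T\<close> is
  equivariantly equivalent to that category: \<open>LF\<close> sends \<open>X\<close> to \<open>Ind X\<close> on which \<open>\<chi>\<close> acts by \<open>\<chi> h\<close>
  on the summand \<open>F\<^sub>h X\<close>, and \<open>Kf\<close> cuts out the part on which all characters act trivially. The
  composite of \<open>LF\<close>, the lift of \<open>\<Phi>\<close>, and \<open>Kf\<close> is the required autoequivalence
  (\<open>descend_autoequivalence\<close>).

  The Krull-Schmidt property holds in idempotent complete categories whose endomorphism spaces have
  bounded dimension (\<open>fitting\<close>, \<open>local_sum\<close>), a class that is closed under passing to equivariant
  objects. Additive closures are expressed through the ideal of morphisms that factor through sums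
  of copies of an object, which any linear functor preserves.
\<close>



section \<open>Calculus of morphisms in a linear category\<close>

text \<open>
  A morphism determines its source and target. Phrasing the calculus with \<open>arr\<close>, \<open>src\<close> and
  \<open>tgt\<close> turns all side conditions into equations for the simplifier, which normalises composites
  to right-nested form.
\<close>

definition arr :: "('k, 'o, 'm, 'z) lin_category_scheme => 'm => bool"
 where "arr C f \<longleftrightarrow> (EX X:Obj C. EX Y:Obj C. f : Homs C X Y)"

definition src :: "('k, 'o, 'm, 'z) lin_category_scheme => 'm => 'o"
 where "src C f = (THE X. X : Obj C & (EX Y:Obj C. f : Homs C X Y))"

definition tgt :: "('k, 'o, 'm, 'z) lin_category_scheme => 'm => 'o"
 where "tgt C f = (THE Y. Y : Obj C & (EX X:Obj C. f : Homs C X Y))"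

definition iso_arr :: "('k, 'o, 'm, 'z) lin_category_scheme => 'm => bool"
 where "iso_arr C f \<longleftrightarrow> arr C f & iso_mor C (src C f) (tgt C f) f"

definition inv_arr :: "('k, 'o, 'm, 'z) lin_category_scheme => 'm => 'm"
 where "inv_arr C f = inv_mor C (src C f) (tgt C f) f"

lemma (in abelian_monoid) finsum_swap:
 assumes "finite I" "finite J" "!!i j. i : I ==> j : J ==> f i j : carrier G"
 shows "finsum G (%i. finsum G (f i) J) I = finsum G (%j. finsum G (%i. f i j) I) J"
 using assms(1,3)
proof (induction I rule: finite_induct)
 case empty
 show ?case by simp
next
 case (insert x I)
 have "finsum G (%j. finsum G (%i. f i j) (insert x I)) J = finsum G (%j. f x j \<oplus> finsum G (%i. f i j) I) J"
  by (rule finsum_cong') (use insert in \<open>auto intro!: finsum_insert finsum_closed\<close>)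
 also have "\<dots> = finsum G (f x) J \<oplus> finsum G (%j. finsum G (%i. f i j) I) J"
  by (rule finsum_addf) (use insert in \<open>auto intro!: finsum_closed\<close>)
 also have "\<dots> = finsum G (%i. finsum G (f i) J) (insert x I)"
  using insert by (subst finsum_insert) (auto intro!: finsum_closed)
 finally show ?case by simp
qed

context linear_category
begin

abbreviation zero_mor ("\<zero>[_,_]") where "\<zero>[X,Y] \<equiv> \<zero>\<^bsub>Hom C X Y\<^esub>"
abbreviation add_mor ("(_ \<oplus>[_,_] _)" [65,0,0,66] 65) where "f \<oplus>[X,Y] g \<equiv> f \<oplus>\<^bsub>Hom C X Y\<^esub> g"
abbreviation neg_mor ("(\<ominus>[_,_] _)" [0,0,81] 80) where "\<ominus>[X,Y] f \<equiv> \<ominus>\<^bsub>Hom C X Y\<^esub> f"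
abbreviation smult_mor ("(_ \<odot>[_,_] _)" [71,0,0,70] 70) where "c \<odot>[X,Y] f \<equiv> c \<odot>\<^bsub>Hom C X Y\<^esub> f"

lemma hom_imp_arr:
 assumes "X : Obj C" "Y : Obj C" "f : Homs C X Y"
 shows "arr C f" "src C f = X" "tgt C f = Y"
proof -
 show "arr C f" unfolding arr_def using assms by blast
 show "src C f = X" unfolding src_def
  by (rule the_equality) (use assms hom_disjoint in blast)+
 show "tgt C f = Y" unfolding tgt_def
  by (rule the_equality) (use assms hom_disjoint in blast)+
qed

lemma arrD:
 assumes "arr C f"
 shows "src C f : Obj C" "tgt C f : Obj C" "f : Homs C (src C f) (tgt C f)"
 using assms hom_imp_arr unfolding arr_def by blast+

lemmas arr_obj [simp] = arrD(1,2)

lemma hom_iff [simp]: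
 "X : Obj C ==> Y : Obj C ==> f : Homs C X Y \<longleftrightarrow> arr C f & src C f = X & tgt C f = Y"
 using hom_imp_arr arrD by metis

lemma comp_arr [simp]:
 assumes "arr C f" "arr C g" "src C g = tgt C f"
 shows "arr C (g \<bullet> f)" "src C (g \<bullet> f) = src C f" "tgt C (g \<bullet> f) = tgt C g"
 using comp_hom[of "src C f" "tgt C f" "tgt C g" f g] assms by auto

lemma Id_arr [simp]:
 assumes "X : Obj C"
 shows "arr C (Id C X)" "src C (Id C X) = X" "tgt C (Id C X) = X"
 using id_hom[OF assms] assms by auto

lemma comp_Id [simp]:
 "arr C f ==> src C f = X ==> f \<bullet> Id C X = f"
 "arr C f ==> tgt C f = X ==> Id C X \<bullet> f = f"
 using comp_id_right[of "src C f" "tgt C f" f] comp_id_left[of "src C f" "tgt C f" f] by auto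

lemma assoc [simp]:
 "arr C f ==> arr C g ==> arr C h ==> src C g = tgt C f ==> src C h = tgt C g
 ==> (h \<bullet> g) \<bullet> f = h \<bullet> (g \<bullet> f)"
 using comp_assoc[of "src C f" "tgt C f" "tgt C g" "tgt C h" f g h] by simp

text \<open>Lets an equation between composites be used inside a right-nested composite.\<close>

lemma reassoc:
 assumes "p \<bullet> q = r" "arr C x" "arr C q" "arr C p" "src C p = tgt C q" "src C q = tgt C x"
 shows "p \<bullet> (q \<bullet> x) = r \<bullet> x"
 using assms by (metis assoc)

lemma hom_group: "X : Obj C ==> Y : Obj C ==> abelian_group (Hom C X Y)"
 using hom_module unfolding module_def by blast

lemma zero_arr [simp]:
 assumes "X : Obj C" "Y : Obj C"
 shows "arr C \<zero>[X,Y]" "src C \<zero>[X,Y] = X" "tgt C \<zero>[X,Y] = Y"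
proof -
 interpret M: abelian_group "Hom C X Y" using hom_group assms .
 from M.zero_closed show "arr C \<zero>[X,Y]" "src C \<zero>[X,Y] = X" "tgt C \<zero>[X,Y] = Y"
  using assms hom_iff by blast+
qed

lemma add_arr [simp]:
 assumes "X : Obj C" "Y : Obj C" "arr C f" "src C f = X" "tgt C f = Y"
  "arr C g" "src C g = X" "tgt C g = Y"
 shows "arr C (f \<oplus>[X,Y] g)" "src C (f \<oplus>[X,Y] g) = X" "tgt C (f \<oplus>[X,Y] g) = Y"
proof -
 interpret M: abelian_group "Hom C X Y" using hom_group assms by blast
 have "f \<oplus>[X,Y] g : Homs C X Y" using assms by (intro M.a_closed) auto
 thus "arr C (f \<oplus>[X,Y] g)" "src C (f \<oplus>[X,Y] g) = X" "tgt C (f \<oplus>[X,Y] g) = Y"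
  using assms hom_iff by blast+
qed

lemma neg_arr [simp]:
 assumes "X : Obj C" "Y : Obj C" "arr C f" "src C f = X" "tgt C f = Y"
 shows "arr C (\<ominus>[X,Y] f)" "src C (\<ominus>[X,Y] f) = X" "tgt C (\<ominus>[X,Y] f) = Y"
proof -
 interpret M: abelian_group "Hom C X Y" using hom_group assms by blast
 have "\<ominus>[X,Y] f : Homs C X Y" using assms by (intro M.a_inv_closed) auto
 thus "arr C (\<ominus>[X,Y] f)" "src C (\<ominus>[X,Y] f) = X" "tgt C (\<ominus>[X,Y] f) = Y"
  using assms hom_iff by blast+
qed

lemma smult_arr [simp]:
 assumes "X : Obj C" "Y : Obj C" "arr C f" "src C f = X" "tgt C f = Y" "c : carrier K"
 shows "arr C (c \<odot>[X,Y] f)" "src C (c \<odot>[X,Y] f) = X" "tgt C (c \<odot>[X,Y] f) = Y"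
proof -
 interpret M: module K "Hom C X Y" using hom_module assms by blast
 have "c \<odot>[X,Y] f : Homs C X Y" using assms by (intro M.smult_closed) auto
 thus "arr C (c \<odot>[X,Y] f)" "src C (c \<odot>[X,Y] f) = X" "tgt C (c \<odot>[X,Y] f) = Y"
  using assms hom_iff by blast+
qed

lemma sum_arr [simp]:
 assumes "X : Obj C" "Y : Obj C" "ALL i:I. arr C (f i)"
  "ALL i:I. src C (f i) = X" "ALL i:I. tgt C (f i) = Y"
 shows "arr C (finsum (Hom C X Y) f I)" "src C (finsum (Hom C X Y) f I) = X"
  "tgt C (finsum (Hom C X Y) f I) = Y"
proof -
 interpret M: abelian_group "Hom C X Y" using hom_group assms by blast
 have "finsum (Hom C X Y) f I : Homs C X Y" using assms by (intro M.finsum_closed) auto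
 thus "arr C (finsum (Hom C X Y) f I)" "src C (finsum (Hom C X Y) f I) = X"
  "tgt C (finsum (Hom C X Y) f I) = Y"
  using assms hom_iff by blast+
qed

lemma comp_add [simp]:
 assumes "X : Obj C" "Y : Obj C" "arr C f" "src C f = X" "tgt C f = Y"
  "arr C f'" "src C f' = X" "tgt C f' = Y"
 shows "arr C g ==> src C g = Y ==>
   g \<bullet> (f \<oplus>[X,Y] f') = (g \<bullet> f) \<oplus>[X,tgt C g] (g \<bullet> f')"
  "arr C g ==> tgt C g = X ==>
   (f \<oplus>[X,Y] f') \<bullet> g = (f \<bullet> g) \<oplus>[src C g,Y] (f' \<bullet> g)"
 using comp_add_right[of X Y "tgt C g" f f' g] comp_add_left[of "src C g" X Y g f f'] assms by auto

lemma comp_smult [simp]: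
 assumes "X : Obj C" "Y : Obj C" "arr C f" "src C f = X" "tgt C f = Y" "c : carrier K"
 shows "arr C g ==> src C g = Y ==>
   g \<bullet> (c \<odot>[X,Y] f) = c \<odot>[X,tgt C g] (g \<bullet> f)"
  "arr C g ==> tgt C g = X ==>
   (c \<odot>[X,Y] f) \<bullet> g = c \<odot>[src C g,Y] (f \<bullet> g)"
 using comp_smult_right[of c X Y "tgt C g" f g] comp_smult_left[of c "src C g" X Y g f] assms by auto

lemma smult_zero_l:
 assumes "X : Obj C" "Y : Obj C" "arr C f" "src C f = X" "tgt C f = Y"
 shows "\<zero>\<^bsub>K\<^esub> \<odot>[X,Y] f = \<zero>[X,Y]"
proof -
 interpret M: module K "Hom C X Y" using hom_module assms by blast
 show ?thesis using assms by (intro M.smult_l_null) auto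
qed

lemma comp_zero [simp]:
 assumes "X : Obj C" "Y : Obj C" "arr C g"
 shows "src C g = Y ==> g \<bullet> \<zero>[X,Y] = \<zero>[X,tgt C g]"
  "tgt C g = X ==> \<zero>[X,Y] \<bullet> g = \<zero>[src C g,Y]"
proof -
 have z: "\<zero>\<^bsub>K\<^esub> \<odot>[X,Y] \<zero>[X,Y] = \<zero>[X,Y]"
  using smult_zero_l[of X Y "\<zero>[X,Y]"] assms by simp
 show "g \<bullet> \<zero>[X,Y] = \<zero>[X,tgt C g]" if "src C g = Y"
  using comp_smult(1)[of X Y "\<zero>[X,Y]" "\<zero>\<^bsub>K\<^esub>" g] assms that
  by (simp add: z smult_zero_l)
 show "\<zero>[X,Y] \<bullet> g = \<zero>[src C g,Y]" if "tgt C g = X"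
  using comp_smult(2)[of X Y "\<zero>[X,Y]" "\<zero>\<^bsub>K\<^esub>" g] assms that
  by (simp add: z smult_zero_l)
qed

lemma smult_neg:
 assumes "X : Obj C" "Y : Obj C" "arr C f" "src C f = X" "tgt C f = Y"
 shows "\<ominus>[X,Y] f = (\<ominus>\<^bsub>K\<^esub> \<one>\<^bsub>K\<^esub>) \<odot>[X,Y] f"
proof -
 interpret M: module K "Hom C X Y" using hom_module assms by blast
 show ?thesis using assms by (subst M.smult_l_minus) auto
qed

lemma comp_neg [simp]:
 assumes "X : Obj C" "Y : Obj C" "arr C f" "src C f = X" "tgt C f = Y" "arr C g"
 shows "src C g = Y ==> g \<bullet> (\<ominus>[X,Y] f) = \<ominus>[X,tgt C g] (g \<bullet> f)"
  "tgt C g = X ==> (\<ominus>[X,Y] f) \<bullet> g = \<ominus>[src C g,Y] (f \<bullet> g)"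
 using assms by (auto simp: smult_neg)

lemma add_zero [simp]:
 assumes "X : Obj C" "Y : Obj C" "arr C f" "src C f = X" "tgt C f = Y"
 shows "f \<oplus>[X,Y] \<zero>[X,Y] = f" "\<zero>[X,Y] \<oplus>[X,Y] f = f"
  "f \<oplus>[X,Y] (\<ominus>[X,Y] f) = \<zero>[X,Y]"
  "(\<ominus>[X,Y] f) \<oplus>[X,Y] f = \<zero>[X,Y]"
proof -
 interpret M: module K "Hom C X Y" using hom_module assms by blast
 have f: "f : Homs C X Y" using assms by simp
 show "f \<oplus>[X,Y] \<zero>[X,Y] = f" "\<zero>[X,Y] \<oplus>[X,Y] f = f"
  "f \<oplus>[X,Y] (\<ominus>[X,Y] f) = \<zero>[X,Y]"
  "(\<ominus>[X,Y] f) \<oplus>[X,Y] f = \<zero>[X,Y]"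
  using f M.M.r_neg M.M.l_neg by auto
qed

lemma smult_simps [simp]:
 assumes "X : Obj C" "Y : Obj C"
 shows "arr C f ==> src C f = X ==> tgt C f = Y ==> \<one>\<^bsub>K\<^esub> \<odot>[X,Y] f = f"
  "c : carrier K ==> c \<odot>[X,Y] \<zero>[X,Y] = \<zero>[X,Y]"
  "arr C f ==> src C f = X ==> tgt C f = Y ==> c : carrier K ==> d : carrier K ==>
   c \<odot>[X,Y] (d \<odot>[X,Y] f) = (c \<otimes>\<^bsub>K\<^esub> d) \<odot>[X,Y] f"
  "arr C f ==> src C f = X ==> tgt C f = Y ==> \<zero>\<^bsub>K\<^esub> \<odot>[X,Y] f = \<zero>[X,Y]"
proof -
 interpret M: module K "Hom C X Y" using hom_module assms by blast
 show "arr C f ==> src C f = X ==> tgt C f = Y ==> \<one>\<^bsub>K\<^esub> \<odot>[X,Y] f = f"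
  "c : carrier K ==> c \<odot>[X,Y] \<zero>[X,Y] = \<zero>[X,Y]"
  "arr C f ==> src C f = X ==> tgt C f = Y ==> c : carrier K ==> d : carrier K ==>
   c \<odot>[X,Y] (d \<odot>[X,Y] f) = (c \<otimes>\<^bsub>K\<^esub> d) \<odot>[X,Y] f"
  "arr C f ==> src C f = X ==> tgt C f = Y ==> \<zero>\<^bsub>K\<^esub> \<odot>[X,Y] f = \<zero>[X,Y]"
  using assms M.smult_one M.smult_r_null M.smult_assoc1 M.smult_l_null by auto
qed

lemma neg_zero [simp]:
 "X : Obj C ==> Y : Obj C ==> \<ominus>[X,Y] \<zero>[X,Y] = \<zero>[X,Y]"
 by (simp add: smult_neg)

subsection \<open>Finite sums of morphisms\<close>

lemma sum_empty [simp]: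
 assumes "X : Obj C" "Y : Obj C"
 shows "finsum (Hom C X Y) f {} = \<zero>[X,Y]"
proof -
 interpret M: abelian_group "Hom C X Y" using hom_group assms by blast
 show ?thesis by simp
qed

lemma sum_insert [simp]:
 assumes "X : Obj C" "Y : Obj C" "finite I" "j \<notin> I" "arr C (f j)" "src C (f j) = X" "tgt C (f j) = Y"
  "ALL i:I. arr C (f i)" "ALL i:I. src C (f i) = X" "ALL i:I. tgt C (f i) = Y"
 shows "finsum (Hom C X Y) f (insert j I) = f j \<oplus>[X,Y] finsum (Hom C X Y) f I"
proof -
 interpret M: abelian_group "Hom C X Y" using hom_group assms by blast
 show ?thesis using assms by (subst M.finsum_insert) auto
qed

lemma sum_cong:
 assumes "X : Obj C" "Y : Obj C" "!!i. i : I ==> f i = g i" "!!i. i : I ==> arr C (g i)"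
  "!!i. i : I ==> src C (g i) = X" "!!i. i : I ==> tgt C (g i) = Y"
 shows "finsum (Hom C X Y) f I = finsum (Hom C X Y) g I"
proof -
 interpret M: abelian_group "Hom C X Y" using hom_group assms by blast
 show ?thesis using assms by (intro M.finsum_cong') auto
qed

lemma sum_infinite:
 assumes "X : Obj C" "Y : Obj C" "infinite I"
 shows "finsum (Hom C X Y) f I = \<zero>[X,Y]"
proof -
 interpret M: abelian_group "Hom C X Y" using hom_group assms by blast
 show ?thesis using assms by simp
qed

lemma comp_sum [simp]:
 assumes "X : Obj C" "Y : Obj C" "ALL i:I. arr C (f i)"
  "ALL i:I. src C (f i) = X" "ALL i:I. tgt C (f i) = Y" "arr C g"
 shows "src C g = Y ==>
   g \<bullet> finsum (Hom C X Y) f I = finsum (Hom C X (tgt C g)) (%i. g \<bullet> f i) I"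
  "tgt C g = X ==>
   finsum (Hom C X Y) f I \<bullet> g = finsum (Hom C (src C g) Y) (%i. f i \<bullet> g) I"
proof -
 show "g \<bullet> finsum (Hom C X Y) f I = finsum (Hom C X (tgt C g)) (%i. g \<bullet> f i) I" if "src C g = Y"
 proof (cases "finite I")
  case True
  then show ?thesis using assms(3-5)
   by (induction I rule: finite_induct) (use assms(1,2,6) that in auto)
 qed (use assms(1,2,6) that in \<open>simp add: sum_infinite\<close>)
 show "finsum (Hom C X Y) f I \<bullet> g = finsum (Hom C (src C g) Y) (%i. f i \<bullet> g) I" if "tgt C g = X"
 proof (cases "finite I")
  case True
  then show ?thesis using assms(3-5)
   by (induction I rule: finite_induct) (use assms(1,2,6) that in auto)
 qed (use assms(1,2,6) that in \<open>simp add: sum_infinite\<close>)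
qed

lemma smult_sum:
 assumes "X : Obj C" "Y : Obj C" "!!i. i : I ==> arr C (f i)"
  "!!i. i : I ==> src C (f i) = X" "!!i. i : I ==> tgt C (f i) = Y" "c : carrier K" "finite I"
 shows "c \<odot>[X,Y] finsum (Hom C X Y) f I = finsum (Hom C X Y) (%i. c \<odot>[X,Y] f i) I"
proof -
 interpret M: module K "Hom C X Y" using hom_module assms by blast
 show ?thesis using assms by (intro M.finsum_smult_ldistr) auto
qed

lemma sum_smult:
 assumes "X : Obj C" "Y : Obj C" "arr C f" "src C f = X" "tgt C f = Y" "finite I"
  and "!!i. i : I ==> c i : carrier K"
 shows "finsum (Hom C X Y) (%i. c i \<odot>[X,Y] f) I = finsum K c I \<odot>[X,Y] f"
proof -
 interpret M: module K "Hom C X Y" using hom_module assms by blast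
 have f: "f : Homs C X Y" using assms by simp
 show ?thesis using assms(6,7)
 proof (induction I rule: finite_induct)
  case empty thus ?case using f by simp
 next
  case (insert i I)
  have "c i : carrier K" "finsum K c I : carrier K" using insert by (auto intro!: finsum_closed)
  thus ?case using insert f assms(1-5)
   by (simp add: M.smult_l_distr Pi_def)
 qed
qed

lemma sum_zero [simp]:
 assumes "X : Obj C" "Y : Obj C"
 shows "finsum (Hom C X Y) (%i. \<zero>[X,Y]) I = \<zero>[X,Y]"
proof -
 interpret M: abelian_group "Hom C X Y" using hom_group assms by blast
 show ?thesis by simp
qed

lemma sum_eq_single:
 assumes "X : Obj C" "Y : Obj C" "finite I" "j : I" "arr C (f j)" "src C (f j) = X" "tgt C (f j) = Y"
  "!!i. i : I ==> i \<noteq> j ==> f i = \<zero>[X,Y]"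
 shows "finsum (Hom C X Y) f I = f j"
proof -
 have arr: "arr C (f i)" "src C (f i) = X" "tgt C (f i) = Y" if "i : I" for i
  using assms that by (cases "i = j"; simp)+
 have "I = insert j (I - {j})" using assms by blast
 then have "finsum (Hom C X Y) f I = finsum (Hom C X Y) f (insert j (I - {j}))" by simp
 also have "\<dots> = f j \<oplus>[X,Y] finsum (Hom C X Y) f (I - {j})"
  using assms arr by (subst sum_insert) auto
 also have "finsum (Hom C X Y) f (I - {j}) = finsum (Hom C X Y) (%i. \<zero>[X,Y]) (I - {j})"
  using assms by (intro sum_cong) auto
 finally show ?thesis using assms by simp
qed

lemma sum_swap:
 assumes "X : Obj C" "Y : Obj C" "finite I" "finite J"
  "!!i j. i : I ==> j : J ==> f i j : Homs C X Y"
 shows "finsum (Hom C X Y) (%i. finsum (Hom C X Y) (f i) J) I =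
  finsum (Hom C X Y) (%j. finsum (Hom C X Y) (%i. f i j) I) J"
 by (rule abelian_monoid.finsum_swap[OF abelian_group.axioms(1)[OF hom_group]]) fact+

lemma sum_reindex:
 assumes "X : Obj C" "Y : Obj C" "bij_betw h I J" "!!j. j : J ==> f j : Homs C X Y"
 shows "finsum (Hom C X Y) f J = finsum (Hom C X Y) (%i. f (h i)) I"
proof -
 interpret M: abelian_group "Hom C X Y" using hom_group assms by blast
 show ?thesis using M.finsum_reindex[of f h I] assms unfolding bij_betw_def by auto
qed

subsection \<open>Isomorphisms\<close>

lemma inverse_unique:
 "inverse_mors C X Y f g ==> inverse_mors C X Y f g' ==> X : Obj C ==> Y : Obj C ==> g = g'"
 unfolding inverse_mors_def by simp (metis assoc comp_Id)

lemma iso_mor_iff [simp]: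
 "X : Obj C ==> Y : Obj C ==> iso_mor C X Y f \<longleftrightarrow> iso_arr C f & src C f = X & tgt C f = Y"
 unfolding iso_arr_def iso_mor_def inverse_mors_def by auto

lemma iso_arr_arr [simp]: "iso_arr C f ==> arr C f"
 unfolding iso_arr_def by simp

lemma inv_arr_inverse: "iso_arr C f ==> inverse_mors C (src C f) (tgt C f) f (inv_arr C f)"
 unfolding inv_arr_def inv_mor_def iso_arr_def iso_mor_def
 by (metis arr_obj inverse_unique the_equality)

lemma inv_mor_eq [simp]:
 "arr C f ==> src C f = X ==> tgt C f = Y ==> inv_mor C X Y f = inv_arr C f"
 unfolding inv_arr_def by simp

lemma inv_arr [simp]:
 assumes "iso_arr C f"
 shows "arr C (inv_arr C f)" "src C (inv_arr C f) = tgt C f" "tgt C (inv_arr C f) = src C f"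
  "inv_arr C f \<bullet> f = Id C (src C f)" "f \<bullet> inv_arr C f = Id C (tgt C f)"
 using inv_arr_inverse[OF assms] assms unfolding inverse_mors_def by auto

lemma inv_arr_cancel [simp]:
 assumes "iso_arr C f" "arr C x"
 shows "tgt C x = src C f ==> inv_arr C f \<bullet> (f \<bullet> x) = x"
  "tgt C x = tgt C f ==> f \<bullet> (inv_arr C f \<bullet> x) = x"
 using assms by (simp_all flip: assoc)

lemma iso_arrI:
 assumes "arr C f" "arr C g" "g \<bullet> f = Id C (src C f)" "f \<bullet> g = Id C (tgt C f)"
  "src C g = tgt C f" "tgt C g = src C f"
 shows "iso_arr C f" "inv_arr C f = g"
proof -
 have i: "inverse_mors C (src C f) (tgt C f) f g"
  unfolding inverse_mors_def using assms by simp
 show "iso_arr C f" unfolding iso_arr_def iso_mor_def using i assms by blast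
 from inverse_unique[OF inv_arr_inverse[OF this] i] assms show "inv_arr C f = g" by simp
qed

lemma iso_inv [simp]: "iso_arr C f ==> iso_arr C (inv_arr C f)"
 "iso_arr C f ==> inv_arr C (inv_arr C f) = f"
 by (rule iso_arrI(1)[of _ f]; simp) (rule iso_arrI(2); simp)

lemma iso_Id [simp]: "X : Obj C ==> iso_arr C (Id C X)" "X : Obj C ==> inv_arr C (Id C X) = Id C X"
 by (rule iso_arrI(1)[of _ "Id C X"]; simp) (rule iso_arrI(2); simp)

lemma iso_comp [simp]:
 assumes "iso_arr C f" "iso_arr C g" "src C g = tgt C f"
 shows "iso_arr C (g \<bullet> f)" "inv_arr C (g \<bullet> f) = inv_arr C f \<bullet> inv_arr C g"
proof -
 show "iso_arr C (g \<bullet> f)" by (rule iso_arrI(1)[of _ "inv_arr C f \<bullet> inv_arr C g"]) (use assms in simp_all)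
 show "inv_arr C (g \<bullet> f) = inv_arr C f \<bullet> inv_arr C g" by (rule iso_arrI(2)) (use assms in simp_all)
qed

lemma iso_cancel_left:
 assumes "iso_arr C f" "f \<bullet> a = f \<bullet> b" "arr C a" "arr C b" "tgt C a = src C f" "tgt C b = src C f"
 shows "a = b"
 using assms by (metis inv_arr_cancel(1))

lemma iso_cancel_right:
 assumes "iso_arr C f" "a \<bullet> f = b \<bullet> f" "arr C a" "arr C b" "src C a = tgt C f" "src C b = tgt C f"
 shows "a = b"
proof -
 have "(a \<bullet> f) \<bullet> inv_arr C f = (b \<bullet> f) \<bullet> inv_arr C f" by (simp only: assms(2))
 thus ?thesis using assms(1,3-6) by simp
qed

lemma isomorphic_iff:
 "isomorphic C X Y \<longleftrightarrow> (EX f. iso_arr C f & src C f = X & tgt C f = Y)"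
 unfolding isomorphic_def by (metis iso_mor_iff arr_obj iso_arr_arr)

lemma isomorphic_refl: "X : Obj C ==> isomorphic C X X"
 unfolding isomorphic_iff by (metis iso_Id(1) Id_arr(2,3))

lemma isomorphic_sym: "isomorphic C X Y ==> isomorphic C Y X"
 unfolding isomorphic_iff by (metis iso_inv(1) inv_arr(2,3))

lemma isomorphic_trans: "isomorphic C X Y ==> isomorphic C Y Z ==> isomorphic C X Z"
 unfolding isomorphic_iff by (metis iso_comp(1) comp_arr(2,3) iso_arr_arr)

lemma isomorphic_obj: "isomorphic C X Y ==> X : Obj C" "isomorphic C X Y ==> Y : Obj C"
 unfolding isomorphic_def by auto

lemma isoclass_eq: "isomorphic C X Y ==> isoclass C X = isoclass C Y"
 unfolding isoclass_def using isomorphic_sym isomorphic_trans by blast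

lemma isoclass_eq_iff: "X : Obj C ==> isoclass C X = isoclass C Y \<longleftrightarrow> isomorphic C X Y"
 by (metis isoclass_eq isoclass_def isomorphic_refl isomorphic_sym mem_Collect_eq)

subsection \<open>Zero objects, retracts and biproducts\<close>

lemma zero_obj_iff:
 "zero_obj C Z \<longleftrightarrow> Z : Obj C & Id C Z = \<zero>[Z,Z]"
proof
 assume z: "zero_obj C Z"
 hence Z: "Z : Obj C" unfolding zero_obj_def by blast
 moreover from this z have "EX! f. f : Homs C Z Z" unfolding zero_obj_def by blast
 ultimately show "Z : Obj C & Id C Z = \<zero>[Z,Z]" using Id_arr zero_arr hom_iff by metis
next
 assume Z: "Z : Obj C & Id C Z = \<zero>[Z,Z]"
 have "(EX! f. f : Homs C X Z) & (EX! f. f : Homs C Z X)" if X: "X : Obj C" for X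
 proof
  have a: "f = \<zero>[X,Z]" if "arr C f" "src C f = X" "tgt C f = Z" for f
  proof -
   have "f = Id C Z \<bullet> f" using that by simp
   also have "\<dots> = \<zero>[X,Z]" using that Z X by (simp del: comp_Id)
   finally show ?thesis .
  qed
  show "EX! f. f : Homs C X Z"
   by (rule ex1I[of _ "\<zero>[X,Z]"]) (use a Z X in auto)
  have b: "f = \<zero>[Z,X]" if "arr C f" "src C f = Z" "tgt C f = X" for f
  proof -
   have "f = f \<bullet> Id C Z" using that by simp
   also have "\<dots> = \<zero>[Z,X]" using that Z X by (simp del: comp_Id)
   finally show ?thesis .
  qed
  show "EX! f. f : Homs C Z X"
   by (rule ex1I[of _ "\<zero>[Z,X]"]) (use b Z X in auto)
 qed
 thus "zero_obj C Z" unfolding zero_obj_def using Z by blast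
qed

lemma zero_obj_hom:
 assumes "zero_obj C Z" "arr C f" "arr C g" "src C f = src C g" "tgt C f = tgt C g"
  "src C f = Z \<or> tgt C f = Z"
 shows "f = g"
proof -
 have Z: "Z : Obj C" using assms zero_obj_iff by blast
 from assms(6) show ?thesis
 proof
  assume s: "src C f = Z"
  have "EX! h. h : Homs C Z (tgt C f)"
   using assms(1) arrD(2)[OF assms(2)] unfolding zero_obj_def by blast
  thus ?thesis using assms(2-5) s Z by simp blast
 next
  assume s: "tgt C f = Z"
  have "EX! h. h : Homs C (src C f) Z"
   using assms(1) arrD(1)[OF assms(2)] unfolding zero_obj_def by blast
  thus ?thesis using assms(2-5) s Z by simp blast
 qed
qed

lemma biproductD:
 assumes "biproduct C I M B \<iota> \<pi>"
 shows "finite I" "B : Obj C" "!!i. i : I ==> M i : Obj C"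
  "!!i. i : I ==> arr C (\<iota> i)" "!!i. i : I ==> src C (\<iota> i) = M i" "!!i. i : I ==> tgt C (\<iota> i) = B"
  "!!i. i : I ==> arr C (\<pi> i)" "!!i. i : I ==> src C (\<pi> i) = B" "!!i. i : I ==> tgt C (\<pi> i) = M i"
  "!!i. i : I ==> \<pi> i \<bullet> \<iota> i = Id C (M i)"
  "!!i j. i : I ==> j : I ==> i \<noteq> j ==> \<pi> j \<bullet> \<iota> i = \<zero>[M i,M j]"
  "finsum (Hom C B B) (%i. \<iota> i \<bullet> \<pi> i) I = Id C B"
 using assms unfolding biproduct_def by auto

lemma biproductI:
 assumes "finite I" "B : Obj C" "!!i. i : I ==> M i : Obj C"
  "!!i. i : I ==> arr C (\<iota> i) & src C (\<iota> i) = M i & tgt C (\<iota> i) = B"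
  "!!i. i : I ==> arr C (\<pi> i) & src C (\<pi> i) = B & tgt C (\<pi> i) = M i"
  "!!i. i : I ==> \<pi> i \<bullet> \<iota> i = Id C (M i)"
  "!!i j. i : I ==> j : I ==> i \<noteq> j ==> \<pi> j \<bullet> \<iota> i = \<zero>[M i,M j]"
  "finsum (Hom C B B) (%i. \<iota> i \<bullet> \<pi> i) I = Id C B"
 shows "biproduct C I M B \<iota> \<pi>"
 using assms unfolding biproduct_def by auto

lemma biproduct_epi:
 assumes b: "biproduct C I M B \<iota> \<pi>" and "arr C f" "arr C g" "src C f = B" "src C g = B"
  "tgt C f = tgt C g" and eq: "!!i. i : I ==> f \<bullet> \<iota> i = g \<bullet> \<iota> i"
 shows "f = g"
proof -
 note [simp] = biproductD[OF b]
 have "f = f \<bullet> finsum (Hom C B B) (%i. \<iota> i \<bullet> \<pi> i) I" using assms by simp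
 also have "\<dots> = finsum (Hom C B (tgt C f)) (%i. f \<bullet> (\<iota> i \<bullet> \<pi> i)) I"
  using assms(2-6) by (subst comp_sum) auto
 also have "\<dots> = finsum (Hom C B (tgt C f)) (%i. g \<bullet> (\<iota> i \<bullet> \<pi> i)) I"
  using assms(2-6) eq by (intro sum_cong) (auto simp flip: assoc)
 also have "\<dots> = g \<bullet> finsum (Hom C B B) (%i. \<iota> i \<bullet> \<pi> i) I"
  using assms(2-6) by (subst comp_sum) auto
 finally show ?thesis using assms by simp
qed

lemma biproduct_mono:
 assumes b: "biproduct C I M B \<iota> \<pi>" and "arr C f" "arr C g" "tgt C f = B" "tgt C g = B"
  "src C f = src C g" and eq: "!!i. i : I ==> \<pi> i \<bullet> f = \<pi> i \<bullet> g"
 shows "f = g"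
proof -
 note [simp] = biproductD[OF b]
 have "f = finsum (Hom C B B) (%i. \<iota> i \<bullet> \<pi> i) I \<bullet> f" using assms by simp
 also have "\<dots> = finsum (Hom C (src C f) B) (%i. (\<iota> i \<bullet> \<pi> i) \<bullet> f) I"
  using assms(2-6) by (subst comp_sum) auto
 also have "\<dots> = finsum (Hom C (src C f) B) (%i. (\<iota> i \<bullet> \<pi> i) \<bullet> g) I"
  using assms(2-6) eq by (intro sum_cong) auto
 also have "\<dots> = finsum (Hom C B B) (%i. \<iota> i \<bullet> \<pi> i) I \<bullet> g"
  using assms(2-6) by (subst comp_sum) auto
 finally show ?thesis using assms by simp
qed

definition copair :: "'i set => 'o => 'o => ('i => 'm) => ('i => 'm) => 'm"
 where "copair I B Y \<pi> a = finsum (Hom C B Y) (%i. a i \<bullet> \<pi> i) I"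

lemma copair:
 assumes b: "biproduct C I M B \<iota> \<pi>" and Y: "Y : Obj C"
  and a: "!!i. i : I ==> arr C (a i) & src C (a i) = M i & tgt C (a i) = Y"
 shows "arr C (copair I B Y \<pi> a)" "src C (copair I B Y \<pi> a) = B" "tgt C (copair I B Y \<pi> a) = Y"
  "!!i. i : I ==> copair I B Y \<pi> a \<bullet> \<iota> i = a i"
proof -
 note [simp] = biproductD[OF b]
 show [simp]: "arr C (copair I B Y \<pi> a)" "src C (copair I B Y \<pi> a) = B" "tgt C (copair I B Y \<pi> a) = Y"
  unfolding copair_def using a Y by auto
 show "copair I B Y \<pi> a \<bullet> \<iota> i = a i" if i: "i : I" for i
 proof -
  have "copair I B Y \<pi> a \<bullet> \<iota> i = finsum (Hom C (M i) Y) (%j. (a j \<bullet> \<pi> j) \<bullet> \<iota> i) I"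
   unfolding copair_def using a Y i by (subst comp_sum) auto
  also have "\<dots> = (a i \<bullet> \<pi> i) \<bullet> \<iota> i"
   using a Y i by (intro sum_eq_single) auto
  finally show ?thesis using a i by simp
 qed
qed

lemma direct_sum2_iff:
 "direct_sum2 C X Y B \<longleftrightarrow> X : Obj C & Y : Obj C & B : Obj C & (EX i p j q.
  arr C i & src C i = X & tgt C i = B & arr C p & src C p = B & tgt C p = X &
  arr C j & src C j = Y & tgt C j = B & arr C q & src C q = B & tgt C q = Y &
  p \<bullet> i = Id C X & q \<bullet> j = Id C Y & p \<bullet> j = \<zero>[Y,X] & q \<bullet> i = \<zero>[X,Y] &
  (i \<bullet> p) \<oplus>[B,B] (j \<bullet> q) = Id C B)" (is "?L = ?R")
proof
 assume ?L
 then obtain \<iota> \<pi> where b: "biproduct C (UNIV :: bool set) (%b. if b then X else Y) B \<iota> \<pi>"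
  unfolding direct_sum2_def direct_sum_def by blast
 note d = biproductD[OF b]
 have o: "X : Obj C" "Y : Obj C" "B : Obj C" using d(3)[of True] d(3)[of False] d(2) by auto
 have s: "finsum (Hom C B B) (%i. \<iota> i \<bullet> \<pi> i) UNIV =
   \<iota> True \<bullet> \<pi> True \<oplus>[B,B] \<iota> False \<bullet> \<pi> False"
 proof -
  have U: "(UNIV :: bool set) = insert True (insert False {})" by auto
  show ?thesis by (subst U) (use d(4-9) o in simp)
 qed
 show ?R
  by (intro conjI exI[of _ "\<iota> True"] exI[of _ "\<pi> True"] exI[of _ "\<iota> False"] exI[of _ "\<pi> False"])
   (use d(4-10)[of True] d(4-10)[of False] d(11)[of True False] d(11)[of False True] d(12) o s in simp_all)
next
 assume ?R
 then obtain i p j q where r [simp]: "X : Obj C" "Y : Obj C" "B : Obj C"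
  "arr C i" "src C i = X" "tgt C i = B" "arr C p" "src C p = B" "tgt C p = X"
  "arr C j" "src C j = Y" "tgt C j = B" "arr C q" "src C q = B" "tgt C q = Y"
  "p \<bullet> i = Id C X" "q \<bullet> j = Id C Y" "p \<bullet> j = \<zero>[Y,X]" "q \<bullet> i = \<zero>[X,Y]"
  "(i \<bullet> p) \<oplus>[B,B] (j \<bullet> q) = Id C B"
  by blast
 have "biproduct C (UNIV :: bool set) (%b. if b then X else Y) B (%b. if b then i else j) (%b. if b then p else q)"
 proof (rule biproductI)
  have U: "(UNIV :: bool set) = insert True (insert False {})" by auto
  show "finsum (Hom C B B) (%b. (if b then i else j) \<bullet> (if b then p else q)) UNIV = Id C B"
   by (subst U) simp
 qed auto
 thus ?L unfolding direct_sum2_def direct_sum_def by blast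
qed

lemma direct_sum_iso:
 assumes "direct_sum C I M B" "direct_sum C J N B'" "bij_betw \<sigma> I J"
  and iso: "!!i. i : I ==> isomorphic C (M i) (N (\<sigma> i))"
 shows "isomorphic C B B'"
proof -
 obtain \<iota> \<pi> \<iota>' \<pi>' where b: "biproduct C I M B \<iota> \<pi>" and b': "biproduct C J N B' \<iota>' \<pi>'"
  using assms unfolding direct_sum_def by blast
 note [simp] = biproductD[OF b] biproductD[OF b']
 have s [simp]: "\<sigma> i : J" if "i : I" for i using assms(3) that by (auto simp: bij_betw_def)
 have sinj: "\<sigma> i = \<sigma> j \<longleftrightarrow> i = j" if "i : I" "j : I" for i j
  using assms(3) that by (auto simp: bij_betw_def inj_on_def)
 have "ALL i:I. EX f. iso_arr C f & src C f = M i & tgt C f = N (\<sigma> i)"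
  using iso unfolding isomorphic_iff by blast
 then obtain f where f [simp]: "!!i. i : I ==> iso_arr C (f i)" "!!i. i : I ==> src C (f i) = M i"
  "!!i. i : I ==> tgt C (f i) = N (\<sigma> i)" by metis
 define u where "u = copair I B B' \<pi> (%i. \<iota>' (\<sigma> i) \<bullet> f i)"
 have u [simp]: "arr C u" "src C u = B" "tgt C u = B'" "!!i. i : I ==> u \<bullet> \<iota> i = \<iota>' (\<sigma> i) \<bullet> f i"
  unfolding u_def using copair[OF b, of B' "%i. \<iota>' (\<sigma> i) \<bullet> f i"] by auto
 define v where "v = finsum (Hom C B' B) (%i. \<iota> i \<bullet> (inv_arr C (f i) \<bullet> \<pi>' (\<sigma> i))) I"
 have v [simp]: "arr C v" "src C v = B'" "tgt C v = B" unfolding v_def by auto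
 have v2: "v \<bullet> \<iota>' (\<sigma> i) = \<iota> i \<bullet> inv_arr C (f i)" if i: "i : I" for i
 proof -
  have "v \<bullet> \<iota>' (\<sigma> i) = finsum (Hom C (N (\<sigma> i)) B) (%j. (\<iota> j \<bullet> (inv_arr C (f j) \<bullet> \<pi>' (\<sigma> j))) \<bullet> \<iota>' (\<sigma> i)) I"
   unfolding v_def using i by (subst comp_sum) auto
  also have "\<dots> = (\<iota> i \<bullet> (inv_arr C (f i) \<bullet> \<pi>' (\<sigma> i))) \<bullet> \<iota>' (\<sigma> i)"
   using i sinj by (intro sum_eq_single) auto
  finally show ?thesis using i by simp
 qed
 have 1: "v \<bullet> u = Id C B"
  by (rule biproduct_epi[OF b]) (auto simp: v2 reassoc[OF v2])
 have 2: "u \<bullet> v = Id C B'"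
 proof (rule biproduct_epi[OF b'])
  fix j assume j: "j : J"
  then obtain i where i: "i : I" "j = \<sigma> i" using assms(3) unfolding bij_betw_def by blast
  have "u \<bullet> (v \<bullet> \<iota>' (\<sigma> i)) = \<iota>' (\<sigma> i)"
   using i reassoc[OF u(4)[OF i(1)], of "inv_arr C (f i)"] by (simp add: v2)
  thus "(u \<bullet> v) \<bullet> \<iota>' j = Id C B' \<bullet> \<iota>' j" using i by simp
 qed auto
 show ?thesis unfolding isomorphic_iff using iso_arrI[of u v] 1 2 u v by auto
qed

end


section \<open>Linear functors\<close>

definition faithful_functor where
 "faithful_functor C D F \<longleftrightarrow> (ALL f g. arr C f & arr C g & src C f = src C g & tgt C f = tgt C g &
  FMor F f = FMor F g --> f = g)"

definition full_functor where
 "full_functor C D F \<longleftrightarrow> (ALL X:Obj C. ALL Y:Obj C. ALL h. arr D h & src D h = FObj F X & tgt D h = FObj F Y -->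
  (EX f. arr C f & src C f = X & tgt C f = Y & FMor F f = h))"

definition ess_surj where
 "ess_surj C D F \<longleftrightarrow> (ALL Y:Obj D. EX X:Obj C. isomorphic D (FObj F X) Y)"

locale lin_functor = C: linear_category K C + D: linear_category K D
 for K :: "('k, 'r) ring_scheme" and C :: "('k, 'o, 'm, 'y) lin_category_scheme"
  and D :: "('k, 'p, 'n, 'z) lin_category_scheme" +
 fixes F :: "('o, 'm, 'p, 'n, 'f) cat_functor_scheme"
 assumes lin: "linear_functor K C D F"
begin

lemma obj [simp]: "X : Obj C ==> FObj F X : Obj D"
 using lin unfolding linear_functor_def by blast

lemma mor [simp]:
 assumes "arr C f"
 shows "arr D (FMor F f)" "src D (FMor F f) = FObj F (src C f)" "tgt D (FMor F f) = FObj F (tgt C f)"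
proof -
 have "FMor F f : Homs D (FObj F (src C f)) (FObj F (tgt C f))"
  using lin C.arrD[OF assms] unfolding linear_functor_def by blast
 thus "arr D (FMor F f)" "src D (FMor F f) = FObj F (src C f)" "tgt D (FMor F f) = FObj F (tgt C f)"
  using assms by auto
qed

lemma map_comp [simp]:
 assumes "arr C f" "arr C g" "src C g = tgt C f"
 shows "FMor F (g \<bullet>\<^bsub>C\<^esub> f) = FMor F g \<bullet>\<^bsub>D\<^esub> FMor F f"
 using lin C.arrD[OF assms(1)] C.arrD[OF assms(2)] assms(3) unfolding linear_functor_def by metis

lemma map_Id [simp]: "X : Obj C ==> FMor F (Id C X) = Id D (FObj F X)"
 using lin unfolding linear_functor_def by blast

lemma map_add [simp]:
 assumes "X : Obj C" "Y : Obj C" "arr C f" "src C f = X" "tgt C f = Y" "arr C f'" "src C f' = X" "tgt C f' = Y"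
 shows "FMor F (f \<oplus>\<^bsub>Hom C X Y\<^esub> f') = FMor F f \<oplus>\<^bsub>Hom D (FObj F X) (FObj F Y)\<^esub> FMor F f'"
proof -
 have "f : Homs C X Y" "f' : Homs C X Y" using assms by auto
 thus ?thesis using lin assms(1,2) unfolding linear_functor_def by blast
qed

lemma map_smult [simp]:
 assumes "X : Obj C" "Y : Obj C" "arr C f" "src C f = X" "tgt C f = Y" "c : carrier K"
 shows "FMor F (c \<odot>\<^bsub>Hom C X Y\<^esub> f) = c \<odot>\<^bsub>Hom D (FObj F X) (FObj F Y)\<^esub> FMor F f"
proof -
 have "f : Homs C X Y" using assms by auto
 thus ?thesis using lin assms unfolding linear_functor_def by blast
qed

lemma map_zero [simp]:
 assumes "X : Obj C" "Y : Obj C"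
 shows "FMor F \<zero>\<^bsub>Hom C X Y\<^esub> = \<zero>\<^bsub>Hom D (FObj F X) (FObj F Y)\<^esub>"
proof -
 have "FMor F \<zero>\<^bsub>Hom C X Y\<^esub> = FMor F (\<zero>\<^bsub>K\<^esub> \<odot>\<^bsub>Hom C X Y\<^esub> \<zero>\<^bsub>Hom C X Y\<^esub>)" using assms by simp
 also have "\<dots> = \<zero>\<^bsub>K\<^esub> \<odot>\<^bsub>Hom D (FObj F X) (FObj F Y)\<^esub> FMor F \<zero>\<^bsub>Hom C X Y\<^esub>"
  by (rule map_smult) (use assms in auto)
 finally show ?thesis using assms by simp
qed

lemma map_neg [simp]:
 assumes "X : Obj C" "Y : Obj C" "arr C f" "src C f = X" "tgt C f = Y"
 shows "FMor F (\<ominus>\<^bsub>Hom C X Y\<^esub> f) = \<ominus>\<^bsub>Hom D (FObj F X) (FObj F Y)\<^esub> FMor F f"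
 using assms by (simp add: C.smult_neg D.smult_neg)

lemma map_sum [simp]:
 assumes "X : Obj C" "Y : Obj C" "ALL i:I. arr C (f i)"
  "ALL i:I. src C (f i) = X" "ALL i:I. tgt C (f i) = Y"
 shows "FMor F (finsum (Hom C X Y) f I) = finsum (Hom D (FObj F X) (FObj F Y)) (%i. FMor F (f i)) I"
proof (cases "finite I")
 case True
 then show ?thesis using assms(3-5)
  by (induction I rule: finite_induct) (use assms(1,2) in auto)
qed (use assms in \<open>simp add: C.sum_infinite D.sum_infinite\<close>)

lemma map_iso [simp]:
 assumes "iso_arr C f"
 shows "iso_arr D (FMor F f)" "inv_arr D (FMor F f) = FMor F (inv_arr C f)"
proof -
 have 1: "FMor F (inv_arr C f) \<bullet>\<^bsub>D\<^esub> FMor F f = Id D (FObj F (src C f))"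
  "FMor F f \<bullet>\<^bsub>D\<^esub> FMor F (inv_arr C f) = Id D (FObj F (tgt C f))"
  using assms by (simp_all flip: map_comp)
 show "iso_arr D (FMor F f)"
  by (rule D.iso_arrI(1)[of _ "FMor F (inv_arr C f)"]) (use assms 1 in simp_all)
 show "inv_arr D (FMor F f) = FMor F (inv_arr C f)"
  by (rule D.iso_arrI(2)) (use assms 1 in simp_all)
qed

lemma map_isomorphic: "isomorphic C X Y ==> isomorphic D (FObj F X) (FObj F Y)"
 unfolding C.isomorphic_iff D.isomorphic_iff
 by (metis map_iso(1) mor(2,3) C.iso_arr_arr)

lemma map_biproduct:
 assumes "biproduct C I M B \<iota> \<pi>"
 shows "biproduct D I (%i. FObj F (M i)) (FObj F B) (%i. FMor F (\<iota> i)) (%i. FMor F (\<pi> i))"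
proof -
 note [simp] = C.biproductD[OF assms]
 have s: "finsum (Hom D (FObj F B) (FObj F B)) (%i. FMor F (\<iota> i) \<bullet>\<^bsub>D\<^esub> FMor F (\<pi> i)) I
   = FMor F (finsum (Hom C B B) (%i. \<iota> i \<bullet>\<^bsub>C\<^esub> \<pi> i) I)"
  by (subst map_sum) (auto intro!: D.sum_cong)
 show ?thesis
  by (rule D.biproductI) (use s in \<open>simp_all flip: map_comp\<close>)
qed

lemma map_direct_sum: "direct_sum C I M B ==> direct_sum D I (%i. FObj F (M i)) (FObj F B)"
 unfolding direct_sum_def using map_biproduct by blast

lemma map_direct_sum2:
 assumes "direct_sum2 C X Y B"
 shows "direct_sum2 D (FObj F X) (FObj F Y) (FObj F B)"
proof -
 have "direct_sum D UNIV (%b. FObj F (if b then X else Y)) (FObj F B)"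
  using map_direct_sum assms unfolding direct_sum2_def by blast
 moreover have "(%b. FObj F (if b then X else Y)) = (%b. if b then FObj F X else FObj F Y)" by auto
 ultimately show ?thesis unfolding direct_sum2_def by simp
qed

lemma map_summand: "summand C X Y ==> summand D (FObj F X) (FObj F Y)"
 unfolding summand_def using map_direct_sum2 by blast

lemma map_zero_obj: "zero_obj C Z ==> zero_obj D (FObj F Z)"
 unfolding C.zero_obj_iff D.zero_obj_iff by (metis map_Id map_zero obj)

end

locale faithful_lin_functor = lin_functor K C D F
 for K :: "('k, 'r) ring_scheme" and C :: "('k, 'o, 'm, 'y) lin_category_scheme"
  and D :: "('k, 'p, 'n, 'z) lin_category_scheme" and F :: "('o, 'm, 'p, 'n, 'f) cat_functor_scheme" +
 assumes faithful: "faithful_functor C D F"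
begin

lemma inj: "FMor F f = FMor F g ==> arr C f ==> arr C g ==> src C f = src C g ==> tgt C f = tgt C g ==> f = g"
 using faithful unfolding faithful_functor_def by blast

lemma reflect_zero_obj: "X : Obj C ==> zero_obj D (FObj F X) ==> zero_obj C X"
 unfolding C.zero_obj_iff D.zero_obj_iff using inj[of "Id C X" "\<zero>\<^bsub>Hom C X X\<^esub>"] by simp

end

locale ff_functor = faithful_lin_functor K C D F
 for K :: "('k, 'r) ring_scheme" and C :: "('k, 'o, 'm, 'y) lin_category_scheme"
  and D :: "('k, 'p, 'n, 'z) lin_category_scheme" and F :: "('o, 'm, 'p, 'n, 'f) cat_functor_scheme" +
 assumes full: "full_functor C D F"
begin

lemma lift:
 assumes "X : Obj C" "Y : Obj C" "arr D h" "src D h = FObj F X" "tgt D h = FObj F Y"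
 obtains f where "arr C f" "src C f = X" "tgt C f = Y" "FMor F f = h"
 using full assms unfolding full_functor_def by blast

lemma reflect_iso:
 assumes "arr C f" "iso_arr D (FMor F f)"
 shows "iso_arr C f"
proof -
 obtain g where g: "arr C g" "src C g = tgt C f" "tgt C g = src C f" "FMor F g = inv_arr D (FMor F f)"
  using lift[of "tgt C f" "src C f" "inv_arr D (FMor F f)"] assms by auto
 show ?thesis
  by (rule C.iso_arrI(1)[of _ g]; (rule inj)?) (use assms g in simp_all)
qed

lemma reflect_isomorphic:
 assumes "X : Obj C" "Y : Obj C" "isomorphic D (FObj F X) (FObj F Y)"
 shows "isomorphic C X Y"
proof -
 obtain h where h: "iso_arr D h" "src D h = FObj F X" "tgt D h = FObj F Y"
  using assms unfolding D.isomorphic_iff by blast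
 obtain f where f: "arr C f" "src C f = X" "tgt C f = Y" "FMor F f = h"
  using lift[of X Y h] assms h by auto
 thus ?thesis unfolding C.isomorphic_iff using reflect_iso h by blast
qed

end

locale lin_equivalence = ff_functor K C D F
 for K :: "('k, 'r) ring_scheme" and C :: "('k, 'o, 'm, 'y) lin_category_scheme"
  and D :: "('k, 'p, 'n, 'z) lin_category_scheme" and F :: "('o, 'm, 'p, 'n, 'f) cat_functor_scheme" +
 assumes ess: "ess_surj C D F"
begin

lemma preimage:
 assumes "Y : Obj D"
 obtains X where "X : Obj C" "isomorphic D (FObj F X) Y"
 using ess assms unfolding ess_surj_def by blast

text \<open>
  Choose a preimage of every object up to isomorphism and transport morphisms along the chosen
  isomorphisms.
\<close>

lemma quasi_inverse:
 "EX (E :: ('p, 'n, 'o, 'm) cat_functor) \<eta> \<theta>. linear_functor K D C E &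
   nat_iso C C id_functor (comp_functor E F) \<eta> & nat_iso D D (comp_functor F E) id_functor \<theta>"
proof -
 have "ALL Y:Obj D. EX X t. X : Obj C & iso_arr D t & src D t = FObj F X & tgt D t = Y"
  using preimage D.isomorphic_iff by metis
 then obtain E0 t where t [simp]: "!!Y. Y : Obj D ==> E0 Y : Obj C" "!!Y. Y : Obj D ==> iso_arr D (t Y)"
  "!!Y. Y : Obj D ==> src D (t Y) = FObj F (E0 Y)" "!!Y. Y : Obj D ==> tgt D (t Y) = Y" by metis
 have "ALL h. EX f. arr D h --> arr C f & src C f = E0 (src D h) & tgt C f = E0 (tgt D h) &
   FMor F f = inv_arr D (t (tgt D h)) \<bullet>\<^bsub>D\<^esub> (h \<bullet>\<^bsub>D\<^esub> t (src D h))"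
 proof
  fix h show "EX f. arr D h --> arr C f & src C f = E0 (src D h) & tgt C f = E0 (tgt D h) &
   FMor F f = inv_arr D (t (tgt D h)) \<bullet>\<^bsub>D\<^esub> (h \<bullet>\<^bsub>D\<^esub> t (src D h))"
   by (cases "arr D h") (use lift[of "E0 (src D h)" "E0 (tgt D h)" "inv_arr D (t (tgt D h)) \<bullet>\<^bsub>D\<^esub> (h \<bullet>\<^bsub>D\<^esub> t (src D h))"] in auto)
 qed
 then obtain E1 where e [simp]: "!!h. arr D h ==> arr C (E1 h)" "!!h. arr D h ==> src C (E1 h) = E0 (src D h)"
  "!!h. arr D h ==> tgt C (E1 h) = E0 (tgt D h)"
  "!!h. arr D h ==> FMor F (E1 h) = inv_arr D (t (tgt D h)) \<bullet>\<^bsub>D\<^esub> (h \<bullet>\<^bsub>D\<^esub> t (src D h))" by metis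
 let ?E = "\<lparr>FObj = E0, FMor = E1\<rparr>"
 have E: "linear_functor K D C ?E"
  unfolding linear_functor_def by (auto intro!: inj)
 have "ALL X:Obj C. EX f. arr C f & src C f = X & tgt C f = E0 (FObj F X) & FMor F f = inv_arr D (t (FObj F X))"
 proof
  fix X assume "X : Obj C"
  thus "EX f. arr C f & src C f = X & tgt C f = E0 (FObj F X) & FMor F f = inv_arr D (t (FObj F X))"
   using lift[of X "E0 (FObj F X)" "inv_arr D (t (FObj F X))"] by auto
 qed
 then obtain \<eta> where h [simp]: "!!X. X : Obj C ==> arr C (\<eta> X)" "!!X. X : Obj C ==> src C (\<eta> X) = X"
  "!!X. X : Obj C ==> tgt C (\<eta> X) = E0 (FObj F X)"
  "!!X. X : Obj C ==> FMor F (\<eta> X) = inv_arr D (t (FObj F X))" by metis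
 have "nat_iso C C id_functor (comp_functor ?E F) \<eta>"
  unfolding nat_iso_def comp_functor_def id_functor_def
  by (auto intro!: inj reflect_iso)
 moreover have "nat_iso D D (comp_functor F ?E) id_functor t"
  unfolding nat_iso_def comp_functor_def id_functor_def by auto
 ultimately show ?thesis using E by blast
qed

lemma equivalence: "equivalence_functor K C D F"
 unfolding equivalence_functor_def using quasi_inverse lin by blast

end

context linear_category
begin

text \<open>
  Faithfulness of \<open>F\<close> follows from the unit and that of its quasi-inverse from the counit;
  together they give fullness.
\<close>

lemma equivalence_imp_lin_equivalence:
 fixes F :: "('o, 'm, 'p, 'n, 'f) cat_functor_scheme"
 assumes D: "linear_category K D" and eq: "equivalence_functor K C D F"
 shows "lin_equivalence K C D F"
proof -
 interpret D: linear_category K D by fact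
 from eq obtain E :: "('p, 'n, 'o, 'm) cat_functor" and \<eta> \<theta> where
  lF: "linear_functor K C D F" and lE: "linear_functor K D C E"
  and n1: "nat_iso C C id_functor (comp_functor E F) \<eta>" and n2: "nat_iso D D (comp_functor F E) id_functor \<theta>"
  unfolding equivalence_functor_def by blast
 interpret F: lin_functor K C D F by unfold_locales (fact lF)
 interpret E: lin_functor K D C E by unfold_locales (fact lE)
 have h [simp]: "iso_arr C (\<eta> X)" "src C (\<eta> X) = X" "tgt C (\<eta> X) = FObj E (FObj F X)" if "X : Obj C" for X
  using n1 that unfolding nat_iso_def id_functor_def comp_functor_def by auto
 have hn: "\<eta> (tgt C f) \<bullet>\<^bsub>C\<^esub> f = FMor E (FMor F f) \<bullet>\<^bsub>C\<^esub> \<eta> (src C f)" if "arr C f" for f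
  using n1 arrD[OF that] unfolding nat_iso_def id_functor_def comp_functor_def by auto
 have t [simp]: "iso_arr D (\<theta> X)" "src D (\<theta> X) = FObj F (FObj E X)" "tgt D (\<theta> X) = X" if "X : Obj D" for X
  using n2 that unfolding nat_iso_def id_functor_def comp_functor_def by auto
 have tn: "\<theta> (tgt D f) \<bullet>\<^bsub>D\<^esub> FMor F (FMor E f) = f \<bullet>\<^bsub>D\<^esub> \<theta> (src D f)" if "arr D f" for f
  using n2 D.arrD[OF that] unfolding nat_iso_def id_functor_def comp_functor_def by auto
 have fF: "f = g" if "FMor F f = FMor F g" "arr C f" "arr C g" "src C f = src C g" "tgt C f = tgt C g" for f g
  by (rule iso_cancel_left[of "\<eta> (tgt C f)"]) (use hn[of f] hn[of g] that in auto)
 have fE: "f = g" if "FMor E f = FMor E g" "arr D f" "arr D g" "src D f = src D g" "tgt D f = tgt D g" for f g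
  by (rule D.iso_cancel_right[of "\<theta> (src D f)"]) (use tn[of f] tn[of g] that in auto)
 show ?thesis
 proof unfold_locales
  show "faithful_functor C D F" unfolding faithful_functor_def using fF by blast
  show "full_functor C D F" unfolding full_functor_def
  proof (intro ballI allI impI)
   fix X Y h assume o [simp]: "X : Obj C" "Y : Obj C" and "arr D h & src D h = FObj F X & tgt D h = FObj F Y"
   hence a [simp]: "arr D h" "src D h = FObj F X" "tgt D h = FObj F Y" by auto
   define f where "f = inv_arr C (\<eta> Y) \<bullet>\<^bsub>C\<^esub> (FMor E h \<bullet>\<^bsub>C\<^esub> \<eta> X)"
   have f [simp]: "arr C f" "src C f = X" "tgt C f = Y" unfolding f_def by auto
   have "\<eta> Y \<bullet>\<^bsub>C\<^esub> f = FMor E h \<bullet>\<^bsub>C\<^esub> \<eta> X" unfolding f_def by simp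
   hence "FMor E (FMor F f) \<bullet>\<^bsub>C\<^esub> \<eta> X = FMor E h \<bullet>\<^bsub>C\<^esub> \<eta> X"
    using hn[of f] by simp
   hence "FMor E (FMor F f) = FMor E h"
    by (rule iso_cancel_right[rotated]) auto
   hence "FMor F f = h" by (rule fE) auto
   thus "EX f. arr C f & src C f = X & tgt C f = Y & FMor F f = h" using f by blast
  qed
  show "ess_surj C D F" unfolding ess_surj_def D.isomorphic_iff using t E.obj by blast
 qed
qed

end

section \<open>Additive closures\<close>

text \<open>
 A morphism lies in the ideal generated by \<open>M\<close> if it is a finite sum of morphisms that factor
 through \<open>M\<close>. An object belongs to \<open>add M\<close> iff its identity lies in this ideal, which makes
 no reference to direct sums and is therefore preserved by every linear functor.
\<close>

inductive through :: "('k, 'o, 'm, 'z) lin_category_scheme => 'o => 'm => bool" for C M where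
 zero: "X : Obj C ==> Y : Obj C ==> through C M \<zero>\<^bsub>Hom C X Y\<^esub>"
| step: "through C M f ==> arr C a ==> arr C b ==> tgt C a = M ==> src C b = M ==>
  src C a = src C f ==> tgt C b = tgt C f ==>
  through C M (f \<oplus>\<^bsub>Hom C (src C f) (tgt C f)\<^esub> (b \<bullet>\<^bsub>C\<^esub> a))"

definition in_add :: "('k, 'o, 'm, 'z) lin_category_scheme => 'o => 'o => bool"
 where "in_add C X M \<longleftrightarrow> X : Obj C & M : Obj C & through C M (Id C X)"

context linear_category
begin

lemma through_arr: "through C M f ==> arr C f"
 by (induction rule: through.induct) auto

lemma through_comp_mor:
 assumes "arr C a" "arr C b" "tgt C a = M" "src C b = M"
 shows "through C M (b \<bullet> a)"
proof -
 have "through C M (\<zero>[src C a,tgt C b] \<oplus>[src C a,tgt C b] (b \<bullet> a))"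
  using through.step[OF through.zero[of "src C a" C "tgt C b" M], of a b] assms by simp
 thus ?thesis using assms by simp
qed

lemma through_add:
 assumes "through C M f" "through C M g" "src C f = src C g" "tgt C f = tgt C g"
 shows "through C M (f \<oplus>[src C f,tgt C f] g)"
 using assms
proof (induction rule: through.induct)
 case (zero X Y)
 thus ?case using through_arr[of M g] by simp
next
 case (step f a b)
 have fg [simp]: "arr C f" "arr C g" using step through_arr by auto
 interpret M: abelian_group "Hom C (src C f) (tgt C f)" using hom_group by simp
 let ?s = "%x y. x \<oplus>[src C f,tgt C f] y"
 have [simp]: "src C g = src C f" "tgt C g = tgt C f" using step by auto
 have "through C M (?s (?s f g) (b \<bullet> a))"
  using through.step[of C M "?s f g" a b] step by simp
 moreover have "?s (?s f g) (b \<bullet> a) = ?s (?s f (b \<bullet> a)) g"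
  using step by (simp add: M.a_ac)
 ultimately show ?case using step by simp
qed

lemma through_comp_left:
 "through C M f ==> arr C g ==> src C g = tgt C f ==> through C M (g \<bullet> f)"
proof (induction rule: through.induct)
 case (zero X Y) thus ?case by (simp add: through.zero)
next
 case (step f a b)
 have [simp]: "arr C f" using step through_arr by auto
 show ?case using step through.step[of C M "g \<bullet> f" a "g \<bullet> b"] by simp
qed

lemma through_comp_right:
 "through C M f ==> arr C g ==> tgt C g = src C f ==> through C M (f \<bullet> g)"
proof (induction rule: through.induct)
 case (zero X Y) thus ?case by (simp add: through.zero)
next
 case (step f a b)
 have [simp]: "arr C f" using step through_arr by auto
 show ?case using step through.step[of C M "f \<bullet> g" "a \<bullet> g" b] by simp
qed

lemma through_sum:
 assumes "finite I" "X : Obj C" "Y : Obj C" "!!i. i : I ==> through C M (f i)"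
  "!!i. i : I ==> src C (f i) = X" "!!i. i : I ==> tgt C (f i) = Y"
 shows "through C M (finsum (Hom C X Y) f I)"
 using assms(1,4-6)
proof (induction I rule: finite_induct)
 case empty thus ?case using assms by (simp add: through.zero)
next
 case (insert i I)
 have a: "arr C (f j)" if "j : insert i I" for j using through_arr insert that by blast
 show ?case using through_add[of M "f i" "finsum (Hom C X Y) f I"] insert a assms(2,3) by simp
qed

lemma through_trans:
 assumes "through C M f" "through C N (Id C M)" shows "through C N f"
 using assms(1)
proof (induction rule: through.induct)
 case (zero X Y) thus ?case by (simp add: through.zero)
next
 case (step f a b)
 have [simp]: "arr C f" using step through_arr by auto
 have M: "M : Obj C" using step by (metis arr_obj(1))
 have "through C N (b \<bullet> (Id C M \<bullet> a))"
  using through_comp_left[OF through_comp_right[OF assms(2), of a], of b] step M by simp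
 hence "through C N (b \<bullet> a)" using step by simp
 thus ?case using through_add[of N f "b \<bullet> a"] step by simp
qed

lemma in_add_refl: "X : Obj C ==> in_add C X X"
 unfolding in_add_def using through_comp_mor[of "Id C X" "Id C X" X] by simp

lemma in_add_trans: "in_add C X Y ==> in_add C Y Z ==> in_add C X Z"
 unfolding in_add_def using through_trans by blast

lemma in_add_retract:
 assumes "arr C s" "arr C r" "src C s = X" "tgt C s = Y" "src C r = Y" "tgt C r = X" "r \<bullet> s = Id C X"
 shows "in_add C X Y"
 unfolding in_add_def using through_comp_mor[of s r Y] assms arr_obj by metis

lemma in_add_iso: "isomorphic C X Y ==> in_add C X Y"
 unfolding isomorphic_iff using in_add_retract by (metis inv_arr iso_arr_arr)

lemma in_add_direct_sum:
 assumes "direct_sum C I M B" "!!i. i : I ==> in_add C (M i) Y" "Y : Obj C"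
 shows "in_add C B Y"
proof -
 obtain \<iota> \<pi> where b: "biproduct C I M B \<iota> \<pi>" using assms unfolding direct_sum_def by blast
 note [simp] = biproductD[OF b]
 have "through C Y (\<iota> i \<bullet> \<pi> i)" if i: "i : I" for i
 proof -
  have "through C Y (\<iota> i \<bullet> (Id C (M i) \<bullet> \<pi> i))"
   using assms(2)[OF i] i unfolding in_add_def
   by (intro through_comp_left through_comp_right) (auto simp: through_arr)
  thus ?thesis using i by simp
 qed
 hence "through C Y (finsum (Hom C B B) (%i. \<iota> i \<bullet> \<pi> i) I)"
  by (intro through_sum) auto
 thus ?thesis unfolding in_add_def using assms by simp
qed

lemma direct_sum_in_add:
 assumes "direct_sum C I M B" "i : I"
 shows "in_add C (M i) B"
proof -
 obtain \<iota> \<pi> where b: "biproduct C I M B \<iota> \<pi>" using assms unfolding direct_sum_def by blast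
 note [simp] = biproductD[OF b]
 show ?thesis by (rule in_add_retract[of "\<iota> i" "\<pi> i"]) (use assms in auto)
qed

lemma through_eq_sum:
 assumes "through C M f"
 shows "EX (n::nat) a b. (ALL i<n. arr C (a i) & arr C (b i) & src C (a i) = src C f & tgt C (a i) = M &
   src C (b i) = M & tgt C (b i) = tgt C f) &
   f = finsum (Hom C (src C f) (tgt C f)) (%i. b i \<bullet> a i) {..<n}"
 using assms
proof (induction rule: through.induct)
 case (zero X Y)
 show ?case by (rule exI[of _ 0]) (use zero in simp)
next
 case (step f a b)
 have f [simp]: "arr C f" using step through_arr by auto
 obtain n a' b' where n: "ALL i<n. arr C (a' i) & arr C (b' i) & src C (a' i) = src C f & tgt C (a' i) = M &
   src C (b' i) = M & tgt C (b' i) = tgt C f"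
   "f = finsum (Hom C (src C f) (tgt C f)) (%i. b' i \<bullet> a' i) {..<n::nat}"
  using step.IH by blast
 have "finsum (Hom C (src C f) (tgt C f)) (%i. (b'(n:=b)) i \<bullet> (a'(n:=a)) i) {..<n} = f"
  by (subst (3) n(2), rule sum_cong) (use n in auto)
 hence "finsum (Hom C (src C f) (tgt C f)) (%i. (b'(n:=b)) i \<bullet> (a'(n:=a)) i) {..<Suc n} =
   (b \<bullet> a) \<oplus>[src C f,tgt C f] f"
  unfolding lessThan_Suc by (subst sum_insert) (use n step in auto)
 also have "\<dots> = f \<oplus>[src C f,tgt C f] (b \<bullet> a)"
 proof -
  interpret M: abelian_group "Hom C (src C f) (tgt C f)" using hom_group by simp
  show ?thesis using step by (intro M.a_comm) auto
 qed
 finally show ?case using n step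
  by (intro exI[of _ "Suc n"] exI[of _ "a'(n:=a)"] exI[of _ "b'(n:=b)"]) (auto simp: less_Suc_eq)
qed

lemma direct_sum_empty: "direct_sum C {} M Z \<longleftrightarrow> zero_obj C Z"
 unfolding direct_sum_def biproduct_def zero_obj_iff by (auto simp: eq_commute)

lemma direct_sum_insert:
 assumes "direct_sum C I M B" "j \<notin> I" "direct_sum2 C (M j) B B'"
 shows "direct_sum C (insert j I) M B'"
proof -
 obtain \<iota> \<pi> where b: "biproduct C I M B \<iota> \<pi>" using assms unfolding direct_sum_def by blast
 note [simp] = biproductD(1-11)[OF b]
 obtain i p k q where r [simp]: "M j : Obj C" "B : Obj C" "B' : Obj C"
  "arr C i" "src C i = M j" "tgt C i = B'" "arr C p" "src C p = B'" "tgt C p = M j"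
  "arr C k" "src C k = B" "tgt C k = B'" "arr C q" "src C q = B'" "tgt C q = B"
  "p \<bullet> i = Id C (M j)" "q \<bullet> k = Id C B" "p \<bullet> k = \<zero>[B,M j]" "q \<bullet> i = \<zero>[M j,B]"
  and s: "(i \<bullet> p) \<oplus>[B',B'] (k \<bullet> q) = Id C B'"
  using assms(3) unfolding direct_sum2_iff by blast
 let ?\<iota> = "%l. if l = j then i else k \<bullet> \<iota> l" let ?\<pi> = "%l. if l = j then p else \<pi> l \<bullet> q"
 note [simp] = reassoc[OF r(17)] reassoc[OF r(18)] reassoc[OF r(19)] reassoc[OF r(16)]
 have kq: "k \<bullet> q = finsum (Hom C B' B') (%l. ?\<iota> l \<bullet> ?\<pi> l) I"
 proof -
  have "k \<bullet> q = k \<bullet> (finsum (Hom C B B) (%i. \<iota> i \<bullet> \<pi> i) I \<bullet> q)" using biproductD(12)[OF b] by simp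
  also have "\<dots> = finsum (Hom C B' B') (%l. k \<bullet> ((\<iota> l \<bullet> \<pi> l) \<bullet> q)) I"
   by (subst comp_sum, auto)
  also have "\<dots> = finsum (Hom C B' B') (%l. ?\<iota> l \<bullet> ?\<pi> l) I"
   using assms(2) by (intro sum_cong) auto
  finally show ?thesis .
 qed
 have "biproduct C (insert j I) M B' ?\<iota> ?\<pi>"
 proof (rule biproductI)
  show "finsum (Hom C B' B') (%l. ?\<iota> l \<bullet> ?\<pi> l) (insert j I) = Id C B'"
   using assms(2) by (subst sum_insert) (auto simp flip: kq simp: s)
  fix l l' assume l: "l : insert j I" "l' : insert j I" "l \<noteq> l'"
  have "\<pi> l' \<bullet> (q \<bullet> (k \<bullet> \<iota> l)) = \<zero>[M l,M l']" if "l \<noteq> j" "l' \<noteq> j"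
   using l that by simp
  thus "?\<pi> l' \<bullet> ?\<iota> l = \<zero>[M l,M l']"
   using l by auto
 qed (use assms(2) in auto)
 thus ?thesis unfolding direct_sum_def by blast
qed

end

locale additive_lin_category = linear_category +
 assumes additive': "additive_category K C"
begin

lemma zero_obj_exists: "EX Z. zero_obj C Z"
 using additive' unfolding additive_category_def by blast

lemma direct_sum2_exists: "X : Obj C ==> Y : Obj C ==> EX B. direct_sum2 C X Y B"
 using additive' unfolding additive_category_def by blast

lemma direct_sum_exists:
 assumes "finite I" "!!i. i : I ==> M i : Obj C"
 shows "EX B. direct_sum C I M B"
 using assms
proof (induction I rule: finite_induct)
 case empty thus ?case using zero_obj_exists by (simp add: direct_sum_empty)
next
 case (insert j I)
 then obtain B where B: "direct_sum C I M B" by auto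
 hence "B : Obj C" unfolding direct_sum_def biproduct_def by blast
 then obtain B' where "direct_sum2 C (M j) B B'" using direct_sum2_exists insert by blast
 thus ?case using direct_sum_insert[OF B insert(2)] by blast
qed

text \<open>A class closed under binary sums and isomorphism is closed under all finite sums.\<close>

lemma direct_sum_closed:
 assumes "direct_sum C I M B" "!!i. i : I ==> M i : S"
  and zero: "!!Z. zero_obj C Z ==> Z : S"
  and sum: "!!X Y B. X : S ==> Y : S ==> direct_sum2 C X Y B ==> B : S"
  and iso: "!!X Y. X : S ==> isomorphic C X Y ==> Y : S"
 shows "B : S"
proof -
 have "finite I" "!!i. i : I ==> M i : Obj C"
  using assms(1) unfolding direct_sum_def biproduct_def by blast+
 hence "EX B. direct_sum C I M B & B : S" using assms(2)
 proof (induction I rule: finite_induct)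
  case empty thus ?case using zero_obj_exists zero by (auto simp: direct_sum_empty)
 next
  case (insert j I)
  then obtain B where B: "direct_sum C I M B" "B : S" by auto
  hence "B : Obj C" unfolding direct_sum_def biproduct_def by blast
  then obtain B' where B': "direct_sum2 C (M j) B B'" using direct_sum2_exists insert by blast
  have "B' : S" using sum[OF _ B(2) B'] insert by auto
  thus ?case using direct_sum_insert[OF B(1) insert(2) B'] by blast
 qed
 then obtain B' where "direct_sum C I M B'" "B' : S" by blast
 moreover have "isomorphic C B' B"
  by (rule direct_sum_iso[OF calculation(1) assms(1), of id])
   (use \<open>!!i. i : I ==> M i : Obj C\<close> isomorphic_refl in auto)
 ultimately show ?thesis using iso by blast
qed

end

context lin_functor
begin

lemma map_through: "through C M f ==> through D (FObj F M) (FMor F f)"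
proof (induction rule: through.induct)
 case (zero X Y) thus ?case by (simp add: through.zero)
next
 case (step f a b)
 have [simp]: "arr C f" using step C.through_arr by auto
 show ?case using through.step[of D "FObj F M" "FMor F f" "FMor F a" "FMor F b"] step by simp
qed

lemma map_in_add: "in_add C X M ==> in_add D (FObj F X) (FObj F M)"
 unfolding in_add_def using map_through by force

end


section \<open>Krull-Schmidt categories\<close>

text \<open>
  Any \<open>N\<close> endomorphisms are linearly dependent. Unlike a choice of generators this bound passes
  to subspaces, in particular to the endomorphisms of an equivariant object.
\<close>

definition dependent_bound :: "('k, 'r) ring_scheme => ('k, 'o, 'm, 'z) lin_category_scheme => nat => 'o => bool"
 where "dependent_bound K C N X \<longleftrightarrow> (ALL f. (ALL i<N. f i : Homs C X X) -->
  (EX c. (ALL i<N. c i : carrier K) & (EX i<N. c i \<noteq> \<zero>\<^bsub>K\<^esub>) &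
   finsum (Hom C X X) (%i. c i \<odot>\<^bsub>Hom C X X\<^esub> f i) {..<N} = \<zero>\<^bsub>Hom C X X\<^esub>))"

text \<open>
  Elimination: an equation with a nonzero coefficient is used to remove one unknown from the
  others.
\<close>

lemma (in field) homogeneous_system_nontrivial:
 assumes "finite S" "finite I" "card S < card I" "!!i s. i : I ==> s : S ==> c i s : carrier R"
 shows "EX a. (ALL i:I. a i : carrier R) & (EX i:I. a i \<noteq> \<zero>) & (ALL s:S. (\<Oplus>i\<in>I. a i \<otimes> c i s) = \<zero>)"
 using assms
proof (induction S arbitrary: I c rule: finite_induct)
 case empty
 hence "I \<noteq> {}" by auto
 thus ?case by (intro exI[of _ "%_. \<one>"]) auto
next
 case (insert s0 S)
 show ?case
 proof (cases "ALL i:I. c i s0 = \<zero>")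
  case True
  obtain a where a: "ALL i:I. a i : carrier R" "EX i:I. a i \<noteq> \<zero>" "ALL s:S. (\<Oplus>i\<in>I. a i \<otimes> c i s) = \<zero>"
  proof -
   have "card S < card I" using insert by auto
   from insert.IH[OF insert.prems(1) this, of c] insert.prems(3) that show thesis by blast
  qed
  have "(\<Oplus>i\<in>I. a i \<otimes> c i s0) = (\<Oplus>i\<in>I. \<zero>)" by (rule finsum_cong') (use True a in auto)
  thus ?thesis using a by (intro exI[of _ a]) auto
 next
  case False
  then obtain i0 where i0: "i0 : I" "c i0 s0 \<noteq> \<zero>" by blast
  let ?J = "I - {i0}"
  define t where "t i = c i s0 \<otimes> inv (c i0 s0)" for i
  have inv0: "inv (c i0 s0) : carrier R" "inv (c i0 s0) \<otimes> c i0 s0 = \<one>"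
   using i0 insert.prems by (auto simp: field_Units)
  have t: "t i : carrier R" if "i : I" for i unfolding t_def using that inv0 insert.prems by auto
  have cc: "!!i s. i : I ==> s : insert s0 S ==> c i s : carrier R" using insert.prems by blast
  obtain a where a: "ALL i:?J. a i : carrier R" "EX i:?J. a i \<noteq> \<zero>"
   "ALL s:S. (\<Oplus>i\<in>?J. a i \<otimes> (c i s \<ominus> t i \<otimes> c i0 s)) = \<zero>"
  proof -
   have J: "finite ?J" "card S < card ?J" using insert.prems insert.hyps i0 by auto
   have "EX a. (ALL i:?J. a i : carrier R) & (EX i:?J. a i \<noteq> \<zero>) &
     (ALL s:S. (\<Oplus>i\<in>?J. a i \<otimes> (c i s \<ominus> t i \<otimes> c i0 s)) = \<zero>)"
    by (rule insert.IH[OF J]) (use cc i0 t in auto)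
   with that show thesis by blast
  qed
  define b where "b = a(i0 := \<ominus> (\<Oplus>i\<in>?J. a i \<otimes> t i))"
  have b0: "(\<Oplus>i\<in>?J. a i \<otimes> t i) : carrier R" by (rule finsum_closed) (use a t in auto)
  have sum: "(\<Oplus>i\<in>I. b i \<otimes> c i s) = (\<Oplus>i\<in>?J. a i \<otimes> (c i s \<ominus> t i \<otimes> c i0 s))" if s: "s : insert s0 S" for s
  proof -
   have "(\<Oplus>i\<in>?J. a i \<otimes> (c i s \<ominus> t i \<otimes> c i0 s)) =
     (\<Oplus>i\<in>?J. a i \<otimes> c i s \<oplus> (\<ominus> (a i \<otimes> t i)) \<otimes> c i0 s)"
    by (rule finsum_cong') (use a t s cc i0 in \<open>auto simp: minus_eq r_distr l_minus r_minus m_assoc\<close>)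
   also have "\<dots> = (\<Oplus>i\<in>?J. a i \<otimes> c i s) \<oplus> (\<Oplus>i\<in>?J. (\<ominus> (a i \<otimes> t i)) \<otimes> c i0 s)"
    by (rule finsum_addf) (use a t s cc i0 in auto)
   also have "(\<Oplus>i\<in>?J. (\<ominus> (a i \<otimes> t i)) \<otimes> c i0 s) = (\<Oplus>i\<in>?J. \<ominus> (a i \<otimes> t i)) \<otimes> c i0 s"
    by (rule finsum_ldistr[symmetric]) (use a t s cc i0 insert.prems in auto)
   also have "(\<Oplus>i\<in>?J. \<ominus> (a i \<otimes> t i)) = (\<Oplus>i\<in>?J. (\<ominus> \<one>) \<otimes> (a i \<otimes> t i))"
    by (rule finsum_cong') (use a t in \<open>auto simp: l_minus\<close>)
   also have "\<dots> = (\<ominus> \<one>) \<otimes> (\<Oplus>i\<in>?J. a i \<otimes> t i)"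
    by (rule finsum_rdistr[symmetric]) (use a t insert.prems in auto)
   also have "\<dots> = b i0" unfolding b_def using b0 by (simp add: l_minus)
   also have "(\<Oplus>i\<in>?J. a i \<otimes> c i s) = (\<Oplus>i\<in>?J. b i \<otimes> c i s)"
    by (rule finsum_cong') (use a s cc in \<open>auto simp: b_def\<close>)
   also have "(\<Oplus>i\<in>?J. b i \<otimes> c i s) \<oplus> b i0 \<otimes> c i0 s = (\<Oplus>i\<in>insert i0 ?J. b i \<otimes> c i s)"
    by (subst finsum_insert) (use a s cc i0 b0 insert.prems in \<open>auto simp: b_def intro!: a_comm\<close>)
   also have "insert i0 ?J = I" using i0 by auto
   finally show ?thesis by simp
  qed
  have "(\<Oplus>i\<in>?J. a i \<otimes> (c i s0 \<ominus> t i \<otimes> c i0 s0)) = (\<Oplus>i\<in>?J. \<zero>)"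
   by (rule finsum_cong') (use a t cc i0 inv0 in \<open>auto simp: t_def m_assoc minus_eq r_neg\<close>)
  hence "ALL s:insert s0 S. (\<Oplus>i\<in>I. b i \<otimes> c i s) = \<zero>" using a sum by auto
  moreover have "ALL i:I. b i : carrier R" using a b0 unfolding b_def by auto
  moreover have "EX i:I. b i \<noteq> \<zero>" using a unfolding b_def by auto
  ultimately show ?thesis by blast
 qed
qed

lemma (in linear_category) hom_finite_dependent_bound:
 assumes X: "X : Obj C" and fin: "finitely_spanned K (Hom C X X)"
 shows "EX N. dependent_bound K C N X"
proof -
 obtain S where S: "finite S" "S \<subseteq> Homs C X X"
  "ALL f:Homs C X X. EX c:S \<rightarrow> carrier K. f = finsum (Hom C X X) (%s. c s \<odot>[X,X] s) S"
  using fin unfolding finitely_spanned_def by blast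
 have s [simp]: "arr C s" "src C s = X" "tgt C s = X" if "s : S" for s using that S X by auto
 (* the coefficients with respect to the finite spanning set give card S equations *)
 have "dependent_bound K C (Suc (card S)) X" unfolding dependent_bound_def
 proof (intro allI impI)
  fix f assume f: "ALL i<Suc (card S). f i : Homs C X X"
  let ?I = "{..<Suc (card S)}"
  have "ALL i:?I. EX c. (ALL s:S. c s : carrier K) & f i = finsum (Hom C X X) (%s. c s \<odot>[X,X] s) S"
  proof
   fix i assume "i : ?I"
   then obtain c where "c : S \<rightarrow> carrier K" "f i = finsum (Hom C X X) (%s. c s \<odot>[X,X] s) S"
    using f S(3) by blast
   thus "EX c. (ALL s:S. c s : carrier K) & f i = finsum (Hom C X X) (%s. c s \<odot>[X,X] s) S"
    by (intro exI[of _ c]) auto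
  qed
  then obtain c where c: "!!i s. i : ?I ==> s : S ==> c i s : carrier K"
   "!!i. i : ?I ==> f i = finsum (Hom C X X) (%s. c i s \<odot>[X,X] s) S" by metis
  obtain a where a: "!!i. i : ?I ==> a i : carrier K" "EX i:?I. a i \<noteq> \<zero>\<^bsub>K\<^esub>"
   "!!s. s : S ==> finsum K (%i. a i \<otimes>\<^bsub>K\<^esub> c i s) ?I = \<zero>\<^bsub>K\<^esub>"
  proof -
   have "EX a. (ALL i:?I. a i : carrier K) & (EX i:?I. a i \<noteq> \<zero>\<^bsub>K\<^esub>) &
     (ALL s:S. finsum K (%i. a i \<otimes>\<^bsub>K\<^esub> c i s) ?I = \<zero>\<^bsub>K\<^esub>)"
    by (rule homogeneous_system_nontrivial[OF S(1)]) (use c(1) in auto)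
   with that show thesis by blast
  qed
  have "finsum (Hom C X X) (%i. a i \<odot>[X,X] f i) ?I =
    finsum (Hom C X X) (%i. finsum (Hom C X X) (%s. (a i \<otimes>\<^bsub>K\<^esub> c i s) \<odot>[X,X] s) S) ?I"
   by (rule sum_cong) (use X a c S(1) in \<open>auto simp: smult_sum intro!: sum_cong\<close>)
  also have "\<dots> = finsum (Hom C X X) (%s. finsum (Hom C X X) (%i. (a i \<otimes>\<^bsub>K\<^esub> c i s) \<odot>[X,X] s) ?I) S"
   by (rule sum_swap) (use X a c S(1) in auto)
  also have "\<dots> = finsum (Hom C X X) (%s. \<zero>[X,X]) S"
  proof (rule sum_cong)
   fix s assume "s : S"
   thus "finsum (Hom C X X) (%i. (a i \<otimes>\<^bsub>K\<^esub> c i s) \<odot>[X,X] s) ?I = \<zero>[X,X]"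
    using sum_smult[of X X s ?I "%i. a i \<otimes>\<^bsub>K\<^esub> c i s"] X a(1,3) c(1) by simp
  qed (use X in auto)
  finally show "EX c. (ALL i<Suc (card S). c i : carrier K) & (EX i<Suc (card S). c i \<noteq> \<zero>\<^bsub>K\<^esub>) &
    finsum (Hom C X X) (%i. c i \<odot>[X,X] f i) ?I = \<zero>[X,X]"
   using a X by (intro exI[of _ a]) auto
 qed
 thus ?thesis by blast
qed

primrec cpow :: "('k, 'o, 'm, 'z) lin_category_scheme => 'm => nat => 'm" where
 "cpow C f 0 = Id C (src C f)"
| "cpow C f (Suc n) = f \<bullet>\<^bsub>C\<^esub> cpow C f n"

locale krull_schmidt = additive_lin_category +
 assumes idem: "idempotent_complete C"
  and bound: "X : Obj C ==> EX N. dependent_bound K C N X"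
begin

lemma cpow_arr [simp]:
 assumes "arr C f" "tgt C f = src C f"
 shows "arr C (cpow C f n)" "src C (cpow C f n) = src C f" "tgt C (cpow C f n) = src C f"
 by (induction n) (use assms in auto)

lemma cpow_commute:
 assumes "arr C f" "tgt C f = src C f" "arr C s" "src C s = src C f" "tgt C s = src C f" "s \<bullet> f = f \<bullet> s"
 shows "s \<bullet> cpow C f n = cpow C f n \<bullet> s"
proof (induction n)
 case (Suc n)
 have "s \<bullet> cpow C f (Suc n) = f \<bullet> (s \<bullet> cpow C f n)"
  using assms reassoc[OF assms(6)] by simp
 thus ?case using Suc assms by simp
qed (use assms in simp)

lemma cpow_add:
 assumes "arr C f" "tgt C f = src C f"
 shows "cpow C f (m + n) = cpow C f m \<bullet> cpow C f n"
 by (induction m) (use assms in auto)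

lemma idem_split:
 assumes "arr C e" "src C e = X" "tgt C e = X" "e \<bullet> e = e"
 obtains Y r s where "Y : Obj C" "arr C r" "src C r = X" "tgt C r = Y"
  "arr C s" "src C s = Y" "tgt C s = X" "s \<bullet> r = e" "r \<bullet> s = Id C Y"
proof -
 have X: "X : Obj C" using assms by auto
 moreover have "e : Homs C X X" using X assms by simp
 ultimately obtain Y r s where "Y : Obj C" "r : Homs C X Y" "s : Homs C Y X" "s \<bullet> r = e" "r \<bullet> s = Id C Y"
  using idem assms(4) unfolding idempotent_complete_def by blast
 thus ?thesis using X by (intro that[of Y r s]) auto
qed

lemma complement:
 assumes "arr C r" "arr C s" "src C s = X" "tgt C s = Y" "src C r = Y" "tgt C r = X" "r \<bullet> s = Id C X"
 obtains X' r' s' where "X' : Obj C" "arr C r'" "arr C s'" "src C s' = X'" "tgt C s' = Y" "src C r' = Y"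
  "tgt C r' = X'" "r' \<bullet> s' = Id C X'" "r' \<bullet> s = \<zero>[X,X']" "r \<bullet> s' = \<zero>[X',X]"
  "(s \<bullet> r) \<oplus>[Y,Y] (s' \<bullet> r') = Id C Y"
proof -
 have o [simp]: "X : Obj C" "Y : Obj C" using assms arr_obj by blast+
 note [simp] = assms reassoc[OF assms(7)]
 interpret M: abelian_group "Hom C Y Y" using hom_group by simp
 define e where "e = Id C Y \<oplus>[Y,Y] (\<ominus>[Y,Y] (s \<bullet> r))"
 have e [simp]: "arr C e" "src C e = Y" "tgt C e = Y" unfolding e_def by auto
 have es: "e \<bullet> s = \<zero>[X,Y]" and re: "r \<bullet> e = \<zero>[Y,X]" unfolding e_def by simp_all
 have "e \<bullet> e = (Id C Y \<bullet> e) \<oplus>[Y,Y] ((\<ominus>[Y,Y] (s \<bullet> r)) \<bullet> e)"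
  by (subst (1) e_def) simp
 also have "\<dots> = e" using re by simp
 finally have ee: "e \<bullet> e = e" .
 obtain X' r' s' where d [simp]: "X' : Obj C" "arr C r'" "src C r' = Y" "tgt C r' = X'"
  "arr C s'" "src C s' = X'" "tgt C s' = Y" "s' \<bullet> r' = e" "r' \<bullet> s' = Id C X'"
  using idem_split[OF e ee] by blast
 have r'e: "r' \<bullet> e = r'" using reassoc[OF d(9), of r'] by simp
 have es': "e \<bullet> s' = s'" by (simp flip: d(8))
 have "r' \<bullet> s = (r' \<bullet> e) \<bullet> s" by (simp only: r'e)
 also have "\<dots> = r' \<bullet> (e \<bullet> s)" by (rule assoc) simp_all
 also have "\<dots> = \<zero>[X,X']" by (simp only: es) simp
 finally have 1: "r' \<bullet> s = \<zero>[X,X']" .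
 have "r \<bullet> s' = r \<bullet> (e \<bullet> s')" by (simp only: es')
 also have "\<dots> = (r \<bullet> e) \<bullet> s'" by (rule assoc[symmetric]) simp_all
 also have "\<dots> = \<zero>[X',X]" by (simp only: re) simp
 finally have 2: "r \<bullet> s' = \<zero>[X',X]" .
 have 3: "(s \<bullet> r) \<oplus>[Y,Y] e = Id C Y"
 proof -
  have c: "s \<bullet> r : Homs C Y Y" "Id C Y : Homs C Y Y" by simp_all
  show ?thesis unfolding e_def using c M.a_lcomm[of "s \<bullet> r" "Id C Y" "\<ominus>[Y,Y] (s \<bullet> r)"]
   by (simp del: hom_iff add: M.r_neg)
 qed
 show ?thesis by (rule that[of X' r' s']) (use 1 2 3 in simp_all)
qed

lemma retract_summand:
 assumes "arr C r" "arr C s" "src C s = X" "tgt C s = Y" "src C r = Y" "tgt C r = X" "r \<bullet> s = Id C X"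
 shows "summand C X Y"
proof -
 have "X : Obj C" "Y : Obj C" using assms arr_obj by blast+
 thus ?thesis using complement[OF assms] assms unfolding summand_def direct_sum2_iff by metis
qed

lemma add_of_iff:
 assumes M: "M : Obj C"
 shows "X : add_of C M \<longleftrightarrow> in_add C X M"
proof
 assume "X : add_of C M"
 then obtain n :: nat and S X' where S: "direct_sum C {..<n} (%_. M) S" and d: "direct_sum2 C X X' S"
  unfolding add_of_def summand_def by blast
 have "in_add C S M" by (rule in_add_direct_sum[OF S]) (use M in_add_refl in auto)
 moreover have "in_add C X S" using d in_add_retract unfolding direct_sum2_iff by metis
 ultimately show "in_add C X M" by (rule in_add_trans[rotated])
next
 assume X: "in_add C X M"
 hence o [simp]: "X : Obj C" unfolding in_add_def by blast
 obtain n :: nat and a b where ab: "!!i. i : {..<n} ==> arr C (a i)" "!!i. i : {..<n} ==> arr C (b i)"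
   "!!i. i : {..<n} ==> src C (a i) = X" "!!i. i : {..<n} ==> tgt C (a i) = M"
   "!!i. i : {..<n} ==> src C (b i) = M" "!!i. i : {..<n} ==> tgt C (b i) = X"
   and s: "Id C X = finsum (Hom C X X) (%i. b i \<bullet> a i) {..<n}"
  using through_eq_sum[of M "Id C X"] X unfolding in_add_def by auto
 obtain S where S: "direct_sum C {..<n} (%_. M) S" using direct_sum_exists[of "{..<n}" "%_. M"] M by auto
 then obtain \<iota> \<pi> where B: "biproduct C {..<n} (%_. M) S \<iota> \<pi>" unfolding direct_sum_def by blast
 note [simp] = biproductD(2-9)[OF B]
 let ?r = "copair {..<n} S X \<pi> b" let ?s = "finsum (Hom C X S) (%i. \<iota> i \<bullet> a i) {..<n}"
 have ri [simp]: "?r \<bullet> \<iota> i = b i" if "i : {..<n}" for i using copair(4)[OF B o, of b] ab that by auto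
 have rr [simp]: "arr C ?r" "src C ?r = S" "tgt C ?r = X"
  using copair(1-3)[OF B o, of b] ab by auto
 have "?r \<bullet> ?s = finsum (Hom C X X) (%i. (?r \<bullet> \<iota> i) \<bullet> a i) {..<n}"
  using ab by (subst comp_sum) (auto intro!: sum_cong simp: reassoc[OF ri])
 also have "\<dots> = Id C X" unfolding s using ab by (intro sum_cong) (auto simp: reassoc[OF ri])
 finally have "summand C X S" using ab by (intro retract_summand[of ?r ?s]) (auto intro!: sum_arr)
 thus "X : add_of C M" using S unfolding add_of_def by blast
qed

lemma add_of_eq_iff:
 assumes "M : Obj C" "N : Obj C"
 shows "add_of C M = add_of C N \<longleftrightarrow> in_add C M N & in_add C N M"
 using assms add_of_iff in_add_refl in_add_trans by blast

lemma indecomposable_idem: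
 assumes ind: "indecomposable C X" and e: "arr C e" "src C e = X" "tgt C e = X" "e \<bullet> e = e"
 shows "e = \<zero>[X,X] \<or> e = Id C X"
proof -
 obtain Y r s where d: "Y : Obj C" "arr C r" "src C r = X" "tgt C r = Y"
  "arr C s" "src C s = Y" "tgt C s = X" "s \<bullet> r = e" "r \<bullet> s = Id C Y"
  using idem_split[OF e] by blast
 have X: "X : Obj C" using d arr_obj by blast
 obtain Z r' s' where d': "Z : Obj C" "arr C r'" "arr C s'" "src C s' = Z" "tgt C s' = X" "src C r' = X"
  "tgt C r' = Z" "r' \<bullet> s' = Id C Z" "r' \<bullet> s = \<zero>[Y,Z]" "r \<bullet> s' = \<zero>[Z,Y]"
  "(s \<bullet> r) \<oplus>[X,X] (s' \<bullet> r') = Id C X"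
  using complement[OF d(2,5,6,7,3,4,9)] by blast
 have "direct_sum2 C Y Z X" unfolding direct_sum2_iff using d d' X by blast
 hence "zero_obj C Y \<or> zero_obj C Z" using ind unfolding indecomposable_def by blast
 thus ?thesis
 proof
  assume "zero_obj C Y"
  hence "r = \<zero>[X,Y]" using zero_obj_hom d X by (metis zero_arr)
  thus ?thesis using d X by auto
 next
  assume "zero_obj C Z"
  hence "r' = \<zero>[X,Z]" using zero_obj_hom d' X by (metis zero_arr)
  hence "e \<oplus>[X,X] \<zero>[X,X] = Id C X" using d' d X by simp
  thus ?thesis using e X by simp
 qed
qed

lemma indecomposableI:
 assumes X: "X : Obj C" "\<not> zero_obj C X"
  and e: "!!e. arr C e ==> src C e = X ==> tgt C e = X ==> e \<bullet> e = e ==> e = \<zero>[X,X] \<or> e = Id C X"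
 shows "indecomposable C X"
 unfolding indecomposable_def
proof (intro conjI allI impI X)
 fix Y Z assume "direct_sum2 C Y Z X"
 then obtain i p j q where r [simp]: "Y : Obj C" "Z : Obj C" "X : Obj C"
  "arr C i" "src C i = Y" "tgt C i = X" "arr C p" "src C p = X" "tgt C p = Y"
  "arr C j" "src C j = Z" "tgt C j = X" "arr C q" "src C q = X" "tgt C q = Z"
  "p \<bullet> i = Id C Y" "q \<bullet> j = Id C Z" "p \<bullet> j = \<zero>[Z,Y]" "q \<bullet> i = \<zero>[Y,Z]"
  unfolding direct_sum2_iff by blast
 note [simp] = reassoc[OF r(16)] reassoc[OF r(17)] reassoc[OF r(18)] reassoc[OF r(19)]
 have "i \<bullet> p = \<zero>[X,X] \<or> i \<bullet> p = Id C X" by (rule e) simp_all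
 thus "zero_obj C Y \<or> zero_obj C Z"
 proof
  assume z: "i \<bullet> p = \<zero>[X,X]"
  have "Id C Y = p \<bullet> ((i \<bullet> p) \<bullet> i)" by simp
  also have "\<dots> = \<zero>[Y,Y]" by (subst z) simp
  finally show ?thesis by (simp add: zero_obj_iff)
 next
  assume z: "i \<bullet> p = Id C X"
  have "Id C Z = q \<bullet> (Id C X \<bullet> j)" by simp
  also have "\<dots> = \<zero>[Z,Z]" by (subst z[symmetric]) simp
  finally show ?thesis by (simp add: zero_obj_iff)
 qed
qed

text \<open>
 A linear relation between the powers of an endomorphism, divided by its lowest coefficient.
\<close>

lemma power_relation:
 assumes f [simp]: "arr C f" "src C f = X" "tgt C f = X"
 shows "EX k s. arr C s & src C s = X & tgt C s = X & s \<bullet> f = f \<bullet> s &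
  cpow C f k = cpow C f (Suc k) \<bullet> s"
proof -
 have X [simp]: "X : Obj C" using f arr_obj by blast
 interpret M: module K "Hom C X X" using hom_module by simp
 obtain N where N: "dependent_bound K C N X" using bound X by blast
 have "EX c. (ALL i<N. c i : carrier K) & (EX i<N. c i \<noteq> \<zero>\<^bsub>K\<^esub>) &
   finsum (Hom C X X) (%i. c i \<odot>[X,X] cpow C f i) {..<N} = \<zero>[X,X]"
  using N unfolding dependent_bound_def by simp
 then obtain c where c: "!!i. i < N ==> c i : carrier K" "EX i<N. c i \<noteq> \<zero>\<^bsub>K\<^esub>"
   "finsum (Hom C X X) (%i. c i \<odot>[X,X] cpow C f i) {..<N} = \<zero>[X,X]"
  by blast
 define k where "k = (LEAST i. i < N & c i \<noteq> \<zero>\<^bsub>K\<^esub>)"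
 have k: "k < N" "c k \<noteq> \<zero>\<^bsub>K\<^esub>" unfolding k_def using LeastI_ex[OF c(2)] by auto
 have z: "c i = \<zero>\<^bsub>K\<^esub>" if "i < k" for i
  using not_less_Least[of i "%i. i < N & c i \<noteq> \<zero>\<^bsub>K\<^esub>"] that k unfolding k_def by auto
 let ?g = "%i. c i \<odot>[X,X] cpow C f i" let ?J = "{Suc k..<N}"
 define u where "u = finsum (Hom C X X) (%i. c i \<odot>[X,X] cpow C f (i - Suc k)) ?J"
 have cJ: "c i : carrier K" if "i : ?J" for i using c(1) that by simp
 have u [simp]: "arr C u" "src C u = X" "tgt C u = X" unfolding u_def using cJ by (auto intro!: sum_arr)
 have cf: "cpow C f n \<bullet> f = f \<bullet> cpow C f n" for n using cpow_commute[of f f n] by simp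
 have uf: "u \<bullet> f = f \<bullet> u"
  unfolding u_def using cJ by (simp, intro sum_cong) (auto simp: cf)
 have g: "?g i : Homs C X X" if "i < N" for i using c that by simp
 have "\<zero>[X,X] = finsum (Hom C X X) ?g ({..<k} \<union> insert k ?J)"
 proof -
  have "{..<k} \<union> insert k ?J = {..<N}" using k by auto
  thus ?thesis using c by simp
 qed
 also have "\<dots> = finsum (Hom C X X) ?g {..<k} \<oplus>[X,X] finsum (Hom C X X) ?g (insert k ?J)"
  using k g by (intro M.finsum_Un_disjoint) auto
 also have "finsum (Hom C X X) ?g {..<k} = finsum (Hom C X X) (%i. \<zero>[X,X]) {..<k}"
  by (rule sum_cong) (auto simp: z)
 also have "finsum (Hom C X X) ?g (insert k ?J) = ?g k \<oplus>[X,X] finsum (Hom C X X) ?g ?J"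
  using k c by (intro sum_insert) auto
 also have "finsum (Hom C X X) ?g ?J = cpow C f (Suc k) \<bullet> u"
 proof -
  have e: "cpow C f i = cpow C f (Suc k) \<bullet> cpow C f (i - Suc k)" if "Suc k \<le> i" for i
   using cpow_add[of f "Suc k" "i - Suc k"] that by (simp del: cpow.simps)
  have "cpow C f (Suc k) \<bullet> u = finsum (Hom C X X) (%i. c i \<odot>[X,X] (cpow C f (Suc k) \<bullet> cpow C f (i - Suc k))) ?J"
   unfolding u_def using cJ by (subst comp_sum) (auto intro!: sum_cong)
  also have "\<dots> = finsum (Hom C X X) ?g ?J" using c by (intro sum_cong) (auto simp flip: e simp del: cpow.simps)
  finally show ?thesis by simp
 qed
 finally have rel: "?g k \<oplus>[X,X] (cpow C f (Suc k) \<bullet> u) = \<zero>[X,X]"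
  using c k by simp
 have i: "inv\<^bsub>K\<^esub> (c k) : carrier K" "inv\<^bsub>K\<^esub> (c k) \<otimes>\<^bsub>K\<^esub> c k = \<one>\<^bsub>K\<^esub>"
  using k c by (auto simp: field_Units)
 define s where "s = (\<ominus>\<^bsub>K\<^esub> (inv\<^bsub>K\<^esub> (c k))) \<odot>[X,X] u"
 have s [simp]: "arr C s" "src C s = X" "tgt C s = X" unfolding s_def using i by auto
 have "?g k = \<ominus>[X,X] (cpow C f (Suc k) \<bullet> u)"
  using M.minus_equality[OF rel] k g[of k] by simp
 hence "inv\<^bsub>K\<^esub> (c k) \<odot>[X,X] ?g k = inv\<^bsub>K\<^esub> (c k) \<odot>[X,X] (\<ominus>[X,X] (cpow C f (Suc k) \<bullet> u))"
  by simp
 hence "cpow C f k = inv\<^bsub>K\<^esub> (c k) \<odot>[X,X] (\<ominus>[X,X] (cpow C f (Suc k) \<bullet> u))"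
  using i c k by simp
 also have "\<dots> = (\<ominus>\<^bsub>K\<^esub> (inv\<^bsub>K\<^esub> (c k))) \<odot>[X,X] (cpow C f (Suc k) \<bullet> u)"
  using i by (subst M.smult_r_minus) (auto simp: M.smult_l_minus)
 also have "\<dots> = cpow C f (Suc k) \<bullet> s" unfolding s_def using i by simp
 finally have "cpow C f k = cpow C f (Suc k) \<bullet> s" .
 moreover have "s \<bullet> f = f \<bullet> s" unfolding s_def using i uf by simp
 ultimately show ?thesis using s by blast
qed

text \<open>
  With \<open>f\<^sup>k = f\<^sup>k\<^sup>+\<^sup>1 s\<close> and \<open>s\<close> commuting with \<open>f\<close>, the power \<open>(f s)\<^sup>k\<close> is idempotent, hence zero
  or the identity.
\<close>

lemma fitting:
 assumes ind: "indecomposable C X" and f [simp]: "arr C f" "src C f = X" "tgt C f = X"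
 shows "iso_arr C f \<or> (EX n. cpow C f n = \<zero>[X,X])"
proof -
 have X [simp]: "X : Obj C" using f arr_obj by blast
 obtain k s where s [simp]: "arr C s" "src C s = X" "tgt C s = X" and sf: "s \<bullet> f = f \<bullet> s"
  and k: "cpow C f k = cpow C f (Suc k) \<bullet> s" using power_relation[OF f] by blast
 define u where "u = f \<bullet> s"
 have u [simp]: "arr C u" "src C u = X" "tgt C u = X" unfolding u_def by auto
 have uf: "u \<bullet> f = f \<bullet> u" unfolding u_def using sf reassoc[OF sf] by simp
 have ku: "cpow C f k = cpow C f k \<bullet> u"
  unfolding u_def using k cpow_commute[of f f k] reassoc[of f "cpow C f k" "cpow C f k \<bullet> f" s] by simp
 have kun: "cpow C f k = cpow C f k \<bullet> cpow C u n" for n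
 proof (induction n)
  case (Suc n)
  have "cpow C f k \<bullet> cpow C u (Suc n) = (cpow C f k \<bullet> u) \<bullet> cpow C u n" by simp
  thus ?case using ku Suc by simp
 qed simp
 have split: "cpow C u n = cpow C f n \<bullet> cpow C s n" for n
 proof (induction n)
  case (Suc n)
  have "s \<bullet> cpow C f n = cpow C f n \<bullet> s" by (rule cpow_commute) (use sf in simp_all)
  thus ?case using Suc reassoc[of s "cpow C f n" "cpow C f n \<bullet> s" "cpow C s n"] by (simp add: u_def)
 qed simp
 let ?e = "cpow C u k"
 have comm: "cpow C s k \<bullet> cpow C f k = cpow C f k \<bullet> cpow C s k"
 proof (rule cpow_commute[of f "cpow C s k"])
  show "cpow C s k \<bullet> f = f \<bullet> cpow C s k" using cpow_commute[of s f k] sf by simp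
 qed simp_all
 have "?e \<bullet> ?e = cpow C s k \<bullet> (cpow C f k \<bullet> cpow C u k)"
  by (subst (1) split) (simp flip: comm)
 also have "\<dots> = ?e" by (simp only: kun[symmetric] comm split[symmetric])
 finally have "?e = \<zero>[X,X] \<or> ?e = Id C X"
  by (intro indecomposable_idem[OF ind]) simp_all
 thus ?thesis
 proof
  assume "?e = \<zero>[X,X]"
  thus ?thesis using kun[of k] by auto
 next
  assume e: "?e = Id C X"
  have "u = Id C X \<or> (EX v. arr C v & src C v = X & tgt C v = X & v \<bullet> u = Id C X & u \<bullet> v = Id C X)"
  proof (cases k)
   case 0
   thus ?thesis using ku by simp
  next
   case (Suc m)
   have "cpow C u m \<bullet> u = u \<bullet> cpow C u m" by (rule cpow_commute[symmetric]) simp_all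
   thus ?thesis using e Suc by (intro disjI2 exI[of _ "cpow C u m"]) simp
  qed
  then obtain v where v: "arr C v" "src C v = X" "tgt C v = X" "v \<bullet> u = Id C X" "u \<bullet> v = Id C X"
   using Id_arr[of X] comp_Id X by metis
  have vf: "v \<bullet> f = f \<bullet> v"
  proof -
   have "v \<bullet> f = (v \<bullet> f) \<bullet> (u \<bullet> v)" using v by (simp only: v(5)) simp
   also have "\<dots> = v \<bullet> ((f \<bullet> u) \<bullet> v)" using v by simp
   also have "\<dots> = (v \<bullet> u) \<bullet> (f \<bullet> v)" using v(1-3) by (simp flip: uf)
   finally show ?thesis using v by simp
  qed
  have "iso_arr C f"
  proof (rule iso_arrI(1)[of f "s \<bullet> v"])
   show "f \<bullet> (s \<bullet> v) = Id C (tgt C f)" using v by (simp add: u_def)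
   have "(s \<bullet> v) \<bullet> f = (s \<bullet> f) \<bullet> v" using v vf by simp
   thus "(s \<bullet> v) \<bullet> f = Id C (src C f)" using v sf by (simp add: u_def)
  qed (use v in simp_all)
  thus ?thesis by blast
 qed
qed

text \<open>
  Otherwise both are nilpotent by \<open>fitting\<close>. On the last nonzero power of \<open>a\<close> the sum acts as \<open>b\<close>,
  so \<open>b\<close> fixes a nonzero morphism.
\<close>

lemma local_Id:
 assumes ind: "indecomposable C X" and a [simp]: "arr C a" "src C a = X" "tgt C a = X"
  and b [simp]: "arr C b" "src C b = X" "tgt C b = X" and ab: "a \<oplus>[X,X] b = Id C X"
 shows "iso_arr C a \<or> iso_arr C b"
proof (rule ccontr)
 assume no: "\<not> ?thesis"
 have X [simp]: "X : Obj C" using a arr_obj by blast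
 obtain m where m: "cpow C b m = \<zero>[X,X]" using fitting[OF ind b] no by blast
 have ex: "EX n. cpow C a n = \<zero>[X,X]" using fitting[OF ind a] no by blast
 define n where "n = (LEAST n. cpow C a n = \<zero>[X,X])"
 have n: "cpow C a n = \<zero>[X,X]" unfolding n_def using LeastI_ex[OF ex] .
 have "Id C X \<noteq> \<zero>[X,X]" using ind unfolding indecomposable_def zero_obj_iff by simp
 then obtain l where l: "n = Suc l" using n by (cases n) auto
 let ?x = "cpow C a l"
 have x0: "?x \<noteq> \<zero>[X,X]"
  using not_less_Least[of l "%n. cpow C a n = \<zero>[X,X]"] l unfolding n_def by auto
 have "?x = (a \<oplus>[X,X] b) \<bullet> ?x" by (simp only: ab) simp
 also have "\<dots> = b \<bullet> ?x" using n l by simp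
 finally have bx: "b \<bullet> ?x = ?x" by simp
 have "cpow C b i \<bullet> ?x = ?x" for i by (induction i) (simp_all add: bx)
 hence "?x = cpow C b m \<bullet> ?x" by simp
 thus False using m x0 by simp
qed

lemma local_iso:
 assumes ind: "indecomposable C X" and a [simp]: "arr C a" "src C a = X" "tgt C a = X"
  and b [simp]: "arr C b" "src C b = X" "tgt C b = X" and iso: "iso_arr C (a \<oplus>[X,X] b)"
 shows "iso_arr C a \<or> iso_arr C b"
proof -
 have X [simp]: "X : Obj C" using a arr_obj by blast
 let ?h = "a \<oplus>[X,X] b" let ?v = "inv_arr C ?h"
 have h: "arr C ?h" "src C ?h = X" "tgt C ?h = X" by auto
 have v: "arr C ?v" "src C ?v = X" "tgt C ?v = X" "?v \<bullet> ?h = Id C X" using inv_arr[OF iso] h by auto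
 have "(?v \<bullet> a) \<oplus>[X,X] (?v \<bullet> b) = Id C X"
  using v(1-3) by (subst v(4)[symmetric]) simp
 hence "iso_arr C (?v \<bullet> a) \<or> iso_arr C (?v \<bullet> b)" using v by (intro local_Id[OF ind]) auto
 moreover have "iso_arr C x" if "iso_arr C (?v \<bullet> x)" "arr C x" "tgt C x = X" for x
 proof -
  have "iso_arr C (?h \<bullet> (?v \<bullet> x))" by (rule iso_comp(1)) (use iso that h v in auto)
  moreover have "?h \<bullet> (?v \<bullet> x) = x" using iso that h by (intro inv_arr_cancel) auto
  ultimately show ?thesis by (simp only:)
 qed
 ultimately show ?thesis using a b by blast
qed

lemma zero_not_iso:
 assumes "indecomposable C X" shows "\<not> iso_arr C \<zero>[X,X]"
proof
 have X: "X : Obj C" using assms unfolding indecomposable_def by blast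
 assume "iso_arr C \<zero>[X,X]"
 from inv_arr[OF this] have "Id C X = \<zero>[X,X]" using X by simp
 thus False using assms unfolding indecomposable_def zero_obj_iff by blast
qed

lemma local_sum:
 assumes ind: "indecomposable C X" and "finite I" "iso_arr C (finsum (Hom C X X) f I)"
  "!!i. i : I ==> arr C (f i)" "!!i. i : I ==> src C (f i) = X" "!!i. i : I ==> tgt C (f i) = X"
 shows "EX i:I. iso_arr C (f i)"
 using assms(2-6)
proof (induction I rule: finite_induct)
 have X [simp]: "X : Obj C" using ind unfolding indecomposable_def by blast
 case empty thus ?case using zero_not_iso[OF ind] by simp
next
 have X [simp]: "X : Obj C" using ind unfolding indecomposable_def by blast
 case (insert i I)
 have "iso_arr C (f i) \<or> iso_arr C (finsum (Hom C X X) f I)"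
  using insert by (intro local_iso[OF ind]) auto
 thus ?case using insert by auto
qed

lemma indecomposable_through:
 assumes ind: "indecomposable C X" and "through C M f" "src C f = X" "tgt C f = X" "iso_arr C f"
 shows "EX r s. arr C r & arr C s & src C s = X & tgt C s = M & src C r = M & tgt C r = X & r \<bullet> s = Id C X"
 using assms(2-5)
proof (induction rule: through.induct)
 case (zero Y Z) thus ?case using zero_not_iso[OF ind] by simp
next
 case (step f a b)
 have [simp]: "arr C f" using step through_arr by auto
 have s [simp]: "src C f = X" "tgt C f = X" using step by auto
 have "iso_arr C f \<or> iso_arr C (b \<bullet> a)" using step by (intro local_iso[OF ind]) auto
 moreover have ?case if "iso_arr C f" by (rule step.IH[OF s that])
 moreover have ?case if iso: "iso_arr C (b \<bullet> a)"
  using inv_arr[OF iso] step by (intro exI[of _ "inv_arr C (b \<bullet> a) \<bullet> b"] exI[of _ a]) simp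
 ultimately show ?case by argo
qed

lemma indecomposable_retract_iso:
 assumes "indecomposable C X" "indecomposable C Y" "in_add C X Y"
 shows "isomorphic C X Y"
proof -
 have o [simp]: "X : Obj C" "Y : Obj C" using assms unfolding indecomposable_def by auto
 obtain r s where rs [simp]: "arr C r" "arr C s" "src C s = X" "tgt C s = Y" "src C r = Y" "tgt C r = X"
  and id: "r \<bullet> s = Id C X"
  using indecomposable_through[OF assms(1), of Y "Id C X"] assms(3) unfolding in_add_def by auto
 note [simp] = id reassoc[OF id]
 have "s \<bullet> r = \<zero>[Y,Y] \<or> s \<bullet> r = Id C Y" by (rule indecomposable_idem[OF assms(2)]) simp_all
 moreover have "s \<bullet> r \<noteq> \<zero>[Y,Y]"
 proof
  assume z: "s \<bullet> r = \<zero>[Y,Y]"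
  have "Id C X = r \<bullet> ((s \<bullet> r) \<bullet> s)" by simp
  also have "\<dots> = \<zero>[X,X]" by (subst z) simp
  finally show False using assms(1) unfolding indecomposable_def zero_obj_iff by simp
 qed
 ultimately have "iso_arr C s" by (intro iso_arrI(1)[of s r]) auto
 thus ?thesis unfolding isomorphic_iff using rs by blast
qed

text \<open>
  The identity of \<open>X\<close> is a sum of morphisms through the \<open>M i\<close>, so one of these is invertible.
\<close>

lemma indecomposable_in_direct_sum:
 assumes ind: "indecomposable C X" and X: "in_add C X B" and B: "direct_sum C I M B"
  and M: "!!i. i : I ==> indecomposable C (M i)"
 shows "EX i:I. isomorphic C X (M i)"
proof -
 obtain \<iota> \<pi> where b: "biproduct C I M B \<iota> \<pi>" using B unfolding direct_sum_def by blast
 note [simp] = biproductD[OF b]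
 have o [simp]: "X : Obj C" using X unfolding in_add_def by blast
 obtain r s where rs [simp]: "arr C r" "arr C s" "src C s = X" "tgt C s = B" "src C r = B" "tgt C r = X"
  and id: "r \<bullet> s = Id C X"
  using indecomposable_through[OF ind, of B "Id C X"] X unfolding in_add_def by auto
 have "Id C X = r \<bullet> (finsum (Hom C B B) (%i. \<iota> i \<bullet> \<pi> i) I \<bullet> s)" by (simp add: id)
 also have "\<dots> = finsum (Hom C X X) (%i. r \<bullet> (\<iota> i \<bullet> (\<pi> i \<bullet> s))) I"
  by (subst comp_sum, auto intro!: sum_cong)
 finally have iso: "iso_arr C (finsum (Hom C X X) (%i. r \<bullet> (\<iota> i \<bullet> (\<pi> i \<bullet> s))) I)" using iso_Id(1) o by metis
 have "EX i:I. iso_arr C (r \<bullet> (\<iota> i \<bullet> (\<pi> i \<bullet> s)))" by (rule local_sum[OF ind _ iso]) auto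
 then obtain i where i: "i : I" "iso_arr C (r \<bullet> (\<iota> i \<bullet> (\<pi> i \<bullet> s)))" by blast
 let ?u = "r \<bullet> (\<iota> i \<bullet> (\<pi> i \<bullet> s))"
 have "in_add C X (M i)"
  by (rule in_add_retract[of "\<pi> i \<bullet> s" "inv_arr C ?u \<bullet> (r \<bullet> \<iota> i)"]) (use i inv_arr[OF i(2)] in simp_all)
 thus ?thesis using indecomposable_retract_iso[OF ind M] i by blast
qed

text \<open>
  Endomorphisms of \<open>Y\<close> stay independent when the projection onto the nonzero complement is
  adjoined.
\<close>

lemma dependent_bound_summand:
 assumes N: "dependent_bound K C (Suc N) X" and d: "direct_sum2 C Y Z X" and Z: "\<not> zero_obj C Z"
 shows "dependent_bound K C N Y"
 unfolding dependent_bound_def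
proof (intro allI impI)
 obtain i p j q where r [simp]: "Y : Obj C" "Z : Obj C" "X : Obj C"
  "arr C i" "src C i = Y" "tgt C i = X" "arr C p" "src C p = X" "tgt C p = Y"
  "arr C j" "src C j = Z" "tgt C j = X" "arr C q" "src C q = X" "tgt C q = Z"
  "p \<bullet> i = Id C Y" "q \<bullet> j = Id C Z" "p \<bullet> j = \<zero>[Z,Y]" "q \<bullet> i = \<zero>[Y,Z]"
  using d unfolding direct_sum2_iff by blast
 note [simp] = reassoc[OF r(16)] reassoc[OF r(17)] reassoc[OF r(18)] reassoc[OF r(19)]
 fix f assume "ALL i<N. f i : Homs C Y Y"
 hence f [simp]: "arr C (f l)" "src C (f l) = Y" "tgt C (f l) = Y" if "l < N" for l using that by auto
 define g where "g l = (if l < N then i \<bullet> (f l \<bullet> p) else j \<bullet> q)" for l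
 have g [simp]: "arr C (g l)" "src C (g l) = X" "tgt C (g l) = X" for l unfolding g_def by auto
 have "EX c. (ALL l<Suc N. c l : carrier K) & (EX l<Suc N. c l \<noteq> \<zero>\<^bsub>K\<^esub>) &
   finsum (Hom C X X) (%l. c l \<odot>[X,X] g l) {..<Suc N} = \<zero>[X,X]"
  using N unfolding dependent_bound_def by simp
 then obtain c where c: "!!l. l < Suc N ==> c l : carrier K" "EX l<Suc N. c l \<noteq> \<zero>\<^bsub>K\<^esub>"
   and s: "finsum (Hom C X X) (%l. c l \<odot>[X,X] g l) {..<Suc N} = \<zero>[X,X]" by blast
 have cN [simp]: "c N : carrier K" "l < N ==> c l : carrier K" for l using c by auto
 define w where "w = finsum (Hom C X X) (%l. c l \<odot>[X,X] g l) {..<N}"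
 have w [simp]: "arr C w" "src C w = X" "tgt C w = X" unfolding w_def by (auto intro!: sum_arr)
 have s': "(c N \<odot>[X,X] g N) \<oplus>[X,X] w = \<zero>[X,X]"
  using s unfolding lessThan_Suc w_def by (subst (asm) sum_insert) auto
 have pj: "q \<bullet> w = \<zero>[X,Z]"
 proof -
  have "q \<bullet> w =
   finsum (Hom C X Z) (%l. q \<bullet> (c l \<odot>[X,X] g l)) {..<N}"
   unfolding w_def by (subst comp_sum) auto
  also have "\<dots> = finsum (Hom C X Z) (%l. \<zero>[X,Z]) {..<N}"
   by (rule sum_cong) (auto simp: g_def)
  finally show ?thesis by simp
 qed
 have "q \<bullet> (((c N \<odot>[X,X] g N) \<oplus>[X,X] w) \<bullet> j) = \<zero>[Z,Z]" by (subst s') simp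
 hence "c N \<odot>[Z,Z] (q \<bullet> (g N \<bullet> j)) = \<zero>[Z,Z]" by (simp add: reassoc[OF pj])
 hence z: "c N \<odot>[Z,Z] Id C Z = \<zero>[Z,Z]" unfolding g_def by simp
 have c0: "c N = \<zero>\<^bsub>K\<^esub>"
 proof (rule ccontr)
  assume "c N \<noteq> \<zero>\<^bsub>K\<^esub>"
  hence i: "inv\<^bsub>K\<^esub> (c N) : carrier K" "inv\<^bsub>K\<^esub> (c N) \<otimes>\<^bsub>K\<^esub> c N = \<one>\<^bsub>K\<^esub>"
   by (auto simp: field_Units)
  have "Id C Z = inv\<^bsub>K\<^esub> (c N) \<odot>[Z,Z] (c N \<odot>[Z,Z] Id C Z)" using i by simp
  also have "\<dots> = \<zero>[Z,Z]" unfolding z using i by simp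
  finally show False using Z unfolding zero_obj_iff by simp
 qed
 have "\<zero>[Y,Y] = p \<bullet> (w \<bullet> i)"
  using s' by (simp add: c0)
 also have "\<dots> = finsum (Hom C Y Y) (%l. c l \<odot>[Y,Y] f l) {..<N}"
  unfolding w_def by (subst comp_sum, auto intro!: sum_cong simp: g_def)
 finally have "finsum (Hom C Y Y) (%l. c l \<odot>[Y,Y] f l) {..<N} = \<zero>[Y,Y]" by simp
 thus "EX c. (ALL i<N. c i : carrier K) & (EX i<N. c i \<noteq> \<zero>\<^bsub>K\<^esub>) &
   finsum (Hom C Y Y) (%i. c i \<odot>[Y,Y] f i) {..<N} = \<zero>[Y,Y]"
  using c c0 by (intro exI[of _ c]) (auto simp: less_Suc_eq)
qed

lemma direct_sum2_sym: "direct_sum2 C Y Z X ==> direct_sum2 C Z Y X"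
 unfolding direct_sum2_iff
proof (elim conjE exE, intro conjI)
 fix i p j q
 assume a: "arr C i" "src C i = Y" "tgt C i = X" "arr C p" "src C p = X" "tgt C p = Y"
  "arr C j" "src C j = Z" "tgt C j = X" "arr C q" "src C q = X" "tgt C q = Z"
  "p \<bullet> i = Id C Y" "q \<bullet> j = Id C Z" "p \<bullet> j = \<zero>[Z,Y]" "q \<bullet> i = \<zero>[Y,Z]"
  "(i \<bullet> p) \<oplus>[X,X] (j \<bullet> q) = Id C X" "X : Obj C"
 interpret M: abelian_group "Hom C X X" using hom_group a by simp
 have "(j \<bullet> q) \<oplus>[X,X] (i \<bullet> p) = Id C X"
  using a(1-12,17,18) M.a_comm[of "i \<bullet> p" "j \<bullet> q"] by simp
 with a show "EX i p j q. arr C i & src C i = Z & tgt C i = X & arr C p & src C p = X & tgt C p = Z &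
  arr C j & src C j = Y & tgt C j = X & arr C q & src C q = X & tgt C q = Y &
  p \<bullet> i = Id C Z & q \<bullet> j = Id C Y & p \<bullet> j = \<zero>[Y,Z] & q \<bullet> i = \<zero>[Z,Y] &
  (i \<bullet> p) \<oplus>[X,X] (j \<bullet> q) = Id C X" by blast
qed auto

text \<open>
  The members of \<open>\<M>\<close> and \<open>X\<close> have the same additive closure, said without forming the sum of
  the family.
\<close>

definition generating_family
 where "generating_family \<M> X \<longleftrightarrow> finite \<M> & (ALL M:\<M>. indecomposable C M & in_add C M X) &
  (ALL W:Obj C. (ALL M:\<M>. in_add C M W) --> in_add C X W)"

text \<open>Both parts of a proper decomposition have a smaller bound.\<close>

lemma generating_family_exists:
 assumes "dependent_bound K C N X" "X : Obj C"
 shows "EX \<M>. generating_family \<M> X"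
 using assms
proof (induction N arbitrary: X)
 case 0 thus ?case unfolding dependent_bound_def by simp
next
 case (Suc N)
 show ?case
 proof (cases "zero_obj C X")
  case True
  hence "generating_family {} X"
   unfolding generating_family_def zero_obj_iff in_add_def using through.zero[of X C X] by auto
  thus ?thesis by blast
 next
  case nz: False
  show ?thesis
  proof (cases "indecomposable C X")
   case True
   hence "generating_family {X} X" unfolding generating_family_def using Suc in_add_refl by auto
   thus ?thesis by blast
  next
   case False
   then obtain Y Z where d: "direct_sum2 C Y Z X" "\<not> zero_obj C Y" "\<not> zero_obj C Z"
    using nz Suc unfolding indecomposable_def by blast
   have o: "Y : Obj C" "Z : Obj C" using d unfolding direct_sum2_iff by auto
   obtain \<M> where M: "generating_family \<M> Y"
    using Suc.IH[OF dependent_bound_summand[OF Suc.prems(1) d(1,3)] o(1)] by blast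
   obtain \<N> where N: "generating_family \<N> Z"
    using Suc.IH[OF dependent_bound_summand[OF Suc.prems(1) direct_sum2_sym[OF d(1)] d(2)] o(2)] by blast
   have YX: "in_add C Y X" "in_add C Z X"
    using direct_sum_in_add[of UNIV "%b. if b then Y else Z" X True] direct_sum_in_add[of UNIV "%b. if b then Y else Z" X False] d(1)
    unfolding direct_sum2_def by auto
   have XW: "in_add C X W" if "in_add C Y W" "in_add C Z W" "W : Obj C" for W
    using in_add_direct_sum[of UNIV "%b. if b then Y else Z" X W] d(1) that unfolding direct_sum2_def by auto
   have "generating_family (\<M> \<union> \<N>) X"
    unfolding generating_family_def
   proof (intro conjI ballI impI)
    show "finite (\<M> \<union> \<N>)" using M N unfolding generating_family_def by blast
    fix P assume "P : \<M> \<union> \<N>"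
    thus "indecomposable C P" "in_add C P X"
     using M N YX in_add_trans unfolding generating_family_def by blast+
   next
    fix W assume W: "W : Obj C" "ALL P:\<M> \<union> \<N>. in_add C P W"
    have "in_add C Y W" "in_add C Z W"
     using M N W unfolding generating_family_def by blast+
    thus "in_add C X W" using XW W by blast
   qed
   thus ?thesis by blast
  qed
 qed
qed

lemma basic_obj: "basic C U ==> U : Obj C"
 unfolding basic_def direct_sum_def biproduct_def by blast

text \<open>A generating family of minimal size has pairwise non-isomorphic members.\<close>

lemma basic_exists:
 assumes X: "X : Obj C"
 shows "EX U. basic C U & in_add C U X & in_add C X U"
proof -
 have "EX \<M>. generating_family \<M> X" using bound[OF X] generating_family_exists X by blast
 then obtain \<M> where M: "generating_family \<M> X" and min: "!!\<N>. generating_family \<N> X ==> card \<M> \<le> card \<N>"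
  using ex_has_least_nat[of "%\<M>. generating_family \<M> X" _ card] by blast
 have fin: "finite \<M>" and ind: "!!M. M : \<M> ==> indecomposable C M" and MX: "!!M. M : \<M> ==> in_add C M X"
  and gen: "!!W. W : Obj C ==> (ALL M:\<M>. in_add C M W) ==> in_add C X W"
  using M unfolding generating_family_def by auto
 have non: "\<not> isomorphic C M N" if "M : \<M>" "N : \<M>" "M \<noteq> N" for M N
 proof
  assume iso: "isomorphic C M N"
  have "ALL P:\<M>. in_add C P W" if "ALL P:\<M>-{M}. in_add C P W" for W
   using that in_add_trans[OF in_add_iso[OF iso], of W] \<open>N : \<M>\<close> \<open>M \<noteq> N\<close> by blast
  hence "generating_family (\<M> - {M}) X" using fin ind MX gen unfolding generating_family_def by auto
  from min[OF this] show False using fin \<open>M : \<M>\<close> by (metis card_Diff1_less not_le)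
 qed
 obtain h where h: "bij_betw h {..<card \<M>} \<M>"
  using ex_bij_betw_nat_finite[OF fin] by (auto simp: lessThan_atLeast0)
 have hM: "h i : \<M>" if "i < card \<M>" for i using h that by (auto simp: bij_betw_def)
 obtain U where U: "direct_sum C {..<card \<M>} h U"
  using direct_sum_exists[of "{..<card \<M>}" h] hM ind unfolding indecomposable_def by auto
 have Uo: "U : Obj C" using U unfolding direct_sum_def biproduct_def by blast
 have "\<not> isomorphic C (h i) (h j)" if "i < card \<M>" "j < card \<M>" "i \<noteq> j" for i j
  using non hM that h by (metis bij_betw_def inj_on_def lessThan_iff)
 hence "basic C U" unfolding basic_def using U hM ind by blast
 moreover have "in_add C U X" by (rule in_add_direct_sum[OF U _ X]) (use MX hM in auto)
 moreover have "in_add C X U"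
 proof (rule gen[OF Uo], rule ballI)
  fix M assume "M : \<M>"
  then obtain i where "i < card \<M>" "M = h i" using h by (auto simp: bij_betw_def)
  thus "in_add C M U" using direct_sum_in_add[OF U, of i] by simp
 qed
 ultimately show ?thesis by blast
qed

text \<open>
  Each indecomposable summand of one object is isomorphic to exactly one summand of the other.
\<close>

lemma basic_unique:
 assumes "basic C U" "basic C V" "in_add C U V" "in_add C V U"
 shows "isomorphic C U V"
proof -
 obtain n :: nat and M where M: "direct_sum C {..<n} M U" "!!i. i < n ==> indecomposable C (M i)"
  "!!i j. i < n ==> j < n ==> isomorphic C (M i) (M j) ==> i = j"
  using assms(1) unfolding basic_def by metis
 obtain n' :: nat and N where N: "direct_sum C {..<n'} N V" "!!i. i < n' ==> indecomposable C (N i)"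
  "!!i j. i < n' ==> j < n' ==> isomorphic C (N i) (N j) ==> i = j"
  using assms(2) unfolding basic_def by metis
 have "ALL i:{..<n}. EX j:{..<n'}. isomorphic C (M i) (N j)"
  using indecomposable_in_direct_sum[OF M(2) in_add_trans[OF direct_sum_in_add[OF M(1)] assms(3)] N(1)] N(2)
  by auto
 then obtain \<sigma> where s: "!!i. i < n ==> \<sigma> i < n'" "!!i. i < n ==> isomorphic C (M i) (N (\<sigma> i))"
  by (metis lessThan_iff)
 have rev: "EX i:{..<n}. isomorphic C (N j) (M i)" if "j < n'" for j
  using indecomposable_in_direct_sum[OF N(2) in_add_trans[OF direct_sum_in_add[OF N(1)] assms(4)] M(1)] M(2) that
  by auto
 have "bij_betw \<sigma> {..<n} {..<n'}"
 proof (rule bij_betw_imageI)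
  show "inj_on \<sigma> {..<n}"
  proof (rule inj_onI)
   fix i j assume ij: "i : {..<n}" "j : {..<n}" "\<sigma> i = \<sigma> j"
   have "isomorphic C (M i) (M j)"
    using s(2)[of i] s(2)[of j] ij isomorphic_trans isomorphic_sym by (metis lessThan_iff)
   thus "i = j" using M(3) ij by simp
  qed
  show "\<sigma> ` {..<n} = {..<n'}"
  proof
   show "{..<n'} \<subseteq> \<sigma> ` {..<n}"
   proof
    fix j assume j: "j : {..<n'}"
    then obtain i where i: "i < n" "isomorphic C (N j) (M i)" using rev by auto
    have "j = \<sigma> i" using N(3)[of j "\<sigma> i"] isomorphic_trans[OF i(2) s(2)[OF i(1)]] j s(1) i by simp
    thus "j : \<sigma> ` {..<n}" using i by simp
   qed
  qed (use s in auto)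
 qed
 thus ?thesis using direct_sum_iso[OF M(1) N(1)] s by simp
qed

end

text \<open>Idempotents can be lifted along a fully faithful functor.\<close>

lemma (in ff_functor) map_indecomposable:
 assumes C: "krull_schmidt K C" and D: "krull_schmidt K D" and X: "indecomposable C X"
 shows "indecomposable D (FObj F X)"
proof -
 interpret C: krull_schmidt K C by fact
 interpret D: krull_schmidt K D by fact
 have Xo: "X : Obj C" "\<not> zero_obj C X" using X unfolding indecomposable_def by auto
 show ?thesis
 proof (rule D.indecomposableI)
  show "\<not> zero_obj D (FObj F X)" using Xo reflect_zero_obj by blast
  fix e assume e: "arr D e" "src D e = FObj F X" "tgt D e = FObj F X" "e \<bullet>\<^bsub>D\<^esub> e = e"
  obtain f where f: "arr C f" "src C f = X" "tgt C f = X" "FMor F f = e" using lift[OF Xo(1) Xo(1) e(1-3)] by blast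
  have "f \<bullet>\<^bsub>C\<^esub> f = f" by (rule inj) (use f e in simp_all)
  hence "f = \<zero>\<^bsub>Hom C X X\<^esub> \<or> f = Id C X" using C.indecomposable_idem[OF X f(1-3)] by blast
  thus "e = \<zero>\<^bsub>Hom D (FObj F X) (FObj F X)\<^esub> \<or> e = Id D (FObj F X)"
   using f(4) map_zero[OF Xo(1) Xo(1)] map_Id[OF Xo(1)] by metis
 qed (use Xo in simp)
qed

lemma (in ff_functor) map_basic:
 assumes C: "krull_schmidt K C" and D: "krull_schmidt K D" and U: "basic C U"
 shows "basic D (FObj F U)"
proof -
 obtain n :: nat and M where M: "direct_sum C {..<n} M U" "!!i. i < n ==> indecomposable C (M i)"
  "!!i j. i < n ==> j < n ==> i \<noteq> j ==> \<not> isomorphic C (M i) (M j)"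
  using U unfolding basic_def by metis
 have "\<not> isomorphic D (FObj F (M i)) (FObj F (M j))" if "i < n" "j < n" "i \<noteq> j" for i j
  using M that reflect_isomorphic unfolding indecomposable_def by blast
 thus ?thesis unfolding basic_def using map_direct_sum[OF M(1)] map_indecomposable[OF C D] M by blast
qed


section \<open>Characters of a split abelian group\<close>

locale field_comm_group = K: field K + G: comm_group G
 for K :: "('k, 'r) ring_scheme" (structure) and G :: "('g, 'z) monoid_scheme"
begin

abbreviation "Gh \<equiv> character_group K G"

lemma charD:
 assumes "\<chi> : carrier Gh"
 shows "!!g. g : carrier G ==> \<chi> g : carrier K" "!!g. g : carrier G ==> \<chi> g \<noteq> \<zero>"
  "!!g h. g : carrier G ==> h : carrier G ==> \<chi> (g \<otimes>\<^bsub>G\<^esub> h) = \<chi> g \<otimes> \<chi> h"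
  "\<chi> \<one>\<^bsub>G\<^esub> = \<one>" "\<chi> : extensional (carrier G)"
proof -
 have h: "\<chi> : hom G (units_of K)" and e: "\<chi> : extensional (carrier G)"
  using assms unfolding character_group_def by auto
 show "\<chi> : extensional (carrier G)" by fact
 have u: "\<chi> g : Units K" if "g : carrier G" for g
  using h that unfolding hom_def units_of_def by auto
 show c: "\<chi> g : carrier K" if "g : carrier G" for g using u[OF that] by (rule K.Units_closed)
 show nz: "\<chi> g \<noteq> \<zero>" if "g : carrier G" for g using u[OF that] by (auto simp: K.field_Units)
 show m: "\<chi> (g \<otimes>\<^bsub>G\<^esub> h) = \<chi> g \<otimes> \<chi> h" if "g : carrier G" "h : carrier G" for g h
  using h that unfolding hom_def units_of_def by auto
 have "\<chi> \<one>\<^bsub>G\<^esub> \<otimes> \<chi> \<one>\<^bsub>G\<^esub> = \<chi> \<one>\<^bsub>G\<^esub> \<otimes> \<one>" using m[of "\<one>\<^bsub>G\<^esub>" "\<one>\<^bsub>G\<^esub>"] c by simp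
 thus "\<chi> \<one>\<^bsub>G\<^esub> = \<one>" using K.m_lcancel[of "\<chi> \<one>\<^bsub>G\<^esub>" "\<chi> \<one>\<^bsub>G\<^esub>" "\<one>"] nz c by simp
qed

lemma charI:
 assumes "!!g. g : carrier G ==> \<chi> g : carrier K" "\<chi> \<one>\<^bsub>G\<^esub> = \<one>" "\<chi> : extensional (carrier G)"
  and m: "!!g h. g : carrier G ==> h : carrier G ==> \<chi> (g \<otimes>\<^bsub>G\<^esub> h) = \<chi> g \<otimes> \<chi> h"
 shows "\<chi> : carrier Gh"
proof -
 have "\<chi> g : Units K" if g: "g : carrier G" for g
 proof -
  have "\<chi> g \<otimes> \<chi> (inv\<^bsub>G\<^esub> g) = \<one>" using m[of g "inv\<^bsub>G\<^esub> g"] assms(2) g by simp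
  hence "\<chi> g \<noteq> \<zero>" using assms(1)[of "inv\<^bsub>G\<^esub> g"] g by auto
  thus ?thesis using assms(1)[OF g] by (simp add: K.field_Units)
 qed
 thus ?thesis using assms unfolding character_group_def hom_def units_of_def by auto
qed

lemma char_inv:
 assumes "\<chi> : carrier Gh" "g : carrier G"
 shows "\<chi> (inv\<^bsub>G\<^esub> g) \<otimes> \<chi> g = \<one>" "\<chi> g \<otimes> \<chi> (inv\<^bsub>G\<^esub> g) = \<one>"
proof -
 show "\<chi> (inv\<^bsub>G\<^esub> g) \<otimes> \<chi> g = \<one>"
  using charD(3)[OF assms(1), of "inv\<^bsub>G\<^esub> g" g] charD(4)[OF assms(1)] assms(2) by simp
 show "\<chi> g \<otimes> \<chi> (inv\<^bsub>G\<^esub> g) = \<one>"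
  using charD(3)[OF assms(1), of g "inv\<^bsub>G\<^esub> g"] charD(4)[OF assms(1)] assms(2) by simp
qed

lemma Gh_mult: "\<chi> \<otimes>\<^bsub>Gh\<^esub> \<psi> = (\<lambda>g\<in>carrier G. \<chi> g \<otimes> \<psi> g)"
 unfolding character_group_def by simp

lemma Gh_one: "\<one>\<^bsub>Gh\<^esub> = (\<lambda>g\<in>carrier G. \<one>)"
 unfolding character_group_def by simp

lemma Gh_group: "comm_group Gh"
proof (rule comm_groupI)
 show "\<one>\<^bsub>Gh\<^esub> : carrier Gh" by (rule charI) (auto simp: Gh_one)
 fix x assume x: "x : carrier Gh"
 show "\<one>\<^bsub>Gh\<^esub> \<otimes>\<^bsub>Gh\<^esub> x = x"
  unfolding Gh_mult Gh_one using charD[OF x] by (auto simp: extensional_def)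
 have "(\<lambda>g\<in>carrier G. x (inv\<^bsub>G\<^esub> g)) : carrier Gh"
  by (rule charI) (use charD[OF x] in \<open>auto simp: G.inv_mult\<close>)
 moreover have "(\<lambda>g\<in>carrier G. x (inv\<^bsub>G\<^esub> g)) \<otimes>\<^bsub>Gh\<^esub> x = \<one>\<^bsub>Gh\<^esub>"
  unfolding Gh_mult Gh_one using char_inv[OF x] by auto
 ultimately show "EX y:carrier Gh. y \<otimes>\<^bsub>Gh\<^esub> x = \<one>\<^bsub>Gh\<^esub>" by blast
 fix y assume y: "y : carrier Gh"
 show "x \<otimes>\<^bsub>Gh\<^esub> y : carrier Gh"
  by (rule charI) (use charD[OF x] charD[OF y] in \<open>auto simp: Gh_mult K.m_ac\<close>)
 show "x \<otimes>\<^bsub>Gh\<^esub> y = y \<otimes>\<^bsub>Gh\<^esub> x"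
  unfolding Gh_mult using charD[OF x] charD[OF y] by (auto simp: K.m_comm)
 fix z assume z: "z : carrier Gh"
 show "x \<otimes>\<^bsub>Gh\<^esub> y \<otimes>\<^bsub>Gh\<^esub> z = x \<otimes>\<^bsub>Gh\<^esub> (y \<otimes>\<^bsub>Gh\<^esub> z)"
  unfolding Gh_mult using charD[OF x] charD[OF y] charD[OF z] by (auto simp: K.m_assoc)
qed

sublocale Gh: comm_group Gh by (rule Gh_group)

lemma Gh_inv: assumes "\<chi> : carrier Gh" shows "inv\<^bsub>Gh\<^esub> \<chi> = (\<lambda>g\<in>carrier G. \<chi> (inv\<^bsub>G\<^esub> g))"
proof (rule Gh.inv_equality)
 show "(\<lambda>g\<in>carrier G. \<chi> (inv\<^bsub>G\<^esub> g)) : carrier Gh"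
  by (rule charI) (use charD[OF assms] in \<open>auto simp: G.inv_mult\<close>)
 show "(\<lambda>g\<in>carrier G. \<chi> (inv\<^bsub>G\<^esub> g)) \<otimes>\<^bsub>Gh\<^esub> \<chi> = \<one>\<^bsub>Gh\<^esub>"
  unfolding Gh_mult Gh_one using char_inv[OF assms] by auto
qed (use assms in auto)

end

locale split_abelian_group = field_comm_group K G
 for K :: "('k, 'r) ring_scheme" (structure) and G :: "('g, 'z) monoid_scheme" +
 assumes finG: "finite (carrier G)" and split: "splits_over G K"
begin

definition ordK where "ordK = finsum K (%_. \<one>) (carrier G)"

lemma ordK_closed [simp]: "ordK : carrier K"
 unfolding ordK_def by (rule K.finsum_closed) auto

text \<open>
  Translation by \<open>h\<close> permutes the terms and multiplies the sum by \<open>\<chi> h \<noteq> \<one>\<close>.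
\<close>

lemma sum_char:
 assumes x: "\<chi> : carrier Gh" and ne: "\<chi> \<noteq> \<one>\<^bsub>Gh\<^esub>"
 shows "finsum K \<chi> (carrier G) = \<zero>"
proof -
 note c = charD[OF x]
 obtain h where h: "h : carrier G" "\<chi> h \<noteq> \<one>"
 proof (rule ccontr)
  assume "\<not> thesis"
  hence "\<chi> g = \<one>" if "g : carrier G" for g using that \<open>!!h. h : carrier G ==> \<chi> h \<noteq> \<one> ==> thesis\<close> by blast
  hence "\<chi> = \<one>\<^bsub>Gh\<^esub>" unfolding Gh_one using c(5) by (auto simp: extensional_def)
  thus False using ne by blast
 qed
 let ?S = "finsum K \<chi> (carrier G)"
 have S: "?S : carrier K" by (rule K.finsum_closed) (use c in auto)
 have b: "bij_betw (%g. h \<otimes>\<^bsub>G\<^esub> g) (carrier G) (carrier G)"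
  by (rule bij_betwI[where g = "%g. inv\<^bsub>G\<^esub> h \<otimes>\<^bsub>G\<^esub> g"]) (use h in \<open>auto simp flip: G.m_assoc\<close>)
 hence im: "(%g. h \<otimes>\<^bsub>G\<^esub> g) ` carrier G = carrier G" and inj: "inj_on (%g. h \<otimes>\<^bsub>G\<^esub> g) (carrier G)"
  unfolding bij_betw_def by auto
 have "?S = finsum K (%g. \<chi> (h \<otimes>\<^bsub>G\<^esub> g)) (carrier G)"
  using K.finsum_reindex[OF _ inj, of \<chi>] c unfolding im by auto
 also have "\<dots> = finsum K (%g. \<chi> h \<otimes> \<chi> g) (carrier G)"
  by (rule K.finsum_cong') (use c h in auto)
 also have "\<dots> = \<chi> h \<otimes> ?S"
  by (rule K.finsum_rdistr[symmetric]) (use c h finG in auto)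
 finally have "\<chi> h \<otimes> ?S = \<one> \<otimes> ?S" using S by simp
 thus ?thesis using K.m_rcancel[of ?S "\<chi> h" "\<one>"] S h c by auto
qed

text \<open>
 The coordinates of the splitting isomorphism, restricted to the group elements, are
 characters. They separate the elements of the group, and every character \<open>\<psi>\<close> is one of
 them, because \<open>\<Sum>\<^sub>g \<psi>(g\<inverse>) g\<close> is a common eigenvector of the translations with eigenvalues
 \<open>\<psi>\<close>. The order of the group is invertible since \<open>k\<^sup>n\<close> has no nilpotents, whereas
 \<open>\<Sum>\<^sub>g g\<close> would be one in the modular case.
\<close>

lemma orthogonality:
 "ordK \<noteq> \<zero> & finite (carrier Gh) &
 (ALL g:carrier G. finsum K (%\<chi>. \<chi> g) (carrier Gh) = (if g = \<one>\<^bsub>G\<^esub> then ordK else \<zero>))"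
proof -
 let ?A = "group_algebra K G"
 obtain n \<phi> where iso: "\<phi> : ring_iso ?A (power_algebra K n)"
  and lin: "!!c a. c : carrier K ==> a : carrier ?A ==> \<phi> (c \<odot>\<^bsub>?A\<^esub> a) = c \<odot>\<^bsub>power_algebra K n\<^esub> \<phi> a"
  using split unfolding splits_over_def by blast
 let ?P = "power_algebra K n"
 have bij: "bij_betw \<phi> (carrier ?A) (carrier ?P)" and hom: "\<phi> : ring_hom ?A ?P"
  using iso unfolding ring_iso_def by auto
 have inj: "a = b" if "\<phi> a = \<phi> b" "a : carrier ?A" "b : carrier ?A" for a b
  using bij that unfolding bij_betw_def inj_on_def by blast
 note hm = ring_hom_mult[OF hom] and ha = ring_hom_add[OF hom] and h1 = ring_hom_one[OF hom]
  and hc = ring_hom_closed[OF hom]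
 have cA: "carrier ?A = carrier G \<rightarrow>\<^sub>E carrier K" and cP: "carrier ?P = {..<n} \<rightarrow>\<^sub>E carrier K"
  unfolding group_algebra_def power_algebra_def by auto
 define d where "d g = (\<lambda>x\<in>carrier G. if x = g then \<one> else \<zero>)" for g
 have dA: "d g : carrier ?A" for g unfolding cA d_def by auto
 have d_mult: "d g \<otimes>\<^bsub>?A\<^esub> a = (\<lambda>x\<in>carrier G. a (inv\<^bsub>G\<^esub> g \<otimes>\<^bsub>G\<^esub> x))" if g: "g : carrier G" and a: "a : carrier ?A" for g a
 proof -
  have "finsum K (%h. d g h \<otimes> a (inv\<^bsub>G\<^esub> h \<otimes>\<^bsub>G\<^esub> x)) (carrier G) = a (inv\<^bsub>G\<^esub> g \<otimes>\<^bsub>G\<^esub> x)" if x: "x : carrier G" for x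
  proof -
   have aK: "a y : carrier K" if "y : carrier G" for y using a that unfolding cA by auto
   have "finsum K (%h. d g h \<otimes> a (inv\<^bsub>G\<^esub> h \<otimes>\<^bsub>G\<^esub> x)) (carrier G) =
    finsum K (%h. if g = h then a (inv\<^bsub>G\<^esub> h \<otimes>\<^bsub>G\<^esub> x) else \<zero>) (carrier G)"
    by (rule K.finsum_cong') (use aK g x in \<open>auto simp: d_def\<close>)
   also have "\<dots> = a (inv\<^bsub>G\<^esub> g \<otimes>\<^bsub>G\<^esub> x)"
    by (rule K.finsum_singleton) (use aK g x finG in auto)
   finally show ?thesis .
  qed
  thus ?thesis unfolding group_algebra_def by auto
 qed
 define \<chi> where "\<chi> i = (\<lambda>g\<in>carrier G. \<phi> (d g) i)" for i
 have \<chi>K: "\<phi> (d g) i : carrier K" if "i < n" for g i using hc[OF dA[of g]] that unfolding cP by auto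
 have one: "\<one>\<^bsub>?A\<^esub> = d \<one>\<^bsub>G\<^esub>" unfolding group_algebra_def d_def by auto
 have \<chi>c: "\<chi> i : carrier Gh" if i: "i < n" for i
 proof (rule charI)
  show "\<chi> i \<one>\<^bsub>G\<^esub> = \<one>" unfolding \<chi>_def using h1 i unfolding one power_algebra_def by auto
  fix g h assume gh: "g : carrier G" "h : carrier G"
  have "d g \<otimes>\<^bsub>?A\<^esub> d h = d (g \<otimes>\<^bsub>G\<^esub> h)"
  proof -
   have "(inv\<^bsub>G\<^esub> g \<otimes>\<^bsub>G\<^esub> x = h) = (x = g \<otimes>\<^bsub>G\<^esub> h)" if "x : carrier G" for x
    using gh that G.inv_solve_left by (metis G.inv_closed G.inv_inv G.inv_solve_left)
   thus ?thesis unfolding d_mult[OF gh(1) dA] using gh by (auto simp: d_def)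
  qed
  hence "\<phi> (d (g \<otimes>\<^bsub>G\<^esub> h)) i = (\<phi> (d g) \<otimes>\<^bsub>?P\<^esub> \<phi> (d h)) i" using hm[OF dA[of g] dA[of h]] by simp
  thus "\<chi> i (g \<otimes>\<^bsub>G\<^esub> h) = \<chi> i g \<otimes> \<chi> i h" unfolding \<chi>_def power_algebra_def using gh i by auto
 qed (use \<chi>K i in \<open>auto simp: \<chi>_def\<close>)
 define a where "a \<psi> = (\<lambda>g\<in>carrier G. \<psi> (inv\<^bsub>G\<^esub> g))" for \<psi> :: "'g => 'k"
 have aA: "a \<psi> : carrier ?A" if "\<psi> : carrier Gh" for \<psi>
  unfolding cA a_def using charD(1)[OF that] by auto
 have \<phi>K: "\<phi> b i : carrier K" if "b : carrier ?A" "i < n" for b i using hc[OF that(1)] that(2) unfolding cP by auto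
 have ex: "EX i<n. \<phi> (a \<psi>) i \<noteq> \<zero>" if p: "\<psi> : carrier Gh" for \<psi>
 proof (rule ccontr)
  assume z: "\<not> ?thesis"
  have z': "\<zero> \<odot>\<^bsub>?A\<^esub> a \<psi> : carrier ?A" unfolding cA unfolding group_algebra_def a_def using charD(1)[OF p] by auto
  have "\<phi> (a \<psi>) = \<zero> \<odot>\<^bsub>?P\<^esub> \<phi> (a \<psi>)"
   using hc[OF aA[OF p]] z unfolding cP power_algebra_def by (auto simp: PiE_def extensional_def)
  hence "\<phi> (a \<psi>) = \<phi> (\<zero> \<odot>\<^bsub>?A\<^esub> a \<psi>)" using lin[OF _ aA[OF p], of "\<zero>"] by simp
  from inj[OF this aA[OF p] z'] have "a \<psi> \<one>\<^bsub>G\<^esub> = (\<zero> \<odot>\<^bsub>?A\<^esub> a \<psi>) \<one>\<^bsub>G\<^esub>" by simp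
  thus False using charD(4)[OF p] unfolding group_algebra_def a_def by simp
 qed
 have all: "\<psi> : \<chi> ` {..<n}" if p: "\<psi> : carrier Gh" for \<psi>
 proof -
  obtain i where i: "i < n" "\<phi> (a \<psi>) i \<noteq> \<zero>" using ex[OF p] by blast
  have "\<psi> g = \<chi> i g" if g: "g : carrier G" for g
  proof -
   have "d g \<otimes>\<^bsub>?A\<^esub> a \<psi> = \<psi> g \<odot>\<^bsub>?A\<^esub> a \<psi>"
    unfolding d_mult[OF g aA[OF p]] unfolding group_algebra_def a_def
    using g charD(1,3)[OF p] by (auto simp: G.inv_mult_group K.m_comm)
   hence "\<phi> (d g) \<otimes>\<^bsub>?P\<^esub> \<phi> (a \<psi>) = \<psi> g \<odot>\<^bsub>?P\<^esub> \<phi> (a \<psi>)"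
    using hm[OF dA[of g] aA[OF p]] lin[OF charD(1)[OF p g] aA[OF p]] by simp
   hence "(\<phi> (d g) \<otimes>\<^bsub>?P\<^esub> \<phi> (a \<psi>)) i = (\<psi> g \<odot>\<^bsub>?P\<^esub> \<phi> (a \<psi>)) i" by simp
   hence "\<phi> (d g) i \<otimes> \<phi> (a \<psi>) i = \<psi> g \<otimes> \<phi> (a \<psi>) i" unfolding power_algebra_def using i(1) by simp
   thus ?thesis unfolding \<chi>_def using K.m_rcancel[of "\<phi> (a \<psi>) i"] i \<phi>K[OF aA[OF p]] \<chi>K charD(1)[OF p g] g by auto
  qed
  hence "\<psi> = \<chi> i" using charD(5)[OF p] charD(5)[OF \<chi>c[OF i(1)]] by (rule extensionalityI[rotated 2]) auto
  thus ?thesis using i(1) by blast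
 qed
 have fin: "finite (carrier Gh)" by (rule finite_subset[of _ "\<chi> ` {..<n}"]) (use all in auto)
 have one_ch: "\<one>\<^bsub>Gh\<^esub> : carrier Gh" by simp
 (* otherwise the sum of all group elements squares to zero *)
 have ord0: "ordK \<noteq> \<zero>"
 proof
  assume z: "ordK = \<zero>"
  let ?N = "a \<one>\<^bsub>Gh\<^esub>"
  obtain i where i: "i < n" "\<phi> ?N i \<noteq> \<zero>" using ex[OF one_ch] by blast
  have N: "?N = (\<lambda>g\<in>carrier G. \<one>)" unfolding a_def Gh_one by auto
  have "finsum K (%h. ?N h \<otimes> ?N (inv\<^bsub>G\<^esub> h \<otimes>\<^bsub>G\<^esub> g)) (carrier G) = \<zero>" if "g : carrier G" for g
   unfolding z[symmetric] ordK_def by (rule K.finsum_cong') (use that in \<open>auto simp: N\<close>)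
  hence "?N \<otimes>\<^bsub>?A\<^esub> ?N = \<zero> \<odot>\<^bsub>?A\<^esub> ?N"
   unfolding group_algebra_def by (auto simp: N)
  hence "\<phi> ?N \<otimes>\<^bsub>?P\<^esub> \<phi> ?N = \<zero> \<odot>\<^bsub>?P\<^esub> \<phi> ?N"
   using hm[OF aA aA, OF one_ch one_ch] lin[OF _ aA[OF one_ch], of "\<zero>"] by simp
  hence "(\<phi> ?N \<otimes>\<^bsub>?P\<^esub> \<phi> ?N) i = (\<zero> \<odot>\<^bsub>?P\<^esub> \<phi> ?N) i" by simp
  hence "\<phi> ?N i \<otimes> \<phi> ?N i = \<zero>" unfolding power_algebra_def using i(1) \<phi>K[OF aA[OF one_ch]] by simp
  thus False using i \<phi>K[OF aA[OF one_ch]] K.integral_iff by blast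
 qed
 let ?S = "%g. finsum K (%\<chi>. \<chi> g) (carrier Gh)"
 have S [simp]: "?S g : carrier K" if "g : carrier G" for g by (rule K.finsum_closed) (use that charD(1) in auto)
 have S0: "?S g = \<zero>" if g: "g : carrier G" and ne: "g \<noteq> \<one>\<^bsub>G\<^esub>" for g
 proof -
  have "EX i<n. \<chi> i g \<noteq> \<one>"
  proof (rule ccontr)
   assume "\<not> ?thesis"
   hence "\<phi> (d g) i = \<phi> \<one>\<^bsub>?A\<^esub> i" if "i < n" for i using that g unfolding h1 \<chi>_def power_algebra_def by auto
   hence "\<phi> (d g) = \<phi> (d \<one>\<^bsub>G\<^esub>)" using hc[OF dA[of g]] hc[OF dA[of "\<one>\<^bsub>G\<^esub>"]] unfolding one cP by (auto intro: PiE_ext)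
   from inj[OF this dA dA] have "d g g = d \<one>\<^bsub>G\<^esub> g" by simp
   thus False using g ne unfolding d_def by simp
  qed
  then obtain \<psi> where p: "\<psi> : carrier Gh" "\<psi> g \<noteq> \<one>" using \<chi>c by blast
  have b: "bij_betw (%\<chi>. \<psi> \<otimes>\<^bsub>Gh\<^esub> \<chi>) (carrier Gh) (carrier Gh)"
   by (rule bij_betwI[where g = "%\<chi>. inv\<^bsub>Gh\<^esub> \<psi> \<otimes>\<^bsub>Gh\<^esub> \<chi>"]) (use p in \<open>auto simp flip: Gh.m_assoc\<close>)
  hence im: "(%\<chi>. \<psi> \<otimes>\<^bsub>Gh\<^esub> \<chi>) ` carrier Gh = carrier Gh" and inj': "inj_on (%\<chi>. \<psi> \<otimes>\<^bsub>Gh\<^esub> \<chi>) (carrier Gh)"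
   unfolding bij_betw_def by auto
  have "?S g = finsum K (%\<chi>. (\<psi> \<otimes>\<^bsub>Gh\<^esub> \<chi>) g) (carrier Gh)"
   using K.finsum_reindex[OF _ inj', of "%\<chi>. \<chi> g"] charD(1) g unfolding im by auto
  also have "\<dots> = finsum K (%\<chi>. \<psi> g \<otimes> \<chi> g) (carrier Gh)"
   by (rule K.finsum_cong') (use charD(1) g p in \<open>auto simp: Gh_mult\<close>)
  also have "\<dots> = \<psi> g \<otimes> ?S g" by (rule K.finsum_rdistr[symmetric]) (use charD(1) g p fin in auto)
  finally have "\<psi> g \<otimes> ?S g = \<one> \<otimes> ?S g" using g by simp
  thus ?thesis using K.m_rcancel[of "?S g" "\<psi> g" "\<one>"] S[OF g] p charD(1)[OF p(1) g] by auto
 qed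
 have "?S \<one>\<^bsub>G\<^esub> = finsum K (%g. if \<one>\<^bsub>G\<^esub> = g then ?S g else \<zero>) (carrier G)"
  by (rule K.finsum_singleton[symmetric]) (use finG in auto)
 also have "\<dots> = finsum K ?S (carrier G)" by (rule K.finsum_cong') (use S0 in auto)
 also have "\<dots> = finsum K (%\<chi>. finsum K \<chi> (carrier G)) (carrier Gh)"
  by (rule K.finsum_swap) (use finG fin charD(1) in auto)
 also have "\<dots> = finsum K (%\<chi>. if \<one>\<^bsub>Gh\<^esub> = \<chi> then ordK else \<zero>) (carrier Gh)"
 proof (rule K.finsum_cong')
  fix \<psi> assume p: "\<psi> : carrier Gh"
  have "finsum K \<one>\<^bsub>Gh\<^esub> (carrier G) = ordK" unfolding ordK_def by (rule K.finsum_cong') (auto simp: Gh_one)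
  thus "finsum K \<psi> (carrier G) = (if \<one>\<^bsub>Gh\<^esub> = \<psi> then ordK else \<zero>)" using sum_char[OF p] by auto
 qed auto
 also have "\<dots> = ordK" by (rule K.finsum_singleton) (use fin in auto)
 finally show ?thesis using ord0 fin S0 by auto
qed

lemmas ordK_nonzero = orthogonality[THEN conjunct1]
lemmas finGh = orthogonality[THEN conjunct2, THEN conjunct1]
lemmas sum_chars = orthogonality[THEN conjunct2, THEN conjunct2, rule_format]

end


section \<open>The category of equivariant objects\<close>

text \<open>
  The data shared by \<open>T\<close> and the equivariant categories over it. Exact functors, thick
  subcategories and tilting objects make sense at this level.
\<close>

locale shifted_category = linear_category K C
 for K :: "('k, 'r) ring_scheme" and C :: "('k, 'o, 'm, 'y) tri_category_scheme" (structure) +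
 assumes shift': "equivalence_functor K C C (Shift C)"
  and exact_triangles': "Exact C \<subseteq> triangles C"

abbreviation (in shifted_category) "So \<equiv> \<Sigma>o C"
abbreviation (in shifted_category) "Sm \<equiv> \<Sigma>m C"

sublocale pretriangulated_category \<subseteq> shifted_category K C
 by unfold_locales (fact shift exact_triangles)+

sublocale pretriangulated_category \<subseteq> additive_lin_category K C
 by unfold_locales (fact additive)

sublocale shifted_category \<subseteq> Sh: lin_equivalence K C C "Shift C"
 using equivalence_imp_lin_equivalence shift' linear_category_axioms by blast

locale equivariantization = shifted_category K C
 for K :: "('k, 'r) ring_scheme" and C :: "('k, 'o, 'm, 'y) tri_category_scheme" (structure) +
 fixes G :: "('g, 'z) monoid_scheme" and A :: "('g, 'o, 'm) tri_action"
 assumes action: "triangle_action K C G A"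
begin

abbreviation "E \<equiv> equivariant_category C G A"
abbreviation "aut \<equiv> equivariant_autoequivalence K C G A"
abbreviation "Fo \<equiv> %g. FObj (act A g)"
abbreviation "Fm \<equiv> %g. FMor (act A g)"
abbreviation "Fw \<equiv> %g. omega (act A g)"
abbreviation mult_G (infixl "\<cdot>" 70) where "g \<cdot> h \<equiv> g \<otimes>\<^bsub>G\<^esub> h"
abbreviation "one_G \<equiv> \<one>\<^bsub>G\<^esub>"
abbreviation "inv_G g \<equiv> inv\<^bsub>G\<^esub> g"
abbreviation comp_E (infixl "\<star>" 70) where "m \<star> n \<equiv> m \<bullet>\<^bsub>E\<^esub> n"

sublocale G: group G
 using action unfolding triangle_action_def by blast

lemma act_autoequivalence: "g : carrier G ==> triangle_autoequivalence K C (act A g)"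
 using action unfolding triangle_action_def by blast

lemma act_equivalence: "g : carrier G ==> lin_equivalence K C C (act A g)"
 using act_autoequivalence equivalence_imp_lin_equivalence linear_category_axioms
 unfolding triangle_autoequivalence_def by blast

lemma act_ff: "g : carrier G ==> ff_functor K C C (act A g)"
 using act_equivalence lin_equivalence.axioms(1) by blast
lemma act_faithful: "g : carrier G ==> faithful_lin_functor K C C (act A g)"
 using act_ff ff_functor.axioms(1) by blast
lemma act_functor: "g : carrier G ==> lin_functor K C C (act A g)"
 using act_faithful faithful_lin_functor.axioms(1) by blast

lemmas act_simps [simp] =
 lin_functor.obj[OF act_functor] lin_functor.mor[OF act_functor] lin_functor.map_comp[OF act_functor]
 lin_functor.map_Id[OF act_functor] lin_functor.map_add[OF act_functor] lin_functor.map_smult[OF act_functor]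
 lin_functor.map_zero[OF act_functor] lin_functor.map_neg[OF act_functor] lin_functor.map_sum[OF act_functor]
 lin_functor.map_iso[OF act_functor]

lemma eps [simp]:
 assumes "g : carrier G" "h : carrier G" "X : Obj C"
 shows "iso_arr C (eps A g h X)" "src C (eps A g h X) = Fo g (Fo h X)"
  "tgt C (eps A g h X) = Fo (g \<cdot> h) X"
 using action assms unfolding triangle_action_def tri_nat_iso_def nat_iso_def comp_tri_functor_def by auto

lemma eps_nat:
 assumes "g : carrier G" "h : carrier G" "arr C f"
 shows "eps A g h (tgt C f) \<bullet> Fm g (Fm h f) = Fm (g \<cdot> h) f \<bullet> eps A g h (src C f)"
 using action assms arrD[OF assms(3)] unfolding triangle_action_def tri_nat_iso_def nat_iso_def comp_tri_functor_def
 by auto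

lemma eps_omega:
 assumes "g : carrier G" "h : carrier G" "X : Obj C"
 shows "Fw (g \<cdot> h) X \<bullet> eps A g h (So X) =
  Sm (eps A g h X) \<bullet> (Fw g (Fo h X) \<bullet> Fm g (Fw h X))"
 using action assms unfolding triangle_action_def tri_nat_iso_def nat_iso_def comp_tri_functor_def by auto

lemma eps_cocycle:
 assumes "g : carrier G" "h : carrier G" "l : carrier G" "X : Obj C"
 shows "eps A (g \<cdot> h) l X \<bullet> eps A g h (Fo l X) =
   eps A g (h \<cdot> l) X \<bullet> Fm g (eps A h l X)"
 using action assms unfolding triangle_action_def by blast

lemma omega [simp]:
 assumes "g : carrier G" "X : Obj C"
 shows "iso_arr C (Fw g X)" "src C (Fw g X) = Fo g (So X)"
  "tgt C (Fw g X) = So (Fo g X)"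
 using act_autoequivalence[OF assms(1)] assms
 unfolding triangle_autoequivalence_def triangle_functor_def nat_iso_def comp_functor_def by auto

lemma omega_nat:
 assumes "g : carrier G" "arr C f"
 shows "Fw g (tgt C f) \<bullet> Fm g (Sm f) = Sm (Fm g f) \<bullet> Fw g (src C f)"
 using act_autoequivalence[OF assms(1)] assms arrD[OF assms(2)]
 unfolding triangle_autoequivalence_def triangle_functor_def nat_iso_def comp_functor_def by auto

subsection \<open>Objects and morphisms\<close>

lemma Obj_E: "Obj E = equivariant_objects C G A" and Hom_E: "Hom E = equivariant_hom C G A"
 and Shift_E: "FObj (Shift E) = equivariant_shift C G A"
 unfolding equivariant_category_def by simp_all

lemma objE:
 assumes "U : Obj E"
 shows "fst U : Obj C" "snd U : extensional (carrier G)"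
  "!!g. g : carrier G ==> iso_arr C (snd U g)" "!!g. g : carrier G ==> src C (snd U g) = fst U"
  "!!g. g : carrier G ==> tgt C (snd U g) = Fo g (fst U)"
  "!!g h. g : carrier G ==> h : carrier G ==>
   snd U (g \<cdot> h) = eps A g h (fst U) \<bullet> (Fm g (snd U h) \<bullet> snd U g)"
proof -
 from assms have o: "fst U : Obj C" and "snd U : extensional (carrier G)"
  and i: "!!g. g : carrier G ==> iso_mor C (fst U) (Fo g (fst U)) (snd U g)"
  and c: "!!g h. g : carrier G ==> h : carrier G ==>
   snd U (g \<cdot> h) = eps A g h (fst U) \<bullet> Fm g (snd U h) \<bullet> snd U g"
  unfolding Obj_E equivariant_objects_def by auto
 show "fst U : Obj C" "snd U : extensional (carrier G)" by fact+
 show i': "iso_arr C (snd U g)" "src C (snd U g) = fst U" "tgt C (snd U g) = Fo g (fst U)"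
  if "g : carrier G" for g using i[OF that] o that by simp_all
 show "snd U (g \<cdot> h) = eps A g h (fst U) \<bullet> (Fm g (snd U h) \<bullet> snd U g)"
  if "g : carrier G" "h : carrier G" for g h
  using c[OF that] that o i' by simp
qed

lemmas objE_simps [simp] = objE(1,3,4,5)

lemma objI:
 assumes "X : Obj C" "\<alpha> : extensional (carrier G)"
  and i: "!!g. g : carrier G ==> iso_arr C (\<alpha> g)" "!!g. g : carrier G ==> src C (\<alpha> g) = X"
  "!!g. g : carrier G ==> tgt C (\<alpha> g) = Fo g X"
  and c: "!!g h. g : carrier G ==> h : carrier G ==>
   \<alpha> (g \<cdot> h) = eps A g h X \<bullet> (Fm g (\<alpha> h) \<bullet> \<alpha> g)"
 shows "(X, \<alpha>) : Obj E"
 unfolding Obj_E equivariant_objects_def using assms by auto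

definition equi :: "('g, 'o, 'm) eobj => 'm => ('g, 'o, 'm) eobj => bool"
 where "equi U f V \<longleftrightarrow> arr C f & src C f = fst U & tgt C f = fst V &
  (ALL g:carrier G. snd V g \<bullet> f = Fm g f \<bullet> snd U g)"

lemma Homs_E:
 assumes "U : Obj E" "V : Obj E"
 shows "Homs E U V = {(U, f, V) | f. equi U f V}"
 unfolding Hom_E equivariant_hom_def equi_def using objE(1) assms by auto

lemma equi_zero: "U : Obj E ==> V : Obj E ==> equi U \<zero>[fst U,fst V] V"
 unfolding equi_def by simp

lemma equi_add: "U : Obj E ==> V : Obj E ==> equi U f V ==> equi U f' V ==>
  equi U (f \<oplus>[fst U,fst V] f') V"
 unfolding equi_def by simp

lemma equi_smult: "U : Obj E ==> V : Obj E ==> equi U f V ==> c : carrier K ==>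
  equi U (c \<odot>[fst U,fst V] f) V"
 unfolding equi_def by simp

lemma equi_comp:
 assumes "U : Obj E" "V : Obj E" "W : Obj E" "equi U f V" "equi V f' W"
 shows "equi U (f' \<bullet> f) W"
proof -
 have [simp]: "arr C f" "src C f = fst U" "tgt C f = fst V" "arr C f'" "src C f' = fst V" "tgt C f' = fst W"
  using assms unfolding equi_def by auto
 have "snd W g \<bullet> (f' \<bullet> f) = Fm g f' \<bullet> (Fm g f \<bullet> snd U g)" if g [simp]: "g : carrier G" for g
 proof -
  have e: "snd W g \<bullet> f' = Fm g f' \<bullet> snd V g" "snd V g \<bullet> f = Fm g f \<bullet> snd U g"
   using assms g unfolding equi_def by auto
  show ?thesis using reassoc[OF e(1), of f] e(2) assms(1-3) by simp
 qed
 thus ?thesis unfolding equi_def using assms(1-3) by simp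
qed

lemma hom_module_E:
 assumes U [simp]: "U : Obj E" and V [simp]: "V : Obj E"
 shows "module K (Hom E U V)"
proof -
 have [simp]: "fst U : Obj C" "fst V : Obj C" using objE by auto
 interpret M: module K "Hom C (fst U) (fst V)" using hom_module by simp
 let ?H = "Hom E U V"
 have c: "carrier ?H = {(U, f, V) | f. equi U f V}" using Homs_E by simp
 have z: "\<zero>\<^bsub>?H\<^esub> = (U, \<zero>[fst U,fst V], V)"
  unfolding Hom_E equivariant_hom_def by simp
 have a: "(U, f, V) \<oplus>\<^bsub>?H\<^esub> (U, f', V) = (U, f \<oplus>[fst U,fst V] f', V)" for f f'
  unfolding Hom_E equivariant_hom_def by simp
 have s: "x \<odot>\<^bsub>?H\<^esub> (U, f, V) = (U, x \<odot>[fst U,fst V] f, V)" for x f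
  unfolding Hom_E equivariant_hom_def by simp
 have m: "f : carrier (Hom C (fst U) (fst V))" if "equi U f V" for f
  using that unfolding equi_def by simp
 show ?thesis
 proof (rule moduleI)
  show "cring K" by unfold_locales
  show "abelian_group ?H"
  proof (rule abelian_groupI)
   fix x y w assume "x : carrier ?H" "y : carrier ?H" "w : carrier ?H"
   then obtain f f' f'' where e: "x = (U, f, V)" "y = (U, f', V)" "w = (U, f'', V)"
    "equi U f V" "equi U f' V" "equi U f'' V" unfolding c by blast
   note me = m[OF e(4)] m[OF e(5)] m[OF e(6)]
   show "(x \<oplus>\<^bsub>?H\<^esub> y) \<oplus>\<^bsub>?H\<^esub> w = x \<oplus>\<^bsub>?H\<^esub> (y \<oplus>\<^bsub>?H\<^esub> w)"
    unfolding e a using me by (simp only: M.a_assoc)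
  next
   fix x y assume "x : carrier ?H" "y : carrier ?H"
   then obtain f f' where e: "x = (U, f, V)" "y = (U, f', V)" "equi U f V" "equi U f' V" unfolding c by blast
   note me = m[OF e(3)] m[OF e(4)]
   show "x \<oplus>\<^bsub>?H\<^esub> y : carrier ?H" unfolding e a c using e equi_add by auto
   show "x \<oplus>\<^bsub>?H\<^esub> y = y \<oplus>\<^bsub>?H\<^esub> x" unfolding e a using M.a_comm[OF me] by (simp only:)
  next
   show "\<zero>\<^bsub>?H\<^esub> : carrier ?H" unfolding z c using equi_zero by auto
   fix x assume "x : carrier ?H"
   then obtain f where e: "x = (U, f, V)" "equi U f V" unfolding c by blast
   show "\<zero>\<^bsub>?H\<^esub> \<oplus>\<^bsub>?H\<^esub> x = x" unfolding e a z using M.M.l_zero[OF m[OF e(2)]] by (simp only:)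
   have "equi U ((\<ominus>\<^bsub>K\<^esub> \<one>\<^bsub>K\<^esub>) \<odot>[fst U,fst V] f) V" using equi_smult e by simp
   moreover have "((\<ominus>\<^bsub>K\<^esub> \<one>\<^bsub>K\<^esub>) \<odot>[fst U,fst V] f) \<oplus>[fst U,fst V] f = \<zero>[fst U,fst V]"
    using e unfolding equi_def by (simp flip: smult_neg)
   ultimately show "EX y:carrier ?H. y \<oplus>\<^bsub>?H\<^esub> x = \<zero>\<^bsub>?H\<^esub>" unfolding c z e using a by auto
  qed
 next
  fix h assume "h : carrier ?H"
  then obtain f where e: "h = (U, f, V)" "equi U f V" unfolding c by blast
  show "\<one>\<^bsub>K\<^esub> \<odot>\<^bsub>?H\<^esub> h = h" unfolding e s using M.smult_one[OF m[OF e(2)]] by (simp only:)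
 next
  fix x h assume x: "x : carrier K" and "h : carrier ?H"
  then obtain f where e: "h = (U, f, V)" "equi U f V" unfolding c by blast
  show "x \<odot>\<^bsub>?H\<^esub> h : carrier ?H" unfolding c e s using equi_smult e x by auto
  fix y assume y: "y : carrier K"
  show "(x \<oplus>\<^bsub>K\<^esub> y) \<odot>\<^bsub>?H\<^esub> h = x \<odot>\<^bsub>?H\<^esub> h \<oplus>\<^bsub>?H\<^esub> y \<odot>\<^bsub>?H\<^esub> h"
   unfolding e s a using M.smult_l_distr[OF x y m[OF e(2)]] by (simp only:)
  show "(x \<otimes>\<^bsub>K\<^esub> y) \<odot>\<^bsub>?H\<^esub> h = x \<odot>\<^bsub>?H\<^esub> (y \<odot>\<^bsub>?H\<^esub> h)"
   unfolding e s using M.smult_assoc1[OF x y m[OF e(2)]] by (simp only:)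
 next
  fix x h h' assume x: "x : carrier K" and "h : carrier ?H" "h' : carrier ?H"
  then obtain f f' where e: "h = (U, f, V)" "h' = (U, f', V)" "equi U f V" "equi U f' V" unfolding c by blast
  show "x \<odot>\<^bsub>?H\<^esub> (h \<oplus>\<^bsub>?H\<^esub> h') = x \<odot>\<^bsub>?H\<^esub> h \<oplus>\<^bsub>?H\<^esub> x \<odot>\<^bsub>?H\<^esub> h'"
   unfolding e s a using M.smult_r_distr[OF x m[OF e(3)] m[OF e(4)]] by (simp only:)
 qed
qed

lemma E_ops:
 "Id E U = (U, Id C (fst U), U)" "(V', f', W) \<star> (U, f, V) = (U, f' \<bullet> f, W)"
 "\<zero>\<^bsub>Hom E U V\<^esub> = (U, \<zero>[fst U,fst V], V)"
 "(U1, f, V1) \<oplus>\<^bsub>Hom E U V\<^esub> (U2, f', V2) = (U, f \<oplus>[fst U,fst V] f', V)"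
 "x \<odot>\<^bsub>Hom E U V\<^esub> (U1, f, V1) = (U, x \<odot>[fst U,fst V] f, V)"
 unfolding equivariant_category_def equivariant_hom_def by simp_all

sublocale E: linear_category K E
proof (intro linear_category.intro linear_category_axioms.intro)
 show "field K" by unfold_locales
next
 fix U V W U' V' f f' h
 show "\<lbrakk>U : Obj E; V : Obj E; U' : Obj E; V' : Obj E; f : Homs E U V; f : Homs E U' V'\<rbrakk> \<Longrightarrow> U = U' & V = V'"
  using Homs_E by auto
 show "U : Obj E ==> Id E U : Homs E U U"
  using Homs_E by (auto simp: E_ops equi_def)
 show "\<lbrakk>U : Obj E; V : Obj E\<rbrakk> \<Longrightarrow> module K (Hom E U V)" by (rule hom_module_E)
 assume o: "U : Obj E" "V : Obj E"
 show "f : Homs E U V ==> f \<star> Id E U = f" "f : Homs E U V ==> Id E V \<star> f = f"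
  using o Homs_E[OF o] by (auto simp: E_ops equi_def)
 assume W: "W : Obj E"
 show "\<lbrakk>f : Homs E U V; h : Homs E V W\<rbrakk> \<Longrightarrow> h \<star> f : Homs E U W"
  using Homs_E[OF o] Homs_E[OF o(2) W] Homs_E[OF o(1) W] equi_comp[OF o W] by (auto simp: E_ops)
 show "\<lbrakk>f : Homs E U V; f' : Homs E U V; h : Homs E V W\<rbrakk>
   \<Longrightarrow> h \<star> (f \<oplus>\<^bsub>Hom E U V\<^esub> f') = (h \<star> f) \<oplus>\<^bsub>Hom E U W\<^esub> (h \<star> f')"
  "\<lbrakk>f : Homs E U V; h : Homs E V W; f' : Homs E V W\<rbrakk>
   \<Longrightarrow> (h \<oplus>\<^bsub>Hom E V W\<^esub> f') \<star> f = (h \<star> f) \<oplus>\<^bsub>Hom E U W\<^esub> (f' \<star> f)"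
  using o W Homs_E by (auto simp: E_ops equi_def)
 fix x show "\<lbrakk>x : carrier K; f : Homs E U V; h : Homs E V W\<rbrakk>
   \<Longrightarrow> h \<star> (x \<odot>\<^bsub>Hom E U V\<^esub> f) = x \<odot>\<^bsub>Hom E U W\<^esub> (h \<star> f)"
  "\<lbrakk>x : carrier K; f : Homs E U V; h : Homs E V W\<rbrakk>
   \<Longrightarrow> (x \<odot>\<^bsub>Hom E V W\<^esub> h) \<star> f = x \<odot>\<^bsub>Hom E U W\<^esub> (h \<star> f)"
  using o W Homs_E by (auto simp: E_ops equi_def)
 assume U': "U' : Obj E"
 show "(f' \<star> h) \<star> f = f' \<star> (h \<star> f)"
  if hyps: "f : Homs E U V" "h : Homs E V W" "f' : Homs E W U'"
 proof -
  obtain a b c where e: "f = (U, a, V)" "h = (V, b, W)" "f' = (W, c, U')" "equi U a V" "equi V b W" "equi W c U'"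
   using hyps Homs_E[OF o] Homs_E[OF o(2) W] Homs_E[OF W U'] by blast
  show ?thesis unfolding e(1-3) E_ops using e(4-6) unfolding equi_def by simp
 qed
qed

lemma arr_E: "arr E (U, f, V) \<longleftrightarrow> U : Obj E & V : Obj E & equi U f V"
 unfolding arr_def using Homs_E by auto

lemma src_tgt_E:
 assumes "arr E m"
 shows "src E m = fst m" "tgt E m = snd (snd m)"
proof -
 obtain U f V where m: "m = (U, f, V)" by (cases m)
 have o: "U : Obj E" "V : Obj E" and e: "equi U f V" using assms unfolding m arr_E by blast+
 have h: "m : Homs E U V" unfolding Homs_E[OF o] m using e by blast
 show "src E m = fst m" "tgt E m = snd (snd m)" using E.hom_imp_arr(2,3)[OF o h] by (simp_all add: m)
qed

lemmas src_tgt_triple [simp] = src_tgt_E[of "(U, f, V)" for U f V, unfolded fst_conv snd_conv]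

definition forget :: "(('g, 'o, 'm) eobj, ('g, 'o, 'm) emor, 'o, 'm) tri_functor"
 where "forget = \<lparr>FObj = fst, FMor = (%m. fst (snd m)), omega = (%U. Id C (So (fst U)))\<rparr>"

lemma forget_simps [simp]: "FObj forget U = fst U" "FMor forget (U, f, V) = f"
 "omega forget U = Id C (So (fst U))"
 unfolding forget_def by auto

sublocale Fo: faithful_lin_functor K E C forget
proof unfold_locales
 show "linear_functor K E C forget"
  unfolding linear_functor_def
  using Homs_E by (auto simp: E_ops equi_def)
 show "faithful_functor E C forget"
  unfolding faithful_functor_def
  by (auto simp: prod_eq_iff src_tgt_E forget_def)
qed

lemma arr_underlying:
 assumes "arr E m"
 shows "arr C (fst (snd m))" "src C (fst (snd m)) = fst (src E m)" "tgt C (fst (snd m)) = fst (tgt E m)"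
  "g : carrier G ==> snd (tgt E m) g \<bullet> fst (snd m) = Fm g (fst (snd m)) \<bullet> snd (src E m) g"
 using assms by (cases m; auto simp: arr_E equi_def)+

lemma iso_E:
 assumes "arr E (U, f, V)"
 shows "iso_arr E (U, f, V) \<longleftrightarrow> iso_arr C f"
proof
 assume "iso_arr E (U, f, V)"
 from Fo.map_iso(1)[OF this] show "iso_arr C f" by simp
next
 assume i: "iso_arr C f"
 have o [simp]: "U : Obj E" "V : Obj E" and e: "equi U f V" using assms arr_E by auto
 hence f [simp]: "src C f = fst U" "tgt C f = fst V" unfolding equi_def by auto
 have a: "arr E (V, inv_arr C f, U)" unfolding arr_E equi_def
 proof (intro conjI ballI)
  fix g assume g [simp]: "g : carrier G"
  have r: "snd V g \<bullet> f = Fm g f \<bullet> snd U g" using e unfolding equi_def by simp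
  have c: "Fm g (inv_arr C f) \<bullet> (Fm g f \<bullet> snd U g) = snd U g"
   using inv_arr_cancel(1)[of "Fm g f" "snd U g"] i by simp
  have "(snd U g \<bullet> inv_arr C f) \<bullet> f = (Fm g (inv_arr C f) \<bullet> snd V g) \<bullet> f"
   using i by (simp add: r c)
  thus "snd U g \<bullet> inv_arr C f = Fm g (inv_arr C f) \<bullet> snd V g"
   by (rule iso_cancel_right[OF i]) (use i in simp_all)
 qed (use i in simp_all)
 show "iso_arr E (U, f, V)"
  by (rule E.iso_arrI(1)[OF assms a]) (use assms a i in \<open>simp_all add: E_ops\<close>)
qed

end


context equivariantization
begin

subsection \<open>Retracts and direct sums of equivariant objects\<close>

text \<open>
  The structure morphisms of the retract are \<open>F\<^sub>g(r) \<alpha>\<^sub>g s\<close>; the equivariance of the idempotent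
  \<open>s r\<close> makes them invertible and coherent.
\<close>

lemma retract_E:
 assumes U [simp]: "U : Obj E" and r [simp]: "arr C r" "src C r = fst U" "tgt C r = Y"
  and s [simp]: "arr C s" "src C s = Y" "tgt C s = fst U" and rs: "r \<bullet> s = Id C Y" and e: "equi U (s \<bullet> r) U"
 shows "EX V:Obj E. fst V = Y & equi U r V & equi V s U"
proof -
 have Y [simp]: "Y : Obj C" using arr_obj(2)[of r] by simp
 note [simp] = rs reassoc[OF rs]
 define \<beta> where "\<beta> = (\<lambda>g\<in>carrier G. Fm g r \<bullet> (snd U g \<bullet> s))"
 have b [simp]: "arr C (\<beta> g)" "src C (\<beta> g) = Y" "tgt C (\<beta> g) = Fo g Y" if "g : carrier G" for g
  using that unfolding \<beta>_def by simp_all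
 have Frs: "Fm g r \<bullet> Fm g s = Id C (Fo g Y)" if "g : carrier G" for g
  using that by (simp flip: act_simps(5))
 have ef: "snd U g \<bullet> (s \<bullet> r) = Fm g (s \<bullet> r) \<bullet> snd U g" if "g : carrier G" for g
  using e that unfolding equi_def by blast
 have bs: "Fm g s \<bullet> \<beta> g = snd U g \<bullet> s" if g [simp]: "g : carrier G" for g
 proof -
  have "Fm g s \<bullet> \<beta> g = (Fm g (s \<bullet> r) \<bullet> snd U g) \<bullet> s" unfolding \<beta>_def by simp
  also have "\<dots> = (snd U g \<bullet> (s \<bullet> r)) \<bullet> s" by (simp only: ef[OF g])
  finally show ?thesis by simp
 qed
 have br: "\<beta> g \<bullet> r = Fm g r \<bullet> snd U g" if g [simp]: "g : carrier G" for g
 proof -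
  have "\<beta> g \<bullet> r = Fm g r \<bullet> (snd U g \<bullet> (s \<bullet> r))" unfolding \<beta>_def by simp
  also have "\<dots> = Fm g (r \<bullet> (s \<bullet> r)) \<bullet> snd U g" by (simp only: ef[OF g]) (simp add: reassoc[OF Frs])
  finally show ?thesis by simp
 qed
 have "(Y, \<beta>) : Obj E"
 proof (rule objI)
  fix g assume g [simp]: "g : carrier G"
  let ?c = "r \<bullet> (inv_arr C (snd U g) \<bullet> Fm g s)"
  show "iso_arr C (\<beta> g)"
  proof (rule iso_arrI(1)[of _ ?c])
   have "?c \<bullet> \<beta> g = r \<bullet> (inv_arr C (snd U g) \<bullet> (Fm g s \<bullet> \<beta> g))" by simp
   also have "\<dots> = Id C Y" unfolding bs[OF g] by simp
   finally show "?c \<bullet> \<beta> g = Id C (src C (\<beta> g))" by simp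
   have "\<beta> g \<bullet> ?c = (\<beta> g \<bullet> r) \<bullet> (inv_arr C (snd U g) \<bullet> Fm g s)" by simp
   also have "\<dots> = Fm g (r \<bullet> s)" unfolding br[OF g] by (simp add: Frs)
   finally show "\<beta> g \<bullet> ?c = Id C (tgt C (\<beta> g))" by simp
  qed simp_all
  fix h assume h [simp]: "h : carrier G"
  have n: "eps A g h Y \<bullet> Fm g (Fm h r) = Fm (g \<cdot> h) r \<bullet> eps A g h (fst U)"
   using eps_nat[OF g h, of r] by simp
  have "eps A g h Y \<bullet> (Fm g (\<beta> h) \<bullet> \<beta> g) =
   eps A g h Y \<bullet> (Fm g (Fm h r) \<bullet> (Fm g (snd U h) \<bullet> (Fm g s \<bullet> \<beta> g)))"
   by (subst (1) \<beta>_def) simp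
  also have "\<dots> = Fm (g \<cdot> h) r \<bullet> (snd U (g \<cdot> h) \<bullet> s)"
   unfolding bs[OF g] objE(6)[OF U g h] by (simp add: reassoc[OF n])
  finally show "\<beta> (g \<cdot> h) = eps A g h Y \<bullet> (Fm g (\<beta> h) \<bullet> \<beta> g)"
   unfolding \<beta>_def by simp
 qed (auto simp: \<beta>_def)
 moreover have "equi U r (Y, \<beta>)" "equi (Y, \<beta>) s U" unfolding equi_def using bs br by auto
 ultimately show ?thesis by (intro bexI[of _ "(Y, \<beta>)"]) auto
qed

lemma transport_E:
 assumes "U : Obj E" "iso_arr C f" "src C f = fst U" "tgt C f = Y"
 shows "EX V:Obj E. fst V = Y & iso_arr E (U, f, V)"
proof -
 have "equi U (inv_arr C f \<bullet> f) U" using assms unfolding equi_def by simp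
 then obtain V where "V : Obj E" "fst V = Y" "equi U f V"
  using retract_E[of U f Y "inv_arr C f"] assms by auto
 thus ?thesis using iso_E[of U f V] assms by (auto simp: arr_E)
qed

text \<open>The sum of the underlying objects carries the diagonal structure.\<close>

lemma biproduct_E:
 assumes b: "biproduct C I (%i. fst (U i)) B \<iota> \<pi>" and U [simp]: "!!i. i : I ==> U i : Obj E"
 shows "EX V:Obj E. fst V = B & biproduct E I U V (%i. (U i, \<iota> i, V)) (%i. (V, \<pi> i, U i))"
proof -
 note [simp] = biproductD[OF b]
 have bF: "biproduct C I (%i. Fo g (fst (U i))) (Fo g B)
   (%i. Fm g (\<iota> i)) (%i. Fm g (\<pi> i))" if "g : carrier G" for g
  using lin_functor.map_biproduct[OF act_functor[OF that] b] .
 define \<beta> where "\<beta> = (\<lambda>g\<in>carrier G. copair I B (Fo g B) \<pi> (%i. Fm g (\<iota> i) \<bullet> snd (U i) g))"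
 have ba [simp]: "arr C (\<beta> g)" "src C (\<beta> g) = B" "tgt C (\<beta> g) = Fo g B"
  and bi: "i : I ==> \<beta> g \<bullet> \<iota> i = Fm g (\<iota> i) \<bullet> snd (U i) g" if g: "g : carrier G" for g i
  using copair[OF b, of "Fo g B" "%i. Fm g (\<iota> i) \<bullet> snd (U i) g"] g unfolding \<beta>_def by auto
 have "(B, \<beta>) : Obj E"
 proof (rule objI)
  fix g assume g [simp]: "g : carrier G"
  define c where "c = copair I (Fo g B) B (%i. Fm g (\<pi> i)) (%i. \<iota> i \<bullet> inv_arr C (snd (U i) g))"
  have c [simp]: "arr C c" "src C c = Fo g B" "tgt C c = B"
   and ci: "i : I ==> c \<bullet> Fm g (\<iota> i) = \<iota> i \<bullet> inv_arr C (snd (U i) g)" for i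
   using copair[OF bF[OF g], of B "%i. \<iota> i \<bullet> inv_arr C (snd (U i) g)"] unfolding c_def by auto
  show "iso_arr C (\<beta> g)"
  proof (rule iso_arrI(1)[of _ c])
   have "c \<bullet> \<beta> g = Id C B"
    by (rule biproduct_epi[OF b]) (auto simp: bi reassoc[OF ci])
   thus "c \<bullet> \<beta> g = Id C (src C (\<beta> g))" by simp
   have "\<beta> g \<bullet> c = Id C (Fo g B)"
    by (rule biproduct_epi[OF bF[OF g]]) (auto simp: ci reassoc[OF bi])
   thus "\<beta> g \<bullet> c = Id C (tgt C (\<beta> g))" by simp
  qed simp_all
  fix h assume h [simp]: "h : carrier G"
  show "\<beta> (g \<cdot> h) = eps A g h B \<bullet> (Fm g (\<beta> h) \<bullet> \<beta> g)"
  proof (rule biproduct_epi[OF b])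
   fix i assume i [simp]: "i : I"
   have n: "eps A g h B \<bullet> Fm g (Fm h (\<iota> i)) = Fm (g \<cdot> h) (\<iota> i) \<bullet> eps A g h (fst (U i))"
    using eps_nat[OF g h, of "\<iota> i"] by simp
   have "Fm g (\<beta> h) \<bullet> (Fm g (\<iota> i) \<bullet> snd (U i) g) = Fm g (\<beta> h \<bullet> \<iota> i) \<bullet> snd (U i) g"
    by simp
   also have "\<dots> = Fm g (Fm h (\<iota> i)) \<bullet> (Fm g (snd (U i) h) \<bullet> snd (U i) g)"
    unfolding bi[OF h i] by simp
   finally show "\<beta> (g \<cdot> h) \<bullet> \<iota> i = (eps A g h B \<bullet> (Fm g (\<beta> h) \<bullet> \<beta> g)) \<bullet> \<iota> i"
    by (simp add: bi objE(6)[OF U] reassoc[OF n])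
  qed simp_all
 qed (simp_all, simp add: \<beta>_def)
 let ?V = "(B, \<beta>)"
 have V [simp]: "?V : Obj E" by fact
 have ei: "equi (U i) (\<iota> i) ?V" if "i : I" for i unfolding equi_def using that bi by auto
 have ep: "equi ?V (\<pi> i) (U i)" if i [simp]: "i : I" for i
 proof -
  have "snd (U i) g \<bullet> \<pi> i = Fm g (\<pi> i) \<bullet> \<beta> g" if g [simp]: "g : carrier G" for g
  proof (rule biproduct_epi[OF b])
   fix j assume j [simp]: "j : I"
   have "Fm g (\<pi> i) \<bullet> (Fm g (\<iota> j) \<bullet> snd (U j) g) = Fm g (\<pi> i \<bullet> \<iota> j) \<bullet> snd (U j) g" by simp
   also have "\<dots> = snd (U i) g \<bullet> (\<pi> i \<bullet> \<iota> j)"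
    by (cases "i = j") (simp_all)
   finally show "(snd (U i) g \<bullet> \<pi> i) \<bullet> \<iota> j = (Fm g (\<pi> i) \<bullet> \<beta> g) \<bullet> \<iota> j"
    by (simp add: bi)
  qed simp_all
  thus ?thesis unfolding equi_def by auto
 qed
 have "biproduct E I U ?V (%i. (U i, \<iota> i, ?V)) (%i. (?V, \<pi> i, U i))"
 proof (rule E.biproductI)
  show "finite I" by simp
  show "?V : Obj E" by simp
  show a: "arr E (U i, \<iota> i, ?V) & src E (U i, \<iota> i, ?V) = U i & tgt E (U i, \<iota> i, ?V) = ?V" if "i : I" for i
   using ei[OF that] that arr_E by simp
  show a': "arr E (?V, \<pi> i, U i) & src E (?V, \<pi> i, U i) = ?V & tgt E (?V, \<pi> i, U i) = U i" if "i : I" for i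
   using ep[OF that] that arr_E by simp
  show "finsum (Hom E ?V ?V) (%i. (U i, \<iota> i, ?V) \<star> (?V, \<pi> i, U i)) I = Id E ?V"
  proof (rule Fo.inj)
   let ?l = "FMor forget (finsum (Hom E ?V ?V) (%i. (U i, \<iota> i, ?V) \<star> (?V, \<pi> i, U i)) I)"
   have "?l =
    finsum (Hom C B B) (%i. FMor forget ((U i, \<iota> i, ?V) \<star> (?V, \<pi> i, U i))) I"
    using a a' by (subst Fo.map_sum) auto
   also have "\<dots> = finsum (Hom C B B) (%i. \<iota> i \<bullet> \<pi> i) I"
    by (rule sum_cong) (auto simp: E_ops)
   finally show "?l = FMor forget (Id E ?V)"
    by simp
  qed (use a a' in auto)
 qed (auto simp: E_ops)
 thus ?thesis by (intro bexI[of _ ?V]) auto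
qed

end

locale ks_equivariantization = equivariantization K C G A + krull_schmidt K C
 for K :: "('k, 'r) ring_scheme" and C :: "('k, 'o, 'm, 'y) tri_category_scheme" (structure)
  and G :: "('g, 'z) monoid_scheme" and A :: "('g, 'o, 'm) tri_action"
begin

lemma direct_sum_exists_E:
 assumes "finite I" "!!i. i : I ==> U i : Obj E"
 shows "EX V:Obj E. direct_sum E I U V"
proof -
 have "!!i. i : I ==> fst (U i) : Obj C" using assms(2) by simp
 from direct_sum_exists[OF assms(1), of "%i. fst (U i)", OF this]
 obtain B where "direct_sum C I (%i. fst (U i)) B" by blast
 then obtain \<iota> \<pi> where "biproduct C I (%i. fst (U i)) B \<iota> \<pi>" unfolding direct_sum_def by blast
 from biproduct_E[OF this assms(2)] show ?thesis unfolding direct_sum_def by blast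
qed

lemma idempotent_complete_E: "idempotent_complete E"
 unfolding idempotent_complete_def
proof (intro ballI impI)
 fix U e assume U: "U : Obj E" and e: "e : Homs E U U" "e \<star> e = e"
 obtain f where f: "e = (U, f, U)" "equi U f U" using e Homs_E[OF U U] by auto
 have fa: "arr C f" "src C f = fst U" "tgt C f = fst U" using f unfolding equi_def by auto
 have "f \<bullet> f = f" using e(2) unfolding f E_ops by simp
 then obtain Y r s where d: "Y : Obj C" "arr C r" "src C r = fst U" "tgt C r = Y"
  "arr C s" "src C s = Y" "tgt C s = fst U" "s \<bullet> r = f" "r \<bullet> s = Id C Y"
  using idem_split[OF fa] by blast
 obtain V where V: "V : Obj E" "fst V = Y" "equi U r V" "equi V s U"
  using retract_E[OF U d(2-7,9)] f(2) d(8) by auto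
 have "(U, r, V) : Homs E U V" "(V, s, U) : Homs E V U" using Homs_E U V by auto
 thus "EX Y:Obj E. EX r:Homs E U Y. EX s:Homs E Y U. s \<star> r = e & r \<star> s = Id E Y"
  using V d unfolding f by (intro bexI[of _ V] bexI[of _ "(U, r, V)"] bexI[of _ "(V, s, U)"]) (auto simp: E_ops)
qed

text \<open>
  The endomorphisms of \<open>U\<close> are a subspace of those of the underlying object.
\<close>

lemma dependent_bound_E:
 assumes U: "U : Obj E"
 shows "EX N. dependent_bound K E N U"
proof -
 obtain N where N: "dependent_bound K C N (fst U)" using bound objE(1)[OF U] by blast
 have "dependent_bound K E N U" unfolding dependent_bound_def
 proof (intro allI impI)
  fix f assume f: "ALL i<N. f i : Homs E U U"
  have fa: "arr E (f i)" "src E (f i) = U" "tgt E (f i) = U" if "i < N" for i using f that U by auto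
  have h: "ALL i<N. FMor forget (f i) : Homs C (fst U) (fst U)"
  proof (intro allI impI)
   fix i assume i: "i < N"
   show "FMor forget (f i) : Homs C (fst U) (fst U)"
    using Fo.mor[OF fa(1)[OF i]] fa[OF i] U by simp
  qed
  from N[unfolded dependent_bound_def, THEN spec, THEN mp, OF h] obtain c where c: "ALL i<N. c i : carrier K" "EX i<N. c i \<noteq> \<zero>\<^bsub>K\<^esub>"
   "finsum (Hom C (fst U) (fst U)) (%i. c i \<odot>[fst U,fst U] FMor forget (f i)) {..<N} = \<zero>[fst U,fst U]"
   by blast
  have "finsum (Hom E U U) (%i. c i \<odot>\<^bsub>Hom E U U\<^esub> f i) {..<N} = \<zero>\<^bsub>Hom E U U\<^esub>"
  proof (rule Fo.inj)
   let ?l = "FMor forget (finsum (Hom E U U) (%i. c i \<odot>\<^bsub>Hom E U U\<^esub> f i) {..<N})"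
   have "?l =
    finsum (Hom C (fst U) (fst U)) (%i. FMor forget (c i \<odot>\<^bsub>Hom E U U\<^esub> f i)) {..<N}"
    using fa U c by (subst Fo.map_sum) (auto)
   also have "\<dots> = finsum (Hom C (fst U) (fst U)) (%i. c i \<odot>[fst U,fst U] FMor forget (f i)) {..<N}"
   proof (rule sum_cong)
    fix i assume "i : {..<N}"
    thus "FMor forget (c i \<odot>\<^bsub>Hom E U U\<^esub> f i) = c i \<odot>[fst U,fst U] FMor forget (f i)"
     using Fo.map_smult[of U U "f i" "c i"] fa c U by simp
   qed (use fa c U Fo.mor in auto)
   finally show "?l = FMor forget \<zero>\<^bsub>Hom E U U\<^esub>"
    using c(3) Fo.map_zero[OF U U] by simp
  qed (use fa U c in \<open>auto simp: E.sum_arr\<close>)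
  thus "EX c. (ALL i<N. c i : carrier K) & (EX i<N. c i \<noteq> \<zero>\<^bsub>K\<^esub>) &
   finsum (Hom E U U) (%i. c i \<odot>\<^bsub>Hom E U U\<^esub> f i) {..<N} = \<zero>\<^bsub>Hom E U U\<^esub>" using c by blast
 qed
 thus ?thesis by blast
qed

sublocale E: krull_schmidt K E
proof (intro krull_schmidt.intro additive_lin_category.intro additive_lin_category_axioms.intro krull_schmidt_axioms.intro)
 show "linear_category K E" by unfold_locales
 show "additive_category K E"
  unfolding additive_category_def
 proof (intro conjI ballI)
  show "linear_category K E" by unfold_locales
  show "EX Z. zero_obj E Z" 
  proof -
   have "EX V:Obj E. direct_sum E ({} :: nat set) (%_. undefined) V" by (rule direct_sum_exists_E) auto
   thus ?thesis using E.direct_sum_empty by blast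
  qed
  fix U V assume "U : Obj E" "V : Obj E"
  thus "EX B. direct_sum2 E U V B"
   unfolding direct_sum2_def using direct_sum_exists_E[of UNIV "%b. if b then U else V"]
   by (metis (no_types, lifting) finite)
 qed
 show "idempotent_complete E" by (rule idempotent_complete_E)
 show "!!X. X : Obj E ==> EX N. dependent_bound K E N X" by (rule dependent_bound_E)
qed

end

section \<open>Lifting equivariant functors to equivariant objects\<close>

text \<open>
  The functor \<open>F\<^sup>G\<close> between equivariant objects, with structure morphisms \<open>\<delta>\<^sub>g F(\<alpha>\<^sub>g)\<close>.
\<close>

definition equivariant_lift where
 "equivariant_lift C G F \<delta> =
  \<lparr>FObj = (%U. (FObj F (fst U), \<lambda>g\<in>carrier G. \<delta> g (fst U) \<bullet>\<^bsub>C\<^esub> FMor F (snd U g))),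
  FMor = (%(U, f, V). ((FObj F (fst U), \<lambda>g\<in>carrier G. \<delta> g (fst U) \<bullet>\<^bsub>C\<^esub> FMor F (snd U g)), FMor F f,
   (FObj F (fst V), \<lambda>g\<in>carrier G. \<delta> g (fst V) \<bullet>\<^bsub>C\<^esub> FMor F (snd V g))))\<rparr>"

locale equivariant_equivalence = equivariantization K C G A + F: lin_equivalence K C C F
 for K :: "('k, 'r) ring_scheme" and C :: "('k, 'o, 'm, 'y) tri_category_scheme" (structure)
  and G :: "('g, 'z) monoid_scheme" and A :: "('g, 'o, 'm) tri_action"
  and F :: "('o, 'm, 'o, 'm, 'f) cat_functor_scheme" +
 fixes \<delta> :: "'g => 'o => 'm"
 assumes delta [simp]: "\<lbrakk>g : carrier G; X : Obj C\<rbrakk> \<Longrightarrow> iso_arr C (\<delta> g X)"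
  "\<lbrakk>g : carrier G; X : Obj C\<rbrakk> \<Longrightarrow> src C (\<delta> g X) = FObj F (Fo g X)"
  "\<lbrakk>g : carrier G; X : Obj C\<rbrakk> \<Longrightarrow> tgt C (\<delta> g X) = Fo g (FObj F X)"
 and delta_nat: "\<lbrakk>g : carrier G; arr C f\<rbrakk> \<Longrightarrow>
   \<delta> g (tgt C f) \<bullet> FMor F (Fm g f) = Fm g (FMor F f) \<bullet> \<delta> g (src C f)"
 and delta_coh: "\<lbrakk>g : carrier G; h : carrier G; X : Obj C\<rbrakk> \<Longrightarrow>
   \<delta> (g \<cdot> h) X \<bullet> FMor F (eps A g h X) = eps A g h (FObj F X) \<bullet> (Fm g (\<delta> h X) \<bullet> \<delta> g (Fo h X))"
begin

abbreviation "L \<equiv> equivariant_lift C G F \<delta>"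

lemma L_simps: "fst (FObj L U) = FObj F (fst U)"
 "g : carrier G ==> snd (FObj L U) g = \<delta> g (fst U) \<bullet> FMor F (snd U g)"
 "FMor L (U, f, V) = (FObj L U, FMor F f, FObj L V)"
 unfolding equivariant_lift_def by simp_all

lemma delta_calc:
 assumes g [simp]: "g : carrier G" and h [simp]: "h : carrier G" and X [simp]: "X : Obj C"
  and a [simp]: "arr C a" "tgt C a = Fo h X" and b [simp]: "arr C b" "tgt C b = Fo g (src C a)"
 shows "\<delta> (g \<cdot> h) X \<bullet> (FMor F (eps A g h X) \<bullet> (FMor F (Fm g a) \<bullet> FMor F b)) =
  eps A g h (FObj F X) \<bullet> (Fm g (\<delta> h X \<bullet> FMor F a) \<bullet> (\<delta> g (src C a) \<bullet> FMor F b))"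
proof -
 note n = delta_nat[OF g a(1), unfolded a(2)] and c = delta_coh[OF g h X]
 show ?thesis by (simp add: reassoc[OF c] reassoc[OF n])
qed

lemma lift_obj: "U : Obj E ==> FObj L U : Obj E"
proof -
 assume U [simp]: "U : Obj E"
 show ?thesis unfolding equivariant_lift_def
  by (simp, rule objI) (auto simp: objE(6)[OF U] delta_calc)
qed

lemma lift_equi:
 assumes U [simp]: "U : Obj E" and V [simp]: "V : Obj E" and f: "arr C f" "src C f = fst U" "tgt C f = fst V"
 shows "equi (FObj L U) (FMor F f) (FObj L V) \<longleftrightarrow> equi U f V"
proof -
 note [simp] = f
 have "(snd V g \<bullet> f = Fm g f \<bullet> snd U g) =
   (snd (FObj L V) g \<bullet> FMor F f = Fm g (FMor F f) \<bullet> snd (FObj L U) g)" if g [simp]: "g : carrier G" for g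
 proof -
  note n = delta_nat[OF g f(1), unfolded f]
  have "(snd (FObj L V) g \<bullet> FMor F f = Fm g (FMor F f) \<bullet> snd (FObj L U) g) =
   (\<delta> g (fst V) \<bullet> FMor F (snd V g \<bullet> f) = \<delta> g (fst V) \<bullet> FMor F (Fm g f \<bullet> snd U g))"
   using n by (simp add: L_simps reassoc[OF n])
  also have "\<dots> = (FMor F (snd V g \<bullet> f) = FMor F (Fm g f \<bullet> snd U g))"
   using iso_cancel_left[of "\<delta> g (fst V)" "FMor F (snd V g \<bullet> f)" "FMor F (Fm g f \<bullet> snd U g)"] by auto
  also have "\<dots> = (snd V g \<bullet> f = Fm g f \<bullet> snd U g)"
  proof
   assume e: "FMor F (snd V g \<bullet> f) = FMor F (Fm g f \<bullet> snd U g)"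
   show "snd V g \<bullet> f = Fm g f \<bullet> snd U g" by (rule F.inj[OF e]) simp_all
  qed (simp only:)
  finally show ?thesis by simp
 qed
 thus ?thesis unfolding equi_def by (simp add: L_simps(1))
qed

lemma lift_functor: "lin_functor K E E L"
proof (unfold_locales, unfold linear_functor_def, intro conjI ballI)
 fix U assume U: "U : Obj E"
 show "FObj L U : Obj E" using lift_obj U .
 show "FMor L (Id E U) = Id E (FObj L U)" using U by (simp add: E_ops L_simps)
 fix V assume V: "V : Obj E"
 have H: "EX f. m = (U, f, V) & equi U f V" if "m : Homs E U V" for m using Homs_E[OF U V] that by auto
 fix m assume "m : Homs E U V"
 then obtain f where m: "m = (U, f, V)" and f: "equi U f V" using H by blast
 have fa: "arr C f" "src C f = fst U" "tgt C f = fst V" using f unfolding equi_def by auto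
 show "FMor L m : Homs E (FObj L U) (FObj L V)"
  using lift_equi[OF U V fa] f Homs_E[OF lift_obj[OF U] lift_obj[OF V]] by (auto simp: m L_simps)
 {
  fix m' assume "m' : Homs E U V"
  then obtain f' where m': "m' = (U, f', V)" and f': "equi U f' V" using H by blast
  have fa': "arr C f'" "src C f' = fst U" "tgt C f' = fst V" using f' unfolding equi_def by auto
  show "FMor L (m \<oplus>\<^bsub>Hom E U V\<^esub> m') = FMor L m \<oplus>\<^bsub>Hom E (FObj L U) (FObj L V)\<^esub> FMor L m'"
   using fa fa' U V by (simp add: m m' E_ops L_simps)
 }
 {
  fix c assume "c : carrier K"
  thus "FMor L (c \<odot>\<^bsub>Hom E U V\<^esub> m) = c \<odot>\<^bsub>Hom E (FObj L U) (FObj L V)\<^esub> FMor L m"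
   using fa U V by (simp add: m E_ops L_simps)
 }
 fix W m' assume W: "W : Obj E" and "m' : Homs E V W"
 then obtain f' where m': "m' = (V, f', W)" and f': "equi V f' W" using Homs_E[OF V W] by auto
 have fa': "arr C f'" "src C f' = fst V" "tgt C f' = fst W" using f' unfolding equi_def by auto
 show "FMor L (m' \<star> m) = FMor L m' \<star> FMor L m"
  using fa fa' by (simp add: m m' E_ops L_simps)
qed

text \<open>
  For essential surjectivity the structure of the given object is moved to an isomorphic object
  in the image of \<open>F\<close> and then pulled back, morphism by morphism, along the fully faithful \<open>F\<close>.
\<close>

lemma lift_equivalence: "lin_equivalence K E E L"
proof -
 interpret L: lin_functor K E E L by (rule lift_functor)
 show ?thesis
 proof unfold_locales
  show "faithful_functor E E L" unfolding faithful_functor_def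
  proof (intro allI impI, elim conjE)
   fix m m' assume a: "arr E m" "arr E m'" "src E m = src E m'" "tgt E m = tgt E m'" "FMor L m = FMor L m'"
   obtain U f V f' where m: "m = (U, f, V)" "m' = (U, f', V)" using a by (cases m; cases m') auto
   have "FMor F f = FMor F f'" using a(5) unfolding m L_simps by simp
   moreover have "arr C f" "src C f = fst U" "tgt C f = fst V" "arr C f'" "src C f' = fst U" "tgt C f' = fst V"
    using a(1,2) unfolding m arr_E equi_def by blast+
   ultimately have "f = f'" using F.inj[of f f'] by simp
   thus "m = m'" using m by simp
  qed
  show "full_functor E E L" unfolding full_functor_def
  proof (intro ballI allI impI, elim conjE)
   fix U V m assume U: "U : Obj E" and V: "V : Obj E" and m: "arr E m" "src E m = FObj L U" "tgt E m = FObj L V"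
   obtain h where mh: "m = (FObj L U, h, FObj L V)" using m by (cases m) auto
   have e: "equi (FObj L U) h (FObj L V)" using m(1) unfolding mh arr_E by blast
   have h: "arr C h" "src C h = FObj F (fst U)" "tgt C h = FObj F (fst V)"
    using e unfolding equi_def by (auto simp: L_simps)
   obtain f where f: "arr C f" "src C f = fst U" "tgt C f = fst V" "FMor F f = h"
    using F.lift[OF _ _ h] objE(1) U V by blast
   have "equi U f V" using lift_equi[OF U V f(1-3)] e f(4) by simp
   hence "arr E (U, f, V)" using arr_E U V by simp
   moreover have "FMor L (U, f, V) = m" using f mh by (simp add: L_simps)
   ultimately show "EX f. arr E f & src E f = U & tgt E f = V & FMor L f = m"
    by (intro exI[of _ "(U, f, V)"]) simp
  qed
  show "ess_surj E E L" unfolding ess_surj_def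
  proof
   fix W assume W: "W : Obj E"
   obtain X where X [simp]: "X : Obj C" and "isomorphic C (FObj F X) (fst W)" using F.preimage[OF objE(1)[OF W]] by blast
   then obtain t where t: "iso_arr C t" "src C t = fst W" "tgt C t = FObj F X"
    using isomorphic_sym unfolding isomorphic_iff by blast
   obtain V where V [simp]: "V : Obj E" "fst V = FObj F X" and iso: "iso_arr E (W, t, V)" using transport_E[OF W t] by blast
   have vs [simp]: "iso_arr C (snd V g)" "src C (snd V g) = FObj F X" "tgt C (snd V g) = Fo g (FObj F X)"
    if "g : carrier G" for g using objE(3-5)[OF V(1)] that by simp_all
   have "ALL g:carrier G. EX a. arr C a & src C a = X & tgt C a = Fo g X &
     FMor F a = inv_arr C (\<delta> g X) \<bullet> snd V g"
   proof
    fix g assume g [simp]: "g : carrier G"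
    show "EX a. arr C a & src C a = X & tgt C a = Fo g X & FMor F a = inv_arr C (\<delta> g X) \<bullet> snd V g"
     using F.lift[of X "Fo g X" "inv_arr C (\<delta> g X) \<bullet> snd V g"] by (simp) blast
   qed
   then obtain a where a [simp]: "!!g. g : carrier G ==> arr C (a g)" "!!g. g : carrier G ==> src C (a g) = X"
    "!!g. g : carrier G ==> tgt C (a g) = Fo g X"
    and Fa: "!!g. g : carrier G ==> FMor F (a g) = inv_arr C (\<delta> g X) \<bullet> snd V g" by metis
   have dFa: "\<delta> g X \<bullet> FMor F (a g) = snd V g" if "g : carrier G" for g using Fa that by simp
   have U: "(X, \<lambda>g\<in>carrier G. a g) : Obj E"
   proof (rule objI)
    fix g assume g [simp]: "g : carrier G"
    show "iso_arr C ((\<lambda>g\<in>carrier G. a g) g)" using F.reflect_iso[of "a g"] Fa by simp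
    fix h assume h [simp]: "h : carrier G"
    have "a (g \<cdot> h) = eps A g h X \<bullet> (Fm g (a h) \<bullet> a g)"
    proof (rule F.inj)
     let ?l = "\<delta> (g \<cdot> h) X \<bullet> FMor F (eps A g h X \<bullet> (Fm g (a h) \<bullet> a g))"
     have "?l =
       eps A g h (FObj F X) \<bullet> (Fm g (\<delta> h X \<bullet> FMor F (a h)) \<bullet> (\<delta> g X \<bullet> FMor F (a g)))"
      using delta_calc[of g h X "a h" "a g"] by simp
     also have "\<dots> = \<delta> (g \<cdot> h) X \<bullet> FMor F (a (g \<cdot> h))"
      using objE(6)[OF V(1) g h] by (simp only: dFa g h G.m_closed V)
     finally have eq: "?l =
       \<delta> (g \<cdot> h) X \<bullet> FMor F (a (g \<cdot> h))" .
     show "FMor F (a (g \<cdot> h)) = FMor F (eps A g h X \<bullet> (Fm g (a h) \<bullet> a g))"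
      by (rule iso_cancel_left[OF _ eq[symmetric]]) simp_all
    qed simp_all
    thus "(\<lambda>g\<in>carrier G. a g) (g \<cdot> h) = eps A g h X \<bullet> (Fm g ((\<lambda>g\<in>carrier G. a g) h) \<bullet> (\<lambda>g\<in>carrier G. a g) g)"
     by simp
   qed auto
   have "(\<lambda>g\<in>carrier G. \<delta> g X \<bullet> FMor F ((\<lambda>g\<in>carrier G. a g) g)) = snd V"
   proof
    fix g show "(\<lambda>g\<in>carrier G. \<delta> g X \<bullet> FMor F ((\<lambda>g\<in>carrier G. a g) g)) g = snd V g"
     using dFa[of g] extensional_arb[OF objE(2)[OF V(1)], of g] by (cases "g : carrier G") simp_all
   qed
   hence "FObj L (X, \<lambda>g\<in>carrier G. a g) = V"
    using V(2) by (simp add: equivariant_lift_def prod_eq_iff)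
   moreover have "isomorphic E W V" unfolding E.isomorphic_iff
    using iso E.iso_arr_arr[OF iso] by (intro exI[of _ "(W, t, V)"]) simp
   hence "isomorphic E V W" by (rule E.isomorphic_sym)
   ultimately show "EX U:Obj E. isomorphic E (FObj L U) W" using U by metis
  qed
 qed
qed

end

context equivariantization
begin

abbreviation shift_delta where
 "shift_delta \<equiv> %g X. inv_mor C (Fo g (So X)) (So (Fo g X)) (Fw g X)"

text \<open>
  The translation of equivariant objects is itself the lift of the translation functor, with
  \<open>\<delta>\<^sub>g\<close> the inverse of \<open>\<omega>\<^sub>g\<close>.
\<close>

lemma shift_equivariant: "equivariant_equivalence K C G A (Shift C) shift_delta"
proof unfold_locales
 fix g assume g [simp]: "g : carrier G"
 {
  fix X assume X [simp]: "X : Obj C"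
  show "iso_arr C (shift_delta g X)" "src C (shift_delta g X) = So (Fo g X)"
   "tgt C (shift_delta g X) = Fo g (So X)" by simp_all
  fix h assume h [simp]: "h : carrier G"
  have "shift_delta (g \<cdot> h) X \<bullet> (Fw (g \<cdot> h) X \<bullet> eps A g h (So X)) =
   shift_delta (g \<cdot> h) X \<bullet> (Sm (eps A g h X) \<bullet> (Fw g (Fo h X) \<bullet> Fm g (Fw h X)))"
   by (simp only: eps_omega[OF g h X])
  hence e: "eps A g h (So X) = inv_arr C (Fw (g \<cdot> h) X) \<bullet> (Sm (eps A g h X) \<bullet> (Fw g (Fo h X) \<bullet> Fm g (Fw h X)))"
   by simp
  have c: "Fm g (Fw h X) \<bullet> (Fm g (inv_arr C (Fw h X)) \<bullet> x) = x"
   if "arr C x" "tgt C x = Fo g (So (Fo h X))" for x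
   using inv_arr_cancel(2)[of "Fm g (Fw h X)" x] that by simp
  show "shift_delta (g \<cdot> h) X \<bullet> Sm (eps A g h X) = eps A g h (So X) \<bullet> (Fm g (shift_delta h X) \<bullet> shift_delta g (Fo h X))"
   by (subst e) (simp add: c)
 }
 fix f assume f [simp]: "arr C f"
 have "(shift_delta g (tgt C f) \<bullet> (Sm (Fm g f))) \<bullet> Fw g (src C f) =
  (Fm g (Sm f) \<bullet> shift_delta g (src C f)) \<bullet> Fw g (src C f)"
  by (simp flip: omega_nat)
 thus "shift_delta g (tgt C f) \<bullet> (Sm (Fm g f)) = Fm g (Sm f) \<bullet> shift_delta g (src C f)"
  by (rule iso_cancel_right[rotated]) simp_all
qed

lemma Shift_E_lift: "Shift E = equivariant_lift C G (Shift C) shift_delta"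
 unfolding equivariant_category_def equivariant_lift_def equivariant_shift_def by simp

lemma Exact_E:
 "(U, V, W, u, v, w) : Exact E \<longleftrightarrow> U : Obj E & V : Obj E & W : Obj E &
  arr E u & src E u = U & tgt E u = V & arr E v & src E v = V & tgt E v = W &
  arr E w & src E w = W & tgt E w = \<Sigma>o E U &
  (fst U, fst V, fst W, FMor forget u, FMor forget v, FMor forget w) : Exact C"
proof -
 have S: "FObj (Shift E) U : Obj E" if "U : Obj E"
  using equivariant_equivalence.lift_obj[OF shift_equivariant that] by (simp add: Shift_E_lift)
 have X: "(U, V, W, u, v, w) : Exact E \<longleftrightarrow> (EX u' v' w'. u = (U, u', V) & v = (V, v', W) & w = (W, w', \<Sigma>o E U) &
  U : Obj E & V : Obj E & W : Obj E & u : Homs E U V & v : Homs E V W & w : Homs E W (\<Sigma>o E U) &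
  (fst U, fst V, fst W, u', v', w') : Exact C)"
  unfolding equivariant_category_def by (auto simp del: split_paired_Ex split_paired_All)
 show ?thesis
 proof
  assume "(U, V, W, u, v, w) : Exact E"
  then show "U : Obj E & V : Obj E & W : Obj E &
  arr E u & src E u = U & tgt E u = V & arr E v & src E v = V & tgt E v = W &
  arr E w & src E w = W & tgt E w = \<Sigma>o E U &
  (fst U, fst V, fst W, FMor forget u, FMor forget v, FMor forget w) : Exact C"
   unfolding X using S E.hom_iff by (elim exE conjE) simp
 next
  assume a: "U : Obj E & V : Obj E & W : Obj E &
  arr E u & src E u = U & tgt E u = V & arr E v & src E v = V & tgt E v = W &
  arr E w & src E w = W & tgt E w = \<Sigma>o E U &
  (fst U, fst V, fst W, FMor forget u, FMor forget v, FMor forget w) : Exact C"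
  then have "u = (U, fst (snd u), V)" "v = (V, fst (snd v), W)" "w = (W, fst (snd w), \<Sigma>o E U)"
   by (auto simp: prod_eq_iff src_tgt_E)
  then obtain u' v' w' where "u = (U, u', V)" "v = (V, v', W)" "w = (W, w', \<Sigma>o E U)" by blast
  thus "(U, V, W, u, v, w) : Exact E" unfolding X using a S E.hom_iff
   by (intro exI[of _ u'] exI[of _ v'] exI[of _ w']) simp
 qed
qed

sublocale E: shifted_category K E
proof (intro shifted_category.intro shifted_category_axioms.intro)
 show "linear_category K E" by unfold_locales
 show "equivalence_functor K E E (Shift E)"
  using lin_equivalence.equivalence[OF equivariant_equivalence.lift_equivalence[OF shift_equivariant]]
  by (simp add: Shift_E_lift)
 show "Exact E \<subseteq> triangles E"
 proof
  fix t assume t: "t : Exact E"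
  obtain U V W u v w where e: "t = (U, V, W, u, v, w)" by (cases t) auto
  have "FObj (Shift E) U : Obj E"
   using equivariant_equivalence.lift_obj[OF shift_equivariant, of U] t Exact_E by (simp add: Shift_E_lift e)
  thus "t : triangles E" using t unfolding triangles_def e Exact_E by simp
 qed
qed

lemma Sh_E: "fst (\<Sigma>o E U) = So (fst U)" "FMor forget (\<Sigma>m E m) = Sm (FMor forget m)"
 unfolding Shift_E_lift equivariant_lift_def by (auto split: prod.splits)

end


section \<open>Exact triangles\<close>

context linear_category
begin

lemma biproduct_diag:
 assumes b: "biproduct C I M B \<iota> \<pi>" and b': "biproduct C I N B' \<iota>' \<pi>'"
  and f: "!!i. i : I ==> arr C (f i)" "!!i. i : I ==> src C (f i) = M i" "!!i. i : I ==> tgt C (f i) = N i"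
  and u: "arr C u" "src C u = B" "tgt C u = B'" and uf: "!!i. i : I ==> u \<bullet> \<iota> i = \<iota>' i \<bullet> f i" and i: "i : I"
 shows "\<pi>' i \<bullet> u = f i \<bullet> \<pi> i"
proof -
 note [simp] = biproductD[OF b] biproductD[OF b'] f u i
 show ?thesis
 proof (rule biproduct_epi[OF b])
  fix j assume j [simp]: "j : I"
  have "\<pi>' i \<bullet> (\<iota>' j \<bullet> f j) = (\<pi>' i \<bullet> \<iota>' j) \<bullet> f j" by (rule assoc[symmetric]) simp_all
  also have "\<dots> = f i \<bullet> (\<pi> i \<bullet> \<iota> j)" by (cases "i = j") simp_all
  finally show "(\<pi>' i \<bullet> u) \<bullet> \<iota> j = (f i \<bullet> \<pi> i) \<bullet> \<iota> j" by (simp add: uf)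
 qed simp_all
qed

lemma pair_exists:
 assumes b: "biproduct C I M B \<iota> \<pi>" and X: "X : Obj C"
  and a: "!!i. i : I ==> arr C (a i)" "!!i. i : I ==> src C (a i) = X" "!!i. i : I ==> tgt C (a i) = M i"
 shows "EX p. arr C p & src C p = X & tgt C p = B & (ALL i:I. \<pi> i \<bullet> p = a i)"
proof -
 note [simp] = biproductD[OF b] X a
 let ?p = "finsum (Hom C X B) (%i. \<iota> i \<bullet> a i) I"
 have "\<pi> j \<bullet> ?p = a j" if j [simp]: "j : I" for j
 proof -
  have "\<pi> j \<bullet> ?p = finsum (Hom C X (M j)) (%i. (\<pi> j \<bullet> \<iota> i) \<bullet> a i) I"
   by (subst comp_sum, auto intro!: sum_cong)
  also have "\<dots> = (\<pi> j \<bullet> \<iota> j) \<bullet> a j" by (rule sum_eq_single) auto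
  finally show ?thesis by simp
 qed
 thus ?thesis by (intro exI[of _ ?p]) auto
qed

lemma unipotent_iso:
 assumes e: "arr C e" "src C e = X" "tgt C e = X"
  and nn: "(e \<oplus>[X,X] (\<ominus>[X,X] Id C X)) \<bullet> (e \<oplus>[X,X] (\<ominus>[X,X] Id C X)) = \<zero>[X,X]"
 shows "iso_arr C e"
proof -
 note [simp] = e
 have X [simp]: "X : Obj C" using arr_obj(1)[of e] by simp
 interpret M: abelian_group "Hom C X X" using hom_group by simp
 define n where "n = e \<oplus>[X,X] (\<ominus>[X,X] Id C X)"
 have n [simp]: "arr C n" "src C n = X" "tgt C n = X" unfolding n_def by simp_all
 have c: "e : carrier (Hom C X X)" "n : carrier (Hom C X X)" "Id C X : carrier (Hom C X X)" by simp_all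
 have en: "e = Id C X \<oplus>[X,X] n"
  unfolding n_def using c M.a_lcomm[of "Id C X" e "\<ominus>[X,X] Id C X"] by (simp del: hom_iff add: M.r_neg)
 have nn': "n \<bullet> n = \<zero>[X,X]" using nn unfolding n_def .
 let ?d = "Id C X \<oplus>[X,X] (\<ominus>[X,X] n)"
 have 1: "(Id C X \<oplus>[X,X] (\<ominus>[X,X] n)) \<oplus>[X,X] n = Id C X"
  using c by (simp del: hom_iff add: M.a_assoc M.l_neg)
 have 2: "(Id C X \<oplus>[X,X] n) \<oplus>[X,X] (\<ominus>[X,X] n) = Id C X"
  using c by (simp del: hom_iff add: M.a_assoc M.r_neg)
 show ?thesis
  by (rule iso_arrI(1)[of e ?d], simp_all) (simp_all add: en nn' 1 2)
qed

lemma two_sided_iso: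
 assumes "iso_arr C (d \<bullet> c)" "iso_arr C (c \<bullet> d)" and [simp]: "arr C c" "arr C d" "src C d = tgt C c" "tgt C d = src C c"
 shows "iso_arr C c"
proof -
 let ?l = "inv_arr C (d \<bullet> c) \<bullet> d" and ?r = "d \<bullet> inv_arr C (c \<bullet> d)"
 have l: "?l \<bullet> c = Id C (src C c)" using inv_arr[OF assms(1)] by simp
 have r: "c \<bullet> ?r = Id C (tgt C c)" using inv_arr[OF assms(2)] by (simp flip: assoc)
 have "?l = ?l \<bullet> (c \<bullet> ?r)" using inv_arr[OF assms(1)] by (simp only: r) simp
 also have "\<dots> = (?l \<bullet> c) \<bullet> ?r" using inv_arr[OF assms(1)] inv_arr[OF assms(2)] by (intro assoc[symmetric]) simp_all
 also have "\<dots> = ?r" using inv_arr[OF assms(2)] by (simp only: l) simp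
 finally have "c \<bullet> ?l = Id C (tgt C c)" using r by simp
 thus ?thesis using l inv_arr[OF assms(1)] by (intro iso_arrI(1)[of c ?l]) simp_all
qed

definition weak_cokernel where
 "weak_cokernel v w \<longleftrightarrow> (ALL f. arr C f & src C f = tgt C v & f \<bullet> v = \<zero>[src C v,tgt C f] -->
  (EX m. arr C m & src C m = tgt C w & tgt C m = tgt C f & f = m \<bullet> w))"

lemma weak_cokernelD:
 "weak_cokernel v w ==> arr C f ==> src C f = tgt C v ==> f \<bullet> v = \<zero>[src C v,tgt C f] ==>
  EX m. arr C m & src C m = tgt C w & tgt C m = tgt C f & f = m \<bullet> w"
 unfolding weak_cokernel_def by blast

lemma comparison_iso:
 assumes wc: "weak_cokernel v w" and [simp]: "arr C v" "arr C w" "src C w = tgt C v"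
  and e: "arr C e" "src C e = tgt C v" "tgt C e = tgt C v" "e \<bullet> v = v" "w \<bullet> e = w"
 shows "iso_arr C e"
proof -
 note [simp] = e
 let ?Z = "tgt C v" let ?n = "e \<oplus>[?Z,?Z] (\<ominus>[?Z,?Z] Id C ?Z)"
 have n [simp]: "arr C ?n" "src C ?n = ?Z" "tgt C ?n = ?Z" by simp_all
 have "?n \<bullet> v = \<zero>[src C v,?Z]" by simp
 then obtain m where m: "arr C m" "src C m = tgt C w" "tgt C m = ?Z" "?n = m \<bullet> w"
  using weak_cokernelD[OF wc, of ?n] by auto
 have wn: "w \<bullet> ?n = \<zero>[?Z,tgt C w]" by simp
 have "?n \<bullet> ?n = (m \<bullet> w) \<bullet> ?n" by (simp only: m(4))
 also have "\<dots> = m \<bullet> (w \<bullet> ?n)" using m(1-3) by (intro assoc) simp_all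
 also have "\<dots> = \<zero>[?Z,?Z]" by (simp only: wn) (use m in simp)
 finally show ?thesis by (intro unipotent_iso[of e ?Z]) simp_all
qed

end

context pretriangulated_category
begin

lemma exactD:
 assumes "(X, Y, Z, u, v, w) : Exact C"
 shows "X : Obj C" "Y : Obj C" "Z : Obj C" "arr C u" "src C u = X" "tgt C u = Y"
  "arr C v" "src C v = Y" "tgt C v = Z" "arr C w" "src C w = Z" "tgt C w = So X"
 using exact_triangles assms unfolding triangles_def by auto

lemma triangleI:
 assumes "arr C u" "src C u = X" "tgt C u = Y"
  "arr C v" "src C v = Y" "tgt C v = Z" "arr C w" "src C w = Z" "tgt C w = So X"
 shows "(X, Y, Z, u, v, w) : triangles C"
proof -
 have "X : Obj C" "Y : Obj C" "Z : Obj C" using assms arr_obj by blast+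
 thus ?thesis unfolding triangles_def using assms by simp
qed

lemma fill:
 assumes t: "(X, Y, Z, u, v, w) : Exact C" and t': "(X', Y', Z', u', v', w') : Exact C"
  and "arr C a" "src C a = X" "tgt C a = X'" "arr C b" "src C b = Y" "tgt C b = Y'" "b \<bullet> u = u' \<bullet> a"
 shows "EX c. arr C c & src C c = Z & tgt C c = Z' & c \<bullet> v = v' \<bullet> b & Sm a \<bullet> w = w' \<bullet> c"
 using TR3[OF t t', of a b] exactD[OF t] exactD[OF t'] assms(3-) by auto

text \<open>
  Rotate the triangle and compare it with \<open>0 \<rightarrow> W \<rightarrow> W \<rightarrow> \<Sigma>0\<close>.
\<close>

lemma exact_weak_cokernel:
 assumes t: "(X, Y, Z, u, v, w) : Exact C"
 shows "weak_cokernel v w"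
 unfolding weak_cokernel_def
proof (intro allI impI, elim conjE)
 fix f assume f [simp]: "arr C f" "src C f = tgt C v" and fv: "f \<bullet> v = \<zero>[src C v,tgt C f]"
 note [simp] = exactD[OF t]
 obtain W where W: "W = tgt C f" by simp
 have Wo [simp]: "W : Obj C" "tgt C f = W" using W by simp_all
 obtain N where N: "zero_obj C N" using zero_obj_exists by blast
 hence No [simp]: "N : Obj C" and N': "zero_obj C (So N)" using zero_obj_iff Sh.map_zero_obj by auto
 have "(N, W, W, \<zero>[N,W], Id C W, \<zero>[W,So N]) : triangles C" by (rule triangleI) simp_all
 from TR2[OF this] have z: "(N, W, W, \<zero>[N,W], Id C W, \<zero>[W,So N]) : Exact C"
  using TR1_id[OF Wo(1) N'] by simp
 have "(X, Y, Z, u, v, w) : triangles C" by (rule triangleI) simp_all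
 from TR2[OF this] t have rot: "(Y, Z, So X, v, w, \<ominus>[So X,So Y] Sm u) : Exact C" by blast
 have "f \<bullet> v = \<zero>[N,W] \<bullet> \<zero>[Y,N]" using fv by simp
 from fill[OF rot z _ _ _ _ _ _ this] obtain m where "arr C m" "src C m = So X" "tgt C m = W" "m \<bullet> w = f"
  by auto
 thus "EX m. arr C m & src C m = tgt C w & tgt C m = tgt C f & f = m \<bullet> w" by auto
qed

text \<open>
 A candidate triangle that admits morphisms to and from a cone of its first map, both over
 the identity, is exact as soon as it shares the weak cokernel property: the two composites
 differ from the identity by an endomorphism of square zero.
\<close>

lemma exact_by_comparison:
 assumes t: "(X, Y, Z, u, v, w) : triangles C" and wc: "weak_cokernel v w"
  and e: "(X, Y, Q, u, v', w') : Exact C"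
  and c [simp]: "arr C c" "src C c = Q" "tgt C c = Z" and cv: "c \<bullet> v' = v" and wc': "w \<bullet> c = w'"
  and d [simp]: "arr C d" "src C d = Z" "tgt C d = Q" and dv: "d \<bullet> v = v'" and wd: "w' \<bullet> d = w"
 shows "(X, Y, Z, u, v, w) : Exact C"
proof -
 note [simp] = exactD[OF e]
 have o: "Z : Obj C" "arr C v" "src C v = Y" "tgt C v = Z" "arr C w" "src C w = Z" "tgt C w = So X"
  using t unfolding triangles_def by auto
 note [simp] = o
 have 1: "iso_arr C (d \<bullet> c)"
  by (rule comparison_iso[OF exact_weak_cokernel[OF e]]) (simp_all add: cv dv reassoc[OF wd] wc')
 have 2: "iso_arr C (c \<bullet> d)"
  by (rule comparison_iso[OF wc]) (simp_all add: cv dv reassoc[OF wc'] wd)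
 have "iso_arr C c" by (rule two_sided_iso[OF 1 2]) simp_all
 thus ?thesis using exact_iso[OF e t, of "Id C X" "Id C Y" c] by (simp add: cv wc')
qed

text \<open>
  The fill-ins between the components and a cone of the sum assemble to comparison morphisms in
  both directions.
\<close>

lemma exact_direct_sum:
 assumes t: "!!i. i : I ==> (X i, Y i, Z i, u i, v i, w i) : Exact C"
  and bX: "biproduct C I X BX \<iota> \<pi>" and bY: "biproduct C I Y BY \<iota>' \<pi>'" and bZ: "biproduct C I Z BZ \<iota>'' \<pi>''"
  and U [simp]: "arr C U" "src C U = BX" "tgt C U = BY" and Ui: "!!i. i : I ==> U \<bullet> \<iota> i = \<iota>' i \<bullet> u i"
  and V [simp]: "arr C V" "src C V = BY" "tgt C V = BZ" and Vi: "!!i. i : I ==> V \<bullet> \<iota>' i = \<iota>'' i \<bullet> v i"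
  and W [simp]: "arr C W" "src C W = BZ" "tgt C W = So BX" and Wi: "!!i. i : I ==> W \<bullet> \<iota>'' i = Sm (\<iota> i) \<bullet> w i"
 shows "(BX, BY, BZ, U, V, W) : Exact C"
proof -
 note [simp] = biproductD[OF bX] biproductD[OF bY] biproductD[OF bZ] exactD[OF t]
 note bS = Sh.map_biproduct[OF bX]
 have pU: "\<pi>' i \<bullet> U = u i \<bullet> \<pi> i" if "i : I" for i by (rule biproduct_diag[OF bX bY]) (use that Ui in auto)
 have pV: "\<pi>'' i \<bullet> V = v i \<bullet> \<pi>' i" if "i : I" for i by (rule biproduct_diag[OF bY bZ]) (use that Vi in auto)
 have pW: "Sm (\<pi> i) \<bullet> W = w i \<bullet> \<pi>'' i" if "i : I" for i by (rule biproduct_diag[OF bZ bS]) (use that Wi in auto)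
 obtain Q v' w' where e: "(BX, BY, Q, U, v', w') : Exact C" using TR1_cone[of BX BY U] by auto
 note [simp] = exactD[OF e]
 have "ALL i:I. EX c. arr C c & src C c = Z i & tgt C c = Q & c \<bullet> v i = v' \<bullet> \<iota>' i & Sm (\<iota> i) \<bullet> w i = w' \<bullet> c"
  by (intro ballI fill[OF t e]) (auto simp: Ui)
 then obtain d where d [simp]: "!!i. i : I ==> arr C (d i)" "!!i. i : I ==> src C (d i) = Z i" "!!i. i : I ==> tgt C (d i) = Q"
  and dv: "!!i. i : I ==> d i \<bullet> v i = v' \<bullet> \<iota>' i" and dw: "!!i. i : I ==> w' \<bullet> d i = Sm (\<iota> i) \<bullet> w i" by metis
 have "ALL i:I. EX c. arr C c & src C c = Q & tgt C c = Z i & c \<bullet> v' = v i \<bullet> \<pi>' i & Sm (\<pi> i) \<bullet> w' = w i \<bullet> c"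
  by (intro ballI fill[OF e t]) (auto simp: pU)
 then obtain c where c [simp]: "!!i. i : I ==> arr C (c i)" "!!i. i : I ==> src C (c i) = Q" "!!i. i : I ==> tgt C (c i) = Z i"
  and cv: "!!i. i : I ==> c i \<bullet> v' = v i \<bullet> \<pi>' i" and cw: "!!i. i : I ==> Sm (\<pi> i) \<bullet> w' = w i \<bullet> c i" by metis
 define D where "D = copair I BZ Q \<pi>'' d"
 have D [simp]: "arr C D" "src C D = BZ" "tgt C D = Q" and Di: "!!i. i : I ==> D \<bullet> \<iota>'' i = d i"
  using copair[OF bZ, of Q d] unfolding D_def by auto
 obtain P where P [simp]: "arr C P" "src C P = Q" "tgt C P = BZ" and Pi: "!!i. i : I ==> \<pi>'' i \<bullet> P = c i"
  using pair_exists[OF bZ, of Q c] by auto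
 have DV: "D \<bullet> V = v'" by (rule biproduct_epi[OF bY]) (auto simp: Vi reassoc[OF Di] dv)
 have wD: "w' \<bullet> D = W" by (rule biproduct_epi[OF bZ]) (auto simp: Di dw Wi)
 have PV: "P \<bullet> v' = V" by (rule biproduct_mono[OF bZ]) (auto simp: reassoc[OF Pi] cv pV)
 have WP: "W \<bullet> P = w'" by (rule biproduct_mono[OF bS]) (auto simp: reassoc[OF pW] Pi cw)
 have wc: "weak_cokernel V W" unfolding weak_cokernel_def
 proof (intro allI impI, elim conjE)
  fix f assume f [simp]: "arr C f" "src C f = tgt C V" and fV: "f \<bullet> V = \<zero>[src C V,tgt C f]"
  have "ALL i:I. EX m. arr C m & src C m = tgt C (w i) & tgt C m = tgt C (f \<bullet> \<iota>'' i) & f \<bullet> \<iota>'' i = m \<bullet> w i"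
  proof
   fix i assume i [simp]: "i : I"
   have "(f \<bullet> V) \<bullet> \<iota>' i = \<zero>[Y i,tgt C f]" unfolding fV by simp
   hence "(f \<bullet> \<iota>'' i) \<bullet> v i = \<zero>[Y i,tgt C f]" by (simp add: Vi)
   thus "EX m. arr C m & src C m = tgt C (w i) & tgt C m = tgt C (f \<bullet> \<iota>'' i) & f \<bullet> \<iota>'' i = m \<bullet> w i"
    by (intro weak_cokernelD[OF exact_weak_cokernel[OF t[OF i]]]) simp_all
  qed
  then obtain m where m [simp]: "!!i. i : I ==> arr C (m i)" "!!i. i : I ==> src C (m i) = tgt C (w i)"
   "!!i. i : I ==> tgt C (m i) = tgt C (f \<bullet> \<iota>'' i)" and mi: "!!i. i : I ==> f \<bullet> \<iota>'' i = m i \<bullet> w i" by metis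
  define q where "q = copair I (So BX) (tgt C f) (%i. Sm (\<pi> i)) m"
  have q [simp]: "arr C q" "src C q = So BX" "tgt C q = tgt C f" and qi: "!!i. i : I ==> q \<bullet> Sm (\<iota> i) = m i"
   using copair[OF bS, of "tgt C f" m] unfolding q_def by auto
  have fq: "f = q \<bullet> W" by (rule biproduct_epi[OF bZ]) (auto simp: mi Wi reassoc[OF qi])
  show "EX m. arr C m & src C m = tgt C W & tgt C m = tgt C f & f = m \<bullet> W"
   by (intro exI[of _ q] conjI, simp, simp, simp, rule fq)
 qed
 have "(BX, BY, BZ, U, V, W) : triangles C" by (rule triangleI) simp_all
 from exact_by_comparison[OF this wc e P PV WP D DV wD] show ?thesis .
qed

text \<open>
  Comparison morphisms with a cone of \<open>u\<close> are obtained by passing through the larger triangle.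
\<close>

lemma exact_retract:
 assumes t': "(X', Y', Z', u', v', w') : Exact C"
  and u: "arr C u" "src C u = X" "tgt C u = Y" and v: "arr C v" "src C v = Y" "tgt C v = Z"
  and w: "arr C w" "src C w = Z" "tgt C w = So X"
  and sX: "arr C sX" "src C sX = X" "tgt C sX = X'" and rX: "arr C rX" "src C rX = X'" "tgt C rX = X" "rX \<bullet> sX = Id C X"
  and sY: "arr C sY" "src C sY = Y" "tgt C sY = Y'" and rY: "arr C rY" "src C rY = Y'" "tgt C rY = Y" "rY \<bullet> sY = Id C Y"
  and sZ: "arr C sZ" "src C sZ = Z" "tgt C sZ = Z'" and rZ: "arr C rZ" "src C rZ = Z'" "tgt C rZ = Z" "rZ \<bullet> sZ = Id C Z"
  and s: "sY \<bullet> u = u' \<bullet> sX" "sZ \<bullet> v = v' \<bullet> sY" "Sm sX \<bullet> w = w' \<bullet> sZ"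
  and r: "rY \<bullet> u' = u \<bullet> rX" "rZ \<bullet> v' = v \<bullet> rY" "Sm rX \<bullet> w' = w \<bullet> rZ"
 shows "(X, Y, Z, u, v, w) : Exact C"
proof -
 have o: "X : Obj C" "Y : Obj C" "Z : Obj C" using u v arr_obj by blast+
 note [simp] = o u v w sX rX sY rY sZ rZ exactD[OF t'] reassoc[OF rX(4)] reassoc[OF rY(4)] reassoc[OF rZ(4)]
 have SX: "Sm rX \<bullet> Sm sX = Id C (So X)" by (simp flip: Sh.map_comp)
 obtain Q vQ wQ where e: "(X, Y, Q, u, vQ, wQ) : Exact C" using TR1_cone[of X Y u] by auto
 note [simp] = exactD[OF e]
 obtain c' where c' [simp]: "arr C c'" "src C c' = Q" "tgt C c' = Z'" and c'v: "c' \<bullet> vQ = v' \<bullet> sY" and c'w: "w' \<bullet> c' = Sm sX \<bullet> wQ"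
  using fill[OF e t', of sX sY] s by auto
 obtain d' where d' [simp]: "arr C d'" "src C d' = Z'" "tgt C d' = Q" and d'v: "d' \<bullet> v' = vQ \<bullet> rY" and d'w: "wQ \<bullet> d' = Sm rX \<bullet> w'"
  using fill[OF t' e, of rX rY] r by auto
 have 1: "(rZ \<bullet> c') \<bullet> vQ = v" by (simp add: c'v reassoc[OF r(2)])
 have 2: "w \<bullet> (rZ \<bullet> c') = wQ" using reassoc[OF r(3), of c'] by (simp add: c'w reassoc[OF SX])
 have 3: "(d' \<bullet> sZ) \<bullet> v = vQ" by (simp add: s reassoc[OF d'v])
 have 4: "wQ \<bullet> (d' \<bullet> sZ) = w" using reassoc[OF SX, of w] by (simp add: reassoc[OF d'w] s)
 have wc: "weak_cokernel v w" unfolding weak_cokernel_def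
 proof (intro allI impI, elim conjE)
  fix f assume f [simp]: "arr C f" "src C f = tgt C v" and fv: "f \<bullet> v = \<zero>[src C v,tgt C f]"
  have "(f \<bullet> rZ) \<bullet> v' = \<zero>[src C v',tgt C (f \<bullet> rZ)]" by (simp add: r(2) reassoc[OF fv])
  then obtain m where m: "arr C m" "src C m = tgt C w'" "tgt C m = tgt C f" "f \<bullet> rZ = m \<bullet> w'"
   using weak_cokernelD[OF exact_weak_cokernel[OF t'], of "f \<bullet> rZ"] by auto
  have "f = (f \<bullet> rZ) \<bullet> sZ" by simp
  also have "\<dots> = m \<bullet> (w' \<bullet> sZ)" unfolding m(4) using m(1-3) by simp
  also have "\<dots> = (m \<bullet> Sm sX) \<bullet> w" using m(1-3) by (simp flip: s(3))
  finally have fm: "f = (m \<bullet> Sm sX) \<bullet> w" .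
  note [simp] = m(1-3)
  show "EX m. arr C m & src C m = tgt C w & tgt C m = tgt C f & f = m \<bullet> w"
   by (intro exI[of _ "m \<bullet> Sm sX"] conjI, simp, simp, simp, rule fm)
 qed
 have "(X, Y, Z, u, v, w) : triangles C" by (rule triangleI) simp_all
 thus ?thesis by (rule exact_by_comparison[OF _ wc e _ _ _ 1 2 _ _ _ 3 4]) simp_all
qed

end

section \<open>Composition of functors\<close>

lemma comp_lin_functor:
 assumes "lin_functor K C D E" "lin_functor K D B F"
 shows "lin_functor K C B (comp_functor F E)"
proof -
 interpret E: lin_functor K C D E by fact
 interpret F: lin_functor K D B F by fact
 show ?thesis
  by unfold_locales (auto simp: linear_functor_def comp_functor_def)
qed

lemma comp_lin_equivalence:
 assumes "lin_equivalence K C D E" "lin_equivalence K D B F"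
 shows "lin_equivalence K C B (comp_functor F E)"
proof -
 interpret E: lin_equivalence K C D E by fact
 interpret F: lin_equivalence K D B F by fact
 interpret FE: lin_functor K C B "comp_functor F E"
  by (rule comp_lin_functor) unfold_locales
 show ?thesis
 proof unfold_locales
  show "faithful_functor C B (comp_functor F E)"
   unfolding faithful_functor_def comp_functor_def using E.inj F.inj by auto
  show "full_functor C B (comp_functor F E)"
   unfolding full_functor_def
  proof (intro ballI allI impI, elim conjE)
   fix X Y h assume X: "X : Obj C" and Y: "Y : Obj C"
    and h: "arr B h" "src B h = FObj (comp_functor F E) X" "tgt B h = FObj (comp_functor F E) Y"
   obtain g where g: "arr D g" "src D g = FObj E X" "tgt D g = FObj E Y" "FMor F g = h"
    using F.lift[of "FObj E X" "FObj E Y" h] X Y h by (auto simp: comp_functor_def)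
   obtain f where "arr C f" "src C f = X" "tgt C f = Y" "FMor E f = g" using E.lift[OF X Y g(1-3)] by blast
   thus "EX f. arr C f & src C f = X & tgt C f = Y & FMor (comp_functor F E) f = h"
    using g by (intro exI[of _ f]) (simp add: comp_functor_def)
  qed
  show "ess_surj C B (comp_functor F E)"
   unfolding ess_surj_def
  proof
   fix Z assume "Z : Obj B"
   then obtain Y where Y: "Y : Obj D" "isomorphic B (FObj F Y) Z" using F.preimage by blast
   then obtain X where X: "X : Obj C" "isomorphic D (FObj E X) Y" using E.preimage by blast
   show "EX X:Obj C. isomorphic B (FObj (comp_functor F E) X) Z"
    using X F.D.isomorphic_trans[OF F.map_isomorphic[OF X(2)] Y(2)] by (auto simp: comp_functor_def)
  qed
 qed
qed

lemma (in linear_category) id_lin_equivalence: "lin_equivalence K C C id_functor"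
proof unfold_locales
 show "linear_functor K C C id_functor" unfolding linear_functor_def id_functor_def by auto
 show "faithful_functor C C id_functor" unfolding faithful_functor_def id_functor_def by auto
 show "full_functor C C id_functor" unfolding full_functor_def id_functor_def by auto
 show "ess_surj C C id_functor" unfolding ess_surj_def id_functor_def using isomorphic_refl by auto
qed

section \<open>Tilting objects and thick subcategories\<close>

definition shift_pow where
 "shift_pow C n = \<lparr>FObj = (\<Sigma>o C ^^ n), FMor = (\<Sigma>m C ^^ n)\<rparr>"

definition hom_zero where
 "hom_zero C X Y \<longleftrightarrow> (ALL f. arr C f & src C f = X & tgt C f = Y --> f = \<zero>\<^bsub>Hom C X Y\<^esub>)"

text \<open>
  The vanishing for negative translates is stated by moving the translation to the first
  argument.
\<close>

definition rigid where
 "rigid C X \<longleftrightarrow> X : Obj C & (ALL n>0. hom_zero C X ((\<Sigma>o C ^^ n) X) & hom_zero C ((\<Sigma>o C ^^ n) X) X)"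

definition thick where
 "thick C S \<longleftrightarrow> triangulated_subcategory C S & (ALL Y:S. ALL X. summand C X Y --> X : S)"

definition generates where
 "generates C X \<longleftrightarrow> (ALL S. thick C S & X : S --> Obj C \<subseteq> S)"

context linear_category
begin

lemma hom_zero_in_add:
 assumes z: "hom_zero C X Y" and X: "in_add C X' X" and Y: "in_add C Y' Y"
 shows "hom_zero C X' Y'"
proof -
 have o: "X : Obj C" "X' : Obj C" "Y : Obj C" "Y' : Obj C" using X Y unfolding in_add_def by auto
 have 1: "f \<bullet> g = \<zero>[src C g,Y]" if "through C X g" "arr C f" "src C f = tgt C g" "tgt C f = Y" for f g
  using that
 proof (induction rule: through.induct)
  case (zero A B) thus ?case by simp
 next
  case (step g a b)
  have [simp]: "arr C g" using through_arr step by blast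
  have "f \<bullet> b = \<zero>[X,Y]" using z step unfolding hom_zero_def by simp
  from reassoc[OF this, of a] show ?case using step o by simp
 qed
 have z': "hom_zero C X' Y" unfolding hom_zero_def
 proof (intro allI impI, elim conjE)
  fix f assume "arr C f" "src C f = X'" "tgt C f = Y"
  thus "f = \<zero>[X',Y]" using 1[of "Id C X'" f] X o unfolding in_add_def by simp
 qed
 have 2: "g \<bullet> f = \<zero>[X',tgt C g]" if "through C Y g" "arr C f" "tgt C f = src C g" "src C f = X'" for f g
  using that
 proof (induction rule: through.induct)
  case (zero A B) thus ?case by simp
 next
  case (step g a b)
  have [simp]: "arr C g" using through_arr step by blast
  have "a \<bullet> f = \<zero>[X',Y]" using z' step unfolding hom_zero_def by simp
  thus ?case using step o by simp
 qed
 show ?thesis unfolding hom_zero_def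
 proof (intro allI impI, elim conjE)
  fix f assume "arr C f" "src C f = X'" "tgt C f = Y'"
  thus "f = \<zero>[X',Y']" using 2[of "Id C Y'" f] Y o unfolding in_add_def by simp
 qed
qed

end

context shifted_category
begin

lemma shift_pow_equivalence: "lin_equivalence K C C (shift_pow C n)"
proof (induction n)
 case 0
 have "shift_pow C 0 = id_functor" unfolding shift_pow_def id_functor_def by (simp add: id_def)
 thus ?case using id_lin_equivalence by simp
next
 case (Suc n)
 have "shift_pow C (Suc n) = comp_functor (Shift C) (shift_pow C n)"
  unfolding shift_pow_def comp_functor_def by simp
 thus ?case using comp_lin_equivalence[OF Suc Sh.lin_equivalence_axioms] by simp
qed

lemma shift_pow_obj: "X : Obj C ==> (So ^^ n) X : Obj C"
 by (induction n) auto

lemma rigid_in_add: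
 assumes "rigid C X" "in_add C Y X" shows "rigid C Y"
proof -
 have "in_add C ((So ^^ n) Y) ((So ^^ n) X)" for n
 proof -
  interpret S: lin_equivalence K C C "shift_pow C n" by (rule shift_pow_equivalence)
  show ?thesis using S.map_in_add[OF assms(2)] by (simp add: shift_pow_def)
 qed
 note a = this
 show ?thesis unfolding rigid_def
 proof (intro conjI allI impI)
  show "Y : Obj C" using assms unfolding in_add_def by blast
  fix n :: nat assume n: "n > 0"
  have r: "hom_zero C X ((So ^^ n) X)" "hom_zero C ((So ^^ n) X) X" using assms n unfolding rigid_def by auto
  show "hom_zero C Y ((So ^^ n) Y)" by (rule hom_zero_in_add[OF r(1) assms(2) a])
  show "hom_zero C ((So ^^ n) Y) Y" by (rule hom_zero_in_add[OF r(2) a assms(2)])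
 qed
qed

lemma Homs_zero_iff:
 assumes "X : Obj C" "Y : Obj C"
 shows "Homs C X Y = {\<zero>[X,Y]} \<longleftrightarrow> hom_zero C X Y"
proof
 assume e: "Homs C X Y = {\<zero>[X,Y]}"
 show "hom_zero C X Y" unfolding hom_zero_def using e hom_iff[OF assms] by blast
next
 assume "hom_zero C X Y"
 thus "Homs C X Y = {\<zero>[X,Y]}" unfolding hom_zero_def using assms hom_iff[OF assms] zero_arr[OF assms] by blast
qed

text \<open>
  A negative translate \<open>Y\<close> satisfies \<open>\<Sigma>\<^sup>n Y \<cong> X\<close>, and \<open>\<Sigma>\<^sup>n\<close> is fully faithful.
\<close>

lemma rigid_iff:
 assumes X: "X : Obj C"
 shows "(ALL i Y. i \<noteq> 0 & is_shift C i X Y --> Homs C X Y = {\<zero>[X,Y]}) \<longleftrightarrow> rigid C X"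
proof
 assume a: "ALL i Y. i \<noteq> 0 & is_shift C i X Y --> Homs C X Y = {\<zero>[X,Y]}"
 show "rigid C X" unfolding rigid_def
 proof (intro conjI allI impI X)
  fix n :: nat assume n: "n > 0"
  interpret S: lin_equivalence K C C "shift_pow C n" by (rule shift_pow_equivalence)
  have S: "FObj (shift_pow C n) = (So ^^ n)" unfolding shift_pow_def by simp
  have "is_shift C (int n) X ((So ^^ n) X)" unfolding is_shift_def using shift_pow_obj X by simp
  thus "hom_zero C X ((So ^^ n) X)" using a n Homs_zero_iff[OF X shift_pow_obj[OF X]] by (metis of_nat_0_less_iff less_irrefl)
  obtain Y where Y: "Y : Obj C" "isomorphic C ((So ^^ n) Y) X" using S.preimage[OF X] unfolding S by blast
  hence "is_shift C (- int n) X Y" unfolding is_shift_def using n by simp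
  hence z: "hom_zero C X Y" using a n Homs_zero_iff[OF X Y(1)] by (metis neg_equal_0_iff_equal of_nat_eq_0_iff less_irrefl)
  obtain t where t: "iso_arr C t" "src C t = (So ^^ n) Y" "tgt C t = X" using Y(2) unfolding isomorphic_iff by blast
  show "hom_zero C ((So ^^ n) X) X" unfolding hom_zero_def
  proof (intro allI impI, elim conjE)
   fix f assume f: "arr C f" "src C f = (So ^^ n) X" "tgt C f = X"
   obtain g where g: "arr C g" "src C g = X" "tgt C g = Y" "FMor (shift_pow C n) g = inv_arr C t \<bullet> f"
    using S.lift[OF X Y(1), of "inv_arr C t \<bullet> f"] t f unfolding S by auto
   have "g = \<zero>[X,Y]" using z g unfolding hom_zero_def by blast
   hence "inv_arr C t \<bullet> f = \<zero>[(So ^^ n) X,(So ^^ n) Y]"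
    using g(4) S.map_zero[OF X Y(1)] unfolding S by simp
   hence "t \<bullet> (inv_arr C t \<bullet> f) = \<zero>[(So ^^ n) X,X]"
    using t X Y shift_pow_obj by simp
   thus "f = \<zero>[(So ^^ n) X,X]" using t f by simp
  qed
 qed
next
 assume r: "rigid C X"
 show "ALL i Y. i \<noteq> 0 & is_shift C i X Y --> Homs C X Y = {\<zero>[X,Y]}"
 proof (intro allI impI, elim conjE)
  fix i :: int and Y assume i: "i \<noteq> 0" and s: "is_shift C i X Y"
  have Y: "Y : Obj C" using s unfolding is_shift_def by blast
  have "hom_zero C X Y"
  proof (cases "i > 0")
   case True
   thus ?thesis using s r unfolding is_shift_def rigid_def by simp
  next
   case False
   define n where "n = nat (- i)"
   have n: "n > 0" using False i unfolding n_def by simp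
   interpret S: lin_equivalence K C C "shift_pow C n" by (rule shift_pow_equivalence)
   have S: "FObj (shift_pow C n) = (So ^^ n)" unfolding shift_pow_def by simp
   have "isomorphic C ((So ^^ n) Y) X" using s False i unfolding is_shift_def n_def by simp
   then obtain t where t: "iso_arr C t" "src C t = (So ^^ n) Y" "tgt C t = X" unfolding isomorphic_iff by blast
   have z: "hom_zero C ((So ^^ n) X) X" using r n unfolding rigid_def by blast
   show ?thesis unfolding hom_zero_def
   proof (intro allI impI, elim conjE)
    fix f assume f [simp]: "arr C f" "src C f = X" "tgt C f = Y"
    have Ff: "arr C (FMor (shift_pow C n) f)" "src C (FMor (shift_pow C n) f) = (So ^^ n) X" "tgt C (FMor (shift_pow C n) f) = (So ^^ n) Y"
     using S.mor[OF f(1)] unfolding S f by simp_all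
    have "t \<bullet> FMor (shift_pow C n) f = \<zero>[(So ^^ n) X,X]"
     using z Ff t unfolding hom_zero_def by simp
    hence "inv_arr C t \<bullet> (t \<bullet> FMor (shift_pow C n) f) = \<zero>[(So ^^ n) X,(So ^^ n) Y]"
     using t X Y shift_pow_obj by simp
    hence "FMor (shift_pow C n) f = FMor (shift_pow C n) \<zero>[X,Y]"
     using t Ff S.map_zero[OF X Y] unfolding S by simp
    thus "f = \<zero>[X,Y]" by (rule S.inj) (use X Y in simp_all)
   qed
  qed
  thus "Homs C X Y = {\<zero>[X,Y]}" using Homs_zero_iff X Y by blast
 qed
qed

lemma thick_Obj: "thick C (Obj C)"
 unfolding thick_def triangulated_subcategory_def
proof (intro conjI ballI allI impI)
 show "case t of (X, Y, Z, u, v, w) => (X : Obj C & Y : Obj C --> Z : Obj C) &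
   (Y : Obj C & Z : Obj C --> X : Obj C) & (X : Obj C & Z : Obj C --> Y : Obj C)" if "t : Exact C" for t
  using exact_triangles' that unfolding triangles_def by (cases t) auto
qed (auto simp: isomorphic_obj zero_obj_iff direct_sum2_iff summand_def)

lemma tilting_iff: "tilting C X \<longleftrightarrow> rigid C X & generates C X"
proof -
 have "thick_closure C X = Obj C \<longleftrightarrow> generates C X" if X: "X : Obj C"
 proof -
  have "thick_closure C X = \<Inter>{S. thick C S & X : S}"
   unfolding thick_closure_def thick_def by (intro arg_cong[where f = Inter]) auto
  moreover have "\<Inter>{S. thick C S & X : S} \<subseteq> Obj C" by (rule Inter_lower) (use thick_Obj X in simp)
  moreover have "Obj C \<subseteq> \<Inter>{S. thick C S & X : S} \<longleftrightarrow> generates C X"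
   unfolding generates_def by (simp add: le_Inf_iff)
  ultimately show ?thesis by (metis subset_antisym order.refl)
 qed
 note g = this
 show ?thesis
 proof (cases "X : Obj C")
  case True
  show ?thesis unfolding tilting_def rigid_iff[OF True] g[OF True] using True by blast
 next
  case False
  thus ?thesis unfolding tilting_def rigid_def by blast
 qed
qed

end

lemma thickD:
 assumes "thick C S"
 shows "S \<subseteq> Obj C" "X : S ==> isomorphic C X Y ==> Y : S" "zero_obj C X ==> X : S"
  "X : S ==> Y : S ==> direct_sum2 C X Y B ==> B : S"
  "X : Obj C ==> \<Sigma>o C X : S \<longleftrightarrow> X : S" "Y : S ==> summand C X Y ==> X : S"
  "(X, Y, Z, u, v, w) : Exact C ==>
   (X : S & Y : S --> Z : S) & (Y : S & Z : S --> X : S) & (X : S & Z : S --> Y : S)"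
proof -
 note a = assms[unfolded thick_def triangulated_subcategory_def]
 note t = a[THEN conjunct1] and c = conjunct2
 show "S \<subseteq> Obj C" using t[THEN conjunct1] .
 show "X : S ==> isomorphic C X Y ==> Y : S" using t[THEN c, THEN conjunct1] by blast
 show "zero_obj C X ==> X : S" using t[THEN c, THEN c, THEN conjunct1] by blast
 show "X : S ==> Y : S ==> direct_sum2 C X Y B ==> B : S"
  using t[THEN c, THEN c, THEN c, THEN conjunct1] by blast
 show "X : Obj C ==> \<Sigma>o C X : S \<longleftrightarrow> X : S"
  using t[THEN c, THEN c, THEN c, THEN c, THEN conjunct1] by blast
 show "Y : S ==> summand C X Y ==> X : S" using a[THEN conjunct2] by blast
 assume e: "(X, Y, Z, u, v, w) : Exact C"
 show "(X : S & Y : S --> Z : S) & (Y : S & Z : S --> X : S) & (X : S & Z : S --> Y : S)"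
  using bspec[OF t[THEN c, THEN c, THEN c, THEN c, THEN c] e] unfolding prod.case .
qed

lemma thick_in_add:
 assumes "krull_schmidt K C" and S: "thick C S" and X: "X : S" and Y: "in_add C Y X"
 shows "Y : S"
proof -
 interpret krull_schmidt K C by fact
 have "X : Obj C" using X thickD(1)[OF S] by blast
 then obtain n :: nat and B where B: "direct_sum C {..<n} (%_. X) B" "summand C Y B"
  using add_of_iff Y unfolding add_of_def by blast
 have "B : S" by (rule direct_sum_closed[OF B(1)]) (use X thickD(2-4)[OF S] in blast)+
 thus ?thesis using thickD(6)[OF S] B(2) by blast
qed

locale exact_functor = C: shifted_category K C + D: shifted_category K D
 for K :: "('k, 'r) ring_scheme" and C :: "('k, 'o, 'm, 'y) tri_category_scheme"
  and D :: "('k, 'p, 'n, 'z) tri_category_scheme" +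
 fixes F :: "('o, 'm, 'p, 'n) tri_functor"
 assumes triangle: "triangle_functor K C D F"

sublocale exact_functor \<subseteq> lin_functor K C D F
 using triangle unfolding triangle_functor_def by unfold_locales blast

context exact_functor
begin

lemma exact: "(X, Y, Z, u, v, w) : Exact C ==>
  (FObj F X, FObj F Y, FObj F Z, FMor F u, FMor F v, omega F X \<bullet>\<^bsub>D\<^esub> FMor F w) : Exact D"
 using triangle unfolding triangle_functor_def by blast

lemma omega [simp]:
 assumes "X : Obj C"
 shows "iso_arr D (omega F X)" "src D (omega F X) = FObj F (\<Sigma>o C X)" "tgt D (omega F X) = \<Sigma>o D (FObj F X)"
 using triangle assms unfolding triangle_functor_def nat_iso_def comp_functor_def by auto

lemma omega_nat:
 assumes "arr C f"
 shows "omega F (tgt C f) \<bullet>\<^bsub>D\<^esub> FMor F (\<Sigma>m C f) = \<Sigma>m D (FMor F f) \<bullet>\<^bsub>D\<^esub> omega F (src C f)"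
 using triangle C.arrD[OF assms] unfolding triangle_functor_def nat_iso_def comp_functor_def by auto

lemma map_shift: "X : Obj C ==> isomorphic D (FObj F (\<Sigma>o C X)) (\<Sigma>o D (FObj F X))"
 unfolding D.isomorphic_iff using omega by blast

lemma map_shift_pow: "X : Obj C ==> isomorphic D (FObj F ((\<Sigma>o C ^^ n) X)) ((\<Sigma>o D ^^ n) (FObj F X))"
proof (induction n)
 case 0 thus ?case using D.isomorphic_refl by simp
next
 case (Suc n)
 have "isomorphic D (FObj F (\<Sigma>o C ((\<Sigma>o C ^^ n) X))) (\<Sigma>o D (FObj F ((\<Sigma>o C ^^ n) X)))"
  using map_shift C.shift_pow_obj Suc by blast
 thus ?case using D.isomorphic_trans D.Sh.map_isomorphic[OF Suc.IH[OF Suc.prems]] by simp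
qed

lemma thick_preimage:
 assumes S: "thick D S" shows "thick C {X : Obj C. FObj F X : S}"
 unfolding thick_def triangulated_subcategory_def
proof (intro conjI ballI allI impI)
 show "case t of (X, Y, Z, u, v, w) =>
   (X : {X : Obj C. FObj F X : S} & Y : {X : Obj C. FObj F X : S} --> Z : {X : Obj C. FObj F X : S}) &
   (Y : {X : Obj C. FObj F X : S} & Z : {X : Obj C. FObj F X : S} --> X : {X : Obj C. FObj F X : S}) &
   (X : {X : Obj C. FObj F X : S} & Z : {X : Obj C. FObj F X : S} --> Y : {X : Obj C. FObj F X : S})"
  if t: "t : Exact C" for t
 proof -
  obtain X Y Z u v w where e: "t = (X, Y, Z, u, v, w)" by (cases t) auto
  have "X : Obj C" "Y : Obj C" "Z : Obj C"
   using subsetD[OF C.exact_triangles' t] unfolding e triangles_def by simp_all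
  thus ?thesis using thickD(7)[OF S exact[OF t[unfolded e]]] unfolding e prod.case mem_Collect_eq by blast
 qed
 fix X assume X: "X : Obj C"
 note i = map_shift[OF X]
 have "FObj F (\<Sigma>o C X) : S \<longleftrightarrow> \<Sigma>o D (FObj F X) : S"
  using thickD(2)[OF S _ i] thickD(2)[OF S _ D.isomorphic_sym[OF i]] by blast
 thus "(\<Sigma>o C X : {X : Obj C. FObj F X : S}) = (X : {X : Obj C. FObj F X : S})"
  using thickD(5)[OF S obj[OF X]] X by simp
next
 fix X Y assume "X : {X : Obj C. FObj F X : S}" "isomorphic C X Y"
 thus "Y : {X : Obj C. FObj F X : S}" using map_isomorphic thickD(2)[OF S] C.isomorphic_obj by blast
next
 fix Z assume "zero_obj C Z"
 thus "Z : {X : Obj C. FObj F X : S}" using map_zero_obj thickD(3)[OF S] C.zero_obj_iff by blast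
next
 fix X Y B assume "X : {X : Obj C. FObj F X : S}" "Y : {X : Obj C. FObj F X : S}" "direct_sum2 C X Y B"
 thus "B : {X : Obj C. FObj F X : S}" using map_direct_sum2 thickD(4)[OF S] C.direct_sum2_iff by blast
next
 fix Y X assume "Y : {X : Obj C. FObj F X : S}" "summand C X Y"
 thus "X : {X : Obj C. FObj F X : S}"
  using map_summand[of X Y] thickD(6)[OF S] unfolding summand_def C.direct_sum2_iff by blast
qed auto

end

lemma tilting_map:
 assumes "exact_functor K C D F" "lin_equivalence K C D F" and X: "tilting C X"
 shows "tilting D (FObj F X)"
proof -
 interpret exact_functor K C D F by fact
 interpret F: lin_equivalence K C D F by fact
 have r: "rigid C X" and g: "generates C X" using X C.tilting_iff by auto
 have Xo: "X : Obj C" using r unfolding rigid_def by blast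
 have z: "hom_zero D (FObj F A) (FObj F B)" if AB: "hom_zero C A B" "A : Obj C" "B : Obj C" for A B
  unfolding hom_zero_def
 proof (intro allI impI, elim conjE)
  fix h assume h: "arr D h" "src D h = FObj F A" "tgt D h = FObj F B"
  obtain f where f: "arr C f" "src C f = A" "tgt C f = B" "FMor F f = h" using F.lift[OF AB(2,3) h] by blast
  hence "f = \<zero>\<^bsub>Hom C A B\<^esub>" using AB(1) unfolding hom_zero_def by blast
  thus "h = \<zero>\<^bsub>Hom D (FObj F A) (FObj F B)\<^esub>" using f(4) map_zero[OF AB(2,3)] by simp
 qed
 have "rigid D (FObj F X)" unfolding rigid_def
 proof (intro conjI allI impI)
  fix n :: nat assume n: "n > 0"
  have i: "isomorphic D (FObj F ((\<Sigma>o C ^^ n) X)) ((\<Sigma>o D ^^ n) (FObj F X))" using map_shift_pow[OF Xo] .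
  have o: "(\<Sigma>o C ^^ n) X : Obj C" using C.shift_pow_obj[OF Xo] .
  have a: "in_add D ((\<Sigma>o D ^^ n) (FObj F X)) (FObj F ((\<Sigma>o C ^^ n) X))" using D.in_add_iso[OF D.isomorphic_sym[OF i]] .
  have b: "in_add D (FObj F X) (FObj F X)" using D.in_add_refl Xo by simp
  have r': "hom_zero C X ((\<Sigma>o C ^^ n) X)" "hom_zero C ((\<Sigma>o C ^^ n) X) X" using r n unfolding rigid_def by auto
  show "hom_zero D (FObj F X) ((\<Sigma>o D ^^ n) (FObj F X))" using D.hom_zero_in_add[OF z[OF r'(1) Xo o] b a] .
  show "hom_zero D ((\<Sigma>o D ^^ n) (FObj F X)) (FObj F X)" using D.hom_zero_in_add[OF z[OF r'(2) o Xo] a b] .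
 qed (use Xo in simp)
 moreover have "generates D (FObj F X)" unfolding generates_def
 proof (intro allI impI subsetI, elim conjE)
  fix S Y assume S: "thick D S" "FObj F X : S" and Y: "Y : Obj D"
  obtain Z where Z: "Z : Obj C" "isomorphic D (FObj F Z) Y" using F.preimage[OF Y] by blast
  have "Obj C \<subseteq> {X : Obj C. FObj F X : S}"
   using g thick_preimage[OF S(1)] S(2) Xo unfolding generates_def by blast
  thus "Y : S" using Z thickD(2)[OF S(1)] by blast
 qed
 ultimately show ?thesis using D.tilting_iff by blast
qed


section \<open>Equivariant triangle functors\<close>

definition comp_tf where
 "comp_tf B F E = \<lparr>FObj = FObj F \<circ> FObj E, FMor = FMor F \<circ> FMor E,
  omega = (%X. omega F (FObj E X) \<bullet>\<^bsub>B\<^esub> FMor F (omega E X))\<rparr>"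

lemma comp_tf_simps [simp]: "FObj (comp_tf B F E) X = FObj F (FObj E X)" "FMor (comp_tf B F E) f = FMor F (FMor E f)"
 "omega (comp_tf B F E) X = omega F (FObj E X) \<bullet>\<^bsub>B\<^esub> FMor F (omega E X)"
 unfolding comp_tf_def by simp_all

text \<open>
 A triangle functor between two categories with \<open>G\<close>-actions, together with isomorphisms
 \<open>\<delta> g : F A\<^sub>g \<rightarrow> B\<^sub>g F\<close> that are natural, compatible with the translations, and coherent.
\<close>

definition equivariant_tf where
 "equivariant_tf K C D G A B F \<delta> \<longleftrightarrow> triangle_functor K C D F &
  (ALL g:carrier G. ALL X:Obj C. iso_arr D (\<delta> g X) & src D (\<delta> g X) = FObj F (FObj (act A g) X) &
   tgt D (\<delta> g X) = FObj (act B g) (FObj F X)) &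
  (ALL g:carrier G. ALL f. arr C f -->
   \<delta> g (tgt C f) \<bullet>\<^bsub>D\<^esub> FMor F (FMor (act A g) f) = FMor (act B g) (FMor F f) \<bullet>\<^bsub>D\<^esub> \<delta> g (src C f)) &
  (ALL g:carrier G. ALL X:Obj C.
   (omega (act B g) (FObj F X) \<bullet>\<^bsub>D\<^esub> FMor (act B g) (omega F X)) \<bullet>\<^bsub>D\<^esub> \<delta> g (\<Sigma>o C X) =
   \<Sigma>m D (\<delta> g X) \<bullet>\<^bsub>D\<^esub> (omega F (FObj (act A g) X) \<bullet>\<^bsub>D\<^esub> FMor F (omega (act A g) X))) &
  (ALL g:carrier G. ALL h:carrier G. ALL X:Obj C.
   \<delta> (g \<otimes>\<^bsub>G\<^esub> h) X \<bullet>\<^bsub>D\<^esub> FMor F (eps A g h X) =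
   eps B g h (FObj F X) \<bullet>\<^bsub>D\<^esub> (FMor (act B g) (\<delta> h X) \<bullet>\<^bsub>D\<^esub> \<delta> g (FObj (act A h) X)))"

lemma equivariant_tfD:
 assumes "equivariant_tf K C D G A B F \<delta>"
 shows "triangle_functor K C D F"
  "!!g X. g : carrier G ==> X : Obj C ==> iso_arr D (\<delta> g X)"
  "!!g X. g : carrier G ==> X : Obj C ==> src D (\<delta> g X) = FObj F (FObj (act A g) X)"
  "!!g X. g : carrier G ==> X : Obj C ==> tgt D (\<delta> g X) = FObj (act B g) (FObj F X)"
  "!!g f. g : carrier G ==> arr C f ==>
   \<delta> g (tgt C f) \<bullet>\<^bsub>D\<^esub> FMor F (FMor (act A g) f) = FMor (act B g) (FMor F f) \<bullet>\<^bsub>D\<^esub> \<delta> g (src C f)"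
  "!!g X. g : carrier G ==> X : Obj C ==>
   (omega (act B g) (FObj F X) \<bullet>\<^bsub>D\<^esub> FMor (act B g) (omega F X)) \<bullet>\<^bsub>D\<^esub> \<delta> g (\<Sigma>o C X) =
   \<Sigma>m D (\<delta> g X) \<bullet>\<^bsub>D\<^esub> (omega F (FObj (act A g) X) \<bullet>\<^bsub>D\<^esub> FMor F (omega (act A g) X))"
  "!!g h X. g : carrier G ==> h : carrier G ==> X : Obj C ==>
   \<delta> (g \<otimes>\<^bsub>G\<^esub> h) X \<bullet>\<^bsub>D\<^esub> FMor F (eps A g h X) =
   eps B g h (FObj F X) \<bullet>\<^bsub>D\<^esub> (FMor (act B g) (\<delta> h X) \<bullet>\<^bsub>D\<^esub> \<delta> g (FObj (act A h) X))"
 using assms unfolding equivariant_tf_def by blast+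

lemma comp_exact_functor:
 assumes "exact_functor K C D E" "exact_functor K D B F"
 shows "exact_functor K C B (comp_tf B F E)"
proof -
 interpret E: exact_functor K C D E by fact
 interpret F: exact_functor K D B F by fact
 have l: "linear_functor K C B (comp_tf B F E)"
  unfolding linear_functor_def by auto
 have n: "nat_iso C B (comp_functor (comp_tf B F E) (Shift C)) (comp_functor (Shift B) (comp_tf B F E)) (omega (comp_tf B F E))"
  unfolding nat_iso_def
 proof (intro conjI ballI)
  fix X assume X [simp]: "X : Obj C"
  show "iso_mor B (FObj (comp_functor (comp_tf B F E) (Shift C)) X) (FObj (comp_functor (Shift B) (comp_tf B F E)) X) (omega (comp_tf B F E) X)"
   by (simp add: comp_functor_def)
  fix Y f assume Y [simp]: "Y : Obj C" and "f : Homs C X Y"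
  hence f [simp]: "arr C f" "src C f = X" "tgt C f = Y" by auto
  have "omega F (FObj E Y) \<bullet>\<^bsub>B\<^esub> (FMor F (omega E Y \<bullet>\<^bsub>D\<^esub> FMor E (\<Sigma>m C f))) =
    omega F (FObj E Y) \<bullet>\<^bsub>B\<^esub> (FMor F (\<Sigma>m D (FMor E f) \<bullet>\<^bsub>D\<^esub> omega E X))"
   using E.omega_nat[of f] by simp
  also have "\<dots> = (omega F (FObj E Y) \<bullet>\<^bsub>B\<^esub> FMor F (\<Sigma>m D (FMor E f))) \<bullet>\<^bsub>B\<^esub> FMor F (omega E X)" by simp
  also have "\<dots> = (\<Sigma>m B (FMor F (FMor E f)) \<bullet>\<^bsub>B\<^esub> omega F (FObj E X)) \<bullet>\<^bsub>B\<^esub> FMor F (omega E X)"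
   using F.omega_nat[of "FMor E f"] by simp
  finally show "omega (comp_tf B F E) Y \<bullet>\<^bsub>B\<^esub> FMor (comp_functor (comp_tf B F E) (Shift C)) f =
    FMor (comp_functor (Shift B) (comp_tf B F E)) f \<bullet>\<^bsub>B\<^esub> omega (comp_tf B F E) X"
   by (simp add: comp_functor_def)
 qed
 have "(FObj F (FObj E X), FObj F (FObj E Y), FObj F (FObj E Z), FMor F (FMor E u), FMor F (FMor E v),
   (omega F (FObj E X) \<bullet>\<^bsub>B\<^esub> FMor F (omega E X)) \<bullet>\<^bsub>B\<^esub> FMor F (FMor E w)) : Exact B"
  if t: "(X, Y, Z, u, v, w) : Exact C" for X Y Z u v w
 proof -
  have "X : Obj C" "Z : Obj C" "w : Homs C Z (\<Sigma>o C X)"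
   using subsetD[OF E.C.exact_triangles' t] unfolding triangles_def by simp_all
  thus ?thesis using F.exact[OF E.exact[OF t]] by simp
 qed
 thus ?thesis
  by unfold_locales (use l n in \<open>auto simp: triangle_functor_def\<close>)
qed

lemma equivariant_tf_comp:
 assumes "equivariantization K C G A" "equivariantization K D G A'" "equivariantization K B G A''"
  and E: "equivariant_tf K C D G A A' E \<delta>" and F: "equivariant_tf K D B G A' A'' F \<delta>'"
 shows "equivariant_tf K C B G A A'' (comp_tf B F E) (%g X. \<delta>' g (FObj E X) \<bullet>\<^bsub>B\<^esub> FMor F (\<delta> g X))"
proof -
 interpret C: equivariantization K C G A by fact
 interpret D: equivariantization K D G A' by fact
 interpret B: equivariantization K B G A'' by fact
 interpret E: exact_functor K C D E by unfold_locales (fact equivariant_tfD(1)[OF E])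
 interpret F: exact_functor K D B F by unfold_locales (fact equivariant_tfD(1)[OF F])
 interpret FE: exact_functor K C B "comp_tf B F E" by (rule comp_exact_functor) unfold_locales
 note [simp] = equivariant_tfD(2-4)[OF E] equivariant_tfD(2-4)[OF F]
 note nE = equivariant_tfD(5)[OF E] and nF = equivariant_tfD(5)[OF F]
 note oE = equivariant_tfD(6)[OF E] and oF = equivariant_tfD(6)[OF F]
 note cE = equivariant_tfD(7)[OF E] and cF = equivariant_tfD(7)[OF F]
 show ?thesis unfolding equivariant_tf_def
 proof (intro conjI ballI allI impI)
  show "triangle_functor K C B (comp_tf B F E)" by (rule FE.triangle)
  fix g assume g [simp]: "g : carrier G"
  {
   fix X assume X [simp]: "X : Obj C"
   show "iso_arr B (\<delta>' g (FObj E X) \<bullet>\<^bsub>B\<^esub> FMor F (\<delta> g X))"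
    "src B (\<delta>' g (FObj E X) \<bullet>\<^bsub>B\<^esub> FMor F (\<delta> g X)) = FObj (comp_tf B F E) (FObj (act A g) X)"
    "tgt B (\<delta>' g (FObj E X) \<bullet>\<^bsub>B\<^esub> FMor F (\<delta> g X)) = FObj (act A'' g) (FObj (comp_tf B F E) X)"
    by simp_all
   have n: "\<delta>' g (\<Sigma>o D (FObj E X)) \<bullet>\<^bsub>B\<^esub> FMor F (FMor (act A' g) (omega E X)) =
     FMor (act A'' g) (FMor F (omega E X)) \<bullet>\<^bsub>B\<^esub> \<delta>' g (FObj E (\<Sigma>o C X))"
    using nF[OF g, of "omega E X"] by simp
   have o: "omega (act A'' g) (FObj F (FObj E X)) \<bullet>\<^bsub>B\<^esub> (FMor (act A'' g) (omega F (FObj E X)) \<bullet>\<^bsub>B\<^esub> \<delta>' g (\<Sigma>o D (FObj E X))) =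
     \<Sigma>m B (\<delta>' g (FObj E X)) \<bullet>\<^bsub>B\<^esub> (omega F (FObj (act A' g) (FObj E X)) \<bullet>\<^bsub>B\<^esub> FMor F (omega (act A' g) (FObj E X)))"
    using oF[OF g, of "FObj E X"] by simp
   have w: "omega F (FObj (act A' g) (FObj E X)) \<bullet>\<^bsub>B\<^esub> FMor F (\<Sigma>m D (\<delta> g X)) =
     \<Sigma>m B (FMor F (\<delta> g X)) \<bullet>\<^bsub>B\<^esub> omega F (FObj E (FObj (act A g) X))"
    using F.omega_nat[of "\<delta> g X"] by simp
   let ?x = "FMor F (\<delta> g (\<Sigma>o C X))"
   have "omega (act A'' g) (FObj F (FObj E X)) \<bullet>\<^bsub>B\<^esub> (FMor (act A'' g) (omega F (FObj E X)) \<bullet>\<^bsub>B\<^esub>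
     (FMor (act A'' g) (FMor F (omega E X)) \<bullet>\<^bsub>B\<^esub> (\<delta>' g (FObj E (\<Sigma>o C X)) \<bullet>\<^bsub>B\<^esub> ?x)))
    = (omega (act A'' g) (FObj F (FObj E X)) \<bullet>\<^bsub>B\<^esub> (FMor (act A'' g) (omega F (FObj E X)) \<bullet>\<^bsub>B\<^esub> \<delta>' g (\<Sigma>o D (FObj E X))))
     \<bullet>\<^bsub>B\<^esub> (FMor F (FMor (act A' g) (omega E X)) \<bullet>\<^bsub>B\<^esub> ?x)"
    by (simp add: B.reassoc[OF n])
   also have "\<dots> = \<Sigma>m B (\<delta>' g (FObj E X)) \<bullet>\<^bsub>B\<^esub> (omega F (FObj (act A' g) (FObj E X)) \<bullet>\<^bsub>B\<^esub>
     FMor F ((omega (act A' g) (FObj E X) \<bullet>\<^bsub>D\<^esub> FMor (act A' g) (omega E X)) \<bullet>\<^bsub>D\<^esub> \<delta> g (\<Sigma>o C X)))"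
    unfolding o by simp
   also have "\<dots> = \<Sigma>m B (\<delta>' g (FObj E X)) \<bullet>\<^bsub>B\<^esub> ((omega F (FObj (act A' g) (FObj E X)) \<bullet>\<^bsub>B\<^esub> FMor F (\<Sigma>m D (\<delta> g X))) \<bullet>\<^bsub>B\<^esub>
     (FMor F (omega E (FObj (act A g) X)) \<bullet>\<^bsub>B\<^esub> FMor F (FMor E (omega (act A g) X))))"
    unfolding oE[OF g X] by simp
   finally show "(omega (act A'' g) (FObj (comp_tf B F E) X) \<bullet>\<^bsub>B\<^esub> FMor (act A'' g) (omega (comp_tf B F E) X)) \<bullet>\<^bsub>B\<^esub> (\<delta>' g (FObj E (\<Sigma>o C X)) \<bullet>\<^bsub>B\<^esub> FMor F (\<delta> g (\<Sigma>o C X))) =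
    \<Sigma>m B (\<delta>' g (FObj E X) \<bullet>\<^bsub>B\<^esub> FMor F (\<delta> g X)) \<bullet>\<^bsub>B\<^esub> (omega (comp_tf B F E) (FObj (act A g) X) \<bullet>\<^bsub>B\<^esub> FMor (comp_tf B F E) (omega (act A g) X))"
    unfolding w by simp
   fix h assume h [simp]: "h : carrier G"
   have n: "\<delta>' g (FObj (act A' h) (FObj E X)) \<bullet>\<^bsub>B\<^esub> FMor F (FMor (act A' g) (\<delta> h X)) =
     FMor (act A'' g) (FMor F (\<delta> h X)) \<bullet>\<^bsub>B\<^esub> \<delta>' g (FObj E (FObj (act A h) X))"
    using nF[OF g, of "\<delta> h X"] by simp
   have "\<delta>' (g \<otimes>\<^bsub>G\<^esub> h) (FObj E X) \<bullet>\<^bsub>B\<^esub> FMor F (\<delta> (g \<otimes>\<^bsub>G\<^esub> h) X \<bullet>\<^bsub>D\<^esub> FMor E (eps A g h X)) =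
    (\<delta>' (g \<otimes>\<^bsub>G\<^esub> h) (FObj E X) \<bullet>\<^bsub>B\<^esub> FMor F (eps A' g h (FObj E X))) \<bullet>\<^bsub>B\<^esub> (FMor F (FMor (act A' g) (\<delta> h X)) \<bullet>\<^bsub>B\<^esub> FMor F (\<delta> g (FObj (act A h) X)))"
    unfolding cE[OF g h X] by simp
   also have "\<dots> = eps A'' g h (FObj F (FObj E X)) \<bullet>\<^bsub>B\<^esub> (FMor (act A'' g) (\<delta>' h (FObj E X)) \<bullet>\<^bsub>B\<^esub>
    ((\<delta>' g (FObj (act A' h) (FObj E X)) \<bullet>\<^bsub>B\<^esub> FMor F (FMor (act A' g) (\<delta> h X))) \<bullet>\<^bsub>B\<^esub> FMor F (\<delta> g (FObj (act A h) X))))"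
    unfolding cF[OF g h E.obj[OF X]] by simp
   finally show "(\<delta>' (g \<otimes>\<^bsub>G\<^esub> h) (FObj E X) \<bullet>\<^bsub>B\<^esub> FMor F (\<delta> (g \<otimes>\<^bsub>G\<^esub> h) X)) \<bullet>\<^bsub>B\<^esub> FMor (comp_tf B F E) (eps A g h X) =
    eps A'' g h (FObj (comp_tf B F E) X) \<bullet>\<^bsub>B\<^esub> (FMor (act A'' g) (\<delta>' h (FObj E X) \<bullet>\<^bsub>B\<^esub> FMor F (\<delta> h X)) \<bullet>\<^bsub>B\<^esub> (\<delta>' g (FObj E (FObj (act A h) X)) \<bullet>\<^bsub>B\<^esub> FMor F (\<delta> g (FObj (act A h) X))))"
    unfolding n by simp
  }
  fix f assume f [simp]: "arr C f"
  have "(\<delta>' g (FObj E (tgt C f)) \<bullet>\<^bsub>B\<^esub> FMor F (\<delta> g (tgt C f))) \<bullet>\<^bsub>B\<^esub> FMor F (FMor E (FMor (act A g) f)) =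
   \<delta>' g (FObj E (tgt C f)) \<bullet>\<^bsub>B\<^esub> FMor F (\<delta> g (tgt C f) \<bullet>\<^bsub>D\<^esub> FMor E (FMor (act A g) f))" by simp
  also have "\<dots> = (\<delta>' g (FObj E (tgt C f)) \<bullet>\<^bsub>B\<^esub> FMor F (FMor (act A' g) (FMor E f))) \<bullet>\<^bsub>B\<^esub> FMor F (\<delta> g (src C f))"
   unfolding nE[OF g f] by simp
  also have "\<dots> = (FMor (act A'' g) (FMor F (FMor E f)) \<bullet>\<^bsub>B\<^esub> \<delta>' g (FObj E (src C f))) \<bullet>\<^bsub>B\<^esub> FMor F (\<delta> g (src C f))"
   using nF[OF g, of "FMor E f"] by simp
  finally show "(\<delta>' g (FObj E (tgt C f)) \<bullet>\<^bsub>B\<^esub> FMor F (\<delta> g (tgt C f))) \<bullet>\<^bsub>B\<^esub> FMor (comp_tf B F E) (FMor (act A g) f) =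
   FMor (act A'' g) (FMor (comp_tf B F E) f) \<bullet>\<^bsub>B\<^esub> (\<delta>' g (FObj E (src C f)) \<bullet>\<^bsub>B\<^esub> FMor F (\<delta> g (src C f)))"
   by simp
 qed
qed

text \<open>
  The restriction of an action along the group homomorphism \<open>\<rho>\<close>.
\<close>

definition pull_action where
 "pull_action \<rho> A = \<lparr>act = (%g. act A (\<rho> g)), eps = (%g h. eps A (\<rho> g) (\<rho> h))\<rparr>"

lemma pull_action_simps [simp]: "act (pull_action \<rho> A) g = act A (\<rho> g)" "eps (pull_action \<rho> A) g h = eps A (\<rho> g) (\<rho> h)"
 unfolding pull_action_def by simp_all

lemma equivariant_tf_pull:
 assumes "equivariant_tf K C D G' A B F \<delta>" "\<rho> : hom G G'"
 shows "equivariant_tf K C D G (pull_action \<rho> A) (pull_action \<rho> B) F (%g. \<delta> (\<rho> g))"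
 using assms unfolding equivariant_tf_def hom_def by (simp add: Pi_iff)

lemma equivariantization_pull:
 assumes "equivariantization K C G' A" "\<rho> : hom G G'" "group G"
 shows "equivariantization K C G (pull_action \<rho> A)"
proof -
 interpret C: equivariantization K C G' A by fact
 show ?thesis
  by unfold_locales (use C.action assms(2,3) in \<open>simp add: triangle_action_def hom_def Pi_iff\<close>)
qed

lemma (in equivariantization) equivariant_autoequivalence_iff:
 "aut (F, \<delta>) \<longleftrightarrow> equivariant_tf K C C G A A F \<delta> & lin_equivalence K C C F"
proof
 assume a: "aut (F, \<delta>)"
 hence t: "triangle_functor K C C F" and e: "equivalence_functor K C C F"
  unfolding equivariant_autoequivalence_def triangle_autoequivalence_def by auto
 interpret F: lin_equivalence K C C F using equivalence_imp_lin_equivalence[OF _ e] linear_category_axioms by blast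
 interpret F: exact_functor K C C F by unfold_locales (fact t)
 have n: "tri_nat_iso C C (comp_tri_functor C F (act A g)) (comp_tri_functor C (act A g) F) (\<delta> g)" if "g : carrier G" for g
  using a that unfolding equivariant_autoequivalence_def by blast
 have d [simp]: "iso_arr C (\<delta> g X)" "src C (\<delta> g X) = FObj F (Fo g X)" "tgt C (\<delta> g X) = Fo g (FObj F X)"
  if "g : carrier G" "X : Obj C" for g X
  using n[OF that(1)] that unfolding tri_nat_iso_def nat_iso_def comp_tri_functor_def by auto
 have "equivariant_tf K C C G A A F \<delta>" unfolding equivariant_tf_def
 proof (intro conjI ballI allI impI)
  fix g f assume g: "g : carrier G" and f: "arr C f"
  show "\<delta> g (tgt C f) \<bullet> FMor F (Fm g f) = Fm g (FMor F f) \<bullet> \<delta> g (src C f)"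
   using n[OF g] arrD[OF f] f unfolding tri_nat_iso_def nat_iso_def comp_tri_functor_def by simp
 next
  fix g h X assume g [simp]: "g : carrier G" and h [simp]: "h : carrier G" and X [simp]: "X : Obj C"
  have "\<delta> (g \<cdot> h) X \<bullet> FMor F (eps A g h X) =
   eps A g h (FObj F X) \<bullet> Fm g (\<delta> h X) \<bullet> \<delta> g (Fo h X)"
   using a g h X unfolding equivariant_autoequivalence_def by blast
  thus "\<delta> (g \<cdot> h) X \<bullet> FMor F (eps A g h X) =
   eps A g h (FObj F X) \<bullet> (Fm g (\<delta> h X) \<bullet> \<delta> g (Fo h X))" by simp
 next
  fix g X assume g: "g : carrier G" and X: "X : Obj C"
  show "(Fw g (FObj F X) \<bullet> Fm g (omega F X)) \<bullet> \<delta> g (So X) =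
   Sm (\<delta> g X) \<bullet> (omega F (Fo g X) \<bullet> FMor F (Fw g X))"
   using n[OF g] X unfolding tri_nat_iso_def comp_tri_functor_def by simp
 qed (use t d in auto)
 thus "equivariant_tf K C C G A A F \<delta> & lin_equivalence K C C F" using F.lin_equivalence_axioms by blast
next
 assume a: "equivariant_tf K C C G A A F \<delta> & lin_equivalence K C C F"
 interpret F: lin_equivalence K C C F using a by blast
 interpret F: exact_functor K C C F by unfold_locales (use a equivariant_tfD(1) in blast)
 note t = equivariant_tfD[OF a[THEN conjunct1]]
 note [simp] = t(2-4)
 show "aut (F, \<delta>)"
  unfolding equivariant_autoequivalence_def prod.case
 proof (intro conjI ballI)
  show "triangle_autoequivalence K C F" unfolding triangle_autoequivalence_def
   using F.triangle F.equivalence by blast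
  fix g assume g [simp]: "g : carrier G"
  show "tri_nat_iso C C (comp_tri_functor C F (act A g)) (comp_tri_functor C (act A g) F) (\<delta> g)"
   unfolding tri_nat_iso_def nat_iso_def comp_tri_functor_def
  proof (intro conjI ballI, simp_all only: tri_functor.simps cat_functor.simps comp_def)
   fix X assume X [simp]: "X : Obj C"
   show "iso_mor C (FObj F (Fo g X)) (Fo g (FObj F X)) (\<delta> g X)" by simp
   show "(Fw g (FObj F X) \<bullet> Fm g (omega F X)) \<bullet> \<delta> g (So X) =
    Sm (\<delta> g X) \<bullet> (omega F (Fo g X) \<bullet> FMor F (Fw g X))"
    by (rule t(6)) simp_all
   fix Y f assume "Y : Obj C" "f : Homs C X Y"
   thus "\<delta> g Y \<bullet> FMor F (Fm g f) = Fm g (FMor F f) \<bullet> \<delta> g X"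
    using t(5)[OF g, of f] by simp
  qed
  fix h X assume h [simp]: "h : carrier G" and X [simp]: "X : Obj C"
  show "\<delta> (g \<cdot> h) X \<bullet> FMor F (eps A g h X) =
   eps A g h (FObj F X) \<bullet> Fm g (\<delta> h X) \<bullet> \<delta> g (Fo h X)"
   using t(7)[OF g h X] by simp
 qed
qed

lemma (in linear_category) iso_smult:
 assumes f: "iso_arr C f" "src C f = X" "tgt C f = Y" and c: "c : carrier K" "c \<noteq> \<zero>\<^bsub>K\<^esub>"
 shows "iso_arr C (c \<odot>[X,Y] f)"
proof -
 have o: "X : Obj C" "Y : Obj C" using f arr_obj iso_arr_arr by blast+
 note [simp] = f o
 have i: "inv\<^bsub>K\<^esub> c : carrier K" "inv\<^bsub>K\<^esub> c \<otimes>\<^bsub>K\<^esub> c = \<one>\<^bsub>K\<^esub>" "c \<otimes>\<^bsub>K\<^esub> inv\<^bsub>K\<^esub> c = \<one>\<^bsub>K\<^esub>"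
  using c by (auto simp: field_Units)
 show ?thesis
  by (rule iso_arrI(1)[of _ "inv\<^bsub>K\<^esub> c \<odot>[Y,X] inv_arr C f"]) (use c i in simp_all)
qed

section \<open>The dual action\<close>

locale dual_setting = equivariantization K C G A + field_comm_group K G
 for K :: "('k, 'r) ring_scheme" and C :: "('k, 'o, 'm, 'y) tri_category_scheme" (structure)
  and G :: "('g, 'z) monoid_scheme" and A :: "('g, 'o, 'm) tri_action"
begin

abbreviation "Ad \<equiv> dual_action C G A"
abbreviation "tw \<equiv> dual_obj C G A"

lemma obj_eqI: "U : Obj E ==> V : Obj E ==> fst U = fst V ==> (!!g. g : carrier G ==> snd U g = snd V g) ==> U = V"
 using objE(2)[of U] objE(2)[of V] by (auto simp: prod_eq_iff extensional_def fun_eq_iff) (metis)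

lemma tw_simps [simp]: "fst (tw \<chi> U) = fst U"
 "g : carrier G ==> snd (tw \<chi> U) g = \<chi> (inv_G g) \<odot>[fst U,Fo g (fst U)] snd U g"
 unfolding dual_obj_def by simp_all

lemma char_simps [simp]: "\<chi> : carrier Gh ==> g : carrier G ==> \<chi> g : carrier K"
 using charD(1) .

lemma tw_obj [simp]:
 assumes chi [simp]: "\<chi> : carrier Gh" and U [simp]: "U : Obj E"
 shows "tw \<chi> U : Obj E"
proof -
 have "(fst U, snd (tw \<chi> U)) : Obj E"
 proof (rule objI)
  show "snd (tw \<chi> U) : extensional (carrier G)" unfolding dual_obj_def by simp
  fix g assume g [simp]: "g : carrier G"
  show "iso_arr C (snd (tw \<chi> U) g)" using charD(2)[OF chi, of "inv_G g"] by (auto intro!: iso_smult)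
  fix h assume h [simp]: "h : carrier G"
  have "\<chi> (inv_G (g \<cdot> h)) = \<chi> (inv_G g) \<otimes>\<^bsub>K\<^esub> \<chi> (inv_G h)"
   using charD(3)[OF chi] by (simp add: G.inv_mult)
  thus "snd (tw \<chi> U) (g \<cdot> h) = eps A g h (fst U) \<bullet> (Fm g (snd (tw \<chi> U) h) \<bullet> snd (tw \<chi> U) g)"
   by (simp add: objE(6)[OF U])
 qed simp_all
 thus ?thesis by (simp add: dual_obj_def)
qed

lemma tw_equi:
 assumes "\<chi> : carrier Gh" "U : Obj E" "V : Obj E" "equi U f V"
 shows "equi (tw \<chi> U) f (tw \<chi> V)"
 using assms unfolding equi_def by simp

lemma tw_tw:
 assumes chi [simp]: "\<chi> : carrier Gh" and psi [simp]: "\<psi> : carrier Gh" and U [simp]: "U : Obj E"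
 shows "tw \<chi> (tw \<psi> U) = tw (\<chi> \<otimes>\<^bsub>Gh\<^esub> \<psi>) U"
 by (rule obj_eqI) (simp_all, simp add: Gh_mult)

lemma tw_one: "U : Obj E ==> tw \<one>\<^bsub>Gh\<^esub> U = U"
 by (rule obj_eqI) (simp_all, simp add: Gh_one)

lemma act_Ad [simp]: "FObj (act Ad \<chi>) U = tw \<chi> U" "FMor (act Ad \<chi>) (U, f, V) = (tw \<chi> U, f, tw \<chi> V)"
 "omega (act Ad \<chi>) U = Id E (tw \<chi> (\<Sigma>o E U))" "eps Ad \<chi> \<psi> U = Id E (tw \<chi> (tw \<psi> U))"
 unfolding dual_action_def by (simp_all add: Let_def)

lemma Shift_snd: "U : Obj E ==> g : carrier G ==>
  snd (\<Sigma>o E U) g = inv_arr C (Fw g (fst U)) \<bullet> Sm (snd U g)"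
 unfolding Shift_E equivariant_shift_def by simp

lemma tw_shift:
 assumes chi [simp]: "\<chi> : carrier Gh" and U [simp]: "U : Obj E"
 shows "\<Sigma>o E (tw \<chi> U) = tw \<chi> (\<Sigma>o E U)"
 by (rule obj_eqI) (simp_all add: Sh_E Shift_snd)

lemma tw_equivalence:
 assumes chi [simp]: "\<chi> : carrier Gh"
 shows "lin_equivalence K E E (act Ad \<chi>)"
proof -
 have H: "EX f. m = (U, f, V) & equi U f V" if "m : Homs E U V" "U : Obj E" "V : Obj E" for m U V
  using Homs_E[OF that(2,3)] that(1) by blast
 have l: "linear_functor K E E (act Ad \<chi>)"
  unfolding linear_functor_def
 proof (intro conjI ballI)
  fix U assume U [simp]: "U : Obj E"
  show "FObj (act Ad \<chi>) U : Obj E" "FMor (act Ad \<chi>) (Id E U) = Id E (FObj (act Ad \<chi>) U)" by (simp_all add: E_ops)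
  fix V m assume V [simp]: "V : Obj E" and "m : Homs E U V"
  then obtain f where m: "m = (U, f, V)" and f: "equi U f V" using H[OF _ U V] by blast
  show "FMor (act Ad \<chi>) m : Homs E (FObj (act Ad \<chi>) U) (FObj (act Ad \<chi>) V)"
   using Homs_E[of "tw \<chi> U" "tw \<chi> V"] tw_equi[OF chi U V f] by (simp add: m)
  {
   fix m' assume "m' : Homs E U V"
   then obtain f' where m': "m' = (U, f', V)" using H[OF _ U V] by blast
   show "FMor (act Ad \<chi>) (m \<oplus>\<^bsub>Hom E U V\<^esub> m') = FMor (act Ad \<chi>) m \<oplus>\<^bsub>Hom E (FObj (act Ad \<chi>) U) (FObj (act Ad \<chi>) V)\<^esub> FMor (act Ad \<chi>) m'"
    by (simp add: m m' E_ops)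
  }
  {
   fix c show "FMor (act Ad \<chi>) (c \<odot>\<^bsub>Hom E U V\<^esub> m) = c \<odot>\<^bsub>Hom E (FObj (act Ad \<chi>) U) (FObj (act Ad \<chi>) V)\<^esub> FMor (act Ad \<chi>) m"
    by (simp add: m E_ops)
  }
  fix W m' assume "W : Obj E" "m' : Homs E V W"
  then obtain f' where m': "m' = (V, f', W)" using H[OF _ V] by blast
  show "FMor (act Ad \<chi>) (m' \<star> m) = FMor (act Ad \<chi>) m' \<star> FMor (act Ad \<chi>) m"
   by (simp add: m m' E_ops)
 qed
 interpret l: lin_functor K E E "act Ad \<chi>" by unfold_locales (fact l)
 have invtw: "tw (inv\<^bsub>Gh\<^esub> \<chi>) (tw \<chi> U) = U" "tw \<chi> (tw (inv\<^bsub>Gh\<^esub> \<chi>) U) = U" if "U : Obj E" for U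
  using that by (simp_all add: tw_tw tw_one)
 show ?thesis
 proof unfold_locales
  show "faithful_functor E E (act Ad \<chi>)" unfolding faithful_functor_def
  proof (intro allI impI, elim conjE)
   fix m m' assume a: "arr E m" "arr E m'" "src E m = src E m'" "tgt E m = tgt E m'" "FMor (act Ad \<chi>) m = FMor (act Ad \<chi>) m'"
   obtain U f V f' where m: "m = (U, f, V)" "m' = (U, f', V)" using a by (cases m; cases m') auto
   show "m = m'" using a(5) by (simp add: m)
  qed
  show "full_functor E E (act Ad \<chi>)" unfolding full_functor_def
  proof (intro ballI allI impI, elim conjE)
   fix U V h assume U [simp]: "U : Obj E" and V [simp]: "V : Obj E" and h: "arr E h" "src E h = FObj (act Ad \<chi>) U" "tgt E h = FObj (act Ad \<chi>) V"
   obtain f where f: "h = (tw \<chi> U, f, tw \<chi> V)" using h by (cases h) auto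
   have "equi (tw \<chi> U) f (tw \<chi> V)" using h(1) unfolding f arr_E by blast
   from tw_equi[OF _ _ _ this, of "inv\<^bsub>Gh\<^esub> \<chi>"] have "equi U f V" by (simp add: invtw)
   hence "arr E (U, f, V)" unfolding arr_E by simp
   thus "EX f. arr E f & src E f = U & tgt E f = V & FMor (act Ad \<chi>) f = h"
    by (intro exI[of _ "(U, f, V)"]) (simp add: f)
  qed
  show "ess_surj E E (act Ad \<chi>)" unfolding ess_surj_def
  proof
   fix U assume U [simp]: "U : Obj E"
   have "isomorphic E (FObj (act Ad \<chi>) (tw (inv\<^bsub>Gh\<^esub> \<chi>) U)) U" using E.isomorphic_refl[OF U] by (simp add: invtw)
   thus "EX X:Obj E. isomorphic E (FObj (act Ad \<chi>) X) U" by (intro bexI[of _ "tw (inv\<^bsub>Gh\<^esub> \<chi>) U"]) simp_all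
  qed
 qed
qed

lemma Ad_mor: "arr E m ==> FMor (act Ad \<chi>) m = (tw \<chi> (src E m), FMor forget m, tw \<chi> (tgt E m))"
 by (cases m) simp

lemma Shift_E_mor: "\<Sigma>m E (U, f, V) = (equivariant_shift C G A U, Sm f, equivariant_shift C G A V)"
 unfolding equivariant_category_def by simp

lemma Shift_mor: "arr E m ==> \<Sigma>m E m = (\<Sigma>o E (src E m), Sm (FMor forget m), \<Sigma>o E (tgt E m))"
 by (cases m) (simp add: Shift_E_mor Shift_E)

lemma dual_triangle_action: "triangle_action K E Gh Ad"
 unfolding triangle_action_def
proof (intro conjI ballI)
 show "group Gh" by unfold_locales
 fix \<chi> assume chi [simp]: "\<chi> : carrier Gh"
 interpret X: lin_equivalence K E E "act Ad \<chi>" by (rule tw_equivalence[OF chi])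
 show "triangle_autoequivalence K E (act Ad \<chi>)"
  unfolding triangle_autoequivalence_def triangle_functor_def
 proof (intro conjI)
  show "linear_functor K E E (act Ad \<chi>)" by (rule X.lin)
  show "equivalence_functor K E E (act Ad \<chi>)" by (rule X.equivalence)
  show "nat_iso E E (comp_functor (act Ad \<chi>) (Shift E)) (comp_functor (Shift E) (act Ad \<chi>)) (omega (act Ad \<chi>))"
   unfolding nat_iso_def comp_functor_def
  proof (intro conjI ballI, simp_all only: cat_functor.simps comp_def)
   fix U assume U [simp]: "U : Obj E"
   show "iso_mor E (FObj (act Ad \<chi>) (\<Sigma>o E U)) (\<Sigma>o E (FObj (act Ad \<chi>) U)) (omega (act Ad \<chi>) U)"
    by (simp add: tw_shift)
   fix V m assume V [simp]: "V : Obj E" and "m : Homs E U V"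
   hence m [simp]: "arr E m" "src E m = U" "tgt E m = V" by auto
   have "FMor (act Ad \<chi>) (\<Sigma>m E m) = \<Sigma>m E (FMor (act Ad \<chi>) m)"
   proof -
    have 1: "arr E (\<Sigma>m E m)" "arr E (FMor (act Ad \<chi>) m)" by simp_all
    have 2: "src E (FMor (act Ad \<chi>) m) = tw \<chi> U" "tgt E (FMor (act Ad \<chi>) m) = tw \<chi> V" by simp_all
    have 3: "FMor forget (FMor (act Ad \<chi>) m) = FMor forget m" by (cases m) simp
    show ?thesis unfolding Ad_mor[OF 1(1)] Shift_mor[OF 1(2)] 2 3 Sh_E by (simp add: tw_shift)
   qed
   thus "omega (act Ad \<chi>) V \<star> FMor (act Ad \<chi>) (\<Sigma>m E m) = \<Sigma>m E (FMor (act Ad \<chi>) m) \<star> omega (act Ad \<chi>) U"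
    by (simp add: tw_shift)
  qed
  show "ALL (U, V, W, u, v, w):Exact E. (FObj (act Ad \<chi>) U, FObj (act Ad \<chi>) V, FObj (act Ad \<chi>) W,
    FMor (act Ad \<chi>) u, FMor (act Ad \<chi>) v, omega (act Ad \<chi>) U \<star> FMor (act Ad \<chi>) w) : Exact E"
  proof (intro ballI, clarify)
   fix U V W u v w assume t: "(U, V, W, u, v, w) : Exact E"
   from t[unfolded Exact_E] have [simp]: "U : Obj E" "V : Obj E" "W : Obj E" "arr E u" "src E u = U" "tgt E u = V"
    "arr E v" "src E v = V" "tgt E v = W" "arr E w" "src E w = W" "tgt E w = \<Sigma>o E U"
    and ex: "(fst U, fst V, fst W, FMor forget u, FMor forget v, FMor forget w) : Exact C" by blast+
   have f: "FMor forget (FMor (act Ad \<chi>) m) = FMor forget m" for m by (cases m) simp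
   have "omega (act Ad \<chi>) U \<star> FMor (act Ad \<chi>) w = FMor (act Ad \<chi>) w" by simp
   moreover have "(tw \<chi> U, tw \<chi> V, tw \<chi> W, FMor (act Ad \<chi>) u, FMor (act Ad \<chi>) v, FMor (act Ad \<chi>) w) : Exact E"
    unfolding Exact_E f using ex by (simp add: tw_shift)
   ultimately show "(FObj (act Ad \<chi>) U, FObj (act Ad \<chi>) V, FObj (act Ad \<chi>) W,
    FMor (act Ad \<chi>) u, FMor (act Ad \<chi>) v, omega (act Ad \<chi>) U \<star> FMor (act Ad \<chi>) w) : Exact E" by (simp only: act_Ad)
  qed
 qed
 fix \<psi> assume psi [simp]: "\<psi> : carrier Gh"
 interpret Y: lin_equivalence K E E "act Ad \<psi>" by (rule tw_equivalence[OF psi])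
 show "tri_nat_iso E E (comp_tri_functor E (act Ad \<chi>) (act Ad \<psi>)) (act Ad (\<chi> \<otimes>\<^bsub>Gh\<^esub> \<psi>)) (eps Ad \<chi> \<psi>)"
  unfolding tri_nat_iso_def nat_iso_def comp_tri_functor_def
 proof (intro conjI ballI, simp_all only: tri_functor.simps cat_functor.simps comp_def)
  fix U assume U [simp]: "U : Obj E"
  show "iso_mor E (FObj (act Ad \<chi>) (FObj (act Ad \<psi>) U)) (FObj (act Ad (\<chi> \<otimes>\<^bsub>Gh\<^esub> \<psi>)) U) (eps Ad \<chi> \<psi> U)"
   by (simp add: tw_tw)
  show "omega (act Ad (\<chi> \<otimes>\<^bsub>Gh\<^esub> \<psi>)) U \<star> eps Ad \<chi> \<psi> (\<Sigma>o E U) =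
   \<Sigma>m E (eps Ad \<chi> \<psi> U) \<star> (omega (act Ad \<chi>) (FObj (act Ad \<psi>) U) \<star> FMor (act Ad \<chi>) (omega (act Ad \<psi>) U))"
   by (simp add: tw_tw tw_shift)
  fix V m assume V [simp]: "V : Obj E" and "m : Homs E U V"
  hence m [simp]: "arr E m" "src E m = U" "tgt E m = V" by auto
  interpret Z: lin_equivalence K E E "act Ad (\<chi> \<otimes>\<^bsub>Gh\<^esub> \<psi>)" by (rule tw_equivalence) simp
  have "FMor (act Ad \<chi>) (FMor (act Ad \<psi>) m) = FMor (act Ad (\<chi> \<otimes>\<^bsub>Gh\<^esub> \<psi>)) m"
  proof -
   have f: "FMor forget (FMor (act Ad \<psi>) m) = FMor forget m" by (cases m) simp
   show ?thesis using Ad_mor[of "FMor (act Ad \<psi>) m" \<chi>] Ad_mor[of m "\<chi> \<otimes>\<^bsub>Gh\<^esub> \<psi>"] by (simp add: f tw_tw)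
  qed
  thus "eps Ad \<chi> \<psi> V \<star> FMor (act Ad \<chi>) (FMor (act Ad \<psi>) m) = FMor (act Ad (\<chi> \<otimes>\<^bsub>Gh\<^esub> \<psi>)) m \<star> eps Ad \<chi> \<psi> U"
   by (simp add: tw_tw)
 qed
 fix \<phi> U assume phi [simp]: "\<phi> : carrier Gh" and U [simp]: "U : Obj E"
 show "eps Ad (\<chi> \<otimes>\<^bsub>Gh\<^esub> \<psi>) \<phi> U \<star> eps Ad \<chi> \<psi> (FObj (act Ad \<phi>) U) =
  eps Ad \<chi> (\<psi> \<otimes>\<^bsub>Gh\<^esub> \<phi>) U \<star> FMor (act Ad \<chi>) (eps Ad \<psi> \<phi> U)"
  by (simp add: tw_tw Gh.m_assoc)
qed

sublocale D: equivariantization K E Gh Ad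
 by unfold_locales (rule dual_triangle_action)

end


lemma lin_equivalence_cong:
 assumes "lin_equivalence K C D F" and e: "FObj F' = FObj F" "FMor F' = FMor F"
 shows "lin_equivalence K C D F'"
proof -
 interpret F: lin_equivalence K C D F by fact
 show ?thesis
  by unfold_locales
   (use F.lin F.faithful F.full F.ess in
   \<open>simp_all add: e linear_functor_def faithful_functor_def full_functor_def ess_surj_def\<close>)
qed

text \<open>
  \<open>F\<^sup>G\<close> as a triangle functor; its connecting isomorphism is that of \<open>F\<close>.
\<close>

definition tri_lift where
 "tri_lift C G A F \<delta> =
  \<lparr>FObj = FObj (equivariant_lift C G F \<delta>), FMor = FMor (equivariant_lift C G F \<delta>),
  omega = (%U. (FObj (equivariant_lift C G F \<delta>) (\<Sigma>o (equivariant_category C G A) U), omega F (fst U),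
   \<Sigma>o (equivariant_category C G A) (FObj (equivariant_lift C G F \<delta>) U)))\<rparr>"

text \<open>
  A twist only rescales the structure morphisms, so \<open>F\<^sup>G\<close> commutes with it on the nose and
  identities serve as the equivariance isomorphisms.
\<close>

lemma (in dual_setting) lift_autoequivalence:
 assumes a: "aut (F, \<delta>)"
 shows "D.aut (tri_lift C G A F \<delta>, %\<chi> U. Id E (tw \<chi> (FObj (tri_lift C G A F \<delta>) U)))"
  and "fst (FObj (tri_lift C G A F \<delta>) U) = FObj F (fst U)"
proof -
 note a' = a[unfolded equivariant_autoequivalence_iff]
 note t = equivariant_tfD[OF a'[THEN conjunct1]]
 interpret F: lin_equivalence K C C F using a' by blast
 interpret F: exact_functor K C C F by unfold_locales (rule t(1))
 interpret L: equivariant_equivalence K C G A F \<delta>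
  by unfold_locales (use t(2-5,7) in auto)
 let ?L = "tri_lift C G A F \<delta>"
 have Lo: "FObj ?L = FObj L.L" and Lm: "FMor ?L = FMor L.L" and Lw: "omega ?L U = (FObj L.L (\<Sigma>o E U), omega F (fst U), \<Sigma>o E (FObj L.L U))" for U
  unfolding tri_lift_def by simp_all
 interpret T: lin_equivalence K E E ?L
  by (rule lin_equivalence_cong[OF L.lift_equivalence Lo Lm])
 show "fst (FObj ?L U) = FObj F (fst U)" unfolding Lo L.L_simps ..
 have so [simp]: "\<Sigma>o E U : Obj E" if "U : Obj E" for U using that by (rule E.Sh.obj)
 have lo [simp]: "FObj L.L U : Obj E" if "U : Obj E" for U using that by (rule L.lift_obj)
 (* equivariance of \<open>\<omega>\<close>: the compatibility of \<open>\<delta>\<close> with the translations *)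
 have we: "equi (FObj L.L (\<Sigma>o E U)) (omega F (fst U)) (\<Sigma>o E (FObj L.L U))" if U [simp]: "U : Obj E" for U
 proof -
  let ?X = "fst U"
  have "snd (\<Sigma>o E (FObj L.L U)) g \<bullet> omega F ?X = Fm g (omega F ?X) \<bullet> snd (FObj L.L (\<Sigma>o E U)) g"
   if g [simp]: "g : carrier G" for g
  proof -
   have n: "Sm (FMor F (snd U g)) \<bullet> omega F ?X = omega F (Fo g ?X) \<bullet> FMor F (Sm (snd U g))"
    using F.omega_nat[of "snd U g"] by simp
   have o: "Fw g (FObj F ?X) \<bullet> (Fm g (omega F ?X) \<bullet> \<delta> g (So ?X)) =
     Sm (\<delta> g ?X) \<bullet> (omega F (Fo g ?X) \<bullet> FMor F (Fw g ?X))"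
    using t(6)[of g ?X] by simp
   have c: "FMor F (Fw g ?X) \<bullet> (FMor F (inv_arr C (Fw g ?X)) \<bullet> x) = x"
    if "arr C x" "tgt C x = FObj F (So (Fo g ?X))" for x
    using inv_arr_cancel(2)[of "FMor F (Fw g ?X)" x] that by simp
   have "Fm g (omega F ?X) \<bullet> (\<delta> g (So ?X) \<bullet> (FMor F (inv_arr C (Fw g ?X)) \<bullet> FMor F (Sm (snd U g)))) =
    inv_arr C (Fw g (FObj F ?X)) \<bullet> ((Fw g (FObj F ?X) \<bullet> (Fm g (omega F ?X) \<bullet> \<delta> g (So ?X)))
     \<bullet> (FMor F (inv_arr C (Fw g ?X)) \<bullet> FMor F (Sm (snd U g))))" by simp
   also have "\<dots> = inv_arr C (Fw g (FObj F ?X)) \<bullet> (Sm (\<delta> g ?X) \<bullet>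
     (omega F (Fo g ?X) \<bullet> FMor F (Sm (snd U g))))"
    unfolding o by (simp add: c)
   also have "\<dots> = inv_arr C (Fw g (FObj F ?X)) \<bullet> (Sm (\<delta> g ?X) \<bullet> (Sm (FMor F (snd U g)) \<bullet> omega F ?X))"
    unfolding n by simp
   finally show ?thesis by (simp add: Shift_snd L.L_simps Sh_E)
  qed
  thus ?thesis unfolding equi_def by (simp add: L.L_simps Sh_E)
 qed
 have ws: "iso_arr E (omega ?L U)" "src E (omega ?L U) = FObj L.L (\<Sigma>o E U)" "tgt E (omega ?L U) = \<Sigma>o E (FObj L.L U)"
  if U: "U : Obj E" for U
 proof -
  have a: "arr E (omega ?L U)" unfolding Lw arr_E using we[OF U] U by simp
  thus "src E (omega ?L U) = FObj L.L (\<Sigma>o E U)" "tgt E (omega ?L U) = \<Sigma>o E (FObj L.L U)" unfolding Lw by simp_all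
  show "iso_arr E (omega ?L U)" using iso_E[OF a[unfolded Lw]] U unfolding Lw by simp
 qed
 have FL: "FMor forget (FMor L.L m) = FMor F (FMor forget m)" for m
  by (cases m) (simp add: L.L_simps)
 have tri: "triangle_functor K E E ?L"
  unfolding triangle_functor_def
 proof (intro conjI)
  show "linear_functor K E E ?L" by (rule T.lin)
  show "nat_iso E E (comp_functor ?L (Shift E)) (comp_functor (Shift E) ?L) (omega ?L)"
   unfolding nat_iso_def comp_functor_def
  proof (intro conjI ballI, simp_all only: cat_functor.simps comp_def)
   fix U assume U [simp]: "U : Obj E"
   show "iso_mor E (FObj ?L (\<Sigma>o E U)) (\<Sigma>o E (FObj ?L U)) (omega ?L U)"
    unfolding Lo using ws[OF U] by simp
   fix V m assume V [simp]: "V : Obj E" and "m : Homs E U V"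
   hence m [simp]: "arr E m" "src E m = U" "tgt E m = V" by auto
   note [simp] = ws[OF U] ws[OF V]
   show "omega ?L V \<star> FMor ?L (\<Sigma>m E m) = \<Sigma>m E (FMor ?L m) \<star> omega ?L U"
   proof (rule Fo.inj)
    have 1: "FMor forget (omega ?L W) = omega F (fst W)" for W unfolding Lw by simp
    have fa: "arr C (FMor forget m)" "src C (FMor forget m) = fst U" "tgt C (FMor forget m) = fst V" using Fo.mor[OF m(1)] by simp_all
    let ?l = "FMor forget (omega ?L V \<star> FMor ?L (\<Sigma>m E m))"
    have "?l = omega F (fst V) \<bullet> FMor F (Sm (FMor forget m))"
     by (subst Fo.map_comp) (simp_all add: Lo Lm 1 FL Sh_E T.mor[unfolded Lo Lm])
    also have "\<dots> = Sm (FMor F (FMor forget m)) \<bullet> omega F (fst U)"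
     using F.omega_nat[OF fa(1)] fa by simp
    also have "\<dots> = FMor forget (\<Sigma>m E (FMor ?L m) \<star> omega ?L U)"
     by (subst Fo.map_comp) (simp_all add: Lo Lm 1 FL Sh_E T.mor[unfolded Lo Lm])
    finally show "?l = FMor forget (\<Sigma>m E (FMor ?L m) \<star> omega ?L U)" .
   qed (simp_all add: Lo Lm T.mor[unfolded Lo Lm])
  qed
  show "ALL (U, V, W, u, v, w):Exact E. (FObj ?L U, FObj ?L V, FObj ?L W, FMor ?L u, FMor ?L v, omega ?L U \<star> FMor ?L w) : Exact E"
  proof (intro ballI, clarify)
   fix U V W u v w assume t: "(U, V, W, u, v, w) : Exact E"
   from t[unfolded Exact_E] have [simp]: "U : Obj E" "V : Obj E" "W : Obj E" "arr E u" "src E u = U" "tgt E u = V"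
    "arr E v" "src E v = V" "tgt E v = W" "arr E w" "src E w = W" "tgt E w = \<Sigma>o E U"
    and ex: "(fst U, fst V, fst W, FMor forget u, FMor forget v, FMor forget w) : Exact C" by blast+
   note [simp] = ws[of U]
   have f: "FMor forget (omega ?L U \<star> FMor ?L w) = omega F (fst U) \<bullet> FMor F (FMor forget w)"
    by (subst Fo.map_comp) (simp_all add: Lm FL Lo T.mor[unfolded Lo Lm], simp add: Lw)
   show "(FObj ?L U, FObj ?L V, FObj ?L W, FMor ?L u, FMor ?L v, omega ?L U \<star> FMor ?L w) : Exact E"
    unfolding Exact_E f using F.exact[OF ex] by (simp add: Lo Lm FL L.L_simps T.mor[unfolded Lo Lm])
  qed
 qed
 have twL: "FObj L.L (tw \<chi> U) = tw \<chi> (FObj L.L U)" if chi [simp]: "\<chi> : carrier Gh" and U [simp]: "U : Obj E" for \<chi> U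
  by (rule obj_eqI) (simp_all add: L.L_simps)
 have "equivariant_tf K E E Gh Ad Ad ?L (%\<chi> U. Id E (tw \<chi> (FObj ?L U)))"
  unfolding equivariant_tf_def
 proof (intro conjI ballI allI impI)
  show "triangle_functor K E E ?L" by (rule tri)
  fix \<chi> assume chi [simp]: "\<chi> : carrier Gh"
  interpret X: lin_equivalence K E E "act Ad \<chi>" by (rule tw_equivalence[OF chi])
  {
   fix U assume U [simp]: "U : Obj E"
   show "iso_arr E (Id E (tw \<chi> (FObj ?L U)))" "src E (Id E (tw \<chi> (FObj ?L U))) = FObj ?L (FObj (act Ad \<chi>) U)"
    "tgt E (Id E (tw \<chi> (FObj ?L U))) = FObj (act Ad \<chi>) (FObj ?L U)" by (simp_all add: Lo twL)
   show "(omega (act Ad \<chi>) (FObj ?L U) \<star> FMor (act Ad \<chi>) (omega ?L U)) \<star> Id E (tw \<chi> (FObj ?L (\<Sigma>o E U))) =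
    \<Sigma>m E (Id E (tw \<chi> (FObj ?L U))) \<star> (omega ?L (FObj (act Ad \<chi>) U) \<star> FMor ?L (omega (act Ad \<chi>) U))"
    by (simp add: Lo Lm Lw E_ops L.L_simps twL tw_shift Sh_E Shift_mor arr_E equi_def Shift_E_mor flip: Shift_E)
   fix \<psi> assume psi [simp]: "\<psi> : carrier Gh"
   show "Id E (tw (\<chi> \<otimes>\<^bsub>Gh\<^esub> \<psi>) (FObj ?L U)) \<star> FMor ?L (eps Ad \<chi> \<psi> U) =
    eps Ad \<chi> \<psi> (FObj ?L U) \<star> (FMor (act Ad \<chi>) (Id E (tw \<psi> (FObj ?L U))) \<star> Id E (tw \<chi> (FObj ?L (FObj (act Ad \<psi>) U))))"
    by (simp add: Lo Lm E_ops L.L_simps twL tw_tw)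
  }
  fix m assume "arr E m"
  then obtain U f V where m: "m = (U, f, V)" and [simp]: "U : Obj E" "V : Obj E" and e: "equi U f V"
   by (cases m) (auto simp: arr_E)
  have s: "src E m = U" "tgt E m = V" using \<open>arr E m\<close> unfolding m by simp_all
  have [simp]: "arr C f" "src C f = fst U" "tgt C f = fst V" using e unfolding equi_def by auto
  show "Id E (tw \<chi> (FObj ?L (tgt E m))) \<star> FMor ?L (FMor (act Ad \<chi>) m) =
   FMor (act Ad \<chi>) (FMor ?L m) \<star> Id E (tw \<chi> (FObj ?L (src E m)))"
   unfolding s by (simp add: m Lo Lm E_ops L.L_simps twL)
 qed
 thus "D.aut (?L, %\<chi> U. Id E (tw \<chi> (FObj ?L U)))"
  unfolding D.equivariant_autoequivalence_iff using T.lin_equivalence_axioms by blast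
qed

section \<open>Induction\<close>

locale splitting = ks_equivariantization K C G A + pretriangulated_category K C + dual_setting K C G A + split_abelian_group K G
 for K :: "('k, 'r) ring_scheme" and C :: "('k, 'o, 'm, 'y) tri_category_scheme" (structure)
  and G :: "('g, 'z) monoid_scheme" and A :: "('g, 'o, 'm) tri_action"
begin

abbreviation "I \<equiv> Ind C G A"

text \<open>
  The biproduct \<open>IB X\<close> selected by \<open>Ind\<close>, with its injections \<open>ii X\<close> and projections \<open>ip X\<close>.
\<close>

definition ib where "ib X = (SOME (B, \<iota>, \<pi>). biproduct C (carrier G) (%h. Fo h X) B \<iota> \<pi>)"
definition "IB X = fst (ib X)"
definition "ii X = fst (snd (ib X))"
definition "ip X = snd (snd (ib X))"

lemma ib: "X : Obj C ==> biproduct C (carrier G) (%h. Fo h X) (IB X) (ii X) (ip X)"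
proof -
 assume X: "X : Obj C"
 have "EX p. case p of (B, \<iota>, \<pi>) => biproduct C (carrier G) (%h. Fo h X) B \<iota> \<pi>"
  using direct_sum_exists[OF finG, of "%h. Fo h X"] X unfolding direct_sum_def by auto
 hence "case ib X of (B, \<iota>, \<pi>) => biproduct C (carrier G) (%h. Fo h X) B \<iota> \<pi>" unfolding ib_def by (rule someI_ex)
 thus ?thesis unfolding IB_def ii_def ip_def by (simp only: case_prod_beta)
qed

lemmas ibD [simp] = biproductD(2,4-11)[OF ib]

lemma Ind_fst [simp]: "fst (I X) = IB X"
 unfolding Ind_def ib_def[symmetric] IB_def by (simp add: case_prod_beta Let_def)

lemma Ind_snd: "g : carrier G ==> snd (I X) g = finsum (Hom C (IB X) (Fo g (IB X))) (%h.
 Fm g (ii X (inv_G g \<cdot> h)) \<bullet> inv_mor C (Fo g (Fo (inv_G g \<cdot> h) X)) (Fo h X) (eps A g (inv_G g \<cdot> h) X) \<bullet> ip X h) (carrier G)"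
 unfolding Ind_def ib_def[symmetric] IB_def ii_def ip_def by (simp add: case_prod_beta Let_def)

lemma Gcancel [simp]: "g : carrier G ==> h : carrier G ==> inv_G g \<cdot> (g \<cdot> h) = h"
 "g : carrier G ==> h : carrier G ==> g \<cdot> (inv_G g \<cdot> h) = h"
 by (simp_all flip: G.m_assoc)

lemma Ind_snd_arr [simp]:
 assumes "g : carrier G" "X : Obj C"
 shows "arr C (snd (I X) g)" "src C (snd (I X) g) = IB X" "tgt C (snd (I X) g) = Fo g (IB X)"
 unfolding Ind_snd[OF assms(1)] using assms by simp_all

lemma Ind_snd_ii:
 assumes g [simp]: "g : carrier G" and k [simp]: "k : carrier G" and X [simp]: "X : Obj C"
 shows "snd (I X) g \<bullet> ii X k = Fm g (ii X (inv_G g \<cdot> k)) \<bullet> inv_arr C (eps A g (inv_G g \<cdot> k) X)"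
proof -
 let ?t = "%h. Fm g (ii X (inv_G g \<cdot> h)) \<bullet> inv_mor C (Fo g (Fo (inv_G g \<cdot> h) X)) (Fo h X) (eps A g (inv_G g \<cdot> h) X) \<bullet> ip X h"
 have "snd (I X) g \<bullet> ii X k = finsum (Hom C (Fo k X) (Fo g (IB X))) (%h. ?t h \<bullet> ii X k) (carrier G)"
  unfolding Ind_snd[OF g] by (subst comp_sum) simp_all
 also have "\<dots> = ?t k \<bullet> ii X k"
  by (rule sum_eq_single) (simp_all add: finG)
 finally show ?thesis by simp
qed

text \<open>
  The structure morphism carries the summand \<open>g h\<close> onto \<open>F\<^sub>g\<close> of the summand \<open>h\<close>. Together with
  \<open>Ind_ext_eps\<close> this reduces identities between morphisms out of \<open>Ind X\<close> to identities between
  the \<open>\<epsilon>\<close>.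
\<close>

lemma Ind_snd_ii_eps:
 assumes "g : carrier G" "h : carrier G" "X : Obj C"
 shows "snd (I X) g \<bullet> (ii X (g \<cdot> h) \<bullet> eps A g h X) = Fm g (ii X h)"
 using reassoc[OF Ind_snd_ii[of g "g \<cdot> h" X], of "eps A g h X"] assms by simp

lemma Ind_ext:
 assumes "X : Obj C" "arr C a" "arr C b" "src C a = IB X" "src C b = IB X" "tgt C a = tgt C b"
  "!!h. h : carrier G ==> a \<bullet> ii X h = b \<bullet> ii X h"
 shows "a = b"
 using biproduct_epi[OF ib] assms by blast

lemma Ind_ext_eps:
 assumes g [simp]: "g : carrier G" and X [simp]: "X : Obj C" and [simp]: "arr C a" "arr C b" "src C a = IB X" "src C b = IB X" "tgt C a = tgt C b"
  and e: "!!h. h : carrier G ==> a \<bullet> (ii X (g \<cdot> h) \<bullet> eps A g h X) = b \<bullet> (ii X (g \<cdot> h) \<bullet> eps A g h X)"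
 shows "a = b"
proof (rule Ind_ext[OF X])
 fix k assume k [simp]: "k : carrier G"
 have "(a \<bullet> ii X k) \<bullet> eps A g (inv_G g \<cdot> k) X = (b \<bullet> ii X k) \<bullet> eps A g (inv_G g \<cdot> k) X"
  using e[of "inv_G g \<cdot> k"] by simp
 thus "a \<bullet> ii X k = b \<bullet> ii X k" by (rule iso_cancel_right[rotated]) simp_all
qed simp_all

lemma Ind_ib_act: "g : carrier G ==> X : Obj C ==>
  biproduct C (carrier G) (%h. Fo g (Fo h X)) (Fo g (IB X)) (%h. Fm g (ii X h)) (%h. Fm g (ip X h))"
 using lin_functor.map_biproduct[OF act_functor ib] .

lemma Ind_obj [simp]:
 assumes X [simp]: "X : Obj C" shows "I X : Obj E"
proof -
 have "(IB X, snd (I X)) : Obj E"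
 proof (rule objI)
  show "snd (I X) : extensional (carrier G)"
   unfolding Ind_def ib_def[symmetric] by (simp add: case_prod_beta Let_def)
  fix g assume g [simp]: "g : carrier G"
  define c where "c = copair (carrier G) (Fo g (IB X)) (IB X) (%h. Fm g (ip X h)) (%h. ii X (g \<cdot> h) \<bullet> eps A g h X)"
  have c [simp]: "arr C c" "src C c = Fo g (IB X)" "tgt C c = IB X"
   and ci: "h : carrier G ==> c \<bullet> Fm g (ii X h) = ii X (g \<cdot> h) \<bullet> eps A g h X" for h
   unfolding c_def using copair[OF Ind_ib_act[OF g X], of "IB X" "%h. ii X (g \<cdot> h) \<bullet> eps A g h X"] by auto
  show "iso_arr C (snd (I X) g)"
  proof (rule iso_arrI(1)[of _ c])
   have "c \<bullet> snd (I X) g = Id C (IB X)"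
    by (rule Ind_ext_eps[OF g X]) (simp_all add: Ind_snd_ii_eps ci)
   thus "c \<bullet> snd (I X) g = Id C (src C (snd (I X) g))" by simp
   have "snd (I X) g \<bullet> c = Id C (Fo g (IB X))"
    by (rule biproduct_epi[OF Ind_ib_act[OF g X]]) (simp_all add: ci Ind_snd_ii_eps)
   thus "snd (I X) g \<bullet> c = Id C (tgt C (snd (I X) g))" by simp
  qed simp_all
  fix h assume h [simp]: "h : carrier G"
  show "snd (I X) (g \<cdot> h) = eps A g h (IB X) \<bullet> (Fm g (snd (I X) h) \<bullet> snd (I X) g)"
  proof (rule Ind_ext_eps[of "g \<cdot> h"])
   fix l assume l [simp]: "l : carrier G"
   let ?e = "eps A g h (Fo l X)"
   have n: "eps A g h (IB X) \<bullet> Fm g (Fm h (ii X l)) = Fm (g \<cdot> h) (ii X l) \<bullet> ?e"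
    using eps_nat[OF g h, of "ii X l"] by simp
   have co: "eps A (g \<cdot> h) l X \<bullet> ?e = eps A g (h \<cdot> l) X \<bullet> Fm g (eps A h l X)" by (rule eps_cocycle) simp_all
   have s: "snd (I X) g \<bullet> (ii X (g \<cdot> (h \<cdot> l)) \<bullet> eps A g (h \<cdot> l) X) = Fm g (ii X (h \<cdot> l))"
    by (rule Ind_snd_ii_eps) simp_all
   let ?l = "((eps A g h (IB X) \<bullet> (Fm g (snd (I X) h) \<bullet> snd (I X) g)) \<bullet> (ii X (g \<cdot> h \<cdot> l) \<bullet> eps A (g \<cdot> h) l X)) \<bullet> ?e"
   have "?l =
    eps A g h (IB X) \<bullet> (Fm g (snd (I X) h) \<bullet> ((snd (I X) g \<bullet> (ii X (g \<cdot> (h \<cdot> l)) \<bullet> eps A g (h \<cdot> l) X)) \<bullet> Fm g (eps A h l X)))"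
    by (simp add: G.m_assoc co[unfolded G.m_assoc[OF g h l]])
   also have "\<dots> = eps A g h (IB X) \<bullet> Fm g (snd (I X) h \<bullet> (ii X (h \<cdot> l) \<bullet> eps A h l X))"
    unfolding s by simp
   also have "\<dots> = Fm (g \<cdot> h) (ii X l) \<bullet> ?e" by (simp only: Ind_snd_ii_eps[OF h l X] n)
   also have "\<dots> = (snd (I X) (g \<cdot> h) \<bullet> (ii X (g \<cdot> h \<cdot> l) \<bullet> eps A (g \<cdot> h) l X)) \<bullet> ?e"
    using Ind_snd_ii_eps[of "g \<cdot> h" l X] by simp
   finally have eq: "?l =
    (snd (I X) (g \<cdot> h) \<bullet> (ii X (g \<cdot> h \<cdot> l) \<bullet> eps A (g \<cdot> h) l X)) \<bullet> ?e" .
   show "snd (I X) (g \<cdot> h) \<bullet> (ii X (g \<cdot> h \<cdot> l) \<bullet> eps A (g \<cdot> h) l X) =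
    (eps A g h (IB X) \<bullet> (Fm g (snd (I X) h) \<bullet> snd (I X) g)) \<bullet> (ii X (g \<cdot> h \<cdot> l) \<bullet> eps A (g \<cdot> h) l X)"
    by (rule iso_cancel_right[OF _ eq[symmetric]]) simp_all
  qed simp_all
 qed simp_all
 thus ?thesis by (metis Ind_fst prod.collapse)
qed

definition cop where "cop X Y a = copair (carrier G) (IB X) Y (ip X) a"

lemma cop:
 assumes "X : Obj C" "Y : Obj C" "!!h. h : carrier G ==> arr C (a h)" "!!h. h : carrier G ==> src C (a h) = Fo h X"
  "!!h. h : carrier G ==> tgt C (a h) = Y"
 shows "arr C (cop X Y a)" "src C (cop X Y a) = IB X" "tgt C (cop X Y a) = Y"
  "!!h. h : carrier G ==> cop X Y a \<bullet> ii X h = a h"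
 unfolding cop_def using copair[OF ib[OF assms(1)] assms(2), of a] assms(3-5) by auto

text \<open>Induction on morphisms.\<close>

definition indm where "indm f = cop (src C f) (IB (tgt C f)) (%h. ii (tgt C f) h \<bullet> Fm h f)"

lemma indm [simp]:
 assumes "arr C f"
 shows "arr C (indm f)" "src C (indm f) = IB (src C f)" "tgt C (indm f) = IB (tgt C f)"
 unfolding indm_def using assms cop[of "src C f" "IB (tgt C f)" "%h. ii (tgt C f) h \<bullet> Fm h f"] by auto

lemma indm_ii: "arr C f ==> h : carrier G ==> indm f \<bullet> ii (src C f) h = ii (tgt C f) h \<bullet> Fm h f"
 unfolding indm_def using cop[of "src C f" "IB (tgt C f)" "%h. ii (tgt C f) h \<bullet> Fm h f"] by auto

lemma indm_equi: assumes f [simp]: "arr C f" shows "equi (I (src C f)) (indm f) (I (tgt C f))"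
 unfolding equi_def
proof (intro conjI ballI)
 let ?X = "src C f" and ?Y = "tgt C f"
 fix g assume g [simp]: "g : carrier G"
 show "snd (I ?Y) g \<bullet> indm f = Fm g (indm f) \<bullet> snd (I ?X) g"
 proof (rule Ind_ext_eps[of g ?X])
  fix h assume h [simp]: "h : carrier G"
  have n: "Fm (g \<cdot> h) f \<bullet> eps A g h ?X = eps A g h ?Y \<bullet> Fm g (Fm h f)" using eps_nat[OF g h f] by simp
  let ?l = "(snd (I ?Y) g \<bullet> indm f) \<bullet> (ii ?X (g \<cdot> h) \<bullet> eps A g h ?X)"
  have "?l = snd (I ?Y) g \<bullet> (ii ?Y (g \<cdot> h) \<bullet> (Fm (g \<cdot> h) f \<bullet> eps A g h ?X))"
   by (simp add: reassoc[OF indm_ii])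
  also have "\<dots> = (snd (I ?Y) g \<bullet> (ii ?Y (g \<cdot> h) \<bullet> eps A g h ?Y)) \<bullet> Fm g (Fm h f)" unfolding n by simp
  also have "\<dots> = Fm g (indm f \<bullet> ii ?X h)" unfolding Ind_snd_ii_eps[OF g h arr_obj(2)[OF f]] indm_ii[OF f h] by simp
  also have "\<dots> = (Fm g (indm f) \<bullet> snd (I ?X) g) \<bullet> (ii ?X (g \<cdot> h) \<bullet> eps A g h ?X)" by (simp add: Ind_snd_ii_eps)
  finally show "?l = (Fm g (indm f) \<bullet> snd (I ?X) g) \<bullet> (ii ?X (g \<cdot> h) \<bullet> eps A g h ?X)" .
 qed simp_all
qed simp_all

lemma indm_comp: "arr C f ==> arr C f' ==> src C f' = tgt C f ==> indm (f' \<bullet> f) = indm f' \<bullet> indm f"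
proof -
 assume a [simp]: "arr C f" "arr C f'" "src C f' = tgt C f"
 have b: "h : carrier G ==> indm f' \<bullet> ii (tgt C f) h = ii (tgt C f') h \<bullet> Fm h f'" for h
  using indm_ii[of f' h] by simp
 show ?thesis
  by (rule Ind_ext[of "src C f"]) (use indm_ii[of "f' \<bullet> f"] in \<open>simp_all add: indm_ii reassoc[OF b]\<close>)
qed

lemma indm_Id: assumes [simp]: "X : Obj C" shows "indm (Id C X) = Id C (IB X)"
 by (rule Ind_ext[of X]) (use indm_ii[of "Id C X"] in simp_all)

lemma indm_add:
 assumes [simp]: "arr C f" "arr C f'" "src C f = X" "tgt C f = Y" "src C f' = X" "tgt C f' = Y"
 shows "indm (f \<oplus>[X,Y] f') = indm f \<oplus>[IB X,IB Y] indm f'"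
proof -
 have o [simp]: "X : Obj C" "Y : Obj C" using arr_obj[of f] by simp_all
 have 1: "h : carrier G ==> indm f \<bullet> ii X h = ii Y h \<bullet> Fm h f" "h : carrier G ==> indm f' \<bullet> ii X h = ii Y h \<bullet> Fm h f'" for h
  using indm_ii[of f h] indm_ii[of f' h] by simp_all
 show ?thesis
  by (rule Ind_ext[of X]) (use indm_ii[of "f \<oplus>[X,Y] f'"] in \<open>simp_all add: 1\<close>)
qed

lemma indm_smult:
 assumes [simp]: "arr C f" "src C f = X" "tgt C f = Y" "c : carrier K"
 shows "indm (c \<odot>[X,Y] f) = c \<odot>[IB X,IB Y] indm f"
proof -
 have o [simp]: "X : Obj C" "Y : Obj C" using arr_obj[of f] by simp_all
 have 1: "h : carrier G ==> indm f \<bullet> ii X h = ii Y h \<bullet> Fm h f" for h using indm_ii[of f h] by simp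
 show ?thesis
  by (rule Ind_ext[of X]) (use indm_ii[of "c \<odot>[X,Y] f"] in \<open>simp_all add: 1\<close>)
qed

text \<open>
  The isomorphism \<open>Ind (\<Sigma> X) \<rightarrow> \<Sigma> Ind X\<close> that makes induction a triangle functor.
\<close>

definition om where "om X = cop (So X) (So (IB X)) (%h. Sm (ii X h) \<bullet> Fw h X)"

lemma om [simp]:
 assumes "X : Obj C"
 shows "arr C (om X)" "src C (om X) = IB (So X)" "tgt C (om X) = So (IB X)"
 unfolding om_def using assms cop[of "So X" "So (IB X)" "%h. Sm (ii X h) \<bullet> Fw h X"] by auto

lemma om_ii: "X : Obj C ==> h : carrier G ==> om X \<bullet> ii (So X) h = Sm (ii X h) \<bullet> Fw h X"
 unfolding om_def using cop[of "So X" "So (IB X)" "%h. Sm (ii X h) \<bullet> Fw h X"] by auto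

lemma om_iso [simp]: assumes X [simp]: "X : Obj C" shows "iso_arr C (om X)"
proof -
 note b = Sh.map_biproduct[OF ib[OF X]]
 define c where "c = copair (carrier G) (So (IB X)) (IB (So X)) (%h. Sm (ip X h)) (%h. ii (So X) h \<bullet> inv_arr C (Fw h X))"
 have c [simp]: "arr C c" "src C c = So (IB X)" "tgt C c = IB (So X)"
  and ci: "h : carrier G ==> c \<bullet> Sm (ii X h) = ii (So X) h \<bullet> inv_arr C (Fw h X)" for h
  unfolding c_def using copair[OF b, of "IB (So X)" "%h. ii (So X) h \<bullet> inv_arr C (Fw h X)"] by auto
 show ?thesis
 proof (rule iso_arrI(1)[of _ c])
  have "c \<bullet> om X = Id C (IB (So X))"
   by (rule Ind_ext[of "So X"]) (simp_all add: om_ii reassoc[OF ci])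
  thus "c \<bullet> om X = Id C (src C (om X))" by simp
  have "om X \<bullet> c = Id C (So (IB X))"
   by (rule biproduct_epi[OF b]) (simp_all add: ci reassoc[OF om_ii])
  thus "om X \<bullet> c = Id C (tgt C (om X))" by simp
 qed simp_all
qed

lemma om_equi: assumes X [simp]: "X : Obj C" shows "equi (I (So X)) (om X) (\<Sigma>o E (I X))"
 unfolding equi_def
proof (intro conjI ballI)
 fix g assume g [simp]: "g : carrier G"
 show "snd (\<Sigma>o E (I X)) g \<bullet> om X = Fm g (om X) \<bullet> snd (I (So X)) g"
 proof (rule Ind_ext_eps[of g "So X"])
  fix h assume h [simp]: "h : carrier G"
  let ?w = "inv_arr C (Fw g (IB X))"
  have eo: "Fw (g \<cdot> h) X \<bullet> eps A g h (So X) =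
   Sm (eps A g h X) \<bullet> (Fw g (Fo h X) \<bullet> Fm g (Fw h X))" by (rule eps_omega) simp_all
  have on: "Sm (Fm g (ii X h)) \<bullet> Fw g (Fo h X) = Fw g (IB X) \<bullet> Fm g (Sm (ii X h))"
   using omega_nat[OF g, of "ii X h"] by simp
  let ?l = "(snd (\<Sigma>o E (I X)) g \<bullet> om X) \<bullet> (ii (So X) (g \<cdot> h) \<bullet> eps A g h (So X))"
  have "?l =
   ?w \<bullet> (Sm (snd (I X) g) \<bullet> (Sm (ii X (g \<cdot> h)) \<bullet> (Fw (g \<cdot> h) X \<bullet> eps A g h (So X))))"
   by (simp add: Shift_snd reassoc[OF om_ii])
  also have "\<dots> = ?w \<bullet> (Sm (snd (I X) g \<bullet> (ii X (g \<cdot> h) \<bullet> eps A g h X)) \<bullet> (Fw g (Fo h X) \<bullet> Fm g (Fw h X)))"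
   unfolding eo by simp
  also have "\<dots> = Fm g (Sm (ii X h) \<bullet> Fw h X)"
   unfolding Ind_snd_ii_eps[OF g h X] by (simp add: reassoc[OF on])
  also have "\<dots> = Fm g (om X \<bullet> ii (So X) h)" by (simp only: om_ii[OF X h])
  also have "\<dots> = (Fm g (om X) \<bullet> snd (I (So X)) g) \<bullet> (ii (So X) (g \<cdot> h) \<bullet> eps A g h (So X))"
   by (simp add: Ind_snd_ii_eps)
  finally show "?l =
   (Fm g (om X) \<bullet> snd (I (So X)) g) \<bullet> (ii (So X) (g \<cdot> h) \<bullet> eps A g h (So X))" .
 qed (simp_all add: Shift_snd Sh_E)
qed (simp_all add: Sh_E)

lemma om_nat: assumes f [simp]: "arr C f" shows "om (tgt C f) \<bullet> indm (Sm f) = Sm (indm f) \<bullet> om (src C f)"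
proof (rule Ind_ext[of "So (src C f)"])
 fix h assume h [simp]: "h : carrier G"
 have 1: "indm (Sm f) \<bullet> ii (So (src C f)) h = ii (So (tgt C f)) h \<bullet> Fm h (Sm f)" using indm_ii[of "Sm f" h] by simp
 have "Sm (indm f) \<bullet> (Sm (ii (src C f) h) \<bullet> Fw h (src C f)) = Sm (indm f \<bullet> ii (src C f) h) \<bullet> Fw h (src C f)" by simp
 also have "\<dots> = Sm (ii (tgt C f) h) \<bullet> (Sm (Fm h f) \<bullet> Fw h (src C f))" unfolding indm_ii[OF f h] by simp
 also have "\<dots> = Sm (ii (tgt C f) h) \<bullet> (Fw h (tgt C f) \<bullet> Fm h (Sm f))" by (simp only: omega_nat[OF h f])
 finally show "(om (tgt C f) \<bullet> indm (Sm f)) \<bullet> ii (So (src C f)) h = (Sm (indm f) \<bullet> om (src C f)) \<bullet> ii (So (src C f)) h"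
  by (simp add: 1 om_ii reassoc[OF om_ii])
qed simp_all

lemma indm_exact:
 assumes t: "(X, Y, Z, u, v, w) : Exact C"
 shows "(IB X, IB Y, IB Z, indm u, indm v, om X \<bullet> indm w) : Exact C"
proof -
 note [simp] = exactD[OF t]
 have ea: "(Fo h X, Fo h Y, Fo h Z, Fm h u, Fm h v, Fw h X \<bullet> Fm h w) : Exact C" if "h : carrier G" for h
  using act_autoequivalence[OF that] t unfolding triangle_autoequivalence_def triangle_functor_def by fast
 have 1: "indm w \<bullet> ii Z h = ii (So X) h \<bullet> Fm h w" if "h : carrier G" for h using indm_ii[of w h] that by simp
 show ?thesis
  by (rule exact_direct_sum[OF ea ib ib ib]) (use indm_ii[of u] indm_ii[of v] in \<open>simp_all add: 1 reassoc[OF om_ii]\<close>)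
qed

subsection \<open>Induction with its canonical linearisation\<close>

text \<open>
 The induced object carries commuting endomorphisms \<open>th X \<chi>\<close>, acting on the summand with
 index \<open>h\<close> by \<open>\<chi> h\<close>; they make it an equivariant object for the dual action.
\<close>

definition th where "th X \<chi> = cop X (IB X) (%h. \<chi> h \<odot>[Fo h X,IB X] ii X h)"

lemma th [simp]:
 assumes "X : Obj C" "\<chi> : carrier Gh"
 shows "arr C (th X \<chi>)" "src C (th X \<chi>) = IB X" "tgt C (th X \<chi>) = IB X"
 unfolding th_def using assms cop[of X "IB X" "%h. \<chi> h \<odot>[Fo h X,IB X] ii X h"] by auto

lemma th_ii: "X : Obj C ==> \<chi> : carrier Gh ==> h : carrier G ==> th X \<chi> \<bullet> ii X h = \<chi> h \<odot>[Fo h X,IB X] ii X h"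
 unfolding th_def using cop[of X "IB X" "%h. \<chi> h \<odot>[Fo h X,IB X] ii X h"] by auto

lemma th_mult:
 assumes [simp]: "X : Obj C" "\<chi> : carrier Gh" "\<psi> : carrier Gh"
 shows "th X (\<chi> \<otimes>\<^bsub>Gh\<^esub> \<psi>) = th X \<psi> \<bullet> th X \<chi>"
 by (rule Ind_ext[of X]) (simp_all add: th_ii, simp add: Gh_mult)

lemma th_one: assumes [simp]: "X : Obj C" shows "th X \<one>\<^bsub>Gh\<^esub> = Id C (IB X)"
 by (rule Ind_ext[of X]) (simp_all add: th_ii, simp add: Gh_one)

lemma th_iso [simp]: assumes [simp]: "X : Obj C" "\<chi> : carrier Gh" shows "iso_arr C (th X \<chi>)"
 by (rule iso_arrI(1)[of _ "th X (inv\<^bsub>Gh\<^esub> \<chi>)"]) (simp_all flip: th_mult add: th_one)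

lemma th_equi: assumes X [simp]: "X : Obj C" and chi [simp]: "\<chi> : carrier Gh" shows "equi (I X) (th X \<chi>) (tw \<chi> (I X))"
 unfolding equi_def
proof (intro conjI ballI)
 fix g assume g [simp]: "g : carrier G"
 show "snd (tw \<chi> (I X)) g \<bullet> th X \<chi> = Fm g (th X \<chi>) \<bullet> snd (I X) g"
 proof (rule Ind_ext_eps[of g X])
  fix h assume h [simp]: "h : carrier G"
  let ?l = "(snd (tw \<chi> (I X)) g \<bullet> th X \<chi>) \<bullet> (ii X (g \<cdot> h) \<bullet> eps A g h X)"
  have "?l =
   (\<chi> (inv_G g) \<otimes>\<^bsub>K\<^esub> \<chi> (g \<cdot> h)) \<odot>[Fo g (Fo h X),Fo g (IB X)] (snd (I X) g \<bullet> (ii X (g \<cdot> h) \<bullet> eps A g h X))"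
   by (simp add: reassoc[OF th_ii])
  also have "\<dots> = \<chi> h \<odot>[Fo g (Fo h X),Fo g (IB X)] Fm g (ii X h)"
   unfolding Ind_snd_ii_eps[OF g h X] using charD(3)[OF chi, of "inv_G g" "g \<cdot> h"] by simp
  also have "\<dots> = Fm g (th X \<chi> \<bullet> ii X h)" unfolding th_ii[OF X chi h] by simp
  finally show "?l = (Fm g (th X \<chi>) \<bullet> snd (I X) g) \<bullet> (ii X (g \<cdot> h) \<bullet> eps A g h X)"
   by (simp add: Ind_snd_ii_eps)
 qed simp_all
qed simp_all

text \<open>
  The comparison functor from \<open>T\<close> to the equivariant objects of the dual action.
\<close>

definition LF where
 "LF = \<lparr>FObj = (%X. (I X, \<lambda>\<chi>\<in>carrier Gh. (I X, th X \<chi>, tw \<chi> (I X)))),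
  FMor = (%f. ((I (src C f), \<lambda>\<chi>\<in>carrier Gh. (I (src C f), th (src C f) \<chi>, tw \<chi> (I (src C f)))),
   (I (src C f), indm f, I (tgt C f)),
   (I (tgt C f), \<lambda>\<chi>\<in>carrier Gh. (I (tgt C f), th (tgt C f) \<chi>, tw \<chi> (I (tgt C f)))))),
  omega = (%X. ((I (So X), \<lambda>\<chi>\<in>carrier Gh. (I (So X), th (So X) \<chi>, tw \<chi> (I (So X)))),
   (I (So X), om X, \<Sigma>o E (I X)), \<Sigma>o D.E (I X, \<lambda>\<chi>\<in>carrier Gh. (I X, th X \<chi>, tw \<chi> (I X)))))\<rparr>"

lemma LF_simps: "fst (FObj LF X) = I X" "\<chi> : carrier Gh ==> snd (FObj LF X) \<chi> = (I X, th X \<chi>, tw \<chi> (I X))"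
 "FMor LF f = (FObj LF (src C f), (I (src C f), indm f, I (tgt C f)), FObj LF (tgt C f))"
 "omega LF X = (FObj LF (So X), (I (So X), om X, \<Sigma>o E (I X)), \<Sigma>o D.E (FObj LF X))"
 unfolding LF_def by simp_all

lemma LF_obj [simp]: assumes X [simp]: "X : Obj C" shows "FObj LF X : Obj D.E"
proof -
 have a: "arr E (I X, th X \<chi>, tw \<chi> (I X))" if "\<chi> : carrier Gh" for \<chi> using that th_equi by (simp add: arr_E)
 have "(fst (FObj LF X), snd (FObj LF X)) : Obj D.E"
 proof (rule D.objI)
  show "snd (FObj LF X) : extensional (carrier Gh)" unfolding LF_def by simp
  fix \<chi> assume chi [simp]: "\<chi> : carrier Gh"
  show "iso_arr E (snd (FObj LF X) \<chi>)" using iso_E[OF a[OF chi]] by (simp add: LF_simps)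
  show "src E (snd (FObj LF X) \<chi>) = fst (FObj LF X)" "tgt E (snd (FObj LF X) \<chi>) = FObj (act Ad \<chi>) (fst (FObj LF X))"
   using a[OF chi] by (simp_all add: LF_simps)
  fix \<psi> assume psi [simp]: "\<psi> : carrier Gh"
  show "snd (FObj LF X) (\<chi> \<otimes>\<^bsub>Gh\<^esub> \<psi>) = eps Ad \<chi> \<psi> (fst (FObj LF X)) \<star> (FMor (act Ad \<chi>) (snd (FObj LF X) \<psi>) \<star> snd (FObj LF X) \<chi>)"
   by (simp add: LF_simps E_ops tw_tw th_mult)
 qed (simp add: LF_simps)
 thus ?thesis by simp
qed

lemma D_Shift_snd:
 assumes d [simp]: "d : Obj D.E" and chi [simp]: "\<chi> : carrier Gh"
 shows "snd (\<Sigma>o D.E d) \<chi> = \<Sigma>m E (snd d \<chi>)"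
proof -
 note [simp] = D.objE[OF d]
 have "snd (\<Sigma>o D.E d) \<chi> = inv_arr E (Id E (\<Sigma>o E (tw \<chi> (fst d)))) \<star> \<Sigma>m E (snd d \<chi>)"
  unfolding D.Shift_E equivariant_shift_def by (simp add: tw_shift)
 thus ?thesis by simp
qed

lemma D_equiI:
 assumes "arr E m" "src E m = fst d" "tgt E m = fst d'" "d : Obj D.E" "d' : Obj D.E"
  and e: "!!\<chi>. \<chi> : carrier Gh ==> FMor forget (snd d' \<chi>) \<bullet> FMor forget m = FMor forget m \<bullet> FMor forget (snd d \<chi>)"
 shows "D.equi d m d'"
 unfolding D.equi_def
proof (intro conjI ballI assms(1-3))
 fix \<chi> assume chi [simp]: "\<chi> : carrier Gh"
 note [simp] = assms(1-5)
 interpret X: lin_equivalence K E E "act Ad \<chi>" by (rule tw_equivalence[OF chi])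
 have f: "FMor forget (FMor (act Ad \<chi>) m) = FMor forget m" by (cases m) simp
 show "snd d' \<chi> \<star> m = FMor (act Ad \<chi>) m \<star> snd d \<chi>"
 proof (rule Fo.inj)
  show "FMor forget (snd d' \<chi> \<star> m) = FMor forget (FMor (act Ad \<chi>) m \<star> snd d \<chi>)"
   using e[OF chi] by (simp add: f)
 qed simp_all
qed

lemma LF_mor_arr: assumes f [simp]: "arr C f" shows "arr D.E (FMor LF f)"
proof -
 have a: "arr E (I (src C f), indm f, I (tgt C f))" using indm_equi[OF f] by (simp add: arr_E)
 have "D.equi (FObj LF (src C f)) (I (src C f), indm f, I (tgt C f)) (FObj LF (tgt C f))"
 proof (rule D_equiI)
  fix \<chi> assume chi [simp]: "\<chi> : carrier Gh"
  have "th (tgt C f) \<chi> \<bullet> indm f = indm f \<bullet> th (src C f) \<chi>"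
   by (rule Ind_ext[of "src C f"]) (simp_all add: indm_ii th_ii reassoc[OF th_ii])
  thus "FMor forget (snd (FObj LF (tgt C f)) \<chi>) \<bullet> FMor forget (I (src C f), indm f, I (tgt C f)) =
   FMor forget (I (src C f), indm f, I (tgt C f)) \<bullet> FMor forget (snd (FObj LF (src C f)) \<chi>)"
   by (simp add: LF_simps)
 qed (use a in \<open>simp_all add: LF_simps(1)\<close>)
 thus ?thesis by (simp add: LF_simps(3) D.arr_E)
qed

lemma LF_omega: assumes X [simp]: "X : Obj C"
 shows "iso_arr D.E (omega LF X)" "src D.E (omega LF X) = FObj LF (So X)" "tgt D.E (omega LF X) = \<Sigma>o D.E (FObj LF X)"
proof -
 have a: "arr E (I (So X), om X, \<Sigma>o E (I X))" using om_equi[OF X] by (simp add: arr_E)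
 have "D.equi (FObj LF (So X)) (I (So X), om X, \<Sigma>o E (I X)) (\<Sigma>o D.E (FObj LF X))"
 proof (rule D_equiI)
  fix \<chi> assume chi [simp]: "\<chi> : carrier Gh"
  have 1: "th (So X) \<chi> \<bullet> ii (So X) h = \<chi> h \<odot>[Fo h (So X),IB (So X)] ii (So X) h" if "h : carrier G" for h
   using that by (simp add: th_ii)
  have 2: "Sm (th X \<chi>) \<bullet> Sm (ii X h) = \<chi> h \<odot>[So (Fo h X),So (IB X)] Sm (ii X h)" if "h : carrier G" for h
  proof -
   have "Sm (th X \<chi>) \<bullet> Sm (ii X h) = Sm (th X \<chi> \<bullet> ii X h)" using that by simp
   thus ?thesis unfolding th_ii[OF X chi that] using that by simp
  qed
  have e: "Sm (th X \<chi>) \<bullet> om X = om X \<bullet> th (So X) \<chi>"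
   by (rule Ind_ext[of "So X"]) (simp_all add: om_ii 1 reassoc[OF 2])
  have "snd (\<Sigma>o D.E (FObj LF X)) \<chi> = \<Sigma>m E (snd (FObj LF X) \<chi>)" by (rule D_Shift_snd) simp_all
  hence "FMor forget (snd (\<Sigma>o D.E (FObj LF X)) \<chi>) = Sm (th X \<chi>)" by (simp add: Sh_E LF_simps)
  thus "FMor forget (snd (\<Sigma>o D.E (FObj LF X)) \<chi>) \<bullet> FMor forget (I (So X), om X, \<Sigma>o E (I X)) =
   FMor forget (I (So X), om X, \<Sigma>o E (I X)) \<bullet> FMor forget (snd (FObj LF (So X)) \<chi>)"
   using e by (simp add: LF_simps)
 qed (use a in \<open>simp_all add: LF_simps(1) D.Sh_E\<close>)
 hence b: "arr D.E (omega LF X)" by (simp add: LF_simps(4) D.arr_E)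
 show "iso_arr D.E (omega LF X)" using D.iso_E[OF b[unfolded LF_simps(4)]] iso_E[OF a] by (simp add: LF_simps(4))
 show "src D.E (omega LF X) = FObj LF (So X)" "tgt D.E (omega LF X) = \<Sigma>o D.E (FObj LF X)"
  using b by (simp_all add: LF_simps(4))
qed

lemma LF_exact_functor: "exact_functor K C D.E LF"
proof -
 have l: "linear_functor K C D.E LF"
  unfolding linear_functor_def
  using LF_mor_arr
  by (auto simp: LF_simps(3) D.E_ops E_ops indm_comp indm_Id indm_add indm_smult LF_simps(1))
 interpret l: lin_functor K C D.E LF by unfold_locales (fact l)
 have u: "FMor forget (FMor D.forget (FMor LF f)) = indm f" for f by (simp add: LF_simps(3))
 have u': "FMor forget (FMor D.forget (omega LF X)) = om X" for X by (simp add: LF_simps(4))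
 have n: "nat_iso C D.E (comp_functor LF (Shift C)) (comp_functor (Shift D.E) LF) (omega LF)"
  unfolding nat_iso_def comp_functor_def
 proof (intro conjI ballI, simp_all only: cat_functor.simps comp_def)
  fix X assume X [simp]: "X : Obj C"
  note [simp] = LF_omega[OF X]
  show "iso_mor D.E (FObj LF (So X)) (\<Sigma>o D.E (FObj LF X)) (omega LF X)" by simp
  fix Y f assume Y [simp]: "Y : Obj C" and "f : Homs C X Y"
  hence f [simp]: "arr C f" "src C f = X" "tgt C f = Y" by auto
  note [simp] = LF_omega[OF Y]
  show "omega LF Y \<bullet>\<^bsub>D.E\<^esub> FMor LF (Sm f) = \<Sigma>m D.E (FMor LF f) \<bullet>\<^bsub>D.E\<^esub> omega LF X"
  proof (rule D.Fo.inj, rule Fo.inj)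
   let ?l = "FMor forget (FMor D.forget (omega LF Y \<bullet>\<^bsub>D.E\<^esub> FMor LF (Sm f)))"
   have "?l = om Y \<bullet> indm (Sm f)"
    by (simp add: u u')
   also have "\<dots> = Sm (indm f) \<bullet> om X" using om_nat[OF f(1)] by simp
   also have "\<dots> = FMor forget (FMor D.forget (\<Sigma>m D.E (FMor LF f) \<bullet>\<^bsub>D.E\<^esub> omega LF X))"
    by (simp add: u u' D.Sh_E Sh_E)
   finally show "?l =
    FMor forget (FMor D.forget (\<Sigma>m D.E (FMor LF f) \<bullet>\<^bsub>D.E\<^esub> omega LF X))" .
  qed simp_all
 qed
 have ex: "(FObj LF X, FObj LF Y, FObj LF Z, FMor LF u, FMor LF v, omega LF X \<bullet>\<^bsub>D.E\<^esub> FMor LF w) : Exact D.E"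
  if t: "(X, Y, Z, u, v, w) : Exact C" for X Y Z u v w
 proof -
  note [simp] = exactD[OF t] LF_omega[OF exactD(1)[OF t]]
  have e: "(IB X, IB Y, IB Z, indm u, indm v, om X \<bullet> indm w) : Exact C" by (rule indm_exact[OF t])
  show ?thesis
   unfolding D.Exact_E Exact_E using e by (simp add: u u' LF_simps(1) D.Sh_E)
 qed
 show ?thesis
  by unfold_locales (use l n ex in \<open>auto simp: triangle_functor_def\<close>)
qed

sublocale L: exact_functor K C D.E LF by (rule LF_exact_functor)

end


section \<open>Descent along the idempotents of the characters\<close>

lemma mutual_equivalence:
 assumes F: "lin_functor K C D F" and H: "lin_functor K D C H"
  and e: "!!X. X : Obj C ==> iso_arr C (\<eta> X)" "!!X. X : Obj C ==> src C (\<eta> X) = X"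
   "!!X. X : Obj C ==> tgt C (\<eta> X) = FObj H (FObj F X)"
  and en: "!!f. arr C f ==> \<eta> (tgt C f) \<bullet>\<^bsub>C\<^esub> f = FMor H (FMor F f) \<bullet>\<^bsub>C\<^esub> \<eta> (src C f)"
  and t: "!!Y. Y : Obj D ==> iso_arr D (\<theta> Y)" "!!Y. Y : Obj D ==> src D (\<theta> Y) = FObj F (FObj H Y)"
   "!!Y. Y : Obj D ==> tgt D (\<theta> Y) = Y"
  and tn: "!!f. arr D f ==> \<theta> (tgt D f) \<bullet>\<^bsub>D\<^esub> FMor F (FMor H f) = f \<bullet>\<^bsub>D\<^esub> \<theta> (src D f)"
 shows "lin_equivalence K C D F" "lin_equivalence K D C H"
proof -
 interpret F: lin_functor K C D F by fact
 interpret H: lin_functor K D C H by fact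
 note [simp] = e t
 have en': "inv_arr C (\<eta> (tgt C f)) \<bullet>\<^bsub>C\<^esub> FMor H (FMor F f) = f \<bullet>\<^bsub>C\<^esub> inv_arr C (\<eta> (src C f))" if f [simp]: "arr C f" for f
 proof -
  have "inv_arr C (\<eta> (tgt C f)) \<bullet>\<^bsub>C\<^esub> FMor H (FMor F f) =
   inv_arr C (\<eta> (tgt C f)) \<bullet>\<^bsub>C\<^esub> ((FMor H (FMor F f) \<bullet>\<^bsub>C\<^esub> \<eta> (src C f)) \<bullet>\<^bsub>C\<^esub> inv_arr C (\<eta> (src C f)))" by simp
  thus ?thesis by (simp flip: en)
 qed
 have tn': "inv_arr D (\<theta> (tgt D f)) \<bullet>\<^bsub>D\<^esub> f = FMor F (FMor H f) \<bullet>\<^bsub>D\<^esub> inv_arr D (\<theta> (src D f))" if f [simp]: "arr D f" for f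
 proof -
  have "inv_arr D (\<theta> (tgt D f)) \<bullet>\<^bsub>D\<^esub> f =
   inv_arr D (\<theta> (tgt D f)) \<bullet>\<^bsub>D\<^esub> ((f \<bullet>\<^bsub>D\<^esub> \<theta> (src D f)) \<bullet>\<^bsub>D\<^esub> inv_arr D (\<theta> (src D f)))" by simp
  thus ?thesis by (simp flip: tn)
 qed
 let ?H = "\<lparr>FObj = FObj H, FMor = FMor H\<rparr>" and ?F = "\<lparr>FObj = FObj F, FMor = FMor F\<rparr>"
 have lH: "linear_functor K D C ?H" using H.lin unfolding linear_functor_def by simp
 have lF: "linear_functor K C D ?F" using F.lin unfolding linear_functor_def by simp
 have "nat_iso C C id_functor (comp_functor ?H F) \<eta>" "nat_iso D D (comp_functor F ?H) id_functor \<theta>"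
  using en tn by (auto simp: nat_iso_def comp_functor_def id_functor_def)
 hence "equivalence_functor K C D F" unfolding equivalence_functor_def using F.lin lH by blast
 thus "lin_equivalence K C D F" by (rule F.C.equivalence_imp_lin_equivalence[OF F.D.linear_category_axioms])
 have "nat_iso D D id_functor (comp_functor ?F H) (%Y. inv_arr D (\<theta> Y))" "nat_iso C C (comp_functor H ?F) id_functor (%X. inv_arr C (\<eta> X))"
  using en' tn' by (auto simp: nat_iso_def comp_functor_def id_functor_def)
 hence "equivalence_functor K D C H" unfolding equivalence_functor_def using H.lin lF by blast
 thus "lin_equivalence K D C H" by (rule F.D.equivalence_imp_lin_equivalence[OF F.C.linear_category_axioms])
qed

context splitting
begin

abbreviation "dX d \<equiv> fst (fst d)"
abbreviation "al d \<equiv> snd (fst d)"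
abbreviation "un m \<equiv> FMor forget (FMor D.forget m)"
text \<open>
  The automorphism of the underlying object of \<open>d\<close> by which \<open>\<chi>\<close> acts.
\<close>

definition t :: "('g => 'k, ('g, 'o, 'm) eobj, ('g, 'o, 'm) emor) eobj => ('g => 'k) => 'm"
 where "t d \<chi> = FMor forget (snd d \<chi>)"

lemma dX [simp]:
 assumes "d : Obj D.E"
 shows "fst d : Obj E" "dX d : Obj C"
 using D.objE[OF assms] objE by auto

lemma al [simp]:
 assumes "d : Obj D.E" "g : carrier G"
 shows "iso_arr C (al d g)" "src C (al d g) = dX d" "tgt C (al d g) = Fo g (dX d)"
 using objE[OF dX(1)[OF assms(1)]] assms(2) by simp_all

lemma al_mult: "d : Obj D.E ==> g : carrier G ==> h : carrier G ==>
  al d (g \<cdot> h) = eps A g h (dX d) \<bullet> (Fm g (al d h) \<bullet> al d g)"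
 using objE(6)[OF dX(1)] by simp

lemma t [simp]:
 assumes "d : Obj D.E" "\<chi> : carrier Gh"
 shows "arr C (t d \<chi>)" "src C (t d \<chi>) = dX d" "tgt C (t d \<chi>) = dX d"
 unfolding t_def using D.objE[OF assms(1)] assms by simp_all

lemma t_mult:
 assumes d [simp]: "d : Obj D.E" and chi [simp]: "\<chi> : carrier Gh" and psi [simp]: "\<psi> : carrier Gh"
 shows "t d (\<chi> \<otimes>\<^bsub>Gh\<^esub> \<psi>) = t d \<psi> \<bullet> t d \<chi>"
proof -
 note o [simp] = D.objE[OF d]
 interpret X: lin_equivalence K E E "act Ad \<chi>" by (rule tw_equivalence[OF chi])
 have f: "FMor forget (FMor (act Ad \<chi>) (snd d \<psi>)) = FMor forget (snd d \<psi>)" by (cases "snd d \<psi>") simp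
 show ?thesis unfolding t_def D.objE(6)[OF d chi psi]
  by (subst Fo.map_comp) (simp_all add: f)
qed

lemma t_one: assumes d [simp]: "d : Obj D.E" shows "t d \<one>\<^bsub>Gh\<^esub> = Id C (dX d)"
proof -
 have i: "iso_arr C (t d \<one>\<^bsub>Gh\<^esub>)" unfolding t_def using D.objE(3)[OF d, of "\<one>\<^bsub>Gh\<^esub>"] Fo.map_iso(1) by simp
 have "t d \<one>\<^bsub>Gh\<^esub> \<bullet> t d \<one>\<^bsub>Gh\<^esub> = t d \<one>\<^bsub>Gh\<^esub> \<bullet> Id C (dX d)" using t_mult[OF d, of "\<one>\<^bsub>Gh\<^esub>" "\<one>\<^bsub>Gh\<^esub>"] by simp
 thus ?thesis by (rule iso_cancel_left[OF i]) simp_all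
qed

lemma t_al:
 assumes d [simp]: "d : Obj D.E" and chi [simp]: "\<chi> : carrier Gh" and g [simp]: "g : carrier G"
 shows "Fm g (t d \<chi>) \<bullet> al d g = \<chi> (inv_G g) \<odot>[dX d,Fo g (dX d)] (al d g \<bullet> t d \<chi>)"
proof -
 note [simp] = D.objE[OF d]
 have a: "arr E (snd d \<chi>)" by simp
 have "snd (tw \<chi> (fst d)) g \<bullet> t d \<chi> = Fm g (t d \<chi>) \<bullet> al d g"
  using arr_underlying(4)[OF a g] unfolding t_def forget_def by simp
 thus ?thesis by simp
qed

lemma un_arr [simp]:
 assumes "arr D.E m"
 shows "arr C (un m)" "src C (un m) = dX (src D.E m)" "tgt C (un m) = dX (tgt D.E m)"
 using assms by simp_all

lemma t_nat:
 assumes m [simp]: "arr D.E m" and chi [simp]: "\<chi> : carrier Gh"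
 shows "t (tgt D.E m) \<chi> \<bullet> un m = un m \<bullet> t (src D.E m) \<chi>"
proof -
 note [simp] = D.objE[OF D.E.arr_obj(1)[OF m]] D.objE[OF D.E.arr_obj(2)[OF m]]
 interpret X: lin_equivalence K E E "act Ad \<chi>" by (rule tw_equivalence[OF chi])
 have f: "FMor forget (FMor (act Ad \<chi>) n) = FMor forget n" for n by (cases n) simp
 have a: "arr E (FMor D.forget m)" "src E (FMor D.forget m) = fst (src D.E m)" "tgt E (FMor D.forget m) = fst (tgt D.E m)"
  by simp_all
 have "snd (tgt D.E m) \<chi> \<star> FMor D.forget m = FMor (act Ad \<chi>) (FMor D.forget m) \<star> snd (src D.E m) \<chi>"
  using D.arr_underlying(4)[OF m chi] unfolding D.forget_def by simp
 hence "FMor forget (snd (tgt D.E m) \<chi> \<star> FMor D.forget m) = FMor forget (FMor (act Ad \<chi>) (FMor D.forget m) \<star> snd (src D.E m) \<chi>)"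
  by (rule arg_cong)
 thus ?thesis unfolding t_def using a by (simp add: f)
qed

lemma al_nat:
 assumes m: "arr D.E m" and g: "g : carrier G"
 shows "al (tgt D.E m) g \<bullet> un m = Fm g (un m) \<bullet> al (src D.E m) g"
proof -
 have a: "arr E (FMor D.forget m)" "src E (FMor D.forget m) = fst (src D.E m)" "tgt E (FMor D.forget m) = fst (tgt D.E m)"
  using m by simp_all
 show ?thesis using arr_underlying(4)[OF a(1) g] unfolding a by (simp add: forget_def)
qed

lemma ordK_inv: "inv\<^bsub>K\<^esub> ordK : carrier K" "inv\<^bsub>K\<^esub> ordK \<otimes>\<^bsub>K\<^esub> ordK = \<one>\<^bsub>K\<^esub>"
 using ordK_closed ordK_nonzero by (auto simp: field_Units)

text \<open>
  The coefficients of the primitive idempotents of the group algebra of the dual group.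
\<close>

definition "cf g \<chi> = inv\<^bsub>K\<^esub> ordK \<otimes>\<^bsub>K\<^esub> \<chi> (inv_G g)"

lemma cf [simp]: "g : carrier G ==> \<chi> : carrier Gh ==> cf g \<chi> : carrier K"
 unfolding cf_def using ordK_inv by simp

lemma cf_mult: "g : carrier G ==> h : carrier G ==> \<chi> : carrier Gh ==> cf h \<chi> \<otimes>\<^bsub>K\<^esub> \<chi> (inv_G g) = cf (g \<cdot> h) \<chi>"
 unfolding cf_def using ordK_inv charD(3)[of \<chi> "inv_G h" "inv_G g"] by (simp add: G.inv_mult_group m_assoc)

lemma cf_sum:
 assumes g [simp]: "g : carrier G" and h [simp]: "h : carrier G"
 shows "finsum K (%\<chi>. cf g \<chi> \<otimes>\<^bsub>K\<^esub> \<chi> h) (carrier Gh) = (if g = h then \<one>\<^bsub>K\<^esub> else \<zero>\<^bsub>K\<^esub>)"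
proof -
 have "finsum K (%\<chi>. cf g \<chi> \<otimes>\<^bsub>K\<^esub> \<chi> h) (carrier Gh) = finsum K (%\<chi>. inv\<^bsub>K\<^esub> ordK \<otimes>\<^bsub>K\<^esub> \<chi> (inv_G g \<cdot> h)) (carrier Gh)"
  by (rule finsum_cong') (auto simp: cf_def ordK_inv charD(3) m_assoc)
 also have "\<dots> = inv\<^bsub>K\<^esub> ordK \<otimes>\<^bsub>K\<^esub> finsum K (%\<chi>. \<chi> (inv_G g \<cdot> h)) (carrier Gh)"
  by (rule finsum_rdistr[symmetric]) (auto simp: finGh ordK_inv)
 also have "\<dots> = (if g = h then \<one>\<^bsub>K\<^esub> else \<zero>\<^bsub>K\<^esub>)"
 proof -
  have "inv_G g \<cdot> h = one_G \<longleftrightarrow> g = h"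
   by (metis G.inv_equality G.inv_inv G.l_inv g h G.inv_closed)
  thus ?thesis using sum_chars[of "inv_G g \<cdot> h"] ordK_inv by simp
 qed
 finally show ?thesis .
qed

text \<open>
  The projection onto the simultaneous eigenspace on which every \<open>\<chi>\<close> acts by \<open>\<chi> g\<close>.
\<close>

definition "e d g = finsum (Hom C (dX d) (dX d)) (%\<chi>. cf g \<chi> \<odot>[dX d,dX d] t d \<chi>) (carrier Gh)"

lemma e [simp]:
 assumes "d : Obj D.E" "g : carrier G"
 shows "arr C (e d g)" "src C (e d g) = dX d" "tgt C (e d g) = dX d"
 unfolding e_def using assms by simp_all

text \<open>Multiplication by \<open>\<psi>\<close> permutes the characters.\<close>

lemma t_e:
 assumes d [simp]: "d : Obj D.E" and psi [simp]: "\<psi> : carrier Gh" and h [simp]: "h : carrier G"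
 shows "t d \<psi> \<bullet> e d h = \<psi> h \<odot>[dX d,dX d] e d h"
proof -
 let ?H = "Hom C (dX d) (dX d)"
 have b: "bij_betw (%\<chi>. \<chi> \<otimes>\<^bsub>Gh\<^esub> \<psi>) (carrier Gh) (carrier Gh)"
  by (rule bij_betwI[where g = "%\<chi>. \<chi> \<otimes>\<^bsub>Gh\<^esub> inv\<^bsub>Gh\<^esub> \<psi>"]) (auto simp: Gh.m_assoc)
 have 1: "\<psi> h \<otimes>\<^bsub>K\<^esub> cf h (\<chi> \<otimes>\<^bsub>Gh\<^esub> \<psi>) = cf h \<chi>" if chi: "\<chi> : carrier Gh" for \<chi>
 proof -
  have "\<psi> h \<otimes>\<^bsub>K\<^esub> cf h (\<chi> \<otimes>\<^bsub>Gh\<^esub> \<psi>) = cf h \<chi> \<otimes>\<^bsub>K\<^esub> (\<psi> (inv_G h) \<otimes>\<^bsub>K\<^esub> \<psi> h)"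
   unfolding cf_def using chi ordK_inv by (simp add: Gh_mult m_ac)
  thus ?thesis using chi by (simp add: char_inv)
 qed
 have "\<psi> h \<odot>\<^bsub>?H\<^esub> e d h = finsum ?H (%\<chi>. (\<psi> h \<otimes>\<^bsub>K\<^esub> cf h \<chi>) \<odot>\<^bsub>?H\<^esub> t d \<chi>) (carrier Gh)"
  unfolding e_def by (subst smult_sum) (auto simp: finGh intro!: sum_cong)
 also have "\<dots> = finsum ?H (%\<chi>. (\<psi> h \<otimes>\<^bsub>K\<^esub> cf h (\<chi> \<otimes>\<^bsub>Gh\<^esub> \<psi>)) \<odot>\<^bsub>?H\<^esub> t d (\<chi> \<otimes>\<^bsub>Gh\<^esub> \<psi>)) (carrier Gh)"
  by (rule sum_reindex[OF _ _ b]) simp_all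
 also have "\<dots> = t d \<psi> \<bullet> e d h"
  unfolding e_def by (subst comp_sum) (auto simp: t_mult 1 intro!: sum_cong)
 finally show ?thesis by simp
qed

lemma e_e:
 assumes d [simp]: "d : Obj D.E" and k [simp]: "k : carrier G" and h [simp]: "h : carrier G"
 shows "e d k \<bullet> e d h = (if k = h then e d h else \<zero>[dX d,dX d])"
proof -
 let ?H = "Hom C (dX d) (dX d)"
 have "e d k \<bullet> e d h = finsum ?H (%\<chi>. (cf k \<chi> \<otimes>\<^bsub>K\<^esub> \<chi> h) \<odot>\<^bsub>?H\<^esub> e d h) (carrier Gh)"
  by (subst e_def[of d k], subst comp_sum) (auto simp: t_e intro!: sum_cong)
 also have "\<dots> = finsum K (%\<chi>. cf k \<chi> \<otimes>\<^bsub>K\<^esub> \<chi> h) (carrier Gh) \<odot>\<^bsub>?H\<^esub> e d h"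
  by (rule sum_smult) (simp_all add: finGh)
 finally show ?thesis by (simp add: cf_sum)
qed

text \<open>Summed over all \<open>g\<close>, only the trivial character survives.\<close>

lemma e_sum:
 assumes d [simp]: "d : Obj D.E"
 shows "finsum (Hom C (dX d) (dX d)) (e d) (carrier G) = Id C (dX d)"
proof -
 let ?H = "Hom C (dX d) (dX d)"
 have c: "finsum K (%g. cf g \<chi>) (carrier G) = (if \<chi> = \<one>\<^bsub>Gh\<^esub> then \<one>\<^bsub>K\<^esub> else \<zero>\<^bsub>K\<^esub>)" if chi [simp]: "\<chi> : carrier Gh" for \<chi>
 proof -
  have "finsum K (%g. cf g \<chi>) (carrier G) = finsum K (%g. inv\<^bsub>K\<^esub> ordK \<otimes>\<^bsub>K\<^esub> (inv\<^bsub>Gh\<^esub> \<chi>) g) (carrier G)"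
   by (rule finsum_cong') (auto simp: cf_def Gh_inv ordK_inv)
  also have "\<dots> = inv\<^bsub>K\<^esub> ordK \<otimes>\<^bsub>K\<^esub> finsum K (inv\<^bsub>Gh\<^esub> \<chi>) (carrier G)"
   by (rule finsum_rdistr[symmetric]) (auto simp: finG ordK_inv)
  also have "\<dots> = (if \<chi> = \<one>\<^bsub>Gh\<^esub> then \<one>\<^bsub>K\<^esub> else \<zero>\<^bsub>K\<^esub>)"
  proof (cases "\<chi> = \<one>\<^bsub>Gh\<^esub>")
   case True
   have "finsum K (inv\<^bsub>Gh\<^esub> \<chi>) (carrier G) = ordK"
    unfolding ordK_def True Gh.inv_one by (rule finsum_cong') (auto simp: Gh_one)
   thus ?thesis using True ordK_inv by simp
  next
   case False
   hence "inv\<^bsub>Gh\<^esub> \<chi> \<noteq> \<one>\<^bsub>Gh\<^esub>" using Gh.inv_inv[OF chi] Gh.inv_one by metis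
   thus ?thesis using sum_char[of "inv\<^bsub>Gh\<^esub> \<chi>"] False ordK_inv by simp
  qed
  finally show ?thesis .
 qed
 have "finsum ?H (e d) (carrier G) = finsum ?H (%\<chi>. finsum ?H (%g. cf g \<chi> \<odot>\<^bsub>?H\<^esub> t d \<chi>) (carrier G)) (carrier Gh)"
  unfolding e_def by (rule sum_swap) (simp_all add: finG finGh)
 also have "\<dots> = finsum ?H (%\<chi>. (if \<chi> = \<one>\<^bsub>Gh\<^esub> then \<one>\<^bsub>K\<^esub> else \<zero>\<^bsub>K\<^esub>) \<odot>\<^bsub>?H\<^esub> t d \<chi>) (carrier Gh)"
  by (rule sum_cong) (simp_all add: sum_smult finG c)
 also have "\<dots> = Id C (dX d)"
  by (subst sum_eq_single[where j = "\<one>\<^bsub>Gh\<^esub>"]) (simp_all add: finGh t_one)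
 finally show ?thesis .
qed

text \<open>
  The structure morphisms \<open>\<alpha>\<^sub>g\<close> permute the eigenspaces.
\<close>

lemma al_e:
 assumes d [simp]: "d : Obj D.E" and g [simp]: "g : carrier G" and h [simp]: "h : carrier G"
 shows "Fm g (e d h) \<bullet> al d g = al d g \<bullet> e d (g \<cdot> h)"
proof -
 interpret X: lin_functor K C C "act A g" by (rule act_functor[OF g])
 let ?H = "Hom C (dX d) (Fo g (dX d))"
 have "Fm g (e d h) \<bullet> al d g = finsum ?H (%\<chi>. cf (g \<cdot> h) \<chi> \<odot>\<^bsub>?H\<^esub> (al d g \<bullet> t d \<chi>)) (carrier Gh)"
  unfolding e_def by (simp, rule sum_cong) (simp_all add: t_al cf_mult)
 also have "\<dots> = al d g \<bullet> e d (g \<cdot> h)"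
  unfolding e_def by (subst comp_sum) (auto intro!: sum_cong)
 finally show ?thesis .
qed

lemma e_nat:
 assumes m [simp]: "arr D.E m" and g [simp]: "g : carrier G"
 shows "e (tgt D.E m) g \<bullet> un m = un m \<bullet> e (src D.E m) g"
 unfolding e_def by (simp, rule sum_cong) (simp_all add: t_nat)

lemma t_shift:
 assumes d [simp]: "d : Obj D.E" and chi [simp]: "\<chi> : carrier Gh"
 shows "t (\<Sigma>o D.E d) \<chi> = Sm (t d \<chi>)"
 unfolding t_def by (simp add: D_Shift_snd Sh_E)

lemma dX_shift [simp]: "dX (\<Sigma>o D.E d) = So (dX d)"
 by (simp add: D.Sh_E Sh_E)

lemma e_shift:
 assumes d [simp]: "d : Obj D.E" and g [simp]: "g : carrier G"
 shows "e (\<Sigma>o D.E d) g = Sm (e d g)"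
 unfolding e_def by (simp, rule sum_cong) (simp_all add: t_shift)

lemma al_shift: "d : Obj D.E ==> g : carrier G ==>
  al (\<Sigma>o D.E d) g = inv_arr C (Fw g (dX d)) \<bullet> Sm (al d g)"
 by (simp add: D.Sh_E Shift_snd)

lemma LF_t: "\<chi> : carrier Gh ==> t (FObj LF X) \<chi> = th X \<chi>"
 unfolding t_def by (simp add: LF_simps)

lemma LF_dX [simp]: "dX (FObj LF X) = IB X" "al (FObj LF X) = snd (I X)"
 by (simp_all add: LF_simps)

lemma LF_un: "un (FMor LF f) = indm f" "un (omega LF X) = om X"
 by (simp_all add: LF_simps)

lemma LF_e: assumes X [simp]: "X : Obj C" and g [simp]: "g : carrier G"
 shows "e (FObj LF X) g = ii X g \<bullet> ip X g"
proof (rule Ind_ext[OF X])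
 fix h assume h [simp]: "h : carrier G"
 let ?H = "Hom C (Fo h X) (IB X)"
 have "e (FObj LF X) g \<bullet> ii X h = finsum ?H (%\<chi>. (cf g \<chi> \<otimes>\<^bsub>K\<^esub> \<chi> h) \<odot>\<^bsub>?H\<^esub> ii X h) (carrier Gh)"
  unfolding e_def by (subst comp_sum) (auto simp: LF_t th_ii intro!: sum_cong)
 also have "\<dots> = finsum K (%\<chi>. cf g \<chi> \<otimes>\<^bsub>K\<^esub> \<chi> h) (carrier Gh) \<odot>\<^bsub>?H\<^esub> ii X h"
  by (rule sum_smult) (simp_all add: finGh)
 also have "\<dots> = (ii X g \<bullet> ip X g) \<bullet> ii X h"
  by (cases "g = h") (simp_all add: cf_sum)
 finally show "e (FObj LF X) g \<bullet> ii X h = (ii X g \<bullet> ip X g) \<bullet> ii X h" .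
qed (use e[of "FObj LF X" g] in simp_all)

subsection \<open>The functor of eigenobjects\<close>

text \<open>
  A splitting \<open>kO d\<close> of the projection onto the trivial eigenspace, with retraction \<open>kr d\<close> and
  section \<open>ks d\<close>.
\<close>

definition "sp d = (SOME (Y, r, s). Y : Obj C & arr C r & src C r = dX d & tgt C r = Y &
  arr C s & src C s = Y & tgt C s = dX d & s \<bullet> r = e d one_G & r \<bullet> s = Id C Y)"
definition "kO d = fst (sp d)"
definition "kr d = fst (snd (sp d))"
definition "ks d = snd (snd (sp d))"

lemma ksplit:
 assumes d: "d : Obj D.E"
 shows "kO d : Obj C & arr C (kr d) & src C (kr d) = dX d & tgt C (kr d) = kO d &
  arr C (ks d) & src C (ks d) = kO d & tgt C (ks d) = dX d & ks d \<bullet> kr d = e d one_G & kr d \<bullet> ks d = Id C (kO d)"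
proof -
 note [simp] = d
 let ?P = "%(Y, r, s). Y : Obj C & arr C r & src C r = dX d & tgt C r = Y &
  arr C s & src C s = Y & tgt C s = dX d & s \<bullet> r = e d one_G & r \<bullet> s = Id C Y"
 obtain Y r s where "Y : Obj C" "arr C r" "src C r = dX d" "tgt C r = Y"
  "arr C s" "src C s = Y" "tgt C s = dX d" "s \<bullet> r = e d one_G" "r \<bullet> s = Id C Y"
  by (rule idem_split[of "e d one_G" "dX d"]) (simp_all add: e_e)
 hence "?P (Y, r, s)" by blast
 hence "?P (sp d)" unfolding sp_def by (rule someI)
 thus ?thesis unfolding kO_def kr_def ks_def by (simp only: case_prod_beta)
qed

lemma kD [simp]:
 assumes "d : Obj D.E"
 shows "kO d : Obj C" "arr C (kr d)" "src C (kr d) = dX d" "tgt C (kr d) = kO d"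
  "arr C (ks d)" "src C (ks d) = kO d" "tgt C (ks d) = dX d" "ks d \<bullet> kr d = e d one_G" "kr d \<bullet> ks d = Id C (kO d)"
 using ksplit[OF assms] by blast+

lemma k_e [simp]:
 assumes d [simp]: "d : Obj D.E"
 shows "kr d \<bullet> e d one_G = kr d" "e d one_G \<bullet> ks d = ks d"
proof -
 have "kr d \<bullet> (ks d \<bullet> kr d) = kr d" by (subst reassoc[OF kD(9)]) simp_all
 thus "kr d \<bullet> e d one_G = kr d" by simp
 have "(ks d \<bullet> kr d) \<bullet> ks d = ks d" by (subst assoc) simp_all
 thus "e d one_G \<bullet> ks d = ks d" by simp
qed

lemmas k_re [simp] = reassoc[OF kD(8)] reassoc[OF kD(9)] reassoc[OF k_e(1)] reassoc[OF k_e(2)]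

definition Kf where
 "Kf = \<lparr>FObj = kO, FMor = (%m. kr (tgt D.E m) \<bullet> (un m \<bullet> ks (src D.E m))),
  omega = (%d. Sm (kr d) \<bullet> ks (\<Sigma>o D.E d))\<rparr>"

lemma Kf_simps [simp]: "FObj Kf = kO" "FMor Kf m = kr (tgt D.E m) \<bullet> (un m \<bullet> ks (src D.E m))"
 "omega Kf d = Sm (kr d) \<bullet> ks (\<Sigma>o D.E d)"
 unfolding Kf_def by simp_all

lemma e1_un [simp]:
 assumes "arr D.E m" "tgt D.E m = d" "arr C x" "tgt C x = dX (src D.E m)"
 shows "e d one_G \<bullet> (un m \<bullet> x) = un m \<bullet> (e (src D.E m) one_G \<bullet> x)"
 using reassoc[OF e_nat[OF assms(1), of "one_G"], of x] assms D.E.arr_obj[OF assms(1)] by simp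

text \<open>
  Everything is the restriction of the underlying data to a retract that all equivariant
  morphisms respect, because they commute with \<open>e\<close>.
\<close>

lemma Kf_exact_functor: "exact_functor K D.E C Kf"
proof -
 have l: "linear_functor K D.E C Kf"
  unfolding linear_functor_def
 proof (intro conjI ballI)
  fix d assume d [simp]: "d : Obj D.E"
  show "FObj Kf d : Obj C" "FMor Kf (Id D.E d) = Id C (FObj Kf d)" by simp_all
  fix d' m assume d' [simp]: "d' : Obj D.E" and "m : Homs D.E d d'"
  hence m [simp]: "arr D.E m" "src D.E m = d" "tgt D.E m = d'" by auto
  show "FMor Kf m : Homs C (FObj Kf d) (FObj Kf d')" by simp
  show "FMor Kf (c \<odot>\<^bsub>Hom D.E d d'\<^esub> m) = c \<odot>[FObj Kf d,FObj Kf d'] FMor Kf m" if "c : carrier K" for c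
   using that by simp
  show "FMor Kf (m \<oplus>\<^bsub>Hom D.E d d'\<^esub> m') = FMor Kf m \<oplus>[FObj Kf d,FObj Kf d'] FMor Kf m'" if "m' : Homs D.E d d'" for m'
   using that by simp
  show "FMor Kf (m' \<bullet>\<^bsub>D.E\<^esub> m) = FMor Kf m' \<bullet> FMor Kf m" if "d'' : Obj D.E" "m' : Homs D.E d' d''" for d'' m'
   using that by simp
 qed
 interpret l: lin_functor K D.E C Kf by unfold_locales (fact l)
 have es: "Sm (e d one_G) \<bullet> ks (\<Sigma>o D.E d) = ks (\<Sigma>o D.E d)" if "d : Obj D.E" for d
  using k_e(2)[of "\<Sigma>o D.E d"] that by (simp add: e_shift)
 have er: "kr (\<Sigma>o D.E d) \<bullet> Sm (e d one_G) = kr (\<Sigma>o D.E d)" if "d : Obj D.E" for d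
  using k_e(1)[of "\<Sigma>o D.E d"] that by (simp add: e_shift)
 have rs: "Sm (kr d) \<bullet> Sm (ks d) = Id C (So (kO d))" if [simp]: "d : Obj D.E" for d
 proof -
  have "Sm (kr d) \<bullet> Sm (ks d) = Sm (kr d \<bullet> ks d)" by (subst Sh.map_comp) simp_all
  thus ?thesis by simp
 qed
 have sr: "Sm (ks d) \<bullet> Sm (kr d) = Sm (e d one_G)" if [simp]: "d : Obj D.E" for d
 proof -
  have "Sm (ks d) \<bullet> Sm (kr d) = Sm (ks d \<bullet> kr d)" by (subst Sh.map_comp) simp_all
  thus ?thesis by simp
 qed
 have re: "Sm (kr d) \<bullet> Sm (e d one_G) = Sm (kr d)" if [simp]: "d : Obj D.E" for d
 proof -
  have "Sm (kr d) \<bullet> Sm (e d one_G) = Sm (kr d \<bullet> e d one_G)" by (subst Sh.map_comp) simp_all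
  thus ?thesis by simp
 qed
 note shs = e_shift es er rs sr re reassoc[OF es] reassoc[OF er] reassoc[OF rs] reassoc[OF sr] reassoc[OF re]
 have n: "nat_iso D.E C (comp_functor Kf (Shift D.E)) (comp_functor (Shift C) Kf) (omega Kf)"
  unfolding nat_iso_def comp_functor_def
 proof (intro conjI ballI, simp_all only: cat_functor.simps comp_def)
  fix d assume d [simp]: "d : Obj D.E"
  have "iso_arr C (omega Kf d)"
   by (rule iso_arrI(1)[of _ "kr (\<Sigma>o D.E d) \<bullet> Sm (ks d)"]) (simp_all add: shs)
  thus "iso_mor C (FObj Kf (\<Sigma>o D.E d)) (So (FObj Kf d)) (omega Kf d)" by simp
  fix d' m assume d' [simp]: "d' : Obj D.E" and "m : Homs D.E d d'"
  hence m [simp]: "arr D.E m" "src D.E m = d" "tgt D.E m = d'" by auto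
  have c: "Sm (e d' one_G) \<bullet> (Sm (un m) \<bullet> ks (\<Sigma>o D.E d)) = Sm (un m) \<bullet> ks (\<Sigma>o D.E d)"
  proof -
   have "Sm (e d' one_G) \<bullet> Sm (un m) = Sm (un m) \<bullet> Sm (e d one_G)"
    using arg_cong[OF e_nat[OF m(1), of "one_G"], of "Sm"] by simp
   from reassoc[OF this] show ?thesis by (simp add: es)
  qed
  show "omega Kf d' \<bullet> FMor Kf (\<Sigma>m D.E m) = Sm (FMor Kf m) \<bullet> omega Kf d"
   by (simp add: shs D.Sh_E Sh_E c)
 qed
 have ex: "(FObj Kf X, FObj Kf Y, FObj Kf Z, FMor Kf u, FMor Kf v, omega Kf X \<bullet> FMor Kf w) : Exact C"
  if t: "(X, Y, Z, u, v, w) : Exact D.E" for X Y Z u v w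
 proof -
  from t[unfolded D.Exact_E] have [simp]: "X : Obj D.E" "Y : Obj D.E" "Z : Obj D.E" "arr D.E u" "src D.E u = X" "tgt D.E u = Y"
   "arr D.E v" "src D.E v = Y" "tgt D.E v = Z" "arr D.E w" "src D.E w = Z" "tgt D.E w = \<Sigma>o D.E X"
   and "(fst X, fst Y, fst Z, FMor D.forget u, FMor D.forget v, FMor D.forget w) : Exact E" by blast+
  hence x: "(dX X, dX Y, dX Z, un u, un v, un w) : Exact C" unfolding Exact_E by blast
  have w: "omega Kf X \<bullet> FMor Kf w = Sm (kr X) \<bullet> (un w \<bullet> ks Z)"
  proof -
   have "omega Kf X \<bullet> FMor Kf w = Sm (kr X) \<bullet> (un w \<bullet> (e Z one_G \<bullet> ks Z))" by simp
   thus ?thesis by simp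
  qed
  have eu: "e (tgt D.E m) one_G \<bullet> un m = un m \<bullet> e (src D.E m) one_G" if "arr D.E m" for m using e_nat[OF that] by simp
  have 1: "Sm (e X one_G) \<bullet> (un w \<bullet> ks Z) = un w \<bullet> ks Z"
   using reassoc[OF eu[of w], of "ks Z"] by (simp add: e_shift)
  have 2: "un u \<bullet> e X one_G = e Y one_G \<bullet> un u" "un v \<bullet> e Y one_G = e Z one_G \<bullet> un v" "un w \<bullet> e Z one_G = Sm (e X one_G) \<bullet> un w"
   using eu[of u] eu[of v] eu[of w] by (simp_all add: e_shift)
  show ?thesis unfolding w
   by (rule exact_retract[OF x, where sX = "ks X" and rX = "kr X" and sY = "ks Y" and rY = "kr Y" and sZ = "ks Z" and rZ = "kr Z"])
    (simp_all add: 1 2 shs)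
 qed
 show ?thesis
  by unfold_locales (use l n ex in \<open>auto simp: triangle_functor_def simp del: Kf_simps\<close>)
qed

sublocale Kf: exact_functor K D.E C Kf by (rule Kf_exact_functor)

subsection \<open>The two functors are mutually inverse\<close>

text \<open>
  The canonical isomorphism \<open>X \<rightarrow> F\<^sub>1 X\<close>, characterised through \<open>\<epsilon>\<^sub>1\<^sub>,\<^sub>1\<close>.
\<close>

definition "uu X = (SOME a. arr C a & src C a = X & tgt C a = Fo one_G X & Fm one_G a = inv_arr C (eps A one_G one_G X))"

lemma uu_ex:
 assumes X [simp]: "X : Obj C"
 shows "arr C (uu X) & src C (uu X) = X & tgt C (uu X) = Fo one_G X & Fm one_G (uu X) = inv_arr C (eps A one_G one_G X)"
proof -
 interpret O: ff_functor K C C "act A one_G" by (rule act_ff) simp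
 have "EX a. arr C a & src C a = X & tgt C a = Fo one_G X & Fm one_G a = inv_arr C (eps A one_G one_G X)"
  by (rule O.lift[of X "Fo one_G X" "inv_arr C (eps A one_G one_G X)"]) (simp_all, blast)
 thus ?thesis unfolding uu_def by (rule someI_ex)
qed

lemma uu [simp]:
 assumes X [simp]: "X : Obj C"
 shows "iso_arr C (uu X)" "src C (uu X) = X" "tgt C (uu X) = Fo one_G X" "Fm one_G (uu X) = inv_arr C (eps A one_G one_G X)"
proof -
 interpret O: ff_functor K C C "act A one_G" by (rule act_ff) simp
 show "src C (uu X) = X" "tgt C (uu X) = Fo one_G X" "Fm one_G (uu X) = inv_arr C (eps A one_G one_G X)" using uu_ex by auto
 thus "iso_arr C (uu X)" using O.reflect_iso[of "uu X"] uu_ex[OF X] by simp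
qed

lemma uu_nat: assumes f [simp]: "arr C f" shows "uu (tgt C f) \<bullet> f = Fm one_G f \<bullet> uu (src C f)"
proof -
 interpret O: ff_functor K C C "act A one_G" by (rule act_ff) simp
 let ?e = "%X. eps A one_G one_G X"
 have n: "?e (tgt C f) \<bullet> Fm one_G (Fm one_G f) = Fm one_G f \<bullet> ?e (src C f)" using eps_nat[of "one_G" "one_G" f] by simp
 have "inv_arr C (?e (tgt C f)) \<bullet> Fm one_G f = inv_arr C (?e (tgt C f)) \<bullet> ((Fm one_G f \<bullet> ?e (src C f)) \<bullet> inv_arr C (?e (src C f)))" by simp
 also have "\<dots> = Fm one_G (Fm one_G f) \<bullet> inv_arr C (?e (src C f))" by (simp flip: n)
 finally have e: "Fm one_G (uu (tgt C f) \<bullet> f) = Fm one_G (Fm one_G f \<bullet> uu (src C f))" by simp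
 show ?thesis by (rule O.inj[OF e]) simp_all
qed

lemma ip_ii [simp]: "X : Obj C ==> h : carrier G ==> arr C x ==> tgt C x = Fo h X ==> ip X h \<bullet> (ii X h \<bullet> x) = x"
 by (subst reassoc[OF biproductD(10)[OF ib]]) simp_all

text \<open>
  The trivial eigenspace of \<open>Ind X\<close> is the summand with index \<open>1\<close>, a copy of \<open>X\<close>.
\<close>

definition "eta X = kr (FObj LF X) \<bullet> (ii X one_G \<bullet> uu X)"

lemma eta:
 assumes X [simp]: "X : Obj C"
 shows "iso_arr C (eta X)" "src C (eta X) = X" "tgt C (eta X) = kO (FObj LF X)"
proof -
 let ?d = "FObj LF X"
 have 1: "ii X one_G \<bullet> (ip X one_G \<bullet> ks ?d) = ks ?d" using k_e(2)[of ?d] by (simp add: LF_e)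
 have s: "src C (kr ?d) = IB X" "tgt C (ks ?d) = IB X" using kD[of ?d] by simp_all
 have 2: "ks ?d \<bullet> (kr ?d \<bullet> (ii X one_G \<bullet> uu X)) = ii X one_G \<bullet> uu X"
  by (subst k_re(1)) (simp_all add: LF_e s)
 show "src C (eta X) = X" "tgt C (eta X) = kO ?d" unfolding eta_def by (simp_all add: s)
 show "iso_arr C (eta X)" unfolding eta_def
  by (rule iso_arrI(1)[of _ "inv_arr C (uu X) \<bullet> (ip X one_G \<bullet> ks ?d)"]) (simp_all add: s 1 2)
qed

lemma eta_nat:
 assumes f [simp]: "arr C f"
 shows "eta (tgt C f) \<bullet> f = FMor Kf (FMor LF f) \<bullet> eta (src C f)"
proof -
 let ?d = "FObj LF (src C f)" and ?d' = "FObj LF (tgt C f)"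
 have "FMor Kf (FMor LF f) \<bullet> eta (src C f) = kr ?d' \<bullet> (un (FMor LF f) \<bullet> (e ?d one_G \<bullet> (ii (src C f) one_G \<bullet> uu (src C f))))"
  unfolding eta_def by simp
 also have "\<dots> = kr ?d' \<bullet> (indm f \<bullet> (ii (src C f) one_G \<bullet> uu (src C f)))" by (simp add: LF_e LF_un)
 also have "\<dots> = kr ?d' \<bullet> (ii (tgt C f) one_G \<bullet> (uu (tgt C f) \<bullet> f))"
  by (simp add: uu_nat reassoc[OF indm_ii])
 finally show ?thesis unfolding eta_def using kD(3)[of ?d'] by simp
qed

text \<open>
  The counit identifies the summand \<open>F\<^sub>h(kO d)\<close> with the eigenspace of \<open>h\<close>, by means of \<open>\<alpha>\<^sub>h\<close>.
\<close>

definition "bm d = cop (kO d) (dX d) (%h. inv_arr C (al d h) \<bullet> Fm h (ks d))"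

lemma bm [simp]:
 assumes "d : Obj D.E"
 shows "arr C (bm d)" "src C (bm d) = IB (kO d)" "tgt C (bm d) = dX d"
 unfolding bm_def using assms cop[of "kO d" "dX d" "%h. inv_arr C (al d h) \<bullet> Fm h (ks d)"] by auto

lemma bm_ii: "d : Obj D.E ==> h : carrier G ==> bm d \<bullet> ii (kO d) h = inv_arr C (al d h) \<bullet> Fm h (ks d)"
 unfolding bm_def using cop[of "kO d" "dX d" "%h. inv_arr C (al d h) \<bullet> Fm h (ks d)"] by auto

lemma Fm_comp: "g : carrier G ==> arr C a ==> arr C b ==> src C a = tgt C b ==> Fm g a \<bullet> Fm g b = Fm g (a \<bullet> b)"
 using lin_functor.map_comp[OF act_functor] by metis

lemma e_al:
 assumes d [simp]: "d : Obj D.E" and h [simp]: "h : carrier G"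
 shows "e d h \<bullet> inv_arr C (al d h) = inv_arr C (al d h) \<bullet> Fm h (e d one_G)"
proof -
 have "e d h \<bullet> inv_arr C (al d h) = inv_arr C (al d h) \<bullet> ((al d h \<bullet> e d h) \<bullet> inv_arr C (al d h))" by simp
 also have "al d h \<bullet> e d h = Fm h (e d one_G) \<bullet> al d h" using al_e[OF d h, of "one_G"] by simp
 finally show ?thesis by simp
qed

lemma e_bm:
 assumes d [simp]: "d : Obj D.E" and h [simp]: "h : carrier G"
 shows "e d h \<bullet> (inv_arr C (al d h) \<bullet> Fm h (ks d)) = inv_arr C (al d h) \<bullet> Fm h (ks d)"
 by (simp add: reassoc[OF e_al] Fm_comp)

text \<open>
  The inverse has the components \<open>F\<^sub>h(r) \<alpha>\<^sub>h\<close>. One composite is the identity because the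
  eigenspaces are orthogonal, the other because they exhaust the object.
\<close>

lemma bm_iso [simp]:
 assumes d [simp]: "d : Obj D.E" shows "iso_arr C (bm d)"
proof -
 let ?X = "kO d"
 obtain a where a [simp]: "arr C a" "src C a = dX d" "tgt C a = IB ?X" and pa: "!!h. h : carrier G ==> ip ?X h \<bullet> a = Fm h (kr d) \<bullet> al d h"
  using pair_exists[OF ib[OF kD(1)[OF d]], of "dX d" "%h. Fm h (kr d) \<bullet> al d h"] by auto
 have ra: "Fm k (kr d) \<bullet> al d k = (Fm k (kr d) \<bullet> al d k) \<bullet> e d k" if [simp]: "k : carrier G" for k
 proof -
  have "Fm k (kr d) \<bullet> al d k = (Fm k (kr d) \<bullet> Fm k (e d one_G)) \<bullet> al d k" by (simp add: Fm_comp)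
  also have "\<dots> = Fm k (kr d) \<bullet> (Fm k (e d one_G) \<bullet> al d k)" by (rule assoc) simp_all
  also have "\<dots> = Fm k (kr d) \<bullet> (al d k \<bullet> e d k)" by (subst al_e) simp_all
  finally have r: "Fm k (kr d) \<bullet> al d k = Fm k (kr d) \<bullet> (al d k \<bullet> e d k)" .
  show ?thesis by (subst r, subst r) (simp add: e_e)
 qed
 show ?thesis
 proof (rule iso_arrI(1)[of _ a])
  have "a \<bullet> bm d = Id C (IB ?X)"
  proof (rule Ind_ext[of ?X], simp_all, rule biproduct_mono[OF ib[of ?X]])
   fix h k assume h [simp]: "h : carrier G" and k [simp]: "k : carrier G"
   let ?l = "ip ?X k \<bullet> (a \<bullet> (bm d \<bullet> ii ?X h))"
   have "?l = (ip ?X k \<bullet> a) \<bullet> (bm d \<bullet> ii ?X h)" by simp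
   also have "\<dots> = (Fm k (kr d) \<bullet> al d k) \<bullet> (inv_arr C (al d h) \<bullet> Fm h (ks d))" by (simp only: pa[OF k] bm_ii[OF d h])
   also have "\<dots> = ((Fm k (kr d) \<bullet> al d k) \<bullet> e d k) \<bullet> (e d h \<bullet> (inv_arr C (al d h) \<bullet> Fm h (ks d)))" by (simp only: ra[OF k, symmetric] e_bm[OF d h])
   also have "\<dots> = (Fm k (kr d) \<bullet> al d k) \<bullet> ((e d k \<bullet> e d h) \<bullet> (inv_arr C (al d h) \<bullet> Fm h (ks d)))" by simp
   also have "\<dots> = ip ?X k \<bullet> ii ?X h"
    unfolding e_e[OF d k h] by (cases "k = h") (simp_all add: e_bm Fm_comp)
   finally show "?l = ip ?X k \<bullet> ii ?X h" .
  qed simp_all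
  thus "a \<bullet> bm d = Id C (src C (bm d))" by simp
  have "bm d \<bullet> a = bm d \<bullet> (finsum (Hom C (IB ?X) (IB ?X)) (%h. ii ?X h \<bullet> ip ?X h) (carrier G) \<bullet> a)"
   using biproductD(12)[OF ib[of ?X]] by simp
  also have "\<dots> = finsum (Hom C (dX d) (dX d)) (%h. (bm d \<bullet> ii ?X h) \<bullet> (ip ?X h \<bullet> a)) (carrier G)" by (simp, rule sum_cong) simp_all
  also have "\<dots> = finsum (Hom C (dX d) (dX d)) (e d) (carrier G)"
  proof (rule sum_cong)
   fix h assume h [simp]: "h : carrier G"
   have "Fm h (ks d) \<bullet> (Fm h (kr d) \<bullet> al d h) = (Fm h (ks d) \<bullet> Fm h (kr d)) \<bullet> al d h" by simp
   also have "\<dots> = al d h \<bullet> e d h" using al_e[OF d h, of "one_G"] by (simp add: Fm_comp)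
   finally have "Fm h (ks d) \<bullet> (Fm h (kr d) \<bullet> al d h) = al d h \<bullet> e d h" .
   thus "(bm d \<bullet> ii ?X h) \<bullet> (ip ?X h \<bullet> a) = e d h" unfolding pa[OF h] bm_ii[OF d h] by simp
  qed simp_all
  finally show "bm d \<bullet> a = Id C (tgt C (bm d))" by (simp add: e_sum)
 qed simp_all
qed

definition "bb d = (FObj LF (kO d), (I (kO d), bm d, fst d), d)"

lemma bb:
 assumes d [simp]: "d : Obj D.E"
 shows "iso_arr D.E (bb d)" "src D.E (bb d) = FObj LF (kO d)" "tgt D.E (bb d) = d"
proof -
 let ?X = "kO d"
 have "al d g \<bullet> bm d = Fm g (bm d) \<bullet> snd (I ?X) g" if g [simp]: "g : carrier G" for g
 proof (rule Ind_ext_eps[of g ?X])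
  fix h assume h [simp]: "h : carrier G"
  have n: "Fm (g \<cdot> h) (ks d) \<bullet> eps A g h ?X = eps A g h (dX d) \<bullet> Fm g (Fm h (ks d))" using eps_nat[OF g h, of "ks d"] by simp
  let ?l = "(al d g \<bullet> bm d) \<bullet> (ii ?X (g \<cdot> h) \<bullet> eps A g h ?X)"
  have "?l =
   al d g \<bullet> (inv_arr C (al d (g \<cdot> h)) \<bullet> (Fm (g \<cdot> h) (ks d) \<bullet> eps A g h ?X))" by (simp add: reassoc[OF bm_ii])
  also have "\<dots> = Fm g (inv_arr C (al d h) \<bullet> Fm h (ks d))"
   unfolding n al_mult[OF d g h] by simp
  also have "\<dots> = Fm g (bm d \<bullet> ii ?X h)" by (simp only: bm_ii[OF d h])
  also have "\<dots> = (Fm g (bm d) \<bullet> snd (I ?X) g) \<bullet> (ii ?X (g \<cdot> h) \<bullet> eps A g h ?X)" by (simp add: Ind_snd_ii_eps)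
  finally show "?l = (Fm g (bm d) \<bullet> snd (I ?X) g) \<bullet> (ii ?X (g \<cdot> h) \<bullet> eps A g h ?X)" .
 qed simp_all
 hence a: "arr E (I ?X, bm d, fst d)" unfolding arr_E equi_def by simp
 have "D.equi (FObj LF ?X) (I ?X, bm d, fst d) d"
 proof (rule D_equiI)
  fix \<chi> assume chi [simp]: "\<chi> : carrier Gh"
  have "t d \<chi> \<bullet> bm d = bm d \<bullet> th ?X \<chi>"
  proof (rule Ind_ext[of ?X])
   fix h assume h [simp]: "h : carrier G"
   let ?l = "(t d \<chi> \<bullet> bm d) \<bullet> ii ?X h"
   have "?l = (t d \<chi> \<bullet> e d h) \<bullet> (bm d \<bullet> ii ?X h)" unfolding bm_ii[OF d h]
    by (simp add: e_bm bm_ii)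
   also have "\<dots> = \<chi> h \<odot>[Fo h ?X,dX d] (bm d \<bullet> ii ?X h)"
    unfolding t_e[OF d chi h] bm_ii[OF d h] by (simp add: e_bm)
   also have "\<dots> = (bm d \<bullet> th ?X \<chi>) \<bullet> ii ?X h" by (simp add: th_ii)
   finally show "?l = (bm d \<bullet> th ?X \<chi>) \<bullet> ii ?X h" .
  qed simp_all
  thus "FMor forget (snd d \<chi>) \<bullet> FMor forget (I ?X, bm d, fst d) = FMor forget (I ?X, bm d, fst d) \<bullet> FMor forget (snd (FObj LF ?X) \<chi>)"
   unfolding t_def by (simp add: LF_simps)
 qed (use a in \<open>simp_all add: LF_simps(1)\<close>)
 hence b: "arr D.E (bb d)" unfolding bb_def D.arr_E by simp
 show "iso_arr D.E (bb d)" using D.iso_E[OF b[unfolded bb_def]] iso_E[OF a] by (simp add: bb_def)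
 show "src D.E (bb d) = FObj LF ?X" "tgt D.E (bb d) = d" using b unfolding bb_def by simp_all
qed

lemma bb_un [simp]: "un (bb d) = bm d" unfolding bb_def by simp

lemma bb_nat:
 assumes m [simp]: "arr D.E m"
 shows "bb (tgt D.E m) \<bullet>\<^bsub>D.E\<^esub> FMor LF (FMor Kf m) = m \<bullet>\<^bsub>D.E\<^esub> bb (src D.E m)"
proof -
 let ?d = "src D.E m" and ?d' = "tgt D.E m"
 note [simp] = bb
 have k: "arr C (FMor Kf m)" "src C (FMor Kf m) = kO ?d" "tgt C (FMor Kf m) = kO ?d'" by simp_all
 have c: "bm ?d' \<bullet> indm (FMor Kf m) = un m \<bullet> bm ?d"
 proof (rule Ind_ext[of "kO ?d"])
  fix h assume h [simp]: "h : carrier G"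
  have 1: "indm (FMor Kf m) \<bullet> ii (kO ?d) h = ii (kO ?d') h \<bullet> Fm h (FMor Kf m)" using indm_ii[OF k(1) h] k by (simp del: Kf_simps(2,3))
  have an: "inv_arr C (al ?d' h) \<bullet> Fm h (un m) = un m \<bullet> inv_arr C (al ?d h)"
  proof -
   have "inv_arr C (al ?d' h) \<bullet> Fm h (un m) = inv_arr C (al ?d' h) \<bullet> ((Fm h (un m) \<bullet> al ?d h) \<bullet> inv_arr C (al ?d h))" by simp
   thus ?thesis by (simp flip: al_nat)
  qed
  let ?l = "(bm ?d' \<bullet> indm (FMor Kf m)) \<bullet> ii (kO ?d) h"
  have "?l = (bm ?d' \<bullet> ii (kO ?d') h) \<bullet> Fm h (FMor Kf m)"
   using k by (simp del: Kf_simps add: 1)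
  also have "\<dots> = inv_arr C (al ?d' h) \<bullet> Fm h (ks ?d' \<bullet> FMor Kf m)" using k unfolding bm_ii[OF D.E.arr_obj(2)[OF m] h] by (simp del: Kf_simps(2,3))
  also have "ks ?d' \<bullet> FMor Kf m = un m \<bullet> ks ?d" by simp
  also have "inv_arr C (al ?d' h) \<bullet> Fm h (un m \<bullet> ks ?d) = (un m \<bullet> bm ?d) \<bullet> ii (kO ?d) h"
   by (simp add: reassoc[OF an] bm_ii)
  finally show "?l = (un m \<bullet> bm ?d) \<bullet> ii (kO ?d) h" .
 qed (use k in \<open>simp_all del: Kf_simps\<close>)
 have fa: "arr D.E (FMor LF (FMor Kf m))" "src D.E (FMor LF (FMor Kf m)) = FObj LF (kO ?d)" "tgt D.E (FMor LF (FMor Kf m)) = FObj LF (kO ?d')"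
  using L.mor[OF k(1)] unfolding k by simp_all
 show ?thesis
 proof (rule D.Fo.inj, rule Fo.inj)
  let ?l = "un (bb ?d' \<bullet>\<^bsub>D.E\<^esub> FMor LF (FMor Kf m))"
  have "?l = bm ?d' \<bullet> indm (FMor Kf m)" using fa by (simp del: Kf_simps add: LF_un)
  also have "\<dots> = un (m \<bullet>\<^bsub>D.E\<^esub> bb ?d)" unfolding c by simp
  finally show "?l = un (m \<bullet>\<^bsub>D.E\<^esub> bb ?d)" .
 qed (use fa in \<open>simp_all del: Kf_simps\<close>)
qed

lemma LF_equivalence: "lin_equivalence K C D.E LF"
 by (rule mutual_equivalence(1)[OF L.lin_functor_axioms Kf.lin_functor_axioms eta(1,2) eta(3)[folded Kf_simps(1)] eta_nat
   bb(1) bb(2)[folded Kf_simps(1)] bb(3) bb_nat])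

lemma Kf_equivalence: "lin_equivalence K D.E C Kf"
 by (rule mutual_equivalence(2)[OF L.lin_functor_axioms Kf.lin_functor_axioms eta(1,2) eta(3)[folded Kf_simps(1)] eta_nat
   bb(1) bb(2)[folded Kf_simps(1)] bb(3) bb_nat])

lemma LK_iso: "d : Obj D.E ==> isomorphic D.E (FObj LF (kO d)) d"
 unfolding D.E.isomorphic_iff using bb by blast

end


section \<open>Equivariance of the comparison\<close>

context splitting
begin

lemma D_field_comm_group: "field_comm_group K Gh"
 by (intro field_comm_group.intro) unfold_locales

sublocale D: dual_setting K E Gh Ad
 using D_field_comm_group by (intro dual_setting.intro D.equivariantization_axioms)

text \<open>
  Evaluation at \<open>g\<close>, a character of the dual group. Along \<open>ev\<close> the group \<open>G\<close> acts on the
  equivariant objects of the dual action.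
\<close>

definition "ev g = (\<lambda>\<chi>\<in>carrier Gh. \<chi> g)"

lemma ev_simp [simp]: "\<chi> : carrier Gh ==> ev g \<chi> = \<chi> g"
 unfolding ev_def by simp

lemma ev_char [simp]: assumes g [simp]: "g : carrier G" shows "ev g : carrier D.Gh"
proof (rule D.charI)
 show "ev g \<one>\<^bsub>Gh\<^esub> = \<one>\<^bsub>K\<^esub>" using ev_simp[OF Gh.one_closed, of g] by (simp add: Gh_one)
 show "ev g (\<chi> \<otimes>\<^bsub>Gh\<^esub> \<psi>) = ev g \<chi> \<otimes>\<^bsub>K\<^esub> ev g \<psi>" if "\<chi> : carrier Gh" "\<psi> : carrier Gh" for \<chi> \<psi>
  using ev_simp[OF Gh.m_closed[OF that], of g] that by (simp add: Gh_mult)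
qed (simp_all add: ev_def)

lemma ev_hom: "ev : hom G D.Gh"
 unfolding hom_def by (auto simp: D.Gh_mult) (auto simp: ev_def charD(3))

abbreviation "B \<equiv> pull_action ev D.Ad"
abbreviation "bt g d \<equiv> D.tw (ev g) d"

lemma bt_obj [simp]: "g : carrier G ==> d : Obj D.E ==> bt g d : Obj D.E" by simp

lemma bt_t:
 assumes d [simp]: "d : Obj D.E" and g [simp]: "g : carrier G" and chi [simp]: "\<chi> : carrier Gh"
 shows "t (bt g d) \<chi> = \<chi> (inv_G g) \<odot>[dX d,dX d] t d \<chi>"
proof -
 have k: "ev g (inv\<^bsub>Gh\<^esub> \<chi>) = \<chi> (inv_G g)" using ev_simp[OF Gh.inv_closed[OF chi], of g] by (simp add: Gh_inv)
 have o: "arr E (snd d \<chi>)" "src E (snd d \<chi>) = fst d" "tgt E (snd d \<chi>) = tw \<chi> (fst d)" using D.objE(3-5)[OF d chi] by simp_all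
 have "snd (bt g d) \<chi> = \<chi> (inv_G g) \<odot>\<^bsub>Hom E (fst d) (tw \<chi> (fst d))\<^esub> snd d \<chi>"
  unfolding D.tw_simps(2)[OF chi] k by simp
 thus ?thesis unfolding t_def using Fo.map_smult[OF _ _ o, of "\<chi> (inv_G g)"] by simp
qed

lemma bt_e:
 assumes d [simp]: "d : Obj D.E" and g [simp]: "g : carrier G" and h [simp]: "h : carrier G"
 shows "e (bt g d) h = e d (g \<cdot> h)"
 unfolding e_def by (simp, rule sum_cong) (simp_all add: bt_t cf_mult)

lemma bt_e1 [simp]: "d : Obj D.E ==> g : carrier G ==> e (bt g d) one_G = e d g"
 using bt_e[of d g "one_G"] by simp

lemma B_mor: assumes m [simp]: "arr D.E m" and g [simp]: "g : carrier G"
 shows "arr D.E (FMor (act D.Ad (ev g)) m)" "src D.E (FMor (act D.Ad (ev g)) m) = bt g (src D.E m)"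
  "tgt D.E (FMor (act D.Ad (ev g)) m) = bt g (tgt D.E m)" "un (FMor (act D.Ad (ev g)) m) = un m"
proof -
 interpret X: lin_equivalence K D.E D.E "act D.Ad (ev g)" by (rule D.tw_equivalence) simp
 show "arr D.E (FMor (act D.Ad (ev g)) m)" "src D.E (FMor (act D.Ad (ev g)) m) = bt g (src D.E m)"
  "tgt D.E (FMor (act D.Ad (ev g)) m) = bt g (tgt D.E m)" by simp_all
 show "un (FMor (act D.Ad (ev g)) m) = un m" unfolding D.Ad_mor[OF m] by simp
qed

lemma B_equivariantization: "equivariantization K D.E G B"
 by (rule equivariantization_pull[OF D.D.equivariantization_axioms ev_hom]) unfold_locales

lemma D_mor_eqI: "arr D.E m ==> arr D.E m' ==> src D.E m = src D.E m' ==> tgt D.E m = tgt D.E m' ==> un m = un m' ==> m = m'"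
 by (rule D.Fo.inj, rule Fo.inj) simp_all

subsection \<open>Induction permutes the summands\<close>

text \<open>
  The equivariance isomorphism of \<open>LF\<close> at \<open>g\<close>: the summand \<open>F\<^sub>h F\<^sub>g X\<close> goes to \<open>F\<^sub>h\<^sub>g X\<close>.
\<close>

definition "dm g X = cop (Fo g X) (IB X) (%h. ii X (h \<cdot> g) \<bullet> eps A h g X)"

lemma dm [simp]:
 assumes "g : carrier G" "X : Obj C"
 shows "arr C (dm g X)" "src C (dm g X) = IB (Fo g X)" "tgt C (dm g X) = IB X"
 unfolding dm_def using assms cop[of "Fo g X" "IB X" "%h. ii X (h \<cdot> g) \<bullet> eps A h g X"] by auto

lemma dm_ii: "g : carrier G ==> X : Obj C ==> h : carrier G ==> dm g X \<bullet> ii (Fo g X) h = ii X (h \<cdot> g) \<bullet> eps A h g X"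
 unfolding dm_def using cop[of "Fo g X" "IB X" "%h. ii X (h \<cdot> g) \<bullet> eps A h g X"] by auto

lemma Gcancel_right [simp]: "g : carrier G ==> h : carrier G ==> h \<cdot> inv_G g \<cdot> g = h" "g : carrier G ==> h : carrier G ==> h \<cdot> g \<cdot> inv_G g = h"
 by (simp_all add: G.m_assoc)

lemma dm_iso [simp]: assumes g [simp]: "g : carrier G" and X [simp]: "X : Obj C" shows "iso_arr C (dm g X)"
proof -
 let ?a = "%h. ii (Fo g X) (h \<cdot> inv_G g) \<bullet> inv_arr C (eps A (h \<cdot> inv_G g) g X)"
 define c where "c = cop X (IB (Fo g X)) ?a"
 have c [simp]: "arr C c" "src C c = IB X" "tgt C c = IB (Fo g X)"
  and ci: "h : carrier G ==> c \<bullet> ii X h = ?a h" for h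
  unfolding c_def using cop[of X "IB (Fo g X)" ?a] by auto
 show ?thesis
 proof (rule iso_arrI(1)[of _ c])
  have "c \<bullet> dm g X = Id C (IB (Fo g X))"
   by (rule Ind_ext[of "Fo g X"]) (simp_all add: dm_ii reassoc[OF ci])
  thus "c \<bullet> dm g X = Id C (src C (dm g X))" by simp
  have "dm g X \<bullet> c = Id C (IB X)"
   by (rule Ind_ext[of X]) (simp_all add: ci reassoc[OF dm_ii])
  thus "dm g X \<bullet> c = Id C (tgt C (dm g X))" by simp
 qed simp_all
qed

definition "dL g X = (FObj LF (Fo g X), (I (Fo g X), dm g X, I X), bt g (FObj LF X))"

lemma dL:
 assumes g [simp]: "g : carrier G" and X [simp]: "X : Obj C"
 shows "iso_arr D.E (dL g X)" "src D.E (dL g X) = FObj LF (Fo g X)" "tgt D.E (dL g X) = bt g (FObj LF X)"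
  "un (dL g X) = dm g X"
proof -
 let ?Y = "Fo g X"
 have "snd (I X) k \<bullet> dm g X = Fm k (dm g X) \<bullet> snd (I ?Y) k" if k [simp]: "k : carrier G" for k
 proof (rule Ind_ext_eps[of k ?Y])
  fix h assume h [simp]: "h : carrier G"
  have co: "eps A (k \<cdot> h) g X \<bullet> eps A k h ?Y = eps A k (h \<cdot> g) X \<bullet> Fm k (eps A h g X)" by (rule eps_cocycle) simp_all
  let ?l = "(snd (I X) k \<bullet> dm g X) \<bullet> (ii ?Y (k \<cdot> h) \<bullet> eps A k h ?Y)"
  have "?l =
   snd (I X) k \<bullet> (ii X (k \<cdot> (h \<cdot> g)) \<bullet> (eps A (k \<cdot> h) g X \<bullet> eps A k h ?Y))"
   by (simp add: reassoc[OF dm_ii] G.m_assoc)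
  also have "\<dots> = (snd (I X) k \<bullet> (ii X (k \<cdot> (h \<cdot> g)) \<bullet> eps A k (h \<cdot> g) X)) \<bullet> Fm k (eps A h g X)"
   unfolding co by simp
  also have "\<dots> = Fm k (dm g X \<bullet> ii ?Y h)" by (simp only: Ind_snd_ii_eps[OF k G.m_closed[OF h g] X] dm_ii[OF g X h]) simp
  also have "\<dots> = (Fm k (dm g X) \<bullet> snd (I ?Y) k) \<bullet> (ii ?Y (k \<cdot> h) \<bullet> eps A k h ?Y)" by (simp add: Ind_snd_ii_eps)
  finally show "?l =
   (Fm k (dm g X) \<bullet> snd (I ?Y) k) \<bullet> (ii ?Y (k \<cdot> h) \<bullet> eps A k h ?Y)" .
 qed simp_all
 hence a: "arr E (I ?Y, dm g X, I X)" unfolding arr_E equi_def by simp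
 have "D.equi (FObj LF ?Y) (I ?Y, dm g X, I X) (bt g (FObj LF X))"
 proof (rule D_equiI)
  fix \<chi> assume chi [simp]: "\<chi> : carrier Gh"
  have "t (bt g (FObj LF X)) \<chi> \<bullet> dm g X = dm g X \<bullet> th ?Y \<chi>"
  proof (rule Ind_ext[of ?Y])
   fix h assume h [simp]: "h : carrier G"
   have k: "\<chi> (inv_G g) \<otimes>\<^bsub>K\<^esub> \<chi> (h \<cdot> g) = \<chi> h"
    using charD(3)[OF chi, of "h \<cdot> g" "inv_G g"] m_comm[of "\<chi> (inv_G g)" "\<chi> (h \<cdot> g)"] by simp
   show "(t (bt g (FObj LF X)) \<chi> \<bullet> dm g X) \<bullet> ii ?Y h = (dm g X \<bullet> th ?Y \<chi>) \<bullet> ii ?Y h"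
    by (simp add: bt_t LF_t dm_ii th_ii reassoc[OF th_ii] k)
  qed (use t[of "bt g (FObj LF X)" \<chi>] in simp_all)
  thus "FMor forget (snd (bt g (FObj LF X)) \<chi>) \<bullet> FMor forget (I ?Y, dm g X, I X) =
   FMor forget (I ?Y, dm g X, I X) \<bullet> FMor forget (snd (FObj LF ?Y) \<chi>)"
   unfolding t_def by (simp add: LF_simps(2))
 qed (use a in \<open>simp_all add: LF_simps(1)\<close>)
 hence b: "arr D.E (dL g X)" unfolding dL_def D.arr_E by simp
 show "iso_arr D.E (dL g X)" using D.iso_E[OF b[unfolded dL_def]] iso_E[OF a] by (simp add: dL_def)
 show "src D.E (dL g X) = FObj LF ?Y" "tgt D.E (dL g X) = bt g (FObj LF X)" using b unfolding dL_def by simp_all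
 show "un (dL g X) = dm g X" unfolding dL_def by simp
qed

lemma LF_equivariant: "equivariant_tf K C D.E G A B LF dL"
 unfolding equivariant_tf_def
proof (intro conjI ballI allI impI)
 show "triangle_functor K C D.E LF" by (rule L.triangle)
 fix g assume g [simp]: "g : carrier G"
 interpret Y: lin_equivalence K D.E D.E "act D.Ad (ev g)" by (rule D.tw_equivalence) simp
 {
  fix X assume X [simp]: "X : Obj C"
  note [simp] = dL[of _ X]
  show "iso_arr D.E (dL g X)" "src D.E (dL g X) = FObj LF (Fo g X)" "tgt D.E (dL g X) = FObj (act B g) (FObj LF X)" by simp_all
  have w [simp]: "arr D.E (FMor (act D.Ad (ev g)) (omega LF X))"
   "src D.E (FMor (act D.Ad (ev g)) (omega LF X)) = bt g (FObj LF (So X))"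
   "tgt D.E (FMor (act D.Ad (ev g)) (omega LF X)) = bt g (\<Sigma>o D.E (FObj LF X))"
   using B_mor(1-3)[of "omega LF X" g] LF_omega[OF X] by auto
  note w' [simp] = dL[of g "So X"]
  show "(omega (act B g) (FObj LF X) \<bullet>\<^bsub>D.E\<^esub> FMor (act B g) (omega LF X)) \<bullet>\<^bsub>D.E\<^esub> dL g (So X) =
   \<Sigma>m D.E (dL g X) \<bullet>\<^bsub>D.E\<^esub> (omega LF (Fo g X) \<bullet>\<^bsub>D.E\<^esub> FMor LF (Fw g X))"
  proof (rule D_mor_eqI)
   have u: "un (FMor (act D.Ad (ev g)) (omega LF X)) = om X" using B_mor(4)[of "omega LF X" g] by (simp add: LF_un)
   have 1: "indm (Fw g X) \<bullet> ii (Fo g (So X)) h = ii (So (Fo g X)) h \<bullet> Fm h (Fw g X)" if "h : carrier G" for h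
    using indm_ii[of "Fw g X" h] that by simp
   have eo: "Fw (h \<cdot> g) X \<bullet> eps A h g (So X) =
    Sm (eps A h g X) \<bullet> (Fw h (Fo g X) \<bullet> Fm h (Fw g X))" if "h : carrier G" for h
    by (rule eps_omega) (simp_all add: that)
   have 2: "Sm (dm g X) \<bullet> Sm (ii (Fo g X) h) = Sm (ii X (h \<cdot> g)) \<bullet> Sm (eps A h g X)" if "h : carrier G" for h
    using arg_cong[OF dm_ii[OF g X that], of "Sm"] that by simp
   have c: "om X \<bullet> dm g (So X) = Sm (dm g X) \<bullet> (om (Fo g X) \<bullet> indm (Fw g X))"
    by (rule Ind_ext[of "Fo g (So X)"])
     (simp_all add: 1 dm_ii reassoc[OF om_ii] eo reassoc[OF 2])
   show "un ((omega (act B g) (FObj LF X) \<bullet>\<^bsub>D.E\<^esub> FMor (act B g) (omega LF X)) \<bullet>\<^bsub>D.E\<^esub> dL g (So X)) =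
    un (\<Sigma>m D.E (dL g X) \<bullet>\<^bsub>D.E\<^esub> (omega LF (Fo g X) \<bullet>\<^bsub>D.E\<^esub> FMor LF (Fw g X)))"
    using c by (simp add: u LF_un D.Sh_E Sh_E D.tw_shift)
  qed (simp_all add: D.tw_shift)
  fix k assume k [simp]: "k : carrier G"
  have v [simp]: "arr D.E (FMor (act D.Ad (ev g)) (dL k X))"
   "src D.E (FMor (act D.Ad (ev g)) (dL k X)) = bt g (FObj LF (Fo k X))"
   "tgt D.E (FMor (act D.Ad (ev g)) (dL k X)) = bt g (bt k (FObj LF X))"
   using B_mor(1-3)[of "dL k X" g] by auto
  note v' [simp] = dL[of g "Fo k X"]
  have ev2 [simp]: "bt g (bt k (FObj LF X)) = bt (g \<cdot> k) (FObj LF X)"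
   using D.tw_tw[of "ev g" "ev k" "FObj LF X"] hom_mult[OF ev_hom g k] by simp
  show "dL (g \<cdot> k) X \<bullet>\<^bsub>D.E\<^esub> FMor LF (eps A g k X) =
   eps B g k (FObj LF X) \<bullet>\<^bsub>D.E\<^esub> (FMor (act B g) (dL k X) \<bullet>\<^bsub>D.E\<^esub> dL g (Fo k X))"
  proof (rule D_mor_eqI)
   have u: "un (FMor (act D.Ad (ev g)) (dL k X)) = dm k X" using B_mor(4)[of "dL k X" g] by simp
   have 1: "indm (eps A g k X) \<bullet> ii (Fo g (Fo k X)) h = ii (Fo (g \<cdot> k) X) h \<bullet> Fm h (eps A g k X)" if "h : carrier G" for h
    using indm_ii[of "eps A g k X" h] that by simp
   have co: "eps A (h \<cdot> g) k X \<bullet> eps A h g (Fo k X) = eps A h (g \<cdot> k) X \<bullet> Fm h (eps A g k X)" if "h : carrier G" for h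
    by (rule eps_cocycle) (simp_all add: that)
   have c: "dm (g \<cdot> k) X \<bullet> indm (eps A g k X) = dm k X \<bullet> dm g (Fo k X)"
    by (rule Ind_ext[of "Fo g (Fo k X)"])
     (simp_all add: 1 dm_ii reassoc[OF dm_ii] co G.m_assoc flip: co[unfolded G.m_assoc])
   show "un (dL (g \<cdot> k) X \<bullet>\<^bsub>D.E\<^esub> FMor LF (eps A g k X)) =
    un (eps B g k (FObj LF X) \<bullet>\<^bsub>D.E\<^esub> (FMor (act B g) (dL k X) \<bullet>\<^bsub>D.E\<^esub> dL g (Fo k X)))"
    using c by (simp add: u LF_un)
  qed simp_all
 }
 fix f assume f [simp]: "arr C f"
 interpret X: lin_functor K C C "act A g" by (rule act_functor) simp
 have v [simp]: "arr D.E (FMor (act D.Ad (ev g)) (FMor LF f))"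
  "src D.E (FMor (act D.Ad (ev g)) (FMor LF f)) = bt g (FObj LF (src C f))"
  "tgt D.E (FMor (act D.Ad (ev g)) (FMor LF f)) = bt g (FObj LF (tgt C f))"
  "un (FMor (act D.Ad (ev g)) (FMor LF f)) = un (FMor LF f)"
  using B_mor[of "FMor LF f" g] by auto
 note v' [simp] = dL[of g "src C f"] dL[of g "tgt C f"]
 show "dL g (tgt C f) \<bullet>\<^bsub>D.E\<^esub> FMor LF (Fm g f) = FMor (act B g) (FMor LF f) \<bullet>\<^bsub>D.E\<^esub> dL g (src C f)"
 proof (rule D_mor_eqI)
  have n: "Fm (h \<cdot> g) f \<bullet> eps A h g (src C f) = eps A h g (tgt C f) \<bullet> Fm h (Fm g f)" if "h : carrier G" for h
   using eps_nat[OF that g f] by simp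
  have 1: "indm (Fm g f) \<bullet> ii (Fo g (src C f)) h = ii (Fo g (tgt C f)) h \<bullet> Fm h (Fm g f)" if "h : carrier G" for h
   using indm_ii[of "Fm g f" h] that by simp
  have c: "dm g (tgt C f) \<bullet> indm (Fm g f) = indm f \<bullet> dm g (src C f)"
   by (rule Ind_ext[of "Fo g (src C f)"])
    (simp_all add: 1 dm_ii reassoc[OF dm_ii] reassoc[OF indm_ii] n)
  show "un (dL g (tgt C f) \<bullet>\<^bsub>D.E\<^esub> FMor LF (Fm g f)) = un (FMor (act B g) (FMor LF f) \<bullet>\<^bsub>D.E\<^esub> dL g (src C f))"
   using c by (simp add: LF_un)
 qed simp_all
qed

subsection \<open>Eigenobjects of a twisted object\<close>

text \<open>
  The equivariance isomorphism of \<open>Kf\<close>: twisting by \<open>ev g\<close> makes the eigenspace of \<open>g\<close> the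
  trivial one, and \<open>\<alpha>\<^sub>g\<close> maps it onto \<open>F\<^sub>g(kO d)\<close>.
\<close>

definition "dK g d = Fm g (kr d) \<bullet> (al d g \<bullet> ks (bt g d))"

lemma bt_k [simp]:
 assumes d [simp]: "d : Obj D.E" and g [simp]: "g : carrier G"
 shows "e d g \<bullet> ks (bt g d) = ks (bt g d)" "kr (bt g d) \<bullet> e d g = kr (bt g d)" "ks (bt g d) \<bullet> kr (bt g d) = e d g"
  "src C (kr (bt g d)) = dX d" "tgt C (ks (bt g d)) = dX d"
proof -
 note 1 = bt_e1[OF d g]
 note d' = bt_obj[OF g d]
 show "e d g \<bullet> ks (bt g d) = ks (bt g d)" "kr (bt g d) \<bullet> e d g = kr (bt g d)" "ks (bt g d) \<bullet> kr (bt g d) = e d g"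
  using k_e[OF d'] kD(8)[OF d'] unfolding 1 by blast+
 show "src C (kr (bt g d)) = dX d" "tgt C (ks (bt g d)) = dX d" using kD(3,7)[OF d'] by simp_all
qed

lemma Fe_al:
 assumes "d : Obj D.E" "g : carrier G"
 shows "Fm g (e d one_G) \<bullet> al d g = al d g \<bullet> e d g"
 using al_e[OF assms, of "one_G"] assms by simp

lemma dK:
 assumes d [simp]: "d : Obj D.E" and g [simp]: "g : carrier G"
 shows "iso_arr C (dK g d)" "src C (dK g d) = kO (bt g d)" "tgt C (dK g d) = Fo g (kO d)"
proof -
 let ?d = "bt g d"
 show s: "src C (dK g d) = kO ?d" "tgt C (dK g d) = Fo g (kO d)" unfolding dK_def by simp_all
 let ?c = "kr ?d \<bullet> (inv_arr C (al d g) \<bullet> Fm g (ks d))"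
 have 1: "Fm g (ks d) \<bullet> Fm g (kr d) = Fm g (e d one_G)" by (simp add: Fm_comp)
 show "iso_arr C (dK g d)"
 proof (rule iso_arrI(1)[of _ ?c])
  have "?c \<bullet> dK g d = kr ?d \<bullet> (inv_arr C (al d g) \<bullet> ((Fm g (e d one_G) \<bullet> al d g) \<bullet> ks ?d))"
   unfolding dK_def by (simp add: reassoc[OF 1])
  also have "\<dots> = Id C (kO ?d)" unfolding Fe_al[OF d g] by simp
  finally show "?c \<bullet> dK g d = Id C (src C (dK g d))" by (simp add: s)
  have "dK g d \<bullet> ?c = Fm g (kr d) \<bullet> ((al d g \<bullet> e d g) \<bullet> (inv_arr C (al d g) \<bullet> Fm g (ks d)))"
   unfolding dK_def by (simp add: reassoc[OF bt_k(3)])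
  also have "\<dots> = Fm g (kr d \<bullet> (e d one_G \<bullet> ks d))" unfolding Fe_al[OF d g, symmetric] by (simp del: k_e k_re)
  finally show "dK g d \<bullet> ?c = Id C (tgt C (dK g d))" by (simp add: s)
 qed (simp_all add: dK_def)
qed

lemma Kf_equivariant: "equivariant_tf K D.E C G B A Kf dK"
 unfolding equivariant_tf_def
proof (intro conjI ballI allI impI)
 show "triangle_functor K D.E C Kf" by (rule Kf.triangle)
 fix g assume g [simp]: "g : carrier G"
 interpret Y: lin_equivalence K D.E D.E "act D.Ad (ev g)" by (rule D.tw_equivalence) simp
 interpret X: lin_functor K C C "act A g" by (rule act_functor) simp
 {
  fix d assume d [simp]: "d : Obj D.E"
  show "iso_arr C (dK g d)" "src C (dK g d) = FObj Kf (FObj (act B g) d)" "tgt C (dK g d) = Fo g (FObj Kf d)" using dK[OF d g] by simp_all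
  let ?S = "\<Sigma>o D.E d" and ?b = "bt g d"
  have S: "\<Sigma>o D.E ?b = bt g ?S" by (simp add: D.tw_shift)
  show "(Fw g (FObj Kf d) \<bullet> Fm g (omega Kf d)) \<bullet> dK g ?S =
   Sm (dK g d) \<bullet> (omega Kf (FObj (act B g) d) \<bullet> FMor Kf (omega (act B g) d))"
  proof -
   have w: "Fw g (kO d) \<bullet> Fm g (Sm (kr d)) = Sm (Fm g (kr d)) \<bullet> Fw g (dX d)"
    using omega_nat[OF g, of "kr d"] by simp
   have 1: "Fm g (ks ?S) \<bullet> (Fm g (kr ?S) \<bullet> x) = Fm g (e ?S one_G) \<bullet> x" if "arr C x" "tgt C x = Fo g (dX ?S)" for x
    using that by (subst reassoc[OF Fm_comp]) simp_all
   have 2: "Fm g (e ?S one_G) \<bullet> (al ?S g \<bullet> ks (bt g ?S)) = al ?S g \<bullet> ks (bt g ?S)"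
    using reassoc[OF Fe_al[of ?S g], of "ks (bt g ?S)"] bt_k(1)[of ?S g] by simp
   let ?l = "(Fw g (FObj Kf d) \<bullet> Fm g (omega Kf d)) \<bullet> dK g ?S"
   have "?l =
    (Fw g (kO d) \<bullet> Fm g (Sm (kr d))) \<bullet> (Fm g (ks ?S) \<bullet> (Fm g (kr ?S) \<bullet> (al ?S g \<bullet> ks (bt g ?S))))"
    unfolding dK_def by simp
   also have "\<dots> = Sm (Fm g (kr d)) \<bullet> (Sm (al d g) \<bullet> ks (bt g ?S))"
    unfolding w 1[of "al ?S g \<bullet> ks (bt g ?S)", simplified] 2 by (simp add: al_shift)
   finally have L: "?l =
    Sm (Fm g (kr d)) \<bullet> (Sm (al d g) \<bullet> ks (bt g ?S))" .
   have 3: "Sm (ks ?b) \<bullet> Sm (kr ?b) = e ?S g"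
   proof -
    have "Sm (ks ?b) \<bullet> Sm (kr ?b) = Sm (ks ?b \<bullet> kr ?b)" by (subst Sh.map_comp) simp_all
    thus ?thesis by (simp add: e_shift)
   qed
   have "FMor Kf (omega (act B g) d) = Id C (kO (bt g ?S))" by (simp flip: Kf_simps(1) del: Kf_simps)
   hence "Sm (dK g d) \<bullet> (omega Kf (FObj (act B g) d) \<bullet> FMor Kf (omega (act B g) d)) =
    Sm (Fm g (kr d)) \<bullet> (Sm (al d g) \<bullet> (Sm (ks ?b) \<bullet> (Sm (kr ?b) \<bullet> ks (bt g ?S))))"
    unfolding dK_def by (simp add: S del: Kf_simps(2))
   also have "\<dots> = Sm (Fm g (kr d)) \<bullet> (Sm (al d g) \<bullet> ks (bt g ?S))"
    using reassoc[OF 3, of "ks (bt g ?S)"] bt_k(1)[of ?S g] by simp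
   finally show ?thesis using L by simp
  qed
  fix h assume h [simp]: "h : carrier G"
  interpret X': lin_functor K C C "act A h" by (rule act_functor) simp
  let ?k = "bt (g \<cdot> h) d" and ?h = "bt h d"
  have b: "bt g ?h = ?k" using D.tw_tw[of "ev g" "ev h" d] hom_mult[OF ev_hom g h] by simp
  show "dK (g \<cdot> h) d \<bullet> FMor Kf (eps B g h d) =
   eps A g h (FObj Kf d) \<bullet> (Fm g (dK h d) \<bullet> dK g (FObj (act B h) d))"
  proof -
   have n: "Fm (g \<cdot> h) (kr d) \<bullet> eps A g h (dX d) = eps A g h (kO d) \<bullet> Fm g (Fm h (kr d))"
    using eps_nat[OF g h, of "kr d"] by simp
   have 1: "FMor Kf (eps B g h d) = Id C (kO ?k)" by (simp add: b flip: Kf_simps(1) del: Kf_simps)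
   let ?l = "dK (g \<cdot> h) d \<bullet> FMor Kf (eps B g h d)"
   have "?l = dK (g \<cdot> h) d"
    unfolding 1 using dK[OF d, of "g \<cdot> h"] by simp
   also have "\<dots> = (Fm (g \<cdot> h) (kr d) \<bullet> eps A g h (dX d)) \<bullet> (Fm g (al d h) \<bullet> (al d g \<bullet> ks ?k))"
    unfolding dK_def al_mult[OF d g h] by simp
   finally have L: "?l =
    eps A g h (kO d) \<bullet> (Fm g (Fm h (kr d)) \<bullet> (Fm g (al d h) \<bullet> (al d g \<bullet> ks ?k)))" unfolding n by simp
   have 2: "Fm g (ks ?h) \<bullet> (Fm g (kr ?h) \<bullet> x) = Fm g (e d h) \<bullet> x" if "arr C x" "tgt C x = Fo g (dX d)" for x
    using that by (subst reassoc[OF Fm_comp]) simp_all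
   have 3: "Fm g (e d h) \<bullet> (al d g \<bullet> ks ?k) = al d g \<bullet> ks ?k"
    using reassoc[OF al_e[OF d g h], of "ks ?k"] by simp
   have "Fm g (dK h d) \<bullet> dK g (FObj (act B h) d) =
    Fm g (Fm h (kr d)) \<bullet> (Fm g (al d h) \<bullet> (Fm g (ks ?h) \<bullet> (Fm g (kr ?h) \<bullet> (al d g \<bullet> ks ?k))))"
    unfolding dK_def by (simp add: b)
   also have "\<dots> = Fm g (Fm h (kr d)) \<bullet> (Fm g (al d h) \<bullet> (al d g \<bullet> ks ?k))" by (simp add: 2 3)
   finally show ?thesis using L by simp
  qed
 }
 fix m assume m [simp]: "arr D.E m"
 let ?d = "src D.E m" and ?d' = "tgt D.E m"
 show "dK g ?d' \<bullet> FMor Kf (FMor (act B g) m) = Fm g (FMor Kf m) \<bullet> dK g ?d"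
 proof -
  have 0: "FMor Kf (FMor (act B g) m) = kr (bt g ?d') \<bullet> (un m \<bullet> ks (bt g ?d))" by (simp add: B_mor)
  have n: "e ?d' g \<bullet> (un m \<bullet> x) = un m \<bullet> (e ?d g \<bullet> x)" if "arr C x" "tgt C x = dX ?d" for x
   using reassoc[OF e_nat[OF m g], of x] that by simp
  let ?l = "dK g ?d' \<bullet> FMor Kf (FMor (act B g) m)"
  have "?l = Fm g (kr ?d') \<bullet> ((al ?d' g \<bullet> un m) \<bullet> ks (bt g ?d))"
   unfolding 0 dK_def by (simp add: reassoc[OF bt_k(3)] n)
  also have "\<dots> = Fm g (kr ?d') \<bullet> (Fm g (un m) \<bullet> (al ?d g \<bullet> ks (bt g ?d)))" unfolding al_nat[OF m g] by simp
  finally have L: "?l = Fm g (kr ?d') \<bullet> (Fm g (un m) \<bullet> (al ?d g \<bullet> ks (bt g ?d)))" .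
  have 2: "Fm g (ks ?d) \<bullet> (Fm g (kr ?d) \<bullet> x) = Fm g (e ?d one_G) \<bullet> x" if "arr C x" "tgt C x = Fo g (dX ?d)" for x
   using that by (subst reassoc[OF Fm_comp]) simp_all
  have "Fm g (e ?d one_G) \<bullet> (al ?d g \<bullet> ks (bt g ?d)) = al ?d g \<bullet> ks (bt g ?d)"
   using reassoc[OF Fe_al[of ?d g], of "ks (bt g ?d)"] by simp
  hence "Fm g (FMor Kf m) \<bullet> dK g ?d = Fm g (kr ?d') \<bullet> (Fm g (un m) \<bullet> (al ?d g \<bullet> ks (bt g ?d)))"
   unfolding dK_def by (simp add: 2)
  thus ?thesis using L by simp
 qed
qed

text \<open>
  Conjugate the lift of \<open>\<Phi>\<close> by the equivalences \<open>LF\<close> and \<open>Kf\<close>. Forgetting the dual structure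
  in \<open>LF (Kf d) \<cong> d\<close> gives the comparison on induced objects.
\<close>

theorem descend_autoequivalence:
 assumes a: "D.aut (\<Phi>, \<delta>)"
 obtains F \<epsilon> where "aut (F, \<epsilon>)"
  "!!X. X : Obj C ==> isomorphic E (I (FObj F X)) (FObj \<Phi> (I X))"
proof -
 let ?Psi = "tri_lift E Gh Ad \<Phi> \<delta>" and ?del = "%\<chi> U. Id D.E (D.tw \<chi> (FObj (tri_lift E Gh Ad \<Phi> \<delta>) U))"
 have l: "equivariant_tf K D.E D.E D.Gh D.Ad D.Ad ?Psi ?del" "lin_equivalence K D.E D.E ?Psi"
  using D.lift_autoequivalence(1)[OF a] unfolding D.D.equivariant_autoequivalence_iff by blast+
 interpret P: lin_equivalence K D.E D.E ?Psi by fact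
 note p = equivariant_tf_pull[OF l(1) ev_hom]
 note Ax = equivariantization_axioms and Bx = B_equivariantization
 note c = equivariant_tf_comp[OF Ax Bx Ax equivariant_tf_comp[OF Ax Bx Bx LF_equivariant p] Kf_equivariant]
 let ?F = "comp_tf C Kf (comp_tf D.E ?Psi LF)"
 have e: "lin_equivalence K C C ?F"
  by (rule lin_equivalence_cong[OF comp_lin_equivalence[OF comp_lin_equivalence[OF LF_equivalence l(2)] Kf_equivalence]])
   (auto simp: comp_functor_def comp_tf_def)
 show thesis
 proof (rule that)
  show "aut (?F, %g X. dK g (FObj (comp_tf D.E ?Psi LF) X) \<bullet>
   FMor Kf (?del (ev g) (FObj LF X) \<bullet>\<^bsub>D.E\<^esub> FMor ?Psi (dL g X)))"
   unfolding equivariant_autoequivalence_iff using c e by blast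
  fix X assume X [simp]: "X : Obj C"
  let ?d = "FObj ?Psi (FObj LF X)"
  have d: "?d : Obj D.E" by (rule P.obj) simp
  have "fst ?d = FObj \<Phi> (I X)" using D.lift_autoequivalence(2)[OF a] by (simp add: LF_simps)
  moreover have "isomorphic E (fst (FObj LF (kO ?d))) (fst ?d)" using D.Fo.map_isomorphic[OF LK_iso[OF d]] by simp
  ultimately show "isomorphic E (I (FObj ?F X)) (FObj \<Phi> (I X))" by (simp add: LF_simps(1))
 qed
qed

end


section \<open>Tilting objects and equivariant objects\<close>

lemma (in equivariantization) forget_exact_functor: "exact_functor K E C forget"
proof -
 have n: "nat_iso E C (comp_functor forget (Shift E)) (comp_functor (Shift C) forget) (omega forget)"
  unfolding nat_iso_def comp_functor_def
 proof (intro conjI ballI, simp_all only: cat_functor.simps comp_def)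
  fix U assume U [simp]: "U : Obj E"
  have o: "fst U : Obj C" by (rule objE(1)[OF U])
  show "iso_mor C (FObj forget (\<Sigma>o E U)) (So (FObj forget U)) (omega forget U)" using o by (simp add: Sh_E)
  fix V m assume V [simp]: "V : Obj E" and "m : Homs E U V"
  hence m [simp]: "arr E m" "src E m = U" "tgt E m = V" by auto
  show "omega forget V \<bullet> FMor forget (\<Sigma>m E m) = Sm (FMor forget m) \<bullet> omega forget U" by (simp add: Sh_E)
 qed
 have "(fst U, fst V, fst W, FMor forget u, FMor forget v, omega forget U \<bullet> FMor forget w) : Exact C"
  if "(U, V, W, u, v, w) : Exact E" for U V W u v w
 proof -
  have x: "(fst U, fst V, fst W, FMor forget u, FMor forget v, FMor forget w) : Exact C"
   "arr E w" "tgt E w = \<Sigma>o E U" using that unfolding Exact_E by blast+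
  have "tgt C (FMor forget w) = So (fst U)" using x(2,3) by (simp add: Sh_E)
  thus ?thesis using x(1,2) by simp
 qed
 with n Fo.lin show ?thesis
  by (intro exact_functor.intro exact_functor_axioms.intro)
   (auto simp: triangle_functor_def shifted_category_axioms E.shifted_category_axioms simp del: forget_simps(3))
qed

lemma (in equivariantization) fst_shift_pow: "fst ((\<Sigma>o E ^^ n) U) = (So ^^ n) (fst U)"
 by (induction n) (simp_all add: Sh_E)

lemma (in linear_category) direct_sum_transport:
 assumes "direct_sum C I M B" "isomorphic C B B'" shows "direct_sum C I M B'"
proof -
 obtain \<iota> \<pi> where b: "biproduct C I M B \<iota> \<pi>" using assms(1) unfolding direct_sum_def by blast
 obtain u where u [simp]: "iso_arr C u" "src C u = B" "tgt C u = B'" using assms(2) unfolding isomorphic_iff by blast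
 note [simp] = biproductD(1-11)[OF b] isomorphic_obj[OF assms(2)]
 have "finsum (Hom C B' B') (%i. (u \<bullet> \<iota> i) \<bullet> (\<pi> i \<bullet> inv_arr C u)) I = u \<bullet> (finsum (Hom C B B) (%i. \<iota> i \<bullet> \<pi> i) I \<bullet> inv_arr C u)"
  by (simp, rule sum_cong) simp_all
 also have "\<dots> = Id C B'" unfolding biproductD(12)[OF b] by simp
 finally have "biproduct C I M B' (%i. u \<bullet> \<iota> i) (%i. \<pi> i \<bullet> inv_arr C u)"
  by (intro biproductI) simp_all
 thus ?thesis unfolding direct_sum_def by blast
qed

lemma (in linear_category) basic_iso:
 assumes "basic C X" "isomorphic C X Y" shows "basic C Y"
proof -
 obtain n :: nat and M where M: "direct_sum C {..<n} M X" "(ALL i<n. indecomposable C (M i)) &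
   (ALL i<n. ALL j<n. i \<noteq> j --> \<not> isomorphic C (M i) (M j))" using assms(1) unfolding basic_def by blast
 show ?thesis unfolding basic_def using direct_sum_transport[OF M(1) assms(2)] M(2) by (intro exI[of _ n] exI[of _ M] conjI) simp_all
qed

lemma (in shifted_category) tilting_in_add:
 assumes "krull_schmidt K C" "tilting C X" "in_add C X Y" "in_add C Y X" shows "tilting C Y"
 using assms rigid_in_add thick_in_add unfolding tilting_iff generates_def by metis

context equivariantization
begin

lemma autoequivalence_Tilt:
 assumes ks: "krull_schmidt K C" and a: "aut (F, \<delta>)"
  and T: "tilting C T" "basic C T" "stable C G A T"
 shows "tilting C (FObj F T)" "basic C (FObj F T)" "stable C G A (FObj F T)"
proof -
 note a' = a[unfolded equivariant_autoequivalence_iff]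
 note t = equivariant_tfD[OF a'[THEN conjunct1]]
 interpret F: lin_equivalence K C C F using a' by blast
 have To: "T : Obj C" using T(1) unfolding tilting_def by blast
 have "exact_functor K C C F" by unfold_locales (rule t(1))
 thus "tilting C (FObj F T)" by (rule tilting_map[OF _ F.lin_equivalence_axioms T(1)])
 show "basic C (FObj F T)" by (rule F.map_basic[OF ks ks T(2)])
 have "isomorphic C (Fo g (FObj F T)) (FObj F T)" if g: "g : carrier G" for g
 proof -
  have "isomorphic C (FObj F (Fo g T)) (Fo g (FObj F T))"
   unfolding isomorphic_iff using t(2-4)[OF g To] by blast
  moreover have "isomorphic C (FObj F (Fo g T)) (FObj F T)"
   using T(3) g F.map_isomorphic unfolding stable_def by blast
  ultimately show ?thesis using isomorphic_sym isomorphic_trans by blast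
 qed
 thus "stable C G A (FObj F T)" unfolding stable_def by blast
qed

text \<open>
  Isomorphic functors have isomorphic values, so the union in the definition of the action is a
  single isoclass.
\<close>

lemma aut_act_isoclass:
 assumes a: "aut (F, \<delta>)" and T: "T : Obj C"
 shows "aut_act C (equivariant_isoclass K C G A (F, \<delta>)) (isoclass C T) = isoclass C (FObj F T)"
proof -
 note a' = a[unfolded equivariant_autoequivalence_iff]
 note t = equivariant_tfD[OF a'[THEN conjunct1]]
 interpret F: lin_equivalence K C C F using a' by blast
 interpret F: exact_functor K C C F by unfold_locales (rule t(1))
 have "equivariant_isomorphic C G A (F, \<delta>) (F, \<delta>)"
  unfolding equivariant_isomorphic_def tri_nat_iso_def nat_iso_def prod.case
 proof (intro exI[of _ "%X. Id C (FObj F X)"] conjI ballI)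
  fix X assume X [simp]: "X : Obj C"
  show "iso_mor C (FObj F X) (FObj F X) (Id C (FObj F X))" by simp
  show "omega F X \<bullet> Id C (FObj F (So X)) = Sm (Id C (FObj F X)) \<bullet> omega F X" by simp
  fix Y f assume "Y : Obj C" "f : Homs C X Y"
  thus "Id C (FObj F Y) \<bullet> FMor F f = FMor F f \<bullet> Id C (FObj F X)" by simp
 next
  fix g X assume g [simp]: "g : carrier G" and X [simp]: "X : Obj C"
  interpret X: lin_functor K C C "act A g" by (rule act_functor) simp
  show "Fm g (Id C (FObj F X)) \<bullet> \<delta> g X = \<delta> g X \<bullet> Id C (FObj F (Fo g X))"
   using t(2-4)[OF g X] by simp
 qed
 hence r: "(F, \<delta>) : equivariant_isoclass K C G A (F, \<delta>)" using a unfolding equivariant_isoclass_def by blast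
 have i: "isoclass C (FObj F' T') = isoclass C (FObj F T)"
  if "(F', \<delta>') : equivariant_isoclass K C G A (F, \<delta>)" "T' : isoclass C T" for F' \<delta>' T'
 proof -
  have TT: "isomorphic C T T'" using that(2) unfolding isoclass_def by blast
  have To: "T' : Obj C" using isomorphic_obj[OF TT] by blast
  from that(1) obtain \<phi> where "nat_iso C C F F' \<phi>"
   unfolding equivariant_isoclass_def equivariant_isomorphic_def tri_nat_iso_def by blast
  hence p: "iso_mor C (FObj F T') (FObj F' T') (\<phi> T')" unfolding nat_iso_def using To by blast
  have "aut (F', \<delta>')" using that(1) unfolding equivariant_isoclass_def by blast
  then interpret F': lin_equivalence K C C F' unfolding equivariant_autoequivalence_iff by blast
  have "FObj F' T' : Obj C" by (rule F'.obj[OF To])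
  hence "isomorphic C (FObj F T') (FObj F' T')" using p F.obj[OF To] unfolding isomorphic_def by blast
  thus ?thesis using isoclass_eq F.map_isomorphic[OF TT] by metis
 qed
 have "T : isoclass C T" using isomorphic_refl[OF T] unfolding isoclass_def by blast
 thus ?thesis unfolding aut_act_def using r i by blast
qed

lemma orbit_isoclass:
 assumes T: "T : Obj C"
 shows "orbit (Aut_tri K C G A) (aut_act C) (isoclass C T) =
  {isoclass C (FObj F T) | F \<delta>. aut (F, \<delta>)}"
proof (intro equalityI subsetI)
 fix \<Y> assume "\<Y> : orbit (Aut_tri K C G A) (aut_act C) (isoclass C T)"
 then obtain P where P: "aut P" "\<Y> = aut_act C (equivariant_isoclass K C G A P) (isoclass C T)"
  unfolding orbit_def Aut_tri_def monoid.simps partial_object.simps by blast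
 obtain F \<delta> where F: "P = (F, \<delta>)" by (cases P)
 show "\<Y> : {isoclass C (FObj F T) | F \<delta>. aut (F, \<delta>)}"
  using P aut_act_isoclass[OF _ T] unfolding F by blast
next
 fix \<Y> assume "\<Y> : {isoclass C (FObj F T) | F \<delta>. aut (F, \<delta>)}"
 then obtain F \<delta> where F: "aut (F, \<delta>)" "\<Y> = isoclass C (FObj F T)" by blast
 have "\<Y> = aut_act C (equivariant_isoclass K C G A (F, \<delta>)) (isoclass C T)" unfolding F(2) aut_act_isoclass[OF F(1) T] ..
 thus "\<Y> : orbit (Aut_tri K C G A) (aut_act C) (isoclass C T)"
  unfolding orbit_def Aut_tri_def monoid.simps partial_object.simps using F(1) by blast
qed

end

context splitting
begin

lemma Ind_functor: "exact_functor K C E (comp_tf E D.forget LF)"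
 by (rule comp_exact_functor[OF LF_exact_functor D.forget_exact_functor])

sublocale J: exact_functor K C E "comp_tf E D.forget LF" by (rule Ind_functor)

lemma J_obj [simp]: "FObj (comp_tf E D.forget LF) X = I X" by (simp add: LF_simps)

lemma Ind_in_add: "in_add C X Y ==> in_add E (I X) (I Y)"
 using J.map_in_add[of X Y] unfolding J_obj .

lemma fst_in_add: "in_add E U V ==> in_add C (fst U) (fst V)"
 using Fo.map_in_add[of U V] by simp

lemma in_add_Ind: assumes X [simp]: "X : Obj C" shows "in_add C X (IB X)"
 by (rule in_add_retract[of "ii X one_G \<bullet> uu X" "inv_arr C (uu X) \<bullet> ip X one_G"]) simp_all

lemma stable_Ind_in_add:
 assumes "X : Obj C" "stable C G A X" shows "in_add C (IB X) X"
 by (rule in_add_direct_sum[of "carrier G" "%h. Fo h X"])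
  (use assms ib in_add_iso in \<open>auto simp: direct_sum_def stable_def\<close>)

text \<open>
  The unit of the adjunction between forgetting and induction, and a retraction of it, which
  averages over the summands and so depends on the order of \<open>G\<close> being invertible.
\<close>

definition "uni U = finsum (Hom C (fst U) (IB (fst U))) (%h. ii (fst U) h \<bullet> snd U h) (carrier G)"
definition "ret U = cop (fst U) (fst U) (%h. inv\<^bsub>K\<^esub> ordK \<odot>[Fo h (fst U),fst U] inv_arr C (snd U h))"

lemma uni [simp]:
 assumes U [simp]: "U : Obj E"
 shows "arr C (uni U)" "src C (uni U) = fst U" "tgt C (uni U) = IB (fst U)"
 unfolding uni_def using objE(1,3-5)[OF U] by simp_all

lemma ip_uni:
 assumes U [simp]: "U : Obj E" and k [simp]: "k : carrier G"
 shows "ip (fst U) k \<bullet> uni U = snd U k"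
proof -
 note [simp] = objE(1,3-5)[OF U]
 let ?X = "fst U" and ?H = "Hom C (fst U) (Fo k (fst U))"
 have "ip ?X k \<bullet> uni U = finsum ?H (%h. (ip ?X k \<bullet> ii ?X h) \<bullet> snd U h) (carrier G)"
  unfolding uni_def by (subst comp_sum) (auto intro!: sum_cong)
 also have "\<dots> = (ip ?X k \<bullet> ii ?X k) \<bullet> snd U k" by (rule sum_eq_single) (simp_all add: finG)
 finally show ?thesis by simp
qed

lemma uni_equi: assumes U [simp]: "U : Obj E" shows "equi U (uni U) (I (fst U))"
 unfolding equi_def
proof (intro conjI ballI)
 note [simp] = objE(1,3-5)[OF U]
 let ?X = "fst U"
 fix g assume g [simp]: "g : carrier G"
 interpret X: lin_functor K C C "act A g" by (rule act_functor) simp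
 let ?H = "Hom C ?X (Fo g (IB ?X))"
 have b: "bij_betw (%h. g \<cdot> h) (carrier G) (carrier G)"
  by (rule bij_betwI[where g = "%h. inv_G g \<cdot> h"]) auto
 have "snd (I ?X) g \<bullet> uni U = finsum ?H (%h. snd (I ?X) g \<bullet> (ii ?X h \<bullet> snd U h)) (carrier G)"
  unfolding uni_def by (subst comp_sum) simp_all
 also have "\<dots> = finsum ?H (%h. snd (I ?X) g \<bullet> (ii ?X (g \<cdot> h) \<bullet> snd U (g \<cdot> h))) (carrier G)"
  by (rule sum_reindex[OF _ _ b]) simp_all
 also have "\<dots> = finsum ?H (%h. (Fm g (ii ?X h) \<bullet> Fm g (snd U h)) \<bullet> snd U g) (carrier G)"
 proof (rule sum_cong)
  fix h assume h [simp]: "h : carrier G"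
  have "snd (I ?X) g \<bullet> (ii ?X (g \<cdot> h) \<bullet> snd U (g \<cdot> h)) =
   (snd (I ?X) g \<bullet> (ii ?X (g \<cdot> h) \<bullet> eps A g h ?X)) \<bullet> (Fm g (snd U h) \<bullet> snd U g)"
   unfolding objE(6)[OF U g h] by simp
  thus "snd (I ?X) g \<bullet> (ii ?X (g \<cdot> h) \<bullet> snd U (g \<cdot> h)) = (Fm g (ii ?X h) \<bullet> Fm g (snd U h)) \<bullet> snd U g"
   by (simp add: Ind_snd_ii_eps)
 qed simp_all
 also have "\<dots> = Fm g (uni U) \<bullet> snd U g"
  unfolding uni_def by (simp, rule sum_cong) simp_all
 finally show "snd (I ?X) g \<bullet> uni U = Fm g (uni U) \<bullet> snd U g" .
qed (use objE(1)[OF U] in simp_all)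

lemma ret [simp]:
 assumes U [simp]: "U : Obj E"
 shows "arr C (ret U)" "src C (ret U) = IB (fst U)" "tgt C (ret U) = fst U"
  "!!h. h : carrier G ==> ret U \<bullet> ii (fst U) h = inv\<^bsub>K\<^esub> ordK \<odot>[Fo h (fst U),fst U] inv_arr C (snd U h)"
proof -
 note [simp] = objE(1,3-5)[OF U]
 have o: "inv\<^bsub>K\<^esub> ordK : carrier K" by (rule ordK_inv)
 show "arr C (ret U)" "src C (ret U) = IB (fst U)" "tgt C (ret U) = fst U"
  "!!h. h : carrier G ==> ret U \<bullet> ii (fst U) h = inv\<^bsub>K\<^esub> ordK \<odot>[Fo h (fst U),fst U] inv_arr C (snd U h)"
  unfolding ret_def
  using cop[of "fst U" "fst U" "%h. inv\<^bsub>K\<^esub> ordK \<odot>[Fo h (fst U),fst U] inv_arr C (snd U h)"] o by simp_all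
qed

lemma ret_equi: assumes U [simp]: "U : Obj E" shows "equi (I (fst U)) (ret U) U"
 unfolding equi_def
proof (intro conjI ballI)
 note [simp] = objE(1,3-5)[OF U] ordK_inv(1)
 let ?X = "fst U"
 fix g assume g [simp]: "g : carrier G"
 interpret X: lin_functor K C C "act A g" by (rule act_functor) simp
 show "snd U g \<bullet> ret U = Fm g (ret U) \<bullet> snd (I ?X) g"
 proof (rule Ind_ext_eps[of g ?X])
  fix h assume h [simp]: "h : carrier G"
  let ?l = "(snd U g \<bullet> ret U) \<bullet> (ii ?X (g \<cdot> h) \<bullet> eps A g h ?X)"
  have "?l =
   inv\<^bsub>K\<^esub> ordK \<odot>[Fo g (Fo h ?X),Fo g ?X] (snd U g \<bullet> (inv_arr C (snd U (g \<cdot> h)) \<bullet> eps A g h ?X))"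
   by (simp add: reassoc[OF ret(4)])
  also have "snd U g \<bullet> (inv_arr C (snd U (g \<cdot> h)) \<bullet> eps A g h ?X) = Fm g (inv_arr C (snd U h))"
   unfolding objE(6)[OF U g h] by simp
  also have "inv\<^bsub>K\<^esub> ordK \<odot>[Fo g (Fo h ?X),Fo g ?X] Fm g (inv_arr C (snd U h)) = Fm g (ret U \<bullet> ii ?X h)"
   unfolding ret(4)[OF U h] by simp
  also have "\<dots> = (Fm g (ret U) \<bullet> snd (I ?X) g) \<bullet> (ii ?X (g \<cdot> h) \<bullet> eps A g h ?X)" by (simp add: Ind_snd_ii_eps del: ret(4))
  finally show "?l =
   (Fm g (ret U) \<bullet> snd (I ?X) g) \<bullet> (ii ?X (g \<cdot> h) \<bullet> eps A g h ?X)" .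
 qed simp_all
qed (use objE(1)[OF U] in simp_all)

lemma ret_uni: assumes U [simp]: "U : Obj E" shows "ret U \<bullet> uni U = Id C (fst U)"
proof -
 note [simp] = objE(1,3-5)[OF U] ordK_inv(1)
 let ?X = "fst U"
 have "ret U \<bullet> uni U = finsum (Hom C ?X ?X) (%h. inv\<^bsub>K\<^esub> ordK \<odot>[?X,?X] Id C ?X) (carrier G)"
  unfolding uni_def by (subst comp_sum) (auto simp: reassoc[OF ret(4)] intro!: sum_cong)
 also have "\<dots> = finsum K (%h. inv\<^bsub>K\<^esub> ordK) (carrier G) \<odot>[?X,?X] Id C ?X"
  by (rule sum_smult) (simp_all add: finG)
 also have "finsum K (%h. inv\<^bsub>K\<^esub> ordK) (carrier G) = inv\<^bsub>K\<^esub> ordK \<otimes>\<^bsub>K\<^esub> ordK"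
  unfolding ordK_def[of] by (subst finsum_rdistr) (auto simp: finG ordK_def[symmetric] intro!: finsum_cong')
 finally show ?thesis by (simp add: ordK_inv)
qed

lemma in_add_Ind_fst: assumes U [simp]: "U : Obj E" shows "in_add E U (I (fst U))"
proof -
 have o: "fst U : Obj C" by (rule objE(1)[OF U])
 have a: "arr E (U, uni U, I (fst U))" "arr E (I (fst U), ret U, U)"
  unfolding arr_E using uni_equi[OF U] ret_equi[OF U] o by simp_all
 show ?thesis
  by (rule E.in_add_retract[OF a]) (use a in \<open>simp_all add: E_ops ret_uni\<close>)
qed

text \<open>
 Conjugating the idempotent \<open>uni U \<bullet> ret U\<close> by the automorphisms \<open>th\<close> gives the projections
 of the induced object onto the twists of \<open>U\<close>; by orthogonality of characters they add up to
 the identity.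
\<close>

lemma Ind_fst_decomposition:
 assumes U [simp]: "U : Obj E"
 defines "X \<equiv> fst U"
 shows "finsum (Hom C (IB X) (IB X)) (%\<chi>. (th X \<chi> \<bullet> uni U) \<bullet> (ret U \<bullet> th X (inv\<^bsub>Gh\<^esub> \<chi>))) (carrier Gh) = Id C (IB X)"
proof -
 have X [simp]: "X : Obj C" "fst U = X" unfolding X_def using objE(1)[OF U] by simp_all
 note [simp] = objE(3-5)[OF U] ordK_inv(1) uni[OF U, unfolded X(2)] ret(1-3)[OF U, unfolded X(2)]
 let ?S = "finsum (Hom C (IB X) (IB X)) (%\<chi>. (th X \<chi> \<bullet> uni U) \<bullet> (ret U \<bullet> th X (inv\<^bsub>Gh\<^esub> \<chi>))) (carrier Gh)"
 have S [simp]: "arr C ?S" "src C ?S = IB X" "tgt C ?S = IB X" by simp_all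
 show ?thesis
 proof (rule Ind_ext[of X], simp_all only: S X Id_arr ibD, rule biproduct_mono[OF ib[of X]])
  fix h k assume h [simp]: "h : carrier G" and k [simp]: "k : carrier G"
  let ?H = "Hom C (Fo h X) (Fo k X)" and ?a = "snd U k \<bullet> inv_arr C (snd U h)"
  have pt: "ip X k \<bullet> th X \<chi> = \<chi> k \<odot>[IB X,Fo k X] ip X k" if [simp]: "\<chi> : carrier Gh" for \<chi>
  proof (rule Ind_ext[of X])
   fix l assume "l : carrier G"
   thus "(ip X k \<bullet> th X \<chi>) \<bullet> ii X l = (\<chi> k \<odot>[IB X,Fo k X] ip X k) \<bullet> ii X l" by (cases "l = k") (simp_all add: th_ii)
  qed simp_all
  have c: "inv\<^bsub>K\<^esub> ordK \<otimes>\<^bsub>K\<^esub> (\<chi> k \<otimes>\<^bsub>K\<^esub> \<chi> (inv_G h)) = cf h \<chi> \<otimes>\<^bsub>K\<^esub> \<chi> k" if "\<chi> : carrier Gh" for \<chi>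
   unfolding cf_def using that by (simp add: m_ac)
  have c': "\<chi> k \<otimes>\<^bsub>K\<^esub> (inv\<^bsub>Gh\<^esub> \<chi>) h = \<chi> k \<otimes>\<^bsub>K\<^esub> \<chi> (inv_G h)" if "\<chi> : carrier Gh" for \<chi>
   using that by (simp add: Gh_inv)
  have "ip X k \<bullet> (?S \<bullet> ii X h) = finsum ?H (%\<chi>. (ip X k \<bullet> th X \<chi>) \<bullet> (uni U \<bullet> (ret U \<bullet> (th X (inv\<^bsub>Gh\<^esub> \<chi>) \<bullet> ii X h)))) (carrier Gh)"
   by (simp, rule sum_cong) simp_all
  also have "\<dots> = finsum ?H (%\<chi>. (cf h \<chi> \<otimes>\<^bsub>K\<^esub> \<chi> k) \<odot>\<^bsub>?H\<^esub> ?a) (carrier Gh)"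
  proof (rule sum_cong)
   fix \<chi> assume chi [simp]: "\<chi> : carrier Gh"
   let ?l = "(ip X k \<bullet> th X \<chi>) \<bullet> (uni U \<bullet> (ret U \<bullet> (th X (inv\<^bsub>Gh\<^esub> \<chi>) \<bullet> ii X h)))"
   have "?l =
    (\<chi> k \<otimes>\<^bsub>K\<^esub> (inv\<^bsub>Gh\<^esub> \<chi>) h) \<odot>\<^bsub>?H\<^esub> ((ip X k \<bullet> uni U) \<bullet> (ret U \<bullet> ii X h))"
    unfolding pt[OF chi] th_ii[OF X(1) Gh.inv_closed[OF chi] h] by (simp add: m_comm)
   also have "(ip X k \<bullet> uni U) \<bullet> (ret U \<bullet> ii X h) = inv\<^bsub>K\<^esub> ordK \<odot>\<^bsub>?H\<^esub> ?a"
    using ip_uni[OF U k] ret(4)[OF U h] by simp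
   also have "(\<chi> k \<otimes>\<^bsub>K\<^esub> (inv\<^bsub>Gh\<^esub> \<chi>) h) \<odot>\<^bsub>?H\<^esub> (inv\<^bsub>K\<^esub> ordK \<odot>\<^bsub>?H\<^esub> ?a) = (cf h \<chi> \<otimes>\<^bsub>K\<^esub> \<chi> k) \<odot>\<^bsub>?H\<^esub> ?a"
    unfolding c'[OF chi] c[OF chi, symmetric] by (simp add: m_comm)
   finally show "?l = (cf h \<chi> \<otimes>\<^bsub>K\<^esub> \<chi> k) \<odot>\<^bsub>?H\<^esub> ?a" .
  qed simp_all
  also have "\<dots> = finsum K (%\<chi>. cf h \<chi> \<otimes>\<^bsub>K\<^esub> \<chi> k) (carrier Gh) \<odot>\<^bsub>?H\<^esub> ?a"
   by (rule sum_smult) (simp_all add: finGh)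
  also have "\<dots> = ip X k \<bullet> (Id C (IB X) \<bullet> ii X h)"
   by (cases "h = k") (simp_all add: cf_sum)
  finally show "ip X k \<bullet> (?S \<bullet> ii X h) = ip X k \<bullet> (Id C (IB X) \<bullet> ii X h)" .
 qed simp_all
qed

text \<open>
  Each term of \<open>Ind_fst_decomposition\<close> factors through a twist of \<open>U\<close>, which is isomorphic to \<open>U\<close>.
\<close>

lemma Ind_fst_in_add:
 assumes U [simp]: "U : Obj E" and st: "stable E Gh Ad U"
 shows "in_add E (I (fst U)) U"
proof -
 let ?X = "fst U" let ?W = "I ?X"
 have X [simp]: "?X : Obj C" by (rule objE(1)[OF U])
 have W [simp]: "?W : Obj E" by simp
 let ?j = "%\<chi>. (tw (inv\<^bsub>Gh\<^esub> \<chi>) U, th ?X \<chi> \<bullet> uni U, ?W)" and ?p = "%\<chi>. (?W, ret U \<bullet> th ?X (inv\<^bsub>Gh\<^esub> \<chi>), tw (inv\<^bsub>Gh\<^esub> \<chi>) U)"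
 have jp: "arr E (?j \<chi>)" "arr E (?p \<chi>)" if chi [simp]: "\<chi> : carrier Gh" for \<chi>
 proof -
  have t: "tw (inv\<^bsub>Gh\<^esub> \<chi>) (tw \<chi> ?W) = ?W" by (simp add: tw_tw tw_one)
  have "equi (tw (inv\<^bsub>Gh\<^esub> \<chi>) ?W) (th ?X \<chi>) ?W"
   using tw_equi[OF _ _ _ th_equi[OF X chi], of "inv\<^bsub>Gh\<^esub> \<chi>"] by (simp add: t)
  moreover have "equi (tw (inv\<^bsub>Gh\<^esub> \<chi>) U) (uni U) (tw (inv\<^bsub>Gh\<^esub> \<chi>) ?W)" by (rule tw_equi) (simp_all add: uni_equi)
  ultimately show "arr E (?j \<chi>)" unfolding arr_E
   using equi_comp[of "tw (inv\<^bsub>Gh\<^esub> \<chi>) U" "tw (inv\<^bsub>Gh\<^esub> \<chi>) ?W" ?W] by simp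
  have "equi (tw (inv\<^bsub>Gh\<^esub> \<chi>) ?W) (ret U) (tw (inv\<^bsub>Gh\<^esub> \<chi>) U)" by (rule tw_equi) (simp_all add: ret_equi)
  thus "arr E (?p \<chi>)" unfolding arr_E
   using equi_comp[of ?W "tw (inv\<^bsub>Gh\<^esub> \<chi>) ?W" "tw (inv\<^bsub>Gh\<^esub> \<chi>) U"] th_equi[OF X, of "inv\<^bsub>Gh\<^esub> \<chi>"] by simp
 qed
 have th: "through E U (?j \<chi> \<star> ?p \<chi>)" if chi [simp]: "\<chi> : carrier Gh" for \<chi>
 proof -
  have "isomorphic E (tw (inv\<^bsub>Gh\<^esub> \<chi>) U) U" using st unfolding stable_def by simp
  hence "through E U (Id E (tw (inv\<^bsub>Gh\<^esub> \<chi>) U))" using E.in_add_iso unfolding in_add_def by blast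
  moreover have "through E (tw (inv\<^bsub>Gh\<^esub> \<chi>) U) (?j \<chi> \<star> ?p \<chi>)"
   using jp[OF chi] by (intro E.through_comp_mor) simp_all
  ultimately show ?thesis using E.through_trans by blast
 qed
 let ?T = "finsum (Hom E ?W ?W) (%\<chi>. ?j \<chi> \<star> ?p \<chi>) (carrier Gh)"
 have a: "arr E (?j \<chi> \<star> ?p \<chi>)" "src E (?j \<chi> \<star> ?p \<chi>) = ?W" "tgt E (?j \<chi> \<star> ?p \<chi>) = ?W" if "\<chi> : carrier Gh" for \<chi>
  using jp[OF that] by (simp_all del: E_ops)
 have T: "through E U ?T" by (rule E.through_sum) (simp_all add: finGh th a)
 have f: "FMor forget (?j \<chi> \<star> ?p \<chi>) = (th ?X \<chi> \<bullet> uni U) \<bullet> (ret U \<bullet> th ?X (inv\<^bsub>Gh\<^esub> \<chi>))" for \<chi>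
  by (simp only: E_ops forget_simps)
 have "?T = Id E ?W"
 proof (rule Fo.inj)
  have "FMor forget ?T = finsum (Hom C (IB ?X) (IB ?X)) (%\<chi>. FMor forget (?j \<chi> \<star> ?p \<chi>)) (carrier Gh)"
   using a by (subst Fo.map_sum) simp_all
  also have "\<dots> = Id C (IB ?X)" unfolding f using Ind_fst_decomposition[OF U] .
  finally show "FMor forget ?T = FMor forget (Id E ?W)" by simp
 qed (use a in simp_all)
 thus ?thesis unfolding in_add_def using T by simp
qed

lemma stable_shift_pow:
 assumes U: "U : Obj E" and st: "stable E Gh Ad U" shows "stable E Gh Ad ((\<Sigma>o E ^^ n) U)"
proof -
 have t: "tw \<chi> ((\<Sigma>o E ^^ n) U) = (\<Sigma>o E ^^ n) (tw \<chi> U)" if "\<chi> : carrier Gh" for \<chi>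
  using that U E.shift_pow_obj[OF U] by (induction n) (simp_all add: tw_shift[symmetric])
 interpret P: lin_equivalence K E E "shift_pow E n" by (rule E.shift_pow_equivalence)
 show ?thesis using st P.map_isomorphic unfolding stable_def shift_pow_def by (simp add: t)
qed

text \<open>
  A morphism \<open>f\<close> between the underlying objects yields the equivariant morphism from \<open>U\<close> to
  \<open>Ind V\<close> that corresponds to it under adjunction. The latter vanishes since \<open>Ind V\<close> lies in
  \<open>add V\<close>, and \<open>F\<^sub>1(f)\<close> can be read off from its component at \<open>1\<close>.
\<close>

lemma hom_zero_forget:
 assumes U [simp]: "U : Obj E" and V [simp]: "V : Obj E" and st: "stable E Gh Ad V"
 shows "hom_zero C (fst U) (fst V) \<longleftrightarrow> hom_zero E U V"
proof
 assume z: "hom_zero C (fst U) (fst V)"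
 show "hom_zero E U V" unfolding hom_zero_def
 proof (intro allI impI, elim conjE)
  fix m assume m [simp]: "arr E m" "src E m = U" "tgt E m = V"
  have "FMor forget m = \<zero>[fst U,fst V]" using z unfolding hom_zero_def by simp
  thus "m = \<zero>\<^bsub>Hom E U V\<^esub>" by (intro Fo.inj[of m "\<zero>\<^bsub>Hom E U V\<^esub>"]) simp_all
 qed
next
 assume z: "hom_zero E U V"
 have o [simp]: "fst U : Obj C" "fst V : Obj C" using objE(1) U V by blast+
 have z': "hom_zero E U (I (fst V))"
  by (rule E.hom_zero_in_add[OF z E.in_add_refl[OF U] Ind_fst_in_add[OF V st]])
 interpret O: ff_functor K C C "act A one_G" by (rule act_ff) simp
 show "hom_zero C (fst U) (fst V)" unfolding hom_zero_def
 proof (intro allI impI, elim conjE)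
  fix f assume f [simp]: "arr C f" "src C f = fst U" "tgt C f = fst V"
  have e: "equi (I (fst U)) (indm f) (I (fst V))" using indm_equi[OF f(1)] by simp
  have s: "arr C (indm f)" "src C (indm f) = IB (fst U)" "tgt C (indm f) = IB (fst V)" using indm[OF f(1)] by simp_all
  have "arr E (U, indm f \<bullet> uni U, I (fst V))" unfolding arr_E
   using equi_comp[of U "I (fst U)" "I (fst V)", OF _ _ _ uni_equi[OF U] e] by simp
  hence "(U, indm f \<bullet> uni U, I (fst V)) = \<zero>\<^bsub>Hom E U (I (fst V))\<^esub>"
   using z'[unfolded hom_zero_def, rule_format, of "(U, indm f \<bullet> uni U, I (fst V))"] by simp
  hence 0: "indm f \<bullet> uni U = \<zero>[fst U,IB (fst V)]" by (simp add: E_ops)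
  have p: "ip (fst V) one_G \<bullet> indm f = Fm one_G f \<bullet> ip (fst U) one_G"
   by (rule biproduct_diag[OF ib ib]) (use s indm_ii[OF f(1)] in simp_all)
  let ?l = "Fm one_G f \<bullet> snd U one_G"
  have "?l = (ip (fst V) one_G \<bullet> indm f) \<bullet> uni U" unfolding p by (simp add: ip_uni)
  also have "\<dots> = ip (fst V) one_G \<bullet> (indm f \<bullet> uni U)" by (rule assoc) (simp_all add: s)
  finally have 1: "?l = ip (fst V) one_G \<bullet> (indm f \<bullet> uni U)" .
  have i: "iso_arr C (snd U one_G)" "src C (snd U one_G) = fst U" "tgt C (snd U one_G) = Fo one_G (fst U)" using objE(3-5)[OF U] by simp_all
  have 2: "Fm one_G f \<bullet> snd U one_G = Fm one_G \<zero>[fst U,fst V] \<bullet> snd U one_G" unfolding 1 0 using i by simp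
  have "Fm one_G f = Fm one_G \<zero>[fst U,fst V]" by (rule iso_cancel_right[OF i(1) 2]) (simp_all add: i)
  thus "f = \<zero>[fst U,fst V]" by (rule O.inj) simp_all
 qed
qed

lemma rigid_forget:
 assumes U: "U : Obj E" and st: "stable E Gh Ad U"
 shows "rigid C (fst U) \<longleftrightarrow> rigid E U"
 unfolding rigid_def using U objE(1)[OF U] hom_zero_forget stable_shift_pow[OF U st] st E.shift_pow_obj[OF U]
 by (simp flip: fst_shift_pow)

text \<open>
  Thick subcategories are pulled back along induction in one direction and along the forgetful
  functor in the other.
\<close>

lemma generates_forget:
 assumes U: "U : Obj E" and st: "stable E Gh Ad U"
 shows "generates C (fst U) \<longleftrightarrow> generates E U"
proof
 assume g: "generates C (fst U)"
 show "generates E U" unfolding generates_def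
 proof (intro allI impI subsetI, elim conjE)
  fix S V assume S: "thick E S" and US: "U : S" and V: "V : Obj E"
  have "I (fst U) : S" by (rule thick_in_add[OF E.krull_schmidt_axioms S US Ind_fst_in_add[OF U st]])
  hence "Obj C \<subseteq> {X : Obj C. I X : S}"
   using g J.thick_preimage[OF S, unfolded J_obj] objE(1)[OF U] unfolding generates_def by simp
  hence "I (fst V) : S" using objE(1)[OF V] by blast
  thus "V : S" by (rule thick_in_add[OF E.krull_schmidt_axioms S _ in_add_Ind_fst[OF V]])
 qed
next
 assume g: "generates E U"
 interpret f: exact_functor K E C forget by (rule forget_exact_functor)
 show "generates C (fst U)" unfolding generates_def
 proof (intro allI impI subsetI, elim conjE)
  fix S X assume S: "thick C S" and US: "fst U : S" and X: "X : Obj C"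
  have "Obj E \<subseteq> {V : Obj E. fst V : S}"
   using g f.thick_preimage[OF S] U US unfolding generates_def by simp
  hence "IB X : S" using Ind_obj[OF X] by auto
  thus "X : S" by (rule thick_in_add[OF krull_schmidt_axioms S _ in_add_Ind[OF X]])
 qed
qed

lemma tilting_forget: "U : Obj E ==> stable E Gh Ad U ==> tilting C (fst U) \<longleftrightarrow> tilting E U"
 unfolding tilting_iff E.tilting_iff using rigid_forget generates_forget by blast

section \<open>The correspondence\<close>

text \<open>
  The relation between a tilting object of \<open>T\<close> and its partner: equality of additive closures.
\<close>

definition "corr X U \<longleftrightarrow> in_add E U (I X) & in_add E (I X) U"
definition "TC X \<longleftrightarrow> tilting C X & basic C X & stable C G A X"
definition "TE U \<longleftrightarrow> tilting E U & basic E U & stable E Gh Ad U"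

lemma TC_obj: "TC X ==> X : Obj C" and TE_obj: "TE U ==> U : Obj E"
 unfolding TC_def TE_def tilting_def by blast+

lemma tw_basic: assumes "\<chi> : carrier Gh" "basic E U" shows "basic E (tw \<chi> U)"
proof -
 interpret X: lin_equivalence K E E "act Ad \<chi>" by (rule tw_equivalence) fact
 show ?thesis using X.map_basic[OF E.krull_schmidt_axioms E.krull_schmidt_axioms assms(2)] by simp
qed

lemma tw_in_add: assumes "\<chi> : carrier Gh" "in_add E U V" shows "in_add E (tw \<chi> U) (tw \<chi> V)"
proof -
 interpret X: lin_equivalence K E E "act Ad \<chi>" by (rule tw_equivalence) fact
 show ?thesis using X.map_in_add[OF assms(2)] by simp
qed

text \<open>
  Twisting fixes \<open>Ind X\<close> up to isomorphism, hence fixes its additive closure, hence fixes the basic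
  object with that closure.
\<close>

lemma corr_stable:
 assumes X: "X : Obj C" and U: "basic E U" and c: "corr X U" shows "stable E Gh Ad U"
 unfolding stable_def
proof
 fix \<chi> assume chi [simp]: "\<chi> : carrier Gh"
 have a: "arr E (I X, th X \<chi>, tw \<chi> (I X))" unfolding arr_E using X th_equi[OF X chi] by simp
 have "isomorphic E (I X) (tw \<chi> (I X))" unfolding E.isomorphic_iff
  using iso_E[OF a] a X by (intro exI[of _ "(I X, th X \<chi>, tw \<chi> (I X))"]) simp
 hence i: "in_add E (I X) (tw \<chi> (I X))" "in_add E (tw \<chi> (I X)) (I X)" using E.in_add_iso E.isomorphic_sym by blast+
 have "in_add E (tw \<chi> U) U" "in_add E U (tw \<chi> U)"
  using c tw_in_add[OF chi] i E.in_add_trans unfolding corr_def by blast+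
 thus "isomorphic E (FObj (act Ad \<chi>) U) U"
  using E.basic_unique[OF tw_basic[OF chi U] U] by simp
qed

lemma corr_fst:
 assumes X: "X : Obj C" "stable C G A X" and c: "corr X U"
 shows "in_add C (fst U) X" "in_add C X (fst U)"
proof -
 have "in_add C (fst U) (IB X)" "in_add C (IB X) (fst U)" using c fst_in_add[of U "I X"] fst_in_add[of "I X" U] unfolding corr_def by simp_all
 thus "in_add C (fst U) X" "in_add C X (fst U)"
  using in_add_Ind[OF X(1)] stable_Ind_in_add[OF X] in_add_trans by blast+
qed

lemma corr_TE: assumes X: "TC X" and U: "basic E U" and c: "corr X U" shows "TE U"
proof -
 have s: "stable E Gh Ad U" by (rule corr_stable[OF TC_obj[OF X] U c])
 have "in_add C (fst U) X" "in_add C X (fst U)" using corr_fst[OF TC_obj[OF X] _ c] X unfolding TC_def by blast+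
 hence "tilting C (fst U)" using tilting_in_add[OF krull_schmidt_axioms] X unfolding TC_def by blast
 thus ?thesis unfolding TE_def using tilting_forget[OF E.basic_obj[OF U] s] U s by blast
qed

lemma corr_exists: assumes X: "X : Obj C" shows "EX U. basic E U & corr X U"
 using E.basic_exists[OF Ind_obj[OF X]] unfolding corr_def by blast

text \<open>
  The basic object is extracted from the underlying object of \<open>U\<close>; it inherits stability because
  the structure morphisms identify \<open>F\<^sub>g U\<close> with \<open>U\<close>.
\<close>

lemma corr_TC: assumes U: "TE U" shows "EX X. TC X & corr X U"
proof -
 have Uo: "U : Obj E" and s: "stable E Gh Ad U" using U TE_obj unfolding TE_def by blast+
 obtain X where X: "basic C X" "in_add C X (fst U)" "in_add C (fst U) X" using basic_exists[OF objE(1)[OF Uo]] by blast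
 have "tilting C (fst U)" using tilting_forget[OF Uo s] U unfolding TE_def by blast
 hence t: "tilting C X" using tilting_in_add[OF krull_schmidt_axioms] X by blast
 have "isomorphic C (Fo g X) X" if g: "g : carrier G" for g
 proof -
  interpret F: lin_equivalence K C C "act A g" by (rule act_equivalence[OF g])
  have "isomorphic C (fst U) (Fo g (fst U))" unfolding isomorphic_iff using objE(3-5)[OF Uo g] by blast
  hence "in_add C (fst U) (Fo g (fst U))" "in_add C (Fo g (fst U)) (fst U)" using in_add_iso isomorphic_sym by blast+
  hence "in_add C (Fo g X) X" "in_add C X (Fo g X)" using X(2,3) F.map_in_add in_add_trans by blast+
  thus ?thesis using basic_unique[OF F.map_basic[OF krull_schmidt_axioms krull_schmidt_axioms X(1)] X(1)] by blast
 qed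
 hence "TC X" unfolding TC_def stable_def using t X(1) by blast
 moreover have "corr X U" unfolding corr_def
  using Ind_in_add[OF X(2)] Ind_in_add[OF X(3)] in_add_Ind_fst[OF Uo] Ind_fst_in_add[OF Uo s] E.in_add_trans by blast
 ultimately show ?thesis by blast
qed

lemma corr_iso:
 assumes X: "TC X" "TC X'" and U: "basic E U" "basic E U'" and c: "corr X U" "corr X' U'"
 shows "isomorphic C X X' \<longleftrightarrow> isomorphic E U U'"
proof
 assume "isomorphic C X X'"
 hence "in_add E (I X) (I X')" "in_add E (I X') (I X)" using Ind_in_add in_add_iso isomorphic_sym by blast+
 hence "in_add E U U'" "in_add E U' U" using c E.in_add_trans unfolding corr_def by blast+
 thus "isomorphic E U U'" by (rule E.basic_unique[OF U])
next
 assume "isomorphic E U U'"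
 hence "in_add C (fst U) (fst U')" "in_add C (fst U') (fst U)" using fst_in_add E.in_add_iso E.isomorphic_sym by blast+
 moreover have "in_add C (fst U) X" "in_add C X (fst U)" "in_add C (fst U') X'" "in_add C X' (fst U')"
  using corr_fst[OF TC_obj] X c unfolding TC_def by blast+
 ultimately have "in_add C X X'" "in_add C X' X" using in_add_trans by blast+
 thus "isomorphic C X X'" using basic_unique X unfolding TC_def by blast
qed

text \<open>
  The lifted functor acts as \<open>F\<close> on underlying objects, and a stable equivariant object is
  determined up to additive closure by its underlying object.
\<close>

lemma corr_lift:
 assumes X: "TC X" and U: "basic E U" and c: "corr X U" and a: "aut (F, \<delta>)"
 shows "EX \<Phi> \<epsilon>. D.aut (\<Phi>, \<epsilon>) & corr (FObj F X) (FObj \<Phi> U)"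
proof -
 let ?P = "tri_lift C G A F \<delta>" and ?e = "%\<chi> U. Id E (tw \<chi> (FObj (tri_lift C G A F \<delta>) U))"
 note l = lift_autoequivalence[OF a]
 interpret F: lin_equivalence K C C F using a unfolding equivariant_autoequivalence_iff by blast
 have TE: "TE U" by (rule corr_TE[OF X U c])
 have T: "TE (FObj ?P U)" using D.autoequivalence_Tilt[OF E.krull_schmidt_axioms l(1)] TE unfolding TE_def by blast
 hence Po: "FObj ?P U : Obj E" and st: "stable E Gh Ad (FObj ?P U)" using TE_obj unfolding TE_def by blast+
 have "in_add C (fst U) X" "in_add C X (fst U)" using corr_fst[OF TC_obj[OF X] _ c] X unfolding TC_def by blast+
 hence "in_add C (fst (FObj ?P U)) (FObj F X)" "in_add C (FObj F X) (fst (FObj ?P U))" unfolding l(2) using F.map_in_add by blast+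
 hence "corr (FObj F X) (FObj ?P U)" unfolding corr_def
  using Ind_in_add in_add_Ind_fst[OF Po] Ind_fst_in_add[OF Po st] E.in_add_trans by blast
 thus ?thesis using l(1) by blast
qed

lemma corr_descend:
 assumes X: "TC X" and c: "corr X U" and a: "D.aut (\<Phi>, \<epsilon>)"
 shows "EX F \<delta>. aut (F, \<delta>) & corr (FObj F X) (FObj \<Phi> U)"
proof -
 obtain F \<delta> where F: "aut (F, \<delta>)"
  "!!X. X : Obj C ==> isomorphic E (I (FObj F X)) (FObj \<Phi> (I X))" using descend_autoequivalence[OF a] by blast
 interpret P: lin_equivalence K E E \<Phi> using a unfolding D.equivariant_autoequivalence_iff by blast
 have i: "isomorphic E (I (FObj F X)) (FObj \<Phi> (I X))" by (rule F(2)[OF TC_obj[OF X]])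
 have "in_add E (I (FObj F X)) (FObj \<Phi> U)" "in_add E (FObj \<Phi> U) (I (FObj F X))"
  using E.in_add_iso[OF i] E.in_add_iso[OF E.isomorphic_sym[OF i]] c P.map_in_add E.in_add_trans unfolding corr_def by blast+
 thus ?thesis using F(1) unfolding corr_def by blast
qed

text \<open>
  The set of all basic objects with the required additive closure; for an isoclass of tilting
  objects it is a single isoclass by \<open>iota_isoclass\<close>.
\<close>

definition "iota \<X> = {U. basic E U & (EX X:\<X>. add_of E U = add_of E (I X))}"

lemma iota_isoclass:
 assumes X: "TC X" and U: "basic E U" and c: "corr X U"
 shows "iota (isoclass C X) = isoclass E U"
proof -
 have add: "add_of E V = add_of E (I Y) \<longleftrightarrow> corr Y V" if "basic E V" "Y : Obj C" for V Y
  unfolding corr_def by (rule E.add_of_eq_iff[OF E.basic_obj[OF that(1)] Ind_obj[OF that(2)]])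
 have "V : iota (isoclass C X) \<longleftrightarrow> V : isoclass E U" for V
 proof
  assume "V : iota (isoclass C X)"
  then obtain Y where V: "basic E V" and Y: "isomorphic C X Y" "add_of E V = add_of E (I Y)"
   unfolding iota_def isoclass_def by blast
  have "corr Y V" using add[OF V isomorphic_obj(2)[OF Y(1)]] Y(2) by blast
  moreover have "in_add E (I X) (I Y)" "in_add E (I Y) (I X)" using Y(1) Ind_in_add in_add_iso isomorphic_sym by blast+
  ultimately have "in_add E U V" "in_add E V U" using c E.in_add_trans unfolding corr_def by blast+
  thus "V : isoclass E U" unfolding isoclass_def using E.basic_unique[OF U V] by blast
 next
  assume "V : isoclass E U"
  hence i: "isomorphic E U V" unfolding isoclass_def by blast
  have V: "basic E V" by (rule E.basic_iso[OF U i])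
  have "corr X V" using c E.in_add_iso[OF i] E.in_add_iso[OF E.isomorphic_sym[OF i]] E.in_add_trans unfolding corr_def by blast
  thus "V : iota (isoclass C X)" unfolding iota_def isoclass_def
   using V add[OF V TC_obj[OF X]] isomorphic_refl[OF TC_obj[OF X]] by blast
 qed
 thus ?thesis by blast
qed

lemma Tilt_C: "Tilt C G A = {isoclass C X | X. TC X}" and Tilt_E: "Tilt E Gh Ad = {isoclass E U | U. TE U}"
 unfolding Tilt_def TC_def TE_def by blast+

lemma iota_bij: "bij_betw iota (Tilt C G A) (Tilt E Gh Ad)"
 unfolding bij_betw_def
proof
 have c: "EX U. basic E U & TE U & corr X U" if "TC X" for X
  using corr_exists[OF TC_obj[OF that]] corr_TE[OF that] by blast
 show "inj_on iota (Tilt C G A)"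
 proof (rule inj_onI)
  fix \<X> \<Y> assume "\<X> : Tilt C G A" "\<Y> : Tilt C G A" and e: "iota \<X> = iota \<Y>"
  then obtain X Y where XY: "\<X> = isoclass C X" "\<Y> = isoclass C Y" "TC X" "TC Y" unfolding Tilt_C by blast
  obtain U V where U: "basic E U" "corr X U" and V: "basic E V" "corr Y V" using c XY(3,4) by blast
  have "isoclass E U = isoclass E V" using e iota_isoclass XY U V by metis
  hence "isomorphic C X Y" using corr_iso[OF XY(3,4) U(1) V(1) U(2) V(2)] E.isoclass_eq_iff[OF E.basic_obj[OF U(1)]] by blast
  thus "\<X> = \<Y>" unfolding XY by (rule isoclass_eq)
 qed
 show "iota ` Tilt C G A = Tilt E Gh Ad"
 proof
  show "iota ` Tilt C G A \<subseteq> Tilt E Gh Ad" unfolding Tilt_C Tilt_E using c iota_isoclass by blast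
  show "Tilt E Gh Ad \<subseteq> iota ` Tilt C G A"
  proof
   fix \<U> assume "\<U> : Tilt E Gh Ad"
   then obtain U where U: "\<U> = isoclass E U" "TE U" unfolding Tilt_E by blast
   obtain X where X: "TC X" "corr X U" using corr_TC[OF U(2)] by blast
   have "\<U> = iota (isoclass C X)" using iota_isoclass[OF X(1) _ X(2)] U unfolding TE_def by blast
   thus "\<U> : iota ` Tilt C G A" unfolding Tilt_C using X(1) by blast
  qed
 qed
qed

lemma iota_add:
 assumes "\<X> : Tilt C G A" "X : \<X>" "U : iota \<X>" shows "add_of E U = add_of E (I X)"
proof -
 obtain Y where Y: "\<X> = isoclass C Y" using assms(1) unfolding Tilt_C by blast
 obtain Z where Z: "Z : \<X>" "add_of E U = add_of E (I Z)" using assms(3) unfolding iota_def by blast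
 have "isomorphic C X Z" using assms(2) Z(1) isomorphic_sym isomorphic_trans unfolding Y isoclass_def by blast
 hence "in_add E (I X) (I Z)" "in_add E (I Z) (I X)" "I X : Obj E" "I Z : Obj E"
  using Ind_in_add in_add_iso isomorphic_sym isomorphic_obj Ind_obj by blast+
 thus ?thesis using Z(2) E.add_of_eq_iff by metis
qed

abbreviation "orbC \<equiv> orbit (Aut_tri K C G A) (aut_act C)"
abbreviation "orbE \<equiv> orbit (Aut_tri K E Gh Ad) (aut_act E)"

text \<open>
  Both inclusions compare orbits through \<open>corr\<close>: autoequivalences are lifted for one and descended
  for the other.
\<close>

lemma iota_orbit:
 assumes X: "TC X" shows "iota ` orbC (isoclass C X) = orbE (iota (isoclass C X))" "orbC (isoclass C X) \<subseteq> Tilt C G A"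
proof -
 obtain U where U: "basic E U" "corr X U" using corr_exists[OF TC_obj[OF X]] by blast
 have TU: "TE U" by (rule corr_TE[OF X U])
 note oC = orbit_isoclass[OF TC_obj[OF X]] and oE = D.orbit_isoclass[OF TE_obj[OF TU]]
 have F: "TC (FObj F X)" if "aut (F, \<delta>)" for F \<delta>
  using autoequivalence_Tilt[OF krull_schmidt_axioms that] X unfolding TC_def by blast
 have P: "basic E (FObj \<Phi> U)" if "D.aut (\<Phi>, \<epsilon>)" for \<Phi> \<epsilon>
  using D.autoequivalence_Tilt[OF E.krull_schmidt_axioms that] TU unfolding TE_def by blast
 show "orbC (isoclass C X) \<subseteq> Tilt C G A" unfolding oC Tilt_C using F by blast
 show "iota ` orbC (isoclass C X) = orbE (iota (isoclass C X))"
  unfolding iota_isoclass[OF X U] oC oE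
 proof (intro equalityI subsetI)
  fix \<U> assume "\<U> : iota ` {isoclass C (FObj F X) | F \<delta>. aut (F, \<delta>)}"
  then obtain F \<delta> where a: "aut (F, \<delta>)" and e: "\<U> = iota (isoclass C (FObj F X))" by blast
  obtain \<Phi> \<epsilon> where b: "D.aut (\<Phi>, \<epsilon>)" "corr (FObj F X) (FObj \<Phi> U)"
   using corr_lift[OF X U a] by blast
  have "\<U> = isoclass E (FObj \<Phi> U)" unfolding e by (rule iota_isoclass[OF F[OF a] P[OF b(1)] b(2)])
  thus "\<U> : {isoclass E (FObj \<Phi> U) | \<Phi> \<epsilon>. D.aut (\<Phi>, \<epsilon>)}" using b(1) by blast
 next
  fix \<U> assume "\<U> : {isoclass E (FObj \<Phi> U) | \<Phi> \<epsilon>. D.aut (\<Phi>, \<epsilon>)}"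
  then obtain \<Phi> \<epsilon> where b: "D.aut (\<Phi>, \<epsilon>)" and e: "\<U> = isoclass E (FObj \<Phi> U)" by blast
  obtain F \<delta> where a: "aut (F, \<delta>)" "corr (FObj F X) (FObj \<Phi> U)"
   using corr_descend[OF X U(2) b] by blast
  have "\<U> = iota (isoclass C (FObj F X))" unfolding e by (rule iota_isoclass[OF F[OF a(1)] P[OF b] a(2), symmetric])
  thus "\<U> : iota ` {isoclass C (FObj F X) | F \<delta>. aut (F, \<delta>)}" using a(1) by blast
 qed
qed

lemma iota_orbits: "bij_betw (%Orb. iota ` Orb) (Tilt_orbits K C G A) (Tilt_orbits K E Gh Ad)"
proof -
 have o: "Tilt_orbits K C G A = orbC ` Tilt C G A" "Tilt_orbits K E Gh Ad = orbE ` Tilt E Gh Ad"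
  unfolding Tilt_orbits_def orbits_def by blast+
 have k: "iota ` orbC \<X> = orbE (iota \<X>)" "orbC \<X> \<subseteq> Tilt C G A" if "\<X> : Tilt C G A" for \<X>
  using that iota_orbit unfolding Tilt_C by blast+
 have inj: "inj_on iota (Tilt C G A)" and im: "iota ` Tilt C G A = Tilt E Gh Ad" using iota_bij unfolding bij_betw_def by blast+
 show ?thesis unfolding bij_betw_def
 proof
  show "inj_on (%Orb. iota ` Orb) (Tilt_orbits K C G A)"
   unfolding o using k(2) inj_on_image_eq_iff[OF inj] by (auto simp: inj_on_def)
  have "(%Orb. iota ` Orb) ` (Tilt_orbits K C G A) = orbE ` (iota ` Tilt C G A)"
   unfolding o image_image using k(1) by (rule image_cong[OF refl])
  thus "(%Orb. iota ` Orb) ` (Tilt_orbits K C G A) = Tilt_orbits K E Gh Ad" unfolding o im .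
 qed
qed

end

theorem theorem7p11:
  fixes K :: "'k ring" and G :: "'g monoid"
    and T :: "('k, 'o, 'm) tri_category" and A :: "('g, 'o, 'm) tri_action"
  assumes "field K"
    and "comm_group G" and "finite (carrier G)" and "splits_over G K"
    and "pretriangulated_category K T"
    and "idempotent_complete T" and "hom_finite K T"
    and "triangle_action K T G A"
  defines "TG \<equiv> equivariant_category T G A"
    and "G' \<equiv> character_group K G"
    and "A' \<equiv> dual_action T G A"
  shows "\<exists>\<iota>. bij_betw \<iota> (Tilt T G A) (Tilt TG G' A') \<and>
      (\<forall>\<X>\<in>Tilt T G A. \<forall>X\<in>\<X>. \<forall>U\<in>\<iota> \<X>. add_of TG U = add_of TG (Ind T G A X)) \<and>
      bij_betw (\<lambda>Orb. \<iota> ` Orb) (Tilt_orbits K T G A) (Tilt_orbits K TG G' A')"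
proof -
 interpret T: pretriangulated_category K T by fact
 interpret G: comm_group G by fact
 have ks: "krull_schmidt K T"
  using T.additive_lin_category_axioms T.hom_finite_dependent_bound assms(6,7)
  by (intro krull_schmidt.intro krull_schmidt_axioms.intro) (auto simp: hom_finite_def)
 have e: "equivariantization K T G A"
  using T.shifted_category_axioms assms(8) by (intro equivariantization.intro equivariantization_axioms.intro)
 have f: "field_comm_group K G" using assms(1,2) by (intro field_comm_group.intro)
 interpret S: splitting K T G A
  using ks e f assms(3-5) by (intro splitting.intro ks_equivariantization.intro dual_setting.intro
    split_abelian_group.intro split_abelian_group_axioms.intro)
 show ?thesis unfolding TG_def G'_def A'_def
  using S.iota_bij S.iota_add S.iota_orbits by blast
qed

end
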